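(* Let $R$ be a reduced commutative Noetherian ring and let $M$ be an $R$-module. (1) The following are equivalent: (a) $M$ is injective. (b) $\operatorname{Coass}_R\operatorname{Hom}_R(L,M)\subseteq\operatorname{Ass}_R L$ for every finitely generated $R$-module $L$. (c) $\operatorname{Hom}_R(L,M)$ is h-divisible for every torsion-free $R$-module $L$. (d) $\operatorname{Hom}_R(L,M)$ is divisible for every finitely generated torsion-free $R$-module $L$. (e) $\operatorname{Hom}_R(P,M)$ is h-divisible for every $P\in\operatorname{Spec} R$. (f) $\operatorname{Hom}_R(P,M)$ is divisible for every $P\in\operatorname{Spec} R$. (g) $\operatorname{Ext}^1_R(R/P,M)$ is divisible for every $P\in\operatorname{Spec} R$. (2) Moreover, if $(R,\mathfrak m,k)\to(S,\mathfrak n,\ell)$ is a local homomorphism of Noetherian local rings and $M$ is an Artinian $S$-module (regarded as an $R$-module by restriction of scalars), then each of the following conditions is also equivalent to $M$ being injective over $R$: (f$'$) $\operatorname{Hom}_R(\mathfrak m,M)$ is a divisible $R$-module. (g$'$) $\operatorname{Ext}^1_R(k,M)$ is a divisible $R$-module. (3) For any $R$-module $M$ (without the extra hypotheses of (2)), the following are equivalent: (i) $M$ is an injective cogenerator. (ii) $\operatorname{Coass}_R\operatorname{Hom}_R(L,M)=\operatorname{Ass}_R L$ for every finitely generated $R$-module $L$. (iii) $M$ is injective, and $\operatorname{Coass}_R\operatorname{Hom}_R(L,M)=\operatorname{Ass}_R L$ whenever $L$ is a simple $R$-module.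
   Context: All rings are commutative with identity. Let $Q$ be the total quotient ring of $R$ (the localization at the set of all non-zerodivisors). An $R$-module $N$ is torsion-free if every non-zerodivisor of $R$ acts injectively on $N$; divisible if every non-zerodivisor of $R$ acts surjectively on $N$; h-divisible if $N$ is an $R$-module quotient of a free $Q$-module. $\operatorname{Ass}_R N$ is the set of associated primes of $N$, with $\operatorname{Ass}0=\emptyset$. A prime $P\in\operatorname{Spec} R$ is coassociated to $N$ if there is a nonzero factor module $N'$ of $N$ which is hollow (i.e. $N'$ cannot be written as the sum of two proper submodules) such that $P=\{a\in R\mid aN'\neq N'\}$; the set of all such primes is $\operatorname{Coass}_R N$. An injective cogenerator for $R$ is an injective $R$-module $E$ such that $\operatorname{Hom}_R(N,E)\neq0$ for every nonzero $R$-module $N$. $(R,\mathfrak m,k)$ denotes a local ring with maximal ideal $\mathfrak m$ and residue field $k$; similarly for $(S,\mathfrak n,\ell)$. *)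

theory Defs
  imports "HOL-Algebra.Module" "HOL-Algebra.QuotRing" "HOL-Algebra.Ring_Divisibility"
begin

subsection \<open>Modules\<close>

text \<open>
  The type of modules extends that of rings; the fields \<open>monoid.mult\<close> and \<open>one\<close> play no role for
  modules and are left undefined in the constructions below.

  Homomorphisms are taken to be extensional (undefined outside the carrier of the domain), so
  that equality of functions is equality of homomorphisms.
\<close>

definition module_hom ::
    "('a, 'r) ring_scheme \<Rightarrow> ('a, 'l, 'p) module_scheme \<Rightarrow> ('a, 'm, 'q) module_scheme \<Rightarrow> ('l \<Rightarrow> 'm) set" where
  "module_hom R L M =
     {f \<in> extensional (carrier L). f \<in> hom (add_monoid L) (add_monoid M) \<and>
        (\<forall>r \<in> carrier R. \<forall>x \<in> carrier L. f (r \<odot>\<^bsub>L\<^esub> x) = r \<odot>\<^bsub>M\<^esub> f x)}"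

definition hom_module ::
    "('a, 'r) ring_scheme \<Rightarrow> ('a, 'l, 'p) module_scheme \<Rightarrow> ('a, 'm, 'q) module_scheme \<Rightarrow> ('a, 'l \<Rightarrow> 'm) module" where
  "hom_module R L M =
     \<lparr>carrier = module_hom R L M, monoid.mult = undefined, one = undefined,
      ring.zero = (\<lambda>x \<in> carrier L. \<zero>\<^bsub>M\<^esub>),
      add = (\<lambda>f g. \<lambda>x \<in> carrier L. f x \<oplus>\<^bsub>M\<^esub> g x),
      smult = (\<lambda>r f. \<lambda>x \<in> carrier L. r \<odot>\<^bsub>M\<^esub> f x)\<rparr>"

definition quot_module ::
    "('a, 'm, 'q) module_scheme \<Rightarrow> 'm set \<Rightarrow> ('a, 'm set) module" where
  "quot_module N K =
     \<lparr>carrier = a_rcosets\<^bsub>N\<^esub> K, monoid.mult = undefined, one = undefined,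
      ring.zero = K, add = set_add N,
      smult = (\<lambda>r X. \<Union>x \<in> X. K +>\<^bsub>N\<^esub> (r \<odot>\<^bsub>N\<^esub> x))\<rparr>"

definition regular_module :: "('a, 'r) ring_scheme \<Rightarrow> ('a, 'a) module" where
  "regular_module R =
     \<lparr>carrier = carrier R, monoid.mult = undefined, one = undefined,
      ring.zero = \<zero>\<^bsub>R\<^esub>, add = add R, smult = monoid.mult R\<rparr>"

definition ideal_module :: "('a, 'r) ring_scheme \<Rightarrow> 'a set \<Rightarrow> ('a, 'a) module" where
  "ideal_module R I = (regular_module R)\<lparr>carrier := I\<rparr>"

definition residue_module :: "('a, 'r) ring_scheme \<Rightarrow> 'a set \<Rightarrow> ('a, 'a set) module" where
  "residue_module R I = quot_module (regular_module R) I"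

definition restrict_scalars ::
    "('a \<Rightarrow> 'b) \<Rightarrow> ('b, 'm, 'q) module_scheme \<Rightarrow> ('a, 'm) module" where
  "restrict_scalars \<phi> N =
     \<lparr>carrier = carrier N, monoid.mult = undefined, one = undefined,
      ring.zero = \<zero>\<^bsub>N\<^esub>, add = add N, smult = (\<lambda>r x. \<phi> r \<odot>\<^bsub>N\<^esub> x)\<rparr>"

text \<open>The free module on the basis \<open>B\<close>: finitely supported functions from \<open>B\<close> to \<open>R\<close>.\<close>

definition free_module :: "('a, 'r) ring_scheme \<Rightarrow> 'b set \<Rightarrow> ('a, 'b \<Rightarrow> 'a) module" where
  "free_module R B =
     \<lparr>carrier = {c \<in> B \<rightarrow>\<^sub>E carrier R. finite {b \<in> B. c b \<noteq> \<zero>\<^bsub>R\<^esub>}},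
      monoid.mult = undefined, one = undefined,
      ring.zero = (\<lambda>b \<in> B. \<zero>\<^bsub>R\<^esub>),
      add = (\<lambda>c d. \<lambda>b \<in> B. c b \<oplus>\<^bsub>R\<^esub> d b),
      smult = (\<lambda>r c. \<lambda>b \<in> B. r \<otimes>\<^bsub>R\<^esub> c b)\<rparr>"

definition fin_gen_module :: "('a, 'r) ring_scheme \<Rightarrow> ('a, 'm, 'q) module_scheme \<Rightarrow> bool" where
  "fin_gen_module R N \<longleftrightarrow> module R N \<and>
     (\<exists>A \<subseteq> carrier N. finite A \<and> (\<forall>H. submodule H R N \<and> A \<subseteq> H \<longrightarrow> H = carrier N))"

definition simple_module :: "('a, 'r) ring_scheme \<Rightarrow> ('a, 'm, 'q) module_scheme \<Rightarrow> bool" where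
  "simple_module R N \<longleftrightarrow> module R N \<and> carrier N \<noteq> {\<zero>\<^bsub>N\<^esub>} \<and>
     (\<forall>H. submodule H R N \<longrightarrow> H = {\<zero>\<^bsub>N\<^esub>} \<or> H = carrier N)"

definition artinian_module :: "('a, 'r) ring_scheme \<Rightarrow> ('a, 'm, 'q) module_scheme \<Rightarrow> bool" where
  "artinian_module R N \<longleftrightarrow> module R N \<and>
     (\<forall>H :: nat \<Rightarrow> 'm set. (\<forall>i. submodule (H i) R N \<and> H (Suc i) \<subseteq> H i)
        \<longrightarrow> (\<exists>n. \<forall>i \<ge> n. H i = H n))"

subsection \<open>Rings\<close>

definition reduced_ring :: "('a, 'r) ring_scheme \<Rightarrow> bool" where
  "reduced_ring R \<longleftrightarrow> cring R \<and>
     (\<forall>x \<in> carrier R. \<forall>n :: nat. x [^]\<^bsub>R\<^esub> n = \<zero>\<^bsub>R\<^esub> \<longrightarrow> x = \<zero>\<^bsub>R\<^esub>)"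

definition noetherian_local_ring :: "('a, 'r) ring_scheme \<Rightarrow> 'a set \<Rightarrow> bool" where
  "noetherian_local_ring R \<mm> \<longleftrightarrow> cring R \<and> noetherian_ring R \<and>
     maximalideal \<mm> R \<and> (\<forall>J. maximalideal J R \<longrightarrow> J = \<mm>)"

definition nonzerodivisors :: "('a, 'r) ring_scheme \<Rightarrow> 'a set" where
  "nonzerodivisors R =
     {s \<in> carrier R. \<forall>x \<in> carrier R. s \<otimes>\<^bsub>R\<^esub> x = \<zero>\<^bsub>R\<^esub> \<longrightarrow> x = \<zero>\<^bsub>R\<^esub>}"

text \<open>The localization at a multiplicative set \<open>S\<close>; the pair \<open>(a, s)\<close> stands for the
  fraction \<open>a / s\<close>.\<close>

definition frac_rel :: "('a, 'r) ring_scheme \<Rightarrow> 'a set \<Rightarrow> (('a \<times> 'a) \<times> ('a \<times> 'a)) set" where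
  "frac_rel R S =
     {((a, s), (b, t)). a \<in> carrier R \<and> s \<in> S \<and> b \<in> carrier R \<and> t \<in> S \<and>
        (\<exists>u \<in> S. u \<otimes>\<^bsub>R\<^esub> (t \<otimes>\<^bsub>R\<^esub> a) = u \<otimes>\<^bsub>R\<^esub> (s \<otimes>\<^bsub>R\<^esub> b))}"

definition fraction :: "('a, 'r) ring_scheme \<Rightarrow> 'a set \<Rightarrow> 'a \<Rightarrow> 'a \<Rightarrow> ('a \<times> 'a) set" where
  "fraction R S a s = frac_rel R S `` {(a, s)}"

definition localization :: "('a, 'r) ring_scheme \<Rightarrow> 'a set \<Rightarrow> ('a \<times> 'a) set ring" where
  "localization R S =
     \<lparr>carrier = (carrier R \<times> S) // frac_rel R S,
      monoid.mult = (\<lambda>X Y. \<Union>(a, s) \<in> X. \<Union>(b, t) \<in> Y. fraction R S (a \<otimes>\<^bsub>R\<^esub> b) (s \<otimes>\<^bsub>R\<^esub> t)),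
      one = fraction R S \<one>\<^bsub>R\<^esub> \<one>\<^bsub>R\<^esub>,
      ring.zero = fraction R S \<zero>\<^bsub>R\<^esub> \<one>\<^bsub>R\<^esub>,
      add = (\<lambda>X Y. \<Union>(a, s) \<in> X. \<Union>(b, t) \<in> Y.
               fraction R S ((t \<otimes>\<^bsub>R\<^esub> a) \<oplus>\<^bsub>R\<^esub> (s \<otimes>\<^bsub>R\<^esub> b)) (s \<otimes>\<^bsub>R\<^esub> t))\<rparr>"

definition total_quotient_ring :: "('a, 'r) ring_scheme \<Rightarrow> ('a \<times> 'a) set ring" where
  "total_quotient_ring R = localization R (nonzerodivisors R)"

definition to_total_quotient :: "('a, 'r) ring_scheme \<Rightarrow> 'a \<Rightarrow> ('a \<times> 'a) set" where
  "to_total_quotient R r = fraction R (nonzerodivisors R) r \<one>\<^bsub>R\<^esub>"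

subsection \<open>Torsion-free, divisible and h-divisible modules\<close>

definition torsion_free :: "('a, 'r) ring_scheme \<Rightarrow> ('a, 'm, 'q) module_scheme \<Rightarrow> bool" where
  "torsion_free R N \<longleftrightarrow> module R N \<and>
     (\<forall>s \<in> nonzerodivisors R. inj_on (\<lambda>x. s \<odot>\<^bsub>N\<^esub> x) (carrier N))"

definition divisible :: "('a, 'r) ring_scheme \<Rightarrow> ('a, 'm, 'q) module_scheme \<Rightarrow> bool" where
  "divisible R N \<longleftrightarrow> module R N \<and>
     (\<forall>s \<in> nonzerodivisors R. (\<lambda>x. s \<odot>\<^bsub>N\<^esub> x) ` carrier N = carrier N)"

text \<open>
  \<open>N\<close> is the image of an \<open>R\<close>-linear map from a free module over the total quotient ring \<open>Q\<close>.
  Bases indexed by subsets of the type of \<open>N\<close> cover all free \<open>Q\<close>-modules: given a surjection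
  \<open>p\<close> from any free \<open>Q\<close>-module, choose for each \<open>n\<close> in \<open>N\<close> a preimage \<open>y n\<close>; sending the
  basis vector \<open>e n\<close> to \<open>y n\<close> yields a surjection from the free \<open>Q\<close>-module on \<open>carrier N\<close>.
\<close>

definition h_divisible :: "('a, 'r) ring_scheme \<Rightarrow> ('a, 'm, 'q) module_scheme \<Rightarrow> bool" where
  "h_divisible R N \<longleftrightarrow> module R N \<and>
     (\<exists>B :: 'm set.
        let F = restrict_scalars (to_total_quotient R) (free_module (total_quotient_ring R) B)
        in \<exists>p \<in> module_hom R F N. p ` carrier F = carrier N)"

subsection \<open>Associated and coassociated primes\<close>

definition Ass :: "('a, 'r) ring_scheme \<Rightarrow> ('a, 'm, 'q) module_scheme \<Rightarrow> 'a set set" where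
  "Ass R N =
     {P. primeideal P R \<and> (\<exists>x \<in> carrier N. P = {a \<in> carrier R. a \<odot>\<^bsub>N\<^esub> x = \<zero>\<^bsub>N\<^esub>})}"

definition hollow :: "('a, 'r) ring_scheme \<Rightarrow> ('a, 'm, 'q) module_scheme \<Rightarrow> bool" where
  "hollow R N \<longleftrightarrow>
     (\<forall>A B. submodule A R N \<and> submodule B R N \<and> A <+>\<^bsub>N\<^esub> B = carrier N
        \<longrightarrow> A = carrier N \<or> B = carrier N)"

definition Coass :: "('a, 'r) ring_scheme \<Rightarrow> ('a, 'm, 'q) module_scheme \<Rightarrow> 'a set set" where
  "Coass R N =
     {P. primeideal P R \<and>
        (\<exists>K. submodule K R N \<and>
           (let N' = quot_module N K in
              carrier N' \<noteq> {\<zero>\<^bsub>N'\<^esub>} \<and> hollow R N' \<and>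
              P = {a \<in> carrier R. (\<lambda>x. a \<odot>\<^bsub>N'\<^esub> x) ` carrier N' \<noteq> carrier N'}))}"

subsection \<open>Injective modules\<close>

text \<open>
  A type \<open>'u\<close> serves as the universe of test modules. By Baer's criterion the notions below do
  not depend on \<open>'u\<close> as soon as \<open>'u\<close> is infinite and admits an injection from \<open>R\<close>: isomorphic
  copies of all finitely generated \<open>R\<close>-modules then live in \<open>'u\<close>.
\<close>

definition injective_module ::
    "'u itself \<Rightarrow> ('a, 'r) ring_scheme \<Rightarrow> ('a, 'm, 'q) module_scheme \<Rightarrow> bool" where
  "injective_module U R E \<longleftrightarrow> module R E \<and>
     (\<forall>(A :: ('a, 'u) module) (B :: ('a, 'u) module). module R A \<and> module R B \<longrightarrow>
        (\<forall>i \<in> module_hom R A B. \<forall>f \<in> module_hom R A E. inj_on i (carrier A) \<longrightarrow>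
           (\<exists>g \<in> module_hom R B E. \<forall>x \<in> carrier A. g (i x) = f x)))"

definition injective_cogenerator ::
    "'u itself \<Rightarrow> ('a, 'r) ring_scheme \<Rightarrow> ('a, 'm, 'q) module_scheme \<Rightarrow> bool" where
  "injective_cogenerator U R E \<longleftrightarrow> injective_module U R E \<and>
     (\<forall>N :: ('a, 'u) module. module R N \<and> carrier N \<noteq> {\<zero>\<^bsub>N\<^esub>} \<longrightarrow>
        carrier (hom_module R N E) \<noteq> {\<zero>\<^bsub>hom_module R N E\<^esub>})"

subsection \<open>The first Ext module\<close>

text \<open>The linear map from the free module on \<open>B \<subseteq> N\<close> to \<open>N\<close> that sends the basis vector \<open>e b\<close>
  to \<open>b\<close>, and its kernel, the relations between the elements of \<open>B\<close>.\<close>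

definition gen_map ::
    "('a, 'r) ring_scheme \<Rightarrow> ('a, 'm, 'q) module_scheme \<Rightarrow> 'm set \<Rightarrow> ('m \<Rightarrow> 'a) \<Rightarrow> 'm" where
  "gen_map R N B =
     (\<lambda>c \<in> carrier (free_module R B). \<Oplus>\<^bsub>N\<^esub>b \<in> {b \<in> B. c b \<noteq> \<zero>\<^bsub>R\<^esub>}. c b \<odot>\<^bsub>N\<^esub> b)"

definition relations ::
    "('a, 'r) ring_scheme \<Rightarrow> ('a, 'm, 'q) module_scheme \<Rightarrow> 'm set \<Rightarrow> ('m \<Rightarrow> 'a) set" where
  "relations R N B = {c \<in> carrier (free_module R B). gen_map R N B c = \<zero>\<^bsub>N\<^esub>}"

text \<open>
  The first cohomology of \<open>Hom (F, M)\<close>, where \<open>F\<^sub>2 \<rightarrow> F\<^sub>1 \<rightarrow> F\<^sub>0 \<rightarrow> N \<rightarrow> 0\<close> is the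
  beginning of the canonical free resolution of \<open>N\<close>: \<open>F\<^sub>0\<close> is free on all elements of \<open>N\<close>, and
  each further \<open>F\<^sub>i\<^sub>+\<^sub>1\<close> is free on all elements of the kernel \<open>K\<^sub>i\<close> of the preceding map.
\<close>

definition ext1_module ::
    "('a, 'r) ring_scheme \<Rightarrow> ('a, 'n, 'p) module_scheme \<Rightarrow> ('a, 'm, 'q) module_scheme \<Rightarrow>
     ('a, ((('n \<Rightarrow> 'a) \<Rightarrow> 'a) \<Rightarrow> 'm) set) module" where
  "ext1_module R N M =
     (let F\<^sub>0 = free_module R (carrier N);
          K\<^sub>0 = relations R N (carrier N);
          F\<^sub>1 = free_module R K\<^sub>0;
          d\<^sub>1 = gen_map R F\<^sub>0 K\<^sub>0;
          K\<^sub>1 = relations R F\<^sub>0 K\<^sub>0;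
          F\<^sub>2 = free_module R K\<^sub>1;
          d\<^sub>2 = gen_map R F\<^sub>1 K\<^sub>1;
          Z = {h \<in> module_hom R F\<^sub>1 M. \<forall>c \<in> carrier F\<^sub>2. h (d\<^sub>2 c) = \<zero>\<^bsub>M\<^esub>};
          B = {compose (carrier F\<^sub>1) g d\<^sub>1 | g. g \<in> module_hom R F\<^sub>0 M}
      in quot_module ((hom_module R F\<^sub>1 M)\<lparr>carrier := Z\<rparr>) B)"

end

theory Submission
  imports Defs
begin

text \<open>
  Write \<open>r\<close> is regular for: \<open>r\<close> is a nonzerodivisor of \<open>R\<close>. By Baer's criterion, injectivity of \<open>M\<close>
  means that every map \<open>I \<rightarrow> M\<close> on an ideal has the form \<open>x \<mapsto> x m\<close>. Three ideas carry the proof.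

  \<^bold>\<open>Reduction to regular primes.\<close> In a reduced ring \<open>I \<inter> ann I = 0\<close>, so a map on \<open>I\<close> extends by zero
  to \<open>I + ann I\<close>, an ideal with zero annihilator. An ideal \<open>J \<noteq> R\<close> has a prime of the form \<open>(J : y)\<close>
  with \<open>y \<notin> J\<close>, so a map on \<open>J\<close> extends further if the maps on primes above \<open>J\<close> extend to \<open>R\<close>; and in
  a reduced Noetherian ring an ideal with zero annihilator contains a regular \<open>s\<close>. Hence only maps
  \<open>g : P \<rightarrow> M\<close> on primes \<open>P\<close> that contain a regular \<open>s\<close> matter
  (\<open>Baer_injective_from_regular_primes\<close>). If \<open>Hom(P, M)\<close> is divisible, write \<open>g = s h\<close>; then
  \<open>g(x) = h(s x) = x h(s)\<close>. Divisibility of \<open>Ext\<^sup>1(R/P, M)\<close>, the quotient of \<open>Hom(P, M)\<close> by the maps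
  \<open>x \<mapsto> x m\<close>, is enough for the same computation (\<open>maps_extend_if_divisible_ext1\<close>). Conversely, if \<open>M\<close>
  is injective then \<open>Ext\<^sup>1\<close> vanishes, and every map from a torsion-free \<open>L\<close> to \<open>M\<close> extends to the
  module of fractions of \<open>L\<close>, so that \<open>Hom(L, M)\<close> is h-divisible (\<open>h_divisible_hom\<close>).

  \<^bold>\<open>Coassociated primes.\<close> Over a Noetherian ring every nonzero module \<open>N\<close> has a nonzero hollow
  quotient (\<open>exists_hollow_above\<close>): it has a quotient in which some \<open>x \<noteq> 0\<close> lies in all nonzero
  submodules; such a module is Artinian, and every nonzero Artinian module has a hollow quotient. So
  if \<open>s N \<noteq> N\<close>, then \<open>s\<close> lies in a prime coassociated to \<open>N\<close>. For torsion-free \<open>L\<close> no associated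
  prime contains a regular element, and \<open>Coass Hom(L, M) \<subseteq> Ass L\<close> implies that \<open>Hom(L, M)\<close> is
  divisible. For injective \<open>M\<close> and finitely generated \<open>L\<close> the inclusion holds
  (\<open>Coass_hom_subset_Ass\<close>): a prime \<open>P\<close> coassociated to \<open>Hom(L, M)\<close> remains so for \<open>Hom(H, M)\<close>, where
  \<open>H \<subseteq> L\<close> consists of elements killed by powers of \<open>P\<close>, and \<open>H\<close> is not killed by any \<open>s \<notin> P\<close>. If \<open>M\<close>
  is moreover a cogenerator and \<open>P = ann x\<close> with \<open>x \<in> L\<close>, then \<open>Hom(R x, M)\<close> is a nonzero quotient of
  \<open>Hom(L, M)\<close> whose only possible coassociated prime is \<open>P\<close>.

  \<^bold>\<open>The local case.\<close> Elements of an Artinian module over \<open>S\<close> are killed by powers of any \<open>r \<in> \<mm>\<close>. Let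
  \<open>P \<noteq> \<mm>\<close> be a prime, \<open>r \<in> \<mm> - P\<close>, and let the maps on larger primes extend. Multiplication by \<open>r\<close> is
  injective on \<open>Ext\<^sup>1(R/P, M)\<close> because maps on \<open>P + r R\<close> extend, and it is locally nilpotent; so
  \<open>Ext\<^sup>1(R/P, M) = 0\<close>. Noetherian induction reduces everything to the prime \<open>\<mm>\<close>.
\<close>

section \<open>Submodules and linear maps\<close>

lemma (in module) submodule_iff:
  "submodule H R M \<longleftrightarrow> H \<subseteq> carrier M \<and> \<zero>\<^bsub>M\<^esub> \<in> H \<and>
     (\<forall>x \<in> H. \<forall>y \<in> H. x \<oplus>\<^bsub>M\<^esub> y \<in> H) \<and> (\<forall>r \<in> carrier R. \<forall>x \<in> H. r \<odot>\<^bsub>M\<^esub> x \<in> H)"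
  (is "_ \<longleftrightarrow> ?R")
proof
  assume H: "submodule H R M"
  from submoduleE[OF H] obtain x where x: "x \<in> H" by auto
  then have "\<zero> \<odot>\<^bsub>M\<^esub> x \<in> H" using submoduleE[OF H] by auto
  then have "\<zero>\<^bsub>M\<^esub> \<in> H" using submoduleE(1)[OF H] x by auto
  then show ?R using submoduleE[OF H] by auto
next
  assume H: ?R
  show "submodule H R M"
  proof (rule submoduleI)
    fix a assume a: "a \<in> H"
    then have "\<ominus>\<^bsub>M\<^esub> a = (\<ominus> \<one>) \<odot>\<^bsub>M\<^esub> a" using H by (subst smult_l_minus) auto
    then show "\<ominus>\<^bsub>M\<^esub> a \<in> H" using H a by auto
  qed (use H in auto)
qed

lemma (in module) submodule_minus:
  assumes "submodule H R M" "x \<in> H" "y \<in> H" shows "x \<ominus>\<^bsub>M\<^esub> y \<in> H"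
  using assms submoduleE[OF assms(1)] unfolding a_minus_def by auto

lemma (in module) smult_minus_distr:
  assumes "r \<in> carrier R" "x \<in> carrier M" "y \<in> carrier M"
  shows "r \<odot>\<^bsub>M\<^esub> (x \<ominus>\<^bsub>M\<^esub> y) = r \<odot>\<^bsub>M\<^esub> x \<ominus>\<^bsub>M\<^esub> r \<odot>\<^bsub>M\<^esub> y"
  using assms by (simp add: a_minus_def smult_r_distr smult_r_minus)

lemma (in module) smult_comm:
  assumes "r \<in> carrier R" "s \<in> carrier R" "x \<in> carrier M"
  shows "r \<odot>\<^bsub>M\<^esub> (s \<odot>\<^bsub>M\<^esub> x) = s \<odot>\<^bsub>M\<^esub> (r \<odot>\<^bsub>M\<^esub> x)"
  using assms smult_assoc1[symmetric] R.m_comm by simp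

lemma (in module) minus_eq_zero_iff:
  assumes "x \<in> carrier M" "y \<in> carrier M" shows "x \<ominus>\<^bsub>M\<^esub> y = \<zero>\<^bsub>M\<^esub> \<longleftrightarrow> x = y"
  using assms by (metis M.minus_equality M.r_neg M.minus_minus a_minus_def M.a_inv_closed M.r_neg1)

lemma (in module) submodule_Int:
  assumes "submodule A R M" "submodule B R M" shows "submodule (A \<inter> B) R M"
  using assms unfolding submodule_iff by auto

lemma (in module) submodule_zero: "submodule {\<zero>\<^bsub>M\<^esub>} R M"
  unfolding submodule_iff by auto

lemma (in module) submodule_sum:
  assumes A: "submodule A R M" and B: "submodule B R M" shows "submodule (A <+>\<^bsub>M\<^esub> B) R M"
proof -
  have c: "A \<subseteq> carrier M" "B \<subseteq> carrier M" using submoduleE(1) A B by auto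
  have 1: "(x \<oplus>\<^bsub>M\<^esub> y) \<oplus>\<^bsub>M\<^esub> (x' \<oplus>\<^bsub>M\<^esub> y') = (x \<oplus>\<^bsub>M\<^esub> x') \<oplus>\<^bsub>M\<^esub> (y \<oplus>\<^bsub>M\<^esub> y')"
    if "x \<in> A" "x' \<in> A" "y \<in> B" "y' \<in> B" for x x' y y'
  proof -
    have "x \<in> carrier M" "x' \<in> carrier M" "y \<in> carrier M" "y' \<in> carrier M" using that c by auto
    then show ?thesis by (simp add: M.add.m_ac)
  qed
  show ?thesis unfolding submodule_iff
  proof (intro conjI ballI)
    show "A <+>\<^bsub>M\<^esub> B \<subseteq> carrier M" using c unfolding set_add_def' by auto
    have "\<zero>\<^bsub>M\<^esub> = \<zero>\<^bsub>M\<^esub> \<oplus>\<^bsub>M\<^esub> \<zero>\<^bsub>M\<^esub>" by simp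
    then show "\<zero>\<^bsub>M\<^esub> \<in> A <+>\<^bsub>M\<^esub> B"
      using A B unfolding set_add_def' submodule_iff by blast
  next
    fix u v assume "u \<in> A <+>\<^bsub>M\<^esub> B" "v \<in> A <+>\<^bsub>M\<^esub> B"
    then show "u \<oplus>\<^bsub>M\<^esub> v \<in> A <+>\<^bsub>M\<^esub> B"
      using 1 A B unfolding set_add_def' submodule_iff by clarsimp metis
  next
    fix r u assume r: "r \<in> carrier R" and "u \<in> A <+>\<^bsub>M\<^esub> B"
    then obtain x y where xy: "x \<in> A" "y \<in> B" "u = x \<oplus>\<^bsub>M\<^esub> y" unfolding set_add_def' by auto
    then have "x \<in> carrier M" "y \<in> carrier M" using c by auto
    then have "r \<odot>\<^bsub>M\<^esub> u = r \<odot>\<^bsub>M\<^esub> x \<oplus>\<^bsub>M\<^esub> r \<odot>\<^bsub>M\<^esub> y"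
      using xy r smult_r_distr by simp
    then show "r \<odot>\<^bsub>M\<^esub> u \<in> A <+>\<^bsub>M\<^esub> B"
      using xy r A B unfolding set_add_def' submodule_iff by blast
  qed
qed

lemma (in module) submodule_restrict_iff:
  assumes "submodule H R M"
  shows "submodule A R (M\<lparr>carrier := H\<rparr>) \<longleftrightarrow> submodule A R M \<and> A \<subseteq> H"
proof -
  interpret H: module R "M\<lparr>carrier := H\<rparr>"
    by (rule submodule.submodule_is_module[OF assms module_axioms])
  show ?thesis using submoduleE(1)[OF assms] unfolding submodule_iff H.submodule_iff by auto
qed

lemma (in module) submodule_cyclic:
  assumes x: "x \<in> carrier M"
  shows "submodule ((\<lambda>r. r \<odot>\<^bsub>M\<^esub> x) ` carrier R) R M" and "x \<in> (\<lambda>r. r \<odot>\<^bsub>M\<^esub> x) ` carrier R"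
proof -
  show "submodule ((\<lambda>r. r \<odot>\<^bsub>M\<^esub> x) ` carrier R) R M"
    unfolding submodule_iff
  proof (intro conjI ballI)
    show "\<zero>\<^bsub>M\<^esub> \<in> (\<lambda>r. r \<odot>\<^bsub>M\<^esub> x) ` carrier R"
      using x by (intro image_eqI[of _ _ \<zero>]) auto
  next
    fix u v assume "u \<in> (\<lambda>r. r \<odot>\<^bsub>M\<^esub> x) ` carrier R" "v \<in> (\<lambda>r. r \<odot>\<^bsub>M\<^esub> x) ` carrier R"
    then obtain a b where "a \<in> carrier R" "b \<in> carrier R" "u = a \<odot>\<^bsub>M\<^esub> x" "v = b \<odot>\<^bsub>M\<^esub> x" by auto
    then show "u \<oplus>\<^bsub>M\<^esub> v \<in> (\<lambda>r. r \<odot>\<^bsub>M\<^esub> x) ` carrier R"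
      using x by (intro image_eqI[of _ _ "a \<oplus> b"]) (auto simp: smult_l_distr)
  next
    fix r u assume "r \<in> carrier R" "u \<in> (\<lambda>r. r \<odot>\<^bsub>M\<^esub> x) ` carrier R"
    then obtain a where "a \<in> carrier R" "u = a \<odot>\<^bsub>M\<^esub> x" by auto
    then show "r \<odot>\<^bsub>M\<^esub> u \<in> (\<lambda>r. r \<odot>\<^bsub>M\<^esub> x) ` carrier R"
      using x \<open>r \<in> carrier R\<close> by (intro image_eqI[of _ _ "r \<otimes> a"]) (auto simp: smult_assoc1)
  qed (use x in auto)
  show "x \<in> (\<lambda>r. r \<odot>\<^bsub>M\<^esub> x) ` carrier R"
    using x by (intro image_eqI[of _ _ \<one>]) auto
qed

lemma (in module) colon_ideal:
  assumes T: "submodule T R M" and y: "y \<in> carrier M"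
  shows "ideal {r \<in> carrier R. r \<odot>\<^bsub>M\<^esub> y \<in> T} R"
proof (rule idealI)
  show "ring R" ..
  show "subgroup {r \<in> carrier R. r \<odot>\<^bsub>M\<^esub> y \<in> T} (add_monoid R)"
  proof (rule R.add.subgroupI)
    show "{r \<in> carrier R. r \<odot>\<^bsub>M\<^esub> y \<in> T} \<noteq> {}"
      using T y unfolding submodule_iff by (auto intro!: exI[of _ \<zero>])
  next
    fix a assume "a \<in> {r \<in> carrier R. r \<odot>\<^bsub>M\<^esub> y \<in> T}"
    then show "\<ominus> a \<in> {r \<in> carrier R. r \<odot>\<^bsub>M\<^esub> y \<in> T}"
      using y submoduleE(3)[OF T] by (auto simp: smult_l_minus)
  next
    fix a b assume "a \<in> {r \<in> carrier R. r \<odot>\<^bsub>M\<^esub> y \<in> T}" "b \<in> {r \<in> carrier R. r \<odot>\<^bsub>M\<^esub> y \<in> T}"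
    then show "a \<oplus> b \<in> {r \<in> carrier R. r \<odot>\<^bsub>M\<^esub> y \<in> T}"
      using y T unfolding submodule_iff by (auto simp: smult_l_distr)
  qed auto
next
  fix a x assume a: "a \<in> {r \<in> carrier R. r \<odot>\<^bsub>M\<^esub> y \<in> T}" and x: "x \<in> carrier R"
  then show "x \<otimes> a \<in> {r \<in> carrier R. r \<odot>\<^bsub>M\<^esub> y \<in> T}"
    using y T unfolding submodule_iff by (auto simp: smult_assoc1)
  then show "a \<otimes> x \<in> {r \<in> carrier R. r \<odot>\<^bsub>M\<^esub> y \<in> T}"
    using a x R.m_comm by auto
qed

text \<open>Unlike for the members of \<open>module_hom\<close>, the values outside \<open>carrier L\<close> are arbitrary, so that
  lambda terms such as \<open>\<lambda>x. g (f x)\<close> are linear maps without restriction.\<close>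

definition linear_map ::
    "('a, 'r) ring_scheme \<Rightarrow> ('a, 'l, 'p) module_scheme \<Rightarrow> ('a, 'm, 'q) module_scheme \<Rightarrow> ('l \<Rightarrow> 'm) \<Rightarrow> bool" where
  "linear_map R L M f \<longleftrightarrow> (\<forall>x \<in> carrier L. f x \<in> carrier M) \<and>
     (\<forall>x \<in> carrier L. \<forall>y \<in> carrier L. f (x \<oplus>\<^bsub>L\<^esub> y) = f x \<oplus>\<^bsub>M\<^esub> f y) \<and>
     (\<forall>r \<in> carrier R. \<forall>x \<in> carrier L. f (r \<odot>\<^bsub>L\<^esub> x) = r \<odot>\<^bsub>M\<^esub> f x)"

lemma linear_mapD:
  assumes "linear_map R L M f"
  shows "x \<in> carrier L \<Longrightarrow> f x \<in> carrier M"
    and "x \<in> carrier L \<Longrightarrow> y \<in> carrier L \<Longrightarrow> f (x \<oplus>\<^bsub>L\<^esub> y) = f x \<oplus>\<^bsub>M\<^esub> f y"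
    and "r \<in> carrier R \<Longrightarrow> x \<in> carrier L \<Longrightarrow> f (r \<odot>\<^bsub>L\<^esub> x) = r \<odot>\<^bsub>M\<^esub> f x"
  using assms unfolding linear_map_def by auto

lemma module_hom_iff:
  "f \<in> module_hom R L M \<longleftrightarrow> f \<in> extensional (carrier L) \<and> linear_map R L M f"
  unfolding module_hom_def linear_map_def hom_def by auto

lemma module_homD: "f \<in> module_hom R L M \<Longrightarrow> linear_map R L M f"
  by (simp add: module_hom_iff)

lemma linear_map_cong:
  assumes "linear_map R L M f" "module R L" "\<And>x. x \<in> carrier L \<Longrightarrow> g x = f x"
  shows "linear_map R L M g"
proof -
  interpret L: module R L by fact
  show ?thesis using assms(1,3) unfolding linear_map_def by simp
qed

lemma restrict_module_hom:
  assumes "linear_map R L M f" "module R L"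
  shows "restrict f (carrier L) \<in> module_hom R L M"
  using linear_map_cong[OF assms, of "restrict f (carrier L)"] by (simp add: module_hom_iff)

lemma linear_map_zero:
  assumes "linear_map R L M f" "module R L" "module R M" shows "f \<zero>\<^bsub>L\<^esub> = \<zero>\<^bsub>M\<^esub>"
proof -
  interpret L: module R L by fact
  interpret M: module R M by fact
  have "f (\<zero>\<^bsub>R\<^esub> \<odot>\<^bsub>L\<^esub> \<zero>\<^bsub>L\<^esub>) = \<zero>\<^bsub>R\<^esub> \<odot>\<^bsub>M\<^esub> f \<zero>\<^bsub>L\<^esub>"
    by (rule linear_mapD(3)[OF assms(1)]) auto
  then show ?thesis using linear_mapD(1)[OF assms(1)] by simp
qed

lemma linear_map_neg:
  assumes "linear_map R L M f" "module R L" "module R M" "x \<in> carrier L"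
  shows "f (\<ominus>\<^bsub>L\<^esub> x) = \<ominus>\<^bsub>M\<^esub> f x"
proof -
  interpret L: module R L by fact
  interpret M: module R M by fact
  have "f ((\<ominus>\<^bsub>R\<^esub> \<one>\<^bsub>R\<^esub>) \<odot>\<^bsub>L\<^esub> x) = (\<ominus>\<^bsub>R\<^esub> \<one>\<^bsub>R\<^esub>) \<odot>\<^bsub>M\<^esub> f x"
    using linear_mapD(3)[OF assms(1)] assms(4) by simp
  then show ?thesis
    using assms(4) linear_mapD(1)[OF assms(1,4)] L.smult_l_minus[of "\<one>\<^bsub>R\<^esub>" x] M.smult_l_minus[of "\<one>\<^bsub>R\<^esub>" "f x"] by simp
qed

lemma linear_map_minus:
  assumes "linear_map R L M f" "module R L" "module R M" "x \<in> carrier L" "y \<in> carrier L"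
  shows "f (x \<ominus>\<^bsub>L\<^esub> y) = f x \<ominus>\<^bsub>M\<^esub> f y"
proof -
  interpret L: module R L by fact
  show ?thesis using assms linear_map_neg[OF assms(1,2,3)]
    by (simp add: a_minus_def linear_mapD(2)[OF assms(1)])
qed

lemma linear_map_comp:
  assumes "linear_map R L M f" "linear_map R M N g"
  shows "linear_map R L N (\<lambda>x. g (f x))"
  using assms unfolding linear_map_def by simp

lemma linear_map_smult:
  assumes "linear_map R L M f" "module R L" "module R M" "s \<in> carrier R"
  shows "linear_map R L M (\<lambda>x. s \<odot>\<^bsub>M\<^esub> f x)"
proof -
  interpret L: module R L by fact
  interpret M: module R M by fact
  show ?thesis using assms(1,4) unfolding linear_map_def
    by (auto simp: M.smult_r_distr M.smult_comm)
qed

lemma linear_map_add: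
  assumes "linear_map R L M f" "linear_map R L M g" "module R L" "module R M"
  shows "linear_map R L M (\<lambda>x. f x \<oplus>\<^bsub>M\<^esub> g x)"
proof -
  interpret L: module R L by fact
  interpret M: module R M by fact
  show ?thesis using assms(1,2) unfolding linear_map_def
    by (auto simp: M.smult_r_distr M.M.add.m_ac)
qed

lemma linear_map_submodule:
  assumes "linear_map R L M f" "H \<subseteq> carrier L"
  shows "linear_map R (L\<lparr>carrier := H\<rparr>) M f"
  using assms unfolding linear_map_def by (auto simp: subset_iff)

lemma linear_map_into_submodule:
  assumes "linear_map R L M f" "\<And>x. x \<in> carrier L \<Longrightarrow> f x \<in> H"
  shows "linear_map R L (M\<lparr>carrier := H\<rparr>) f"
  using assms unfolding linear_map_def by auto

lemma linear_map_id: "linear_map R L L (\<lambda>x. x)"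
  unfolding linear_map_def by simp

lemma submodule_preimage:
  assumes f: "linear_map R L M f" and L: "module R L" and M: "module R M" and H: "submodule H R M"
  shows "submodule {x \<in> carrier L. f x \<in> H} R L"
proof -
  interpret L: module R L by fact
  interpret M: module R M by fact
  show ?thesis using H linear_mapD[OF f] linear_map_zero[OF f L M]
    unfolding L.submodule_iff M.submodule_iff by auto
qed

lemma submodule_image:
  assumes f: "linear_map R L M f" and L: "module R L" and M: "module R M" and H: "submodule H R L"
  shows "submodule (f ` H) R M"
proof -
  interpret L: module R L by fact
  interpret M: module R M by fact
  have HL: "H \<subseteq> carrier L" using H unfolding L.submodule_iff by auto
  show ?thesis unfolding M.submodule_iff
  proof (intro conjI ballI)
    show "f ` H \<subseteq> carrier M" using HL linear_mapD(1)[OF f] by auto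
    show "\<zero>\<^bsub>M\<^esub> \<in> f ` H" using linear_map_zero[OF f L M] H unfolding L.submodule_iff by force
  next
    fix u v assume "u \<in> f ` H" "v \<in> f ` H"
    then obtain x y where xy: "x \<in> H" "y \<in> H" "u = f x" "v = f y" by auto
    then have "u \<oplus>\<^bsub>M\<^esub> v = f (x \<oplus>\<^bsub>L\<^esub> y)" using linear_mapD(2)[OF f, of x y] HL by (simp add: subsetD)
    then show "u \<oplus>\<^bsub>M\<^esub> v \<in> f ` H" using xy H unfolding L.submodule_iff by auto
  next
    fix r u assume r: "r \<in> carrier R" and "u \<in> f ` H"
    then obtain x where x: "x \<in> H" "u = f x" by auto
    then have "r \<odot>\<^bsub>M\<^esub> u = f (r \<odot>\<^bsub>L\<^esub> x)" using linear_mapD(3)[OF f, of r x] HL r by (simp add: subsetD)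
    then show "r \<odot>\<^bsub>M\<^esub> u \<in> f ` H" using x r H unfolding L.submodule_iff by auto
  qed
qed

section \<open>Modules of homomorphisms, ideals as modules\<close>

lemma hom_module_simps [simp]:
  "carrier (hom_module R L M) = module_hom R L M"
  "\<zero>\<^bsub>hom_module R L M\<^esub> = (\<lambda>x \<in> carrier L. \<zero>\<^bsub>M\<^esub>)"
  "f \<oplus>\<^bsub>hom_module R L M\<^esub> g = (\<lambda>x \<in> carrier L. f x \<oplus>\<^bsub>M\<^esub> g x)"
  "r \<odot>\<^bsub>hom_module R L M\<^esub> f = (\<lambda>x \<in> carrier L. r \<odot>\<^bsub>M\<^esub> f x)"
  unfolding hom_module_def by auto

lemma module_hom_eqI:
  assumes "f \<in> extensional (carrier L)" "g \<in> extensional (carrier L)" "\<And>x. x \<in> carrier L \<Longrightarrow> f x = g x"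
  shows "f = g"
  using assms by (rule extensionalityI)

lemma hom_module_module:
  assumes L: "module R L" and M: "module R M"
  shows "module R (hom_module R L M)"
proof -
  interpret L: module R L by fact
  interpret M: module R M by fact
  have zero: "(\<lambda>x \<in> carrier L. \<zero>\<^bsub>M\<^esub>) \<in> module_hom R L M"
    by (rule restrict_module_hom[OF _ L]) (auto simp: linear_map_def)
  have add: "(\<lambda>x \<in> carrier L. f x \<oplus>\<^bsub>M\<^esub> g x) \<in> module_hom R L M"
    if "f \<in> module_hom R L M" "g \<in> module_hom R L M" for f g
    using that by (intro restrict_module_hom[OF linear_map_add L] L M module_homD)
  have smult: "(\<lambda>x \<in> carrier L. r \<odot>\<^bsub>M\<^esub> f x) \<in> module_hom R L M"
    if "r \<in> carrier R" "f \<in> module_hom R L M" for f r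
    using that by (intro restrict_module_hom[OF linear_map_smult L] L M module_homD)
  have val: "f x \<in> carrier M" if "f \<in> module_hom R L M" "x \<in> carrier L" for f x
    using linear_mapD(1)[OF module_homD[OF that(1)] that(2)] .
  have ext: "f \<in> extensional (carrier L)" if "f \<in> module_hom R L M" for f
    using that by (simp add: module_hom_iff)
  have neg: "(\<lambda>z \<in> carrier L. (\<lambda>z \<in> carrier L. (\<ominus>\<^bsub>R\<^esub> \<one>\<^bsub>R\<^esub>) \<odot>\<^bsub>M\<^esub> f z) z \<oplus>\<^bsub>M\<^esub> f z) = (\<lambda>x \<in> carrier L. \<zero>\<^bsub>M\<^esub>)"
    if f: "f \<in> module_hom R L M" for f
    by (rule restrict_ext) (simp add: M.smult_l_minus val f M.M.l_neg)
  show ?thesis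
  proof (rule moduleI)
    show "abelian_group (hom_module R L M)"
    proof (rule abelian_groupI; unfold hom_module_simps)
      fix f assume f: "f \<in> module_hom R L M"
      show "(\<lambda>z \<in> carrier L. (\<lambda>x \<in> carrier L. \<zero>\<^bsub>M\<^esub>) z \<oplus>\<^bsub>M\<^esub> f z) = f"
        by (rule module_hom_eqI[of _ L]) (auto simp: ext val f)
      show "\<exists>g \<in> module_hom R L M. (\<lambda>z \<in> carrier L. g z \<oplus>\<^bsub>M\<^esub> f z) = (\<lambda>x \<in> carrier L. \<zero>\<^bsub>M\<^esub>)"
        using neg[OF f] smult[OF _ f, of "\<ominus>\<^bsub>R\<^esub> \<one>\<^bsub>R\<^esub>"] by (intro bexI) auto
    next
      fix f g h assume "f \<in> module_hom R L M" "g \<in> module_hom R L M" "h \<in> module_hom R L M"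
      then show "(\<lambda>x \<in> carrier L. (\<lambda>x \<in> carrier L. f x \<oplus>\<^bsub>M\<^esub> g x) x \<oplus>\<^bsub>M\<^esub> h x) =
          (\<lambda>x \<in> carrier L. f x \<oplus>\<^bsub>M\<^esub> (\<lambda>x \<in> carrier L. g x \<oplus>\<^bsub>M\<^esub> h x) x)"
        by (intro restrict_ext) (simp add: val M.M.a_assoc)
    next
      fix f g assume "f \<in> module_hom R L M" "g \<in> module_hom R L M"
      then show "(\<lambda>x \<in> carrier L. f x \<oplus>\<^bsub>M\<^esub> g x) = (\<lambda>x \<in> carrier L. g x \<oplus>\<^bsub>M\<^esub> f x)"
        by (intro restrict_ext) (simp add: val M.M.a_comm)
    qed (simp_all only: zero add)
    show "\<one>\<^bsub>R\<^esub> \<odot>\<^bsub>hom_module R L M\<^esub> x = x" if "x \<in> carrier (hom_module R L M)" for x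
      using that by (intro module_hom_eqI[of _ L]) (auto simp: ext val)
  qed (auto simp: smult L.R.is_cring val M.smult_l_distr M.smult_r_distr M.smult_assoc1 intro!: restrict_ext)
qed

lemma divisible_hom_iff:
  assumes L: "module R L" and M: "module R M"
  shows "divisible R (hom_module R L M) \<longleftrightarrow>
    (\<forall>s \<in> nonzerodivisors R. \<forall>f. linear_map R L M f \<longrightarrow>
       (\<exists>g. linear_map R L M g \<and> (\<forall>x \<in> carrier L. f x = s \<odot>\<^bsub>M\<^esub> g x)))" (is "_ \<longleftrightarrow> ?R")
proof
  assume d: "divisible R (hom_module R L M)"
  show ?R
  proof (intro ballI allI impI)
    fix s f assume s: "s \<in> nonzerodivisors R" and f: "linear_map R L M f"
    have "restrict f (carrier L) \<in> (\<lambda>x. s \<odot>\<^bsub>hom_module R L M\<^esub> x) ` carrier (hom_module R L M)"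
      using d s restrict_module_hom[OF f L] unfolding divisible_def by simp
    then obtain g where g: "g \<in> module_hom R L M" "restrict f (carrier L) = (\<lambda>x \<in> carrier L. s \<odot>\<^bsub>M\<^esub> g x)"
      by auto
    have "f x = s \<odot>\<^bsub>M\<^esub> g x" if "x \<in> carrier L" for x
      using fun_cong[OF g(2), of x] that by simp
    then show "\<exists>g. linear_map R L M g \<and> (\<forall>x \<in> carrier L. f x = s \<odot>\<^bsub>M\<^esub> g x)"
      using g module_homD by blast
  qed
next
  assume r: ?R
  interpret H: module R "hom_module R L M" by (rule hom_module_module[OF L M])
  have "h \<in> (\<lambda>x. s \<odot>\<^bsub>hom_module R L M\<^esub> x) ` carrier (hom_module R L M)"
    if s: "s \<in> nonzerodivisors R" and h: "h \<in> carrier (hom_module R L M)" for s h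
  proof -
    obtain g where g: "linear_map R L M g" "\<And>x. x \<in> carrier L \<Longrightarrow> h x = s \<odot>\<^bsub>M\<^esub> g x"
      using r s h module_homD by (metis hom_module_simps(1))
    have "h = (\<lambda>x \<in> carrier L. s \<odot>\<^bsub>M\<^esub> restrict g (carrier L) x)"
      using h g(2) by (intro module_hom_eqI[of _ L]) (auto simp: module_hom_iff)
    then show "h \<in> (\<lambda>x. s \<odot>\<^bsub>hom_module R L M\<^esub> x) ` carrier (hom_module R L M)"
      using restrict_module_hom[OF g(1) L] by (intro image_eqI[of _ _ "restrict g (carrier L)"]) simp_all
  qed
  moreover have "(\<lambda>x. s \<odot>\<^bsub>hom_module R L M\<^esub> x) ` carrier (hom_module R L M) \<subseteq> carrier (hom_module R L M)"
    if "s \<in> nonzerodivisors R" for s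
    using that H.smult_closed unfolding nonzerodivisors_def by blast
  ultimately show "divisible R (hom_module R L M)"
    unfolding divisible_def using hom_module_module[OF L M] by blast
qed

lemma regular_module_simps [simp]:
  "carrier (regular_module R) = carrier R" "\<zero>\<^bsub>regular_module R\<^esub> = \<zero>\<^bsub>R\<^esub>"
  "x \<oplus>\<^bsub>regular_module R\<^esub> y = x \<oplus>\<^bsub>R\<^esub> y" "r \<odot>\<^bsub>regular_module R\<^esub> x = r \<otimes>\<^bsub>R\<^esub> x"
  unfolding regular_module_def by auto

lemma ideal_module_simps [simp]:
  "carrier (ideal_module R I) = I" "\<zero>\<^bsub>ideal_module R I\<^esub> = \<zero>\<^bsub>R\<^esub>"
  "x \<oplus>\<^bsub>ideal_module R I\<^esub> y = x \<oplus>\<^bsub>R\<^esub> y" "r \<odot>\<^bsub>ideal_module R I\<^esub> x = r \<otimes>\<^bsub>R\<^esub> x"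
  unfolding ideal_module_def by auto

lemma (in cring) regular_module_module: "module R (regular_module R)"
proof (rule moduleI)
  show "abelian_group (regular_module R)"
    by (rule abelian_groupI; unfold regular_module_simps)
       (auto intro: a_assoc a_comm l_neg)
qed (auto simp: is_cring l_distr r_distr m_assoc)

lemma (in cring) submodule_regular_iff: "submodule I R (regular_module R) \<longleftrightarrow> ideal I R"
proof -
  interpret M: module R "regular_module R" by (rule regular_module_module)
  show ?thesis
  proof
    assume I: "submodule I R (regular_module R)"
    have "{r \<in> carrier R. r \<odot>\<^bsub>regular_module R\<^esub> \<one> \<in> I} = I"
      using I unfolding M.submodule_iff by auto
    then show "ideal I R" using M.colon_ideal[OF I, of \<one>] by simp
  next
    assume "ideal I R"
    then interpret I: ideal I R .
    show "submodule I R (regular_module R)"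
      unfolding M.submodule_iff using I.a_subset I.I_l_closed by (auto simp: I.a_closed)
  qed
qed

lemma (in cring) ideal_module_module:
  assumes "ideal I R" shows "module R (ideal_module R I)"
  using submodule.submodule_is_module[of I R "regular_module R"] assms
  unfolding ideal_module_def by (simp add: submodule_regular_iff regular_module_module)

section \<open>Noetherian rings and modules\<close>

lemma (in noetherian_ring) ideals_maximal:
  assumes "F \<noteq> {}" and F: "\<And>I. I \<in> F \<Longrightarrow> ideal I R"
  obtains I where "I \<in> F" "\<And>J. J \<in> F \<Longrightarrow> I \<subseteq> J \<Longrightarrow> J = I"
proof -
  have "\<exists>I \<in> F. \<forall>J \<in> F. I \<subseteq> J \<longrightarrow> J = I"
  proof (rule subset_Zorn_nonempty[OF assms(1)])
    fix C assume C: "C \<noteq> {}" "subset.chain F C"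
    then have "subset.chain {I. ideal I R} C"
      using F unfolding pred_on.chain_def by auto
    then show "\<Union>C \<in> F"
      using ideal_chain_is_trivial[OF C(1)] C(2) unfolding pred_on.chain_def by auto
  qed
  then show ?thesis using that by blast
qed

text \<open>A maximal member of the family of ideals \<open>(T : y)\<close> with \<open>y \<notin> T\<close> is prime, because
  \<open>(T : y) \<subseteq> (T : a y)\<close> for every scalar \<open>a\<close>.\<close>

lemma (in module) colon_prime:
  assumes N: "noetherian_ring R" and T: "submodule T R M" "T \<noteq> carrier M"
  obtains y where "y \<in> carrier M - T" "primeideal {r \<in> carrier R. r \<odot>\<^bsub>M\<^esub> y \<in> T} R"
proof -
  interpret N: noetherian_ring R by fact
  define c where "c y = {r \<in> carrier R. r \<odot>\<^bsub>M\<^esub> y \<in> T}" for y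
  have ne: "carrier M - T \<noteq> {}" using T submoduleE(1)[OF T(1)] by auto
  have id: "ideal (c y) R" if "y \<in> carrier M" for y
    using colon_ideal[OF T(1) that] unfolding c_def .
  obtain I where I: "I \<in> c ` (carrier M - T)" "\<And>J. J \<in> c ` (carrier M - T) \<Longrightarrow> I \<subseteq> J \<Longrightarrow> J = I"
    by (rule N.ideals_maximal[of "c ` (carrier M - T)"]) (use ne id in auto)
  then obtain y where y: "y \<in> carrier M - T" and Iy: "I = c y" by auto
  have "primeideal (c y) R"
  proof (rule primeidealI)
    show "ideal (c y) R" using id y by auto
    show "cring R" by (rule R.is_cring)
    have "\<one> \<notin> c y" using y unfolding c_def by auto
    then show "carrier R \<noteq> c y" by auto
    fix a b assume ab: "a \<in> carrier R" "b \<in> carrier R" "a \<otimes> b \<in> c y"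
    have "b \<in> c y" if "a \<notin> c y"
    proof -
      have ay: "a \<odot>\<^bsub>M\<^esub> y \<in> carrier M - T" using that ab y unfolding c_def by auto
      have "c y \<subseteq> c (a \<odot>\<^bsub>M\<^esub> y)"
        using ab y T(1) unfolding c_def submodule_iff by (auto simp: smult_comm[of _ a])
      then have "c (a \<odot>\<^bsub>M\<^esub> y) = c y" using I(2)[of "c (a \<odot>\<^bsub>M\<^esub> y)"] ay Iy by auto
      moreover have "b \<in> c (a \<odot>\<^bsub>M\<^esub> y)"
        using ab y unfolding c_def by (auto simp: smult_assoc1 smult_comm[of b a])
      ultimately show ?thesis by simp
    qed
    then show "a \<in> c y \<or> b \<in> c y" by auto
  qed
  then show ?thesis using that[OF y] unfolding c_def by blast
qed

definition fin_gen_submodule ::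
    "('a, 'r) ring_scheme \<Rightarrow> ('a, 'm, 'q) module_scheme \<Rightarrow> 'm set \<Rightarrow> bool" where
  "fin_gen_submodule R M H \<longleftrightarrow>
     (\<exists>A \<subseteq> H. finite A \<and> (\<forall>H'. submodule H' R M \<and> A \<subseteq> H' \<longrightarrow> H \<subseteq> H'))"

text \<open>Adjoining one generator \<open>a\<close> to \<open>S\<close> keeps all submodules finitely generated: the
  coefficients of \<open>a\<close> in the elements of \<open>H\<close> form a finitely generated ideal, and an element of
  \<open>H\<close> with coefficient zero lies in \<open>S\<close>.\<close>

lemma (in module) fin_gen_submodule_insert:
  assumes N: "noetherian_ring R" and S: "submodule S R M" and a: "a \<in> carrier M"
    and fg: "\<And>H. submodule H R M \<Longrightarrow> H \<subseteq> S \<Longrightarrow> fin_gen_submodule R M H"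
    and H: "submodule H R M" and HS: "\<And>h. h \<in> H \<Longrightarrow> \<exists>r \<in> carrier R. \<exists>y \<in> S. h = r \<odot>\<^bsub>M\<^esub> a \<oplus>\<^bsub>M\<^esub> y"
  shows "fin_gen_submodule R M H"
proof -
  interpret N: noetherian_ring R by fact
  have Sc: "S \<subseteq> carrier M" and Hc: "H \<subseteq> carrier M"
    using S H submoduleE(1) by auto
  define c where "c K = {r \<in> carrier R. \<exists>y \<in> S. r \<odot>\<^bsub>M\<^esub> a \<oplus>\<^bsub>M\<^esub> y \<in> K}" for K
  have c_colon: "c K = {r \<in> carrier R. r \<odot>\<^bsub>M\<^esub> a \<in> K <+>\<^bsub>M\<^esub> S}" if K: "submodule K R M" for K
  proof -
    have Kc: "K \<subseteq> carrier M" using submoduleE(1)[OF K] .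
    have "(\<exists>y \<in> S. r \<odot>\<^bsub>M\<^esub> a \<oplus>\<^bsub>M\<^esub> y \<in> K) \<longleftrightarrow> r \<odot>\<^bsub>M\<^esub> a \<in> K <+>\<^bsub>M\<^esub> S" if r: "r \<in> carrier R" for r
    proof
      assume "\<exists>y \<in> S. r \<odot>\<^bsub>M\<^esub> a \<oplus>\<^bsub>M\<^esub> y \<in> K"
      then obtain y where y: "y \<in> S" "r \<odot>\<^bsub>M\<^esub> a \<oplus>\<^bsub>M\<^esub> y \<in> K" by auto
      have "r \<odot>\<^bsub>M\<^esub> a = (r \<odot>\<^bsub>M\<^esub> a \<oplus>\<^bsub>M\<^esub> y) \<oplus>\<^bsub>M\<^esub> \<ominus>\<^bsub>M\<^esub> y"
        using y(1) r a Sc by (auto simp: M.a_assoc M.r_neg subsetD)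
      then show "r \<odot>\<^bsub>M\<^esub> a \<in> K <+>\<^bsub>M\<^esub> S"
        using y submoduleE(3)[OF S y(1)] unfolding set_add_def' by blast
    next
      assume "r \<odot>\<^bsub>M\<^esub> a \<in> K <+>\<^bsub>M\<^esub> S"
      then obtain k y where y: "k \<in> K" "y \<in> S" "r \<odot>\<^bsub>M\<^esub> a = k \<oplus>\<^bsub>M\<^esub> y" unfolding set_add_def' by auto
      then have "k = r \<odot>\<^bsub>M\<^esub> a \<oplus>\<^bsub>M\<^esub> \<ominus>\<^bsub>M\<^esub> y"
        using Kc Sc by (simp add: M.a_assoc M.r_neg subsetD)
      then show "\<exists>y \<in> S. r \<odot>\<^bsub>M\<^esub> a \<oplus>\<^bsub>M\<^esub> y \<in> K"
        using y submoduleE(3)[OF S y(2)] by metis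
    qed
    then show ?thesis unfolding c_def by auto
  qed
  have c_ideal: "ideal (c K) R" if K: "submodule K R M" for K
    using colon_ideal[OF submodule_sum[OF K S] a] c_colon[OF K] by simp
  obtain B where B: "B \<subseteq> carrier R" "finite B" "c H = Idl B"
    using N.finetely_gen[OF c_ideal[OF H]] by auto
  have "\<forall>b \<in> B. \<exists>y. y \<in> S \<and> b \<odot>\<^bsub>M\<^esub> a \<oplus>\<^bsub>M\<^esub> y \<in> H"
    using R.genideal_self[OF B(1)] B(3) unfolding c_def by auto
  then obtain y where y: "\<And>b. b \<in> B \<Longrightarrow> y b \<in> S" "\<And>b. b \<in> B \<Longrightarrow> b \<odot>\<^bsub>M\<^esub> a \<oplus>\<^bsub>M\<^esub> y b \<in> H"
    by metis
  obtain C where C: "C \<subseteq> H \<inter> S" "finite C" "\<And>H'. submodule H' R M \<Longrightarrow> C \<subseteq> H' \<Longrightarrow> H \<inter> S \<subseteq> H'"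
    using fg[OF submodule_Int[OF H S]] unfolding fin_gen_submodule_def by auto
  have "H \<subseteq> K" if K: "submodule K R M" and sub: "C \<union> (\<lambda>b. b \<odot>\<^bsub>M\<^esub> a \<oplus>\<^bsub>M\<^esub> y b) ` B \<subseteq> K" for K
  proof
    fix h assume h: "h \<in> H"
    have HK: "submodule (H \<inter> K) R M" by (rule submodule_Int[OF H K])
    have "B \<subseteq> c (H \<inter> K)"
    proof
      fix b assume b: "b \<in> B"
      then have "b \<odot>\<^bsub>M\<^esub> a \<oplus>\<^bsub>M\<^esub> y b \<in> H \<inter> K" using sub y(2) by auto
      then show "b \<in> c (H \<inter> K)" using b B(1) y(1) unfolding c_def by blast
    qed
    then have cHK: "c H \<subseteq> c (H \<inter> K)" using R.genideal_minimal[OF c_ideal[OF HK]] B(3) by auto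
    obtain r z where rz: "r \<in> carrier R" "z \<in> S" "h = r \<odot>\<^bsub>M\<^esub> a \<oplus>\<^bsub>M\<^esub> z" using HS[OF h] by auto
    then have "r \<in> c H" using h unfolding c_def by auto
    then obtain w where w: "w \<in> S" "r \<odot>\<^bsub>M\<^esub> a \<oplus>\<^bsub>M\<^esub> w \<in> H \<inter> K" using cHK unfolding c_def by auto
    have car: "z \<in> carrier M" "w \<in> carrier M" "r \<odot>\<^bsub>M\<^esub> a \<in> carrier M" using w rz a Sc by auto
    have eq: "h \<ominus>\<^bsub>M\<^esub> (r \<odot>\<^bsub>M\<^esub> a \<oplus>\<^bsub>M\<^esub> w) = z \<ominus>\<^bsub>M\<^esub> w"
    proof -
      have "h \<ominus>\<^bsub>M\<^esub> (r \<odot>\<^bsub>M\<^esub> a \<oplus>\<^bsub>M\<^esub> w) = (z \<oplus>\<^bsub>M\<^esub> r \<odot>\<^bsub>M\<^esub> a) \<oplus>\<^bsub>M\<^esub> (\<ominus>\<^bsub>M\<^esub> (r \<odot>\<^bsub>M\<^esub> a) \<oplus>\<^bsub>M\<^esub> \<ominus>\<^bsub>M\<^esub> w)"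
        using car rz by (simp add: a_minus_def M.minus_add M.a_comm)
      also have "\<dots> = z \<ominus>\<^bsub>M\<^esub> w"
        using car by (simp add: M.a_assoc M.r_neg2 M.r_neg1 a_minus_def)
      finally show ?thesis .
    qed
    have "h \<ominus>\<^bsub>M\<^esub> (r \<odot>\<^bsub>M\<^esub> a \<oplus>\<^bsub>M\<^esub> w) \<in> H \<inter> S"
      using submodule_minus[OF H h, of "r \<odot>\<^bsub>M\<^esub> a \<oplus>\<^bsub>M\<^esub> w"] submodule_minus[OF S rz(2) w(1)] w eq by auto
    then have "h \<ominus>\<^bsub>M\<^esub> (r \<odot>\<^bsub>M\<^esub> a \<oplus>\<^bsub>M\<^esub> w) \<in> K" using C(3)[OF K] sub by auto
    then have "(h \<ominus>\<^bsub>M\<^esub> (r \<odot>\<^bsub>M\<^esub> a \<oplus>\<^bsub>M\<^esub> w)) \<oplus>\<^bsub>M\<^esub> (r \<odot>\<^bsub>M\<^esub> a \<oplus>\<^bsub>M\<^esub> w) \<in> K"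
      using w submoduleE(5)[OF K] by auto
    moreover have "(h \<ominus>\<^bsub>M\<^esub> (r \<odot>\<^bsub>M\<^esub> a \<oplus>\<^bsub>M\<^esub> w)) \<oplus>\<^bsub>M\<^esub> (r \<odot>\<^bsub>M\<^esub> a \<oplus>\<^bsub>M\<^esub> w) = h"
      using car h Hc by (simp add: a_minus_def M.a_assoc M.l_neg subsetD)
    ultimately show "h \<in> K" by simp
  qed
  then show ?thesis unfolding fin_gen_submodule_def
    using C(1,2) B(2) y(2) by (intro exI[of _ "C \<union> (\<lambda>b. b \<odot>\<^bsub>M\<^esub> a \<oplus>\<^bsub>M\<^esub> y b) ` B"]) auto
qed

lemma (in module) submodule_INT:
  assumes F: "\<And>H. H \<in> F \<Longrightarrow> submodule H R M" "F \<noteq> {}" shows "submodule (\<Inter>F) R M"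
proof -
  note E = F(1)[unfolded submodule_iff]
  show ?thesis unfolding submodule_iff
  proof (intro conjI ballI)
    show "\<Inter>F \<subseteq> carrier M" using F(2) E by blast
  qed (use E in auto)
qed

lemma noetherian_fin_gen_submodule:
  assumes N: "noetherian_ring R" and fgM: "fin_gen_module R M" and H: "submodule H R M"
  shows "fin_gen_submodule R M H"
proof -
  interpret M: module R M using fgM unfolding fin_gen_module_def by auto
  obtain A where A: "A \<subseteq> carrier M" "finite A" "\<And>H. submodule H R M \<Longrightarrow> A \<subseteq> H \<Longrightarrow> H = carrier M"
    using fgM unfolding fin_gen_module_def by blast
  define span where "span X = \<Inter>{K. submodule K R M \<and> X \<subseteq> K}" for X
  have span_sub: "submodule (span X) R M" if "X \<subseteq> carrier M" for X
    unfolding span_def by (rule M.submodule_INT) (use that M.carrier_is_submodule in auto)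
  have fg: "\<forall>H. submodule H R M \<longrightarrow> H \<subseteq> span X \<longrightarrow> fin_gen_submodule R M H" if "finite X" "X \<subseteq> carrier M" for X
    using that
  proof induction
    case empty
    have "span {} \<subseteq> {\<zero>\<^bsub>M\<^esub>}" unfolding span_def using M.submodule_zero by auto
    moreover have "{\<zero>\<^bsub>M\<^esub>} \<subseteq> H'" if "submodule H' R M" for H'
      using that unfolding M.submodule_iff by auto
    ultimately show ?case unfolding fin_gen_submodule_def
      by (intro allI impI exI[of _ "{}"]) (meson empty_subsetI finite.emptyI order_trans)
  next
    case (insert a X)
    let ?C = "(\<lambda>r. r \<odot>\<^bsub>M\<^esub> a) ` carrier R"
    have a: "a \<in> carrier M" and X: "X \<subseteq> carrier M" using insert by auto
    have X': "X \<subseteq> span X" unfolding span_def by auto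
    have C: "submodule ?C R M" "a \<in> ?C" using M.submodule_cyclic[OF a] by auto
    have S: "submodule (span X) R M" by (rule span_sub[OF X])
    have 0: "\<zero>\<^bsub>M\<^esub> \<in> ?C" "\<zero>\<^bsub>M\<^esub> \<in> span X" using C(1) S unfolding M.submodule_iff by auto
    have "insert a X \<subseteq> ?C <+>\<^bsub>M\<^esub> span X"
    proof
      fix x assume "x \<in> insert a X"
      then have "x \<in> carrier M" "x \<in> ?C \<or> x \<in> span X" using C(2) X' insert.prems by auto
      then have "x = x \<oplus>\<^bsub>M\<^esub> \<zero>\<^bsub>M\<^esub>" "x = \<zero>\<^bsub>M\<^esub> \<oplus>\<^bsub>M\<^esub> x" by auto
      with 0 \<open>x \<in> ?C \<or> x \<in> span X\<close> show "x \<in> ?C <+>\<^bsub>M\<^esub> span X" unfolding set_add_def' by blast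
    qed
    then have *: "span (insert a X) \<subseteq> ?C <+>\<^bsub>M\<^esub> span X"
      using M.submodule_sum[OF C(1) S] unfolding span_def[of "insert a X"] by auto
    show ?case
    proof (intro allI impI)
      fix H assume H: "submodule H R M" "H \<subseteq> span (insert a X)"
      show "fin_gen_submodule R M H"
      proof (rule M.fin_gen_submodule_insert[OF N S a _ H(1)])
        show "fin_gen_submodule R M K" if "submodule K R M" "K \<subseteq> span X" for K
          using insert.IH[OF X] that by auto
        show "\<exists>r \<in> carrier R. \<exists>y \<in> span X. h = r \<odot>\<^bsub>M\<^esub> a \<oplus>\<^bsub>M\<^esub> y" if "h \<in> H" for h
          using * that H(2) unfolding set_add_def' by blast
      qed
    qed
  qed
  have "A \<subseteq> span A" unfolding span_def by auto
  then have "span A = carrier M" by (rule A(3)[OF span_sub[OF A(1)]])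
  then have "H \<subseteq> span A" using M.submoduleE(1)[OF H] by simp
  then show ?thesis by (rule fg[OF A(2,1), rule_format, OF H])
qed

lemma fin_gen_submodule_iff:
  assumes M: "module R M" and H: "submodule H R M"
  shows "fin_gen_module R (M\<lparr>carrier := H\<rparr>) \<longleftrightarrow> fin_gen_submodule R M H"
proof -
  interpret M: module R M by fact
  have mH: "module R (M\<lparr>carrier := H\<rparr>)" by (rule submodule.submodule_is_module[OF H M])
  have eq: "(\<forall>H'. submodule H' R (M\<lparr>carrier := H\<rparr>) \<and> A \<subseteq> H' \<longrightarrow> H' = H) \<longleftrightarrow>
      (\<forall>H'. submodule H' R M \<and> A \<subseteq> H' \<longrightarrow> H \<subseteq> H')" (is "?l \<longleftrightarrow> ?r") if "A \<subseteq> H" for A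
  proof
    assume l: ?l
    show ?r
    proof (intro allI impI)
      fix H' assume H': "submodule H' R M \<and> A \<subseteq> H'"
      then have "submodule (H \<inter> H') R M" "A \<subseteq> H \<inter> H'" using M.submodule_Int[OF H] that by auto
      then have "H \<inter> H' = H" using l[rule_format, of "H \<inter> H'"] by (simp add: M.submodule_restrict_iff[OF H])
      then show "H \<subseteq> H'" by auto
    qed
  qed (auto simp: M.submodule_restrict_iff[OF H])
  have "(\<exists>A. A \<subseteq> H \<and> finite A \<and> (\<forall>H'. submodule H' R (M\<lparr>carrier := H\<rparr>) \<and> A \<subseteq> H' \<longrightarrow> H' = H)) \<longleftrightarrow>
      (\<exists>A. A \<subseteq> H \<and> finite A \<and> (\<forall>H'. submodule H' R M \<and> A \<subseteq> H' \<longrightarrow> H \<subseteq> H'))"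
    by (rule ex_cong1, rule conj_cong[OF refl], rule conj_cong[OF refl], rule eq)
  then show ?thesis using mH unfolding fin_gen_module_def fin_gen_submodule_def by simp
qed

lemma noetherian_chain_stabilises:
  assumes N: "noetherian_ring R" and fgM: "fin_gen_module R M"
    and H: "\<And>n :: nat. submodule (H n) R M" "\<And>n. H n \<subseteq> H (Suc n)"
  shows "\<exists>n. \<forall>m. H m \<subseteq> H n"
proof -
  interpret M: module R M using fgM unfolding fin_gen_module_def by auto
  have mono: "H i \<subseteq> H j" if "i \<le> j" for i j using lift_Suc_mono_le[of H, OF H(2) that] .
  have "submodule (\<Union>n. H n) R M" unfolding M.submodule_iff
  proof (intro conjI ballI)
    fix x y assume "x \<in> (\<Union>n. H n)" "y \<in> (\<Union>n. H n)"
    then obtain i j where "x \<in> H i" "y \<in> H j" by auto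
    then have "x \<in> H (max i j)" "y \<in> H (max i j)" using mono[of i "max i j"] mono[of j "max i j"] by auto
    then show "x \<oplus>\<^bsub>M\<^esub> y \<in> (\<Union>n. H n)" using M.submoduleE(5)[OF H(1)] by blast
    fix r assume "r \<in> carrier R"
    then show "r \<odot>\<^bsub>M\<^esub> x \<in> (\<Union>n. H n)" using \<open>x \<in> H i\<close> M.submoduleE(4)[OF H(1)] by blast
  next
    show "(\<Union>n. H n) \<subseteq> carrier M" using M.submoduleE(1)[OF H(1)] by blast
    show "\<zero>\<^bsub>M\<^esub> \<in> (\<Union>n. H n)" using H(1)[of 0] unfolding M.submodule_iff by blast
  qed
  from noetherian_fin_gen_submodule[OF N fgM this] obtain A where A: "A \<subseteq> (\<Union>n. H n)" "finite A"
    "\<And>H'. submodule H' R M \<Longrightarrow> A \<subseteq> H' \<Longrightarrow> (\<Union>n. H n) \<subseteq> H'"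
    unfolding fin_gen_submodule_def by auto
  have "\<exists>n. A \<subseteq> H n" using A(2,1)
  proof induction
    case (insert a A)
    then obtain i j where "a \<in> H i" "A \<subseteq> H j" by auto
    then have "insert a A \<subseteq> H (max i j)" using mono[of i "max i j"] mono[of j "max i j"] by auto
    then show ?case by auto
  qed auto
  then obtain n where "A \<subseteq> H n" by auto
  then have "(\<Union>n. H n) \<subseteq> H n" by (rule A(3)[OF H(1)])
  then show ?thesis by blast
qed

section \<open>Extension of linear maps and Baer's criterion\<close>

text \<open>The graph of a linear map into \<open>E\<close> whose domain is a submodule of \<open>B\<close>. As a set of pairs it
  behaves well under unions of chains.\<close>

definition partial_hom ::
    "('a, 'r) ring_scheme \<Rightarrow> ('a, 'b, 'p) module_scheme \<Rightarrow> ('a, 'e, 'q) module_scheme \<Rightarrow> ('b \<times> 'e) set \<Rightarrow> bool" where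
  "partial_hom R B E G \<longleftrightarrow> G \<subseteq> carrier B \<times> carrier E \<and> (\<zero>\<^bsub>B\<^esub>, \<zero>\<^bsub>E\<^esub>) \<in> G \<and>
     (\<forall>x e y f. (x, e) \<in> G \<longrightarrow> (y, f) \<in> G \<longrightarrow> (x \<oplus>\<^bsub>B\<^esub> y, e \<oplus>\<^bsub>E\<^esub> f) \<in> G) \<and>
     (\<forall>r \<in> carrier R. \<forall>x e. (x, e) \<in> G \<longrightarrow> (r \<odot>\<^bsub>B\<^esub> x, r \<odot>\<^bsub>E\<^esub> e) \<in> G) \<and>
     (\<forall>e. (\<zero>\<^bsub>B\<^esub>, e) \<in> G \<longrightarrow> e = \<zero>\<^bsub>E\<^esub>)"

lemma partial_homD:
  assumes "partial_hom R B E G"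
  shows "(x, e) \<in> G \<Longrightarrow> x \<in> carrier B" "(x, e) \<in> G \<Longrightarrow> e \<in> carrier E" "(\<zero>\<^bsub>B\<^esub>, \<zero>\<^bsub>E\<^esub>) \<in> G"
    "(x, e) \<in> G \<Longrightarrow> (y, f) \<in> G \<Longrightarrow> (x \<oplus>\<^bsub>B\<^esub> y, e \<oplus>\<^bsub>E\<^esub> f) \<in> G"
    "r \<in> carrier R \<Longrightarrow> (x, e) \<in> G \<Longrightarrow> (r \<odot>\<^bsub>B\<^esub> x, r \<odot>\<^bsub>E\<^esub> e) \<in> G"
    "(\<zero>\<^bsub>B\<^esub>, e) \<in> G \<Longrightarrow> e = \<zero>\<^bsub>E\<^esub>"
  using assms unfolding partial_hom_def by auto

lemma partial_hom_minus:
  assumes "partial_hom R B E G" "module R B" "module R E" "(x, e) \<in> G" "(y, f) \<in> G"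
  shows "(x \<ominus>\<^bsub>B\<^esub> y, e \<ominus>\<^bsub>E\<^esub> f) \<in> G"
proof -
  interpret B: module R B by fact
  interpret E: module R E by fact
  note G = partial_homD[OF assms(1)]
  have "((\<ominus>\<^bsub>R\<^esub> \<one>\<^bsub>R\<^esub>) \<odot>\<^bsub>B\<^esub> y, (\<ominus>\<^bsub>R\<^esub> \<one>\<^bsub>R\<^esub>) \<odot>\<^bsub>E\<^esub> f) \<in> G" by (rule G(5)) (use assms in auto)
  then have "(\<ominus>\<^bsub>B\<^esub> y, \<ominus>\<^bsub>E\<^esub> f) \<in> G"
    using G(1,2)[OF assms(5)] B.smult_l_minus[of "\<one>\<^bsub>R\<^esub>" y] E.smult_l_minus[of "\<one>\<^bsub>R\<^esub>" f] by simp
  then show ?thesis unfolding a_minus_def by (rule G(4)[OF assms(4)])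
qed

lemma partial_hom_unique:
  assumes "partial_hom R B E G" "module R B" "module R E" "(x, e) \<in> G" "(x, f) \<in> G"
  shows "e = f"
proof -
  interpret B: module R B by fact
  interpret E: module R E by fact
  note G = partial_homD[OF assms(1)]
  have "(x \<ominus>\<^bsub>B\<^esub> x, e \<ominus>\<^bsub>E\<^esub> f) \<in> G" by (rule partial_hom_minus[OF assms])
  then have "(\<zero>\<^bsub>B\<^esub>, e \<ominus>\<^bsub>E\<^esub> f) \<in> G" using B.minus_eq_zero_iff[of x x] G(1)[OF assms(4)] by simp
  then have "e \<ominus>\<^bsub>E\<^esub> f = \<zero>\<^bsub>E\<^esub>" by (rule G(6))
  then show ?thesis using E.minus_eq_zero_iff G(2) assms(4,5) by simp
qed

lemma partial_hom_adjoin: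
  assumes G: "partial_hom R B E G" and B: "module R B" and E: "module R E"
    and b: "b \<in> carrier B" and m: "m \<in> carrier E"
    and compat: "\<And>r e. r \<in> carrier R \<Longrightarrow> (r \<odot>\<^bsub>B\<^esub> b, e) \<in> G \<Longrightarrow> e = r \<odot>\<^bsub>E\<^esub> m"
  shows "\<exists>G'. partial_hom R B E G' \<and> G \<subseteq> G' \<and> (b, m) \<in> G'"
proof -
  interpret B: module R B by fact
  interpret E: module R E by fact
  note D = partial_homD[OF G]
  define G' where "G' = {(x \<oplus>\<^bsub>B\<^esub> r \<odot>\<^bsub>B\<^esub> b, e \<oplus>\<^bsub>E\<^esub> r \<odot>\<^bsub>E\<^esub> m) | x e r. (x, e) \<in> G \<and> r \<in> carrier R}"
  have G'I: "(u, v) \<in> G'"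
    if "(x, e) \<in> G" "r \<in> carrier R" "u = x \<oplus>\<^bsub>B\<^esub> r \<odot>\<^bsub>B\<^esub> b" "v = e \<oplus>\<^bsub>E\<^esub> r \<odot>\<^bsub>E\<^esub> m" for x e r u v
    using that unfolding G'_def by blast
  have "partial_hom R B E G'" unfolding partial_hom_def
  proof (intro conjI allI impI ballI)
    show "G' \<subseteq> carrier B \<times> carrier E" unfolding G'_def using b m by (auto dest: D(1,2))
    show "(\<zero>\<^bsub>B\<^esub>, \<zero>\<^bsub>E\<^esub>) \<in> G'"
      by (rule G'I[OF D(3), of "\<zero>\<^bsub>R\<^esub>"]) (use b m in auto)
  next
    fix u v u' v' assume "(u, v) \<in> G'" "(u', v') \<in> G'"
    then obtain x e r x' e' r' where *: "(x, e) \<in> G" "(x', e') \<in> G" "r \<in> carrier R" "r' \<in> carrier R"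
      "u = x \<oplus>\<^bsub>B\<^esub> r \<odot>\<^bsub>B\<^esub> b" "v = e \<oplus>\<^bsub>E\<^esub> r \<odot>\<^bsub>E\<^esub> m" "u' = x' \<oplus>\<^bsub>B\<^esub> r' \<odot>\<^bsub>B\<^esub> b" "v' = e' \<oplus>\<^bsub>E\<^esub> r' \<odot>\<^bsub>E\<^esub> m"
      unfolding G'_def by blast
    have "x \<in> carrier B" "x' \<in> carrier B" "e \<in> carrier E" "e' \<in> carrier E" using * D by auto
    then show "(u \<oplus>\<^bsub>B\<^esub> u', v \<oplus>\<^bsub>E\<^esub> v') \<in> G'"
      by (intro G'I[OF D(4)[OF *(1,2)], of "r \<oplus>\<^bsub>R\<^esub> r'"])
         (use * b m in \<open>auto simp: B.smult_l_distr E.smult_l_distr B.M.add.m_ac E.M.add.m_ac\<close>)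
  next
    fix s u v assume s: "s \<in> carrier R" and "(u, v) \<in> G'"
    then obtain x e r where *: "(x, e) \<in> G" "r \<in> carrier R"
      "u = x \<oplus>\<^bsub>B\<^esub> r \<odot>\<^bsub>B\<^esub> b" "v = e \<oplus>\<^bsub>E\<^esub> r \<odot>\<^bsub>E\<^esub> m"
      unfolding G'_def by blast
    have "x \<in> carrier B" "e \<in> carrier E" using * D by auto
    then show "(s \<odot>\<^bsub>B\<^esub> u, s \<odot>\<^bsub>E\<^esub> v) \<in> G'"
      by (intro G'I[OF D(5)[OF s *(1)], of "s \<otimes>\<^bsub>R\<^esub> r"])
         (use * b m s in \<open>auto simp: B.smult_r_distr E.smult_r_distr B.smult_assoc1 E.smult_assoc1\<close>)
  next
    fix v assume "(\<zero>\<^bsub>B\<^esub>, v) \<in> G'"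
    then obtain x e r where *: "(x, e) \<in> G" "r \<in> carrier R"
      "\<zero>\<^bsub>B\<^esub> = x \<oplus>\<^bsub>B\<^esub> r \<odot>\<^bsub>B\<^esub> b" "v = e \<oplus>\<^bsub>E\<^esub> r \<odot>\<^bsub>E\<^esub> m"
      unfolding G'_def by blast
    have c: "x \<in> carrier B" "e \<in> carrier E" using * D by auto
    have "x = \<ominus>\<^bsub>B\<^esub> (r \<odot>\<^bsub>B\<^esub> b)" using *(2,3) b c by (metis B.M.minus_equality B.smult_closed)
    then have "x = (\<ominus>\<^bsub>R\<^esub> r) \<odot>\<^bsub>B\<^esub> b" using *(2) b B.smult_l_minus by simp
    then have "e = (\<ominus>\<^bsub>R\<^esub> r) \<odot>\<^bsub>E\<^esub> m" using compat[of "\<ominus>\<^bsub>R\<^esub> r" e] *(1,2) by simp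
    then show "v = \<zero>\<^bsub>E\<^esub>" using *(2,4) m by (simp add: E.smult_l_minus E.M.l_neg)
  qed
  moreover have "G \<subseteq> G'"
  proof clarify
    fix x e assume xe: "(x, e) \<in> G"
    show "(x, e) \<in> G'"
      by (rule G'I[OF xe, of "\<zero>\<^bsub>R\<^esub>"]) (use b m D(1,2)[OF xe] in auto)
  qed
  moreover have "(b, m) \<in> G'"
    by (rule G'I[OF D(3), of "\<one>\<^bsub>R\<^esub>"]) (use b m in auto)
  ultimately show ?thesis by blast
qed

lemma partial_hom_chain_Union:
  assumes ne: "C \<noteq> {}" and C: "\<And>G. G \<in> C \<Longrightarrow> partial_hom R B E G"
    and chain: "\<And>G H. G \<in> C \<Longrightarrow> H \<in> C \<Longrightarrow> G \<subseteq> H \<or> H \<subseteq> G"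
  shows "partial_hom R B E (\<Union>C)"
  unfolding partial_hom_def
proof (intro conjI allI impI ballI)
  show "\<Union>C \<subseteq> carrier B \<times> carrier E" using C unfolding partial_hom_def by blast
  show "(\<zero>\<^bsub>B\<^esub>, \<zero>\<^bsub>E\<^esub>) \<in> \<Union>C" using C ne unfolding partial_hom_def by blast
next
  fix x e y f assume "(x, e) \<in> \<Union>C" "(y, f) \<in> \<Union>C"
  then obtain G H where GH: "G \<in> C" "H \<in> C" "(x, e) \<in> G" "(y, f) \<in> H" by auto
  then obtain K where K: "K \<in> C" "(x, e) \<in> K" "(y, f) \<in> K" using chain[OF GH(1,2)] by blast
  then show "(x \<oplus>\<^bsub>B\<^esub> y, e \<oplus>\<^bsub>E\<^esub> f) \<in> \<Union>C" using partial_homD(4)[OF C[OF K(1)] K(2,3)] by blast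
next
  fix r x e assume "r \<in> carrier R" "(x, e) \<in> \<Union>C"
  then show "(r \<odot>\<^bsub>B\<^esub> x, r \<odot>\<^bsub>E\<^esub> e) \<in> \<Union>C" using partial_homD(5)[OF C] by blast
next
  fix e assume "(\<zero>\<^bsub>B\<^esub>, e) \<in> \<Union>C"
  then show "e = \<zero>\<^bsub>E\<^esub>" using partial_homD(6)[OF C] by blast
qed

lemma partial_hom_Domain:
  assumes "partial_hom R B E G" "module R B" shows "submodule (Domain G) R B"
proof -
  interpret B: module R B by fact
  note D = partial_homD[OF assms(1)]
  show ?thesis unfolding B.submodule_iff by (auto intro: D(1,3) dest: D(4,5))
qed

text \<open>By Zorn's lemma a partial homomorphism extends to all of \<open>B\<close> as soon as every proper
  extension of it can be extended to at least one further element.\<close>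

lemma partial_hom_extends:
  assumes B: "module R B" and E: "module R E" and G0: "partial_hom R B E G0"
    and step: "\<And>G. partial_hom R B E G \<Longrightarrow> G0 \<subseteq> G \<Longrightarrow> Domain G \<noteq> carrier B \<Longrightarrow>
      \<exists>b \<in> carrier B - Domain G. \<exists>m \<in> carrier E. \<forall>r \<in> carrier R. \<forall>e. (r \<odot>\<^bsub>B\<^esub> b, e) \<in> G \<longrightarrow> e = r \<odot>\<^bsub>E\<^esub> m"
  shows "\<exists>g. linear_map R B E g \<and> (\<forall>x e. (x, e) \<in> G0 \<longrightarrow> g x = e)"
proof -
  interpret B: module R B by fact
  interpret E: module R E by fact
  let ?A = "{G. partial_hom R B E G \<and> G0 \<subseteq> G}"
  have "\<exists>G \<in> ?A. \<forall>H \<in> ?A. G \<subseteq> H \<longrightarrow> H = G"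
  proof (rule subset_Zorn_nonempty)
    show "?A \<noteq> {}" using G0 by auto
    fix C assume C: "C \<noteq> {}" "subset.chain ?A C"
    have CA: "C \<subseteq> ?A" using C(2) unfolding pred_on.chain_def by simp
    have "partial_hom R B E (\<Union>C)"
    proof (rule partial_hom_chain_Union[OF C(1)])
      show "partial_hom R B E G" if "G \<in> C" for G using subsetD[OF CA that] by simp
      show "G \<subseteq> H \<or> H \<subseteq> G" if "G \<in> C" "H \<in> C" for G H
        using C(2) that unfolding subset_chain_def by simp
    qed
    moreover obtain G where "G \<in> C" using C(1) by auto
    moreover from subsetD[OF CA this] have "G0 \<subseteq> G" by simp
    ultimately show "\<Union>C \<in> ?A" by auto
  qed
  then obtain G where GA: "G \<in> ?A" and Gmax: "\<forall>H \<in> ?A. G \<subseteq> H \<longrightarrow> H = G" by (rule bexE)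
  then have G: "partial_hom R B E G" "G0 \<subseteq> G" by auto
  have dom: "Domain G = carrier B"
  proof (rule ccontr)
    assume "Domain G \<noteq> carrier B"
    from step[OF G this] obtain b m where bm: "b \<in> carrier B - Domain G" "m \<in> carrier E"
      and compat: "\<forall>r \<in> carrier R. \<forall>e. (r \<odot>\<^bsub>B\<^esub> b, e) \<in> G \<longrightarrow> e = r \<odot>\<^bsub>E\<^esub> m" by (elim bexE)
    have "\<exists>G'. partial_hom R B E G' \<and> G \<subseteq> G' \<and> (b, m) \<in> G'"
      by (rule partial_hom_adjoin[OF G(1) B E _ bm(2)]) (use bm(1) compat in auto)
    then obtain G' where G': "partial_hom R B E G'" "G \<subseteq> G'" "(b, m) \<in> G'" by (elim exE conjE)
    then have "G' = G" using Gmax G(2) by simp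
    then show False using G'(3) bm(1) by (simp add: Domain_iff)
  qed
  define g where "g x = (SOME e. (x, e) \<in> G)" for x
  have gG: "(x, g x) \<in> G" if "x \<in> carrier B" for x
    using that dom unfolding g_def by (metis Domain.cases someI_ex)
  have gI: "g x = e" if "(x, e) \<in> G" for x e
    using partial_hom_unique[OF G(1) B E gG that] partial_homD(1)[OF G(1) that] by simp
  note D = partial_homD[OF G(1)]
  have "linear_map R B E g" unfolding linear_map_def
  proof (intro conjI ballI)
    show "g x \<in> carrier E" if "x \<in> carrier B" for x using D(2)[OF gG[OF that]] .
    show "g (x \<oplus>\<^bsub>B\<^esub> y) = g x \<oplus>\<^bsub>E\<^esub> g y" if "x \<in> carrier B" "y \<in> carrier B" for x y
      by (rule gI[OF D(4)[OF gG gG]]) (use that in auto)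
    show "g (r \<odot>\<^bsub>B\<^esub> x) = r \<odot>\<^bsub>E\<^esub> g x" if "r \<in> carrier R" "x \<in> carrier B" for r x
      by (rule gI[OF D(5)[OF that(1) gG[OF that(2)]]])
  qed
  moreover have "\<forall>x e. (x, e) \<in> G0 \<longrightarrow> g x = e" using gI[OF subsetD[OF G(2)]] by simp
  ultimately show ?thesis by blast
qed

lemma graph_partial_hom:
  assumes A: "module R A" and B: "module R B" and E: "module R E"
    and i: "linear_map R A B i" and f: "linear_map R A E f"
    and ker: "\<And>x. x \<in> carrier A \<Longrightarrow> i x = \<zero>\<^bsub>B\<^esub> \<Longrightarrow> f x = \<zero>\<^bsub>E\<^esub>"
  shows "partial_hom R B E {(i x, f x) | x. x \<in> carrier A}"
proof -
  interpret A: module R A by fact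
  interpret B: module R B by fact
  interpret E: module R E by fact
  note i' = linear_mapD[OF i] linear_map_zero[OF i A B]
  note f' = linear_mapD[OF f] linear_map_zero[OF f A E]
  show ?thesis unfolding partial_hom_def
  proof (intro conjI allI impI ballI)
    show "(\<zero>\<^bsub>B\<^esub>, \<zero>\<^bsub>E\<^esub>) \<in> {(i x, f x) | x. x \<in> carrier A}" using i'(4) f'(4) by force
    fix x e y h assume "(x, e) \<in> {(i x, f x) | x. x \<in> carrier A}" "(y, h) \<in> {(i x, f x) | x. x \<in> carrier A}"
    then obtain u v where "u \<in> carrier A" "v \<in> carrier A" "x = i u" "e = f u" "y = i v" "h = f v" by auto
    then show "(x \<oplus>\<^bsub>B\<^esub> y, e \<oplus>\<^bsub>E\<^esub> h) \<in> {(i x, f x) | x. x \<in> carrier A}"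
      using i'(2)[of u v] f'(2)[of u v] by (auto intro!: exI[of _ "u \<oplus>\<^bsub>A\<^esub> v"])
  next
    fix r x e assume "r \<in> carrier R" "(x, e) \<in> {(i x, f x) | x. x \<in> carrier A}"
    then obtain u where "u \<in> carrier A" "x = i u" "e = f u" by auto
    then show "(r \<odot>\<^bsub>B\<^esub> x, r \<odot>\<^bsub>E\<^esub> e) \<in> {(i x, f x) | x. x \<in> carrier A}"
      using i'(3)[of r u] f'(3)[of r u] \<open>r \<in> carrier R\<close> by (auto intro!: exI[of _ "r \<odot>\<^bsub>A\<^esub> u"])
  next
    fix e assume "(\<zero>\<^bsub>B\<^esub>, e) \<in> {(i x, f x) | x. x \<in> carrier A}"
    then obtain u where u: "u \<in> carrier A" "i u = \<zero>\<^bsub>B\<^esub>" "e = f u" by auto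
    then show "e = \<zero>\<^bsub>E\<^esub>" using ker[OF u(1,2)] by simp
  qed (use i'(1) f'(1) in auto)
qed

text \<open>All linear maps from the ideal \<open>I\<close> to \<open>E\<close> extend to \<open>R\<close>; in other words
  \<open>Ext\<^sup>1(R/I, E) = 0\<close>.\<close>

definition maps_extend :: "('a, 'r) ring_scheme \<Rightarrow> ('a, 'm, 'q) module_scheme \<Rightarrow> 'a set \<Rightarrow> bool" where
  "maps_extend R E I \<longleftrightarrow> (\<forall>f. linear_map R (ideal_module R I) E f \<longrightarrow>
     (\<exists>m \<in> carrier E. \<forall>x \<in> I. f x = x \<odot>\<^bsub>E\<^esub> m))"

text \<open>When a partial homomorphism \<open>G\<close> is to be extended to \<open>b\<close>, its values on the multiples of \<open>b\<close> in
  its domain form a map on an ideal; a value for \<open>b\<close> is admissible if it extends this map to \<open>R\<close>.\<close>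

lemma maps_extend_step:
  assumes B: "module R B" and E: "module R E" and G: "partial_hom R B E G" and b: "b \<in> carrier B"
    and ext: "maps_extend R E {r \<in> carrier R. r \<odot>\<^bsub>B\<^esub> b \<in> Domain G}"
  shows "\<exists>m \<in> carrier E. \<forall>r \<in> carrier R. \<forall>e. (r \<odot>\<^bsub>B\<^esub> b, e) \<in> G \<longrightarrow> e = r \<odot>\<^bsub>E\<^esub> m"
proof -
  interpret B: module R B by fact
  interpret E: module R E by fact
  let ?I = "{r \<in> carrier R. r \<odot>\<^bsub>B\<^esub> b \<in> Domain G}"
  define f where "f r = (SOME e. (r \<odot>\<^bsub>B\<^esub> b, e) \<in> G)" for r
  have fG: "(r \<odot>\<^bsub>B\<^esub> b, f r) \<in> G" if "r \<in> ?I" for r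
  proof -
    from that have "\<exists>e. (r \<odot>\<^bsub>B\<^esub> b, e) \<in> G" by (simp add: Domain_iff)
    then show ?thesis unfolding f_def by (rule someI_ex)
  qed
  note D = partial_homD[OF G] and uniq = partial_hom_unique[OF G B E]
  have I: "ideal ?I R" by (rule B.colon_ideal[OF partial_hom_Domain[OF G B] b])
  have "linear_map R (ideal_module R ?I) E f" unfolding linear_map_def ideal_module_simps
  proof (intro conjI ballI)
    fix r assume r: "r \<in> ?I"
    then have rR: "r \<in> carrier R" by simp
    show "f r \<in> carrier E" by (rule D(2)[OF fG[OF r]])
    show "f (s \<otimes>\<^bsub>R\<^esub> r) = s \<odot>\<^bsub>E\<^esub> f r" if s: "s \<in> carrier R" for s
    proof (rule uniq)
      show "(s \<otimes>\<^bsub>R\<^esub> r \<odot>\<^bsub>B\<^esub> b, f (s \<otimes>\<^bsub>R\<^esub> r)) \<in> G" by (rule fG[OF ideal.I_l_closed[OF I r s]])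
      show "(s \<otimes>\<^bsub>R\<^esub> r \<odot>\<^bsub>B\<^esub> b, s \<odot>\<^bsub>E\<^esub> f r) \<in> G"
        using D(5)[OF s fG[OF r]] by (simp only: B.smult_assoc1[OF s rR b])
    qed
    show "f (r \<oplus>\<^bsub>R\<^esub> s) = f r \<oplus>\<^bsub>E\<^esub> f s" if s: "s \<in> ?I" for s
    proof (rule uniq)
      from s have sR: "s \<in> carrier R" by simp
      show "((r \<oplus>\<^bsub>R\<^esub> s) \<odot>\<^bsub>B\<^esub> b, f (r \<oplus>\<^bsub>R\<^esub> s)) \<in> G" by (rule fG[OF additive_subgroup.a_closed[OF ideal.axioms(1)[OF I] r s]])
      show "((r \<oplus>\<^bsub>R\<^esub> s) \<odot>\<^bsub>B\<^esub> b, f r \<oplus>\<^bsub>E\<^esub> f s) \<in> G"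
        using D(4)[OF fG[OF r] fG[OF s]] by (simp only: B.smult_l_distr[OF rR sR b])
    qed
  qed
  with ext have "\<exists>m \<in> carrier E. \<forall>r \<in> ?I. f r = r \<odot>\<^bsub>E\<^esub> m" unfolding maps_extend_def by simp
  then obtain m where m: "m \<in> carrier E" and "\<forall>r \<in> ?I. f r = r \<odot>\<^bsub>E\<^esub> m" by (rule bexE)
  then have fm: "f r = r \<odot>\<^bsub>E\<^esub> m" if "r \<in> ?I" for r using that by blast
  have "e = r \<odot>\<^bsub>E\<^esub> m" if r: "r \<in> carrier R" and e: "(r \<odot>\<^bsub>B\<^esub> b, e) \<in> G" for r e
  proof -
    have I: "r \<in> ?I" using r e by auto
    show ?thesis using uniq[OF e fG[OF I]] fm[OF I] by simp
  qed
  then show ?thesis using m by blast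
qed

lemma Baer_criterion:
  assumes A: "module R A" and B: "module R B" and E: "module R E"
    and i: "linear_map R A B i" and f: "linear_map R A E f"
    and ker: "\<And>x. x \<in> carrier A \<Longrightarrow> i x = \<zero>\<^bsub>B\<^esub> \<Longrightarrow> f x = \<zero>\<^bsub>E\<^esub>"
    and ext: "\<And>I. ideal I R \<Longrightarrow> maps_extend R E I"
  shows "\<exists>g. linear_map R B E g \<and> (\<forall>x \<in> carrier A. g (i x) = f x)"
proof -
  interpret B: module R B by fact
  have step: "\<exists>b \<in> carrier B - Domain G. \<exists>m \<in> carrier E. \<forall>r \<in> carrier R. \<forall>e. (r \<odot>\<^bsub>B\<^esub> b, e) \<in> G \<longrightarrow> e = r \<odot>\<^bsub>E\<^esub> m"
    if G: "partial_hom R B E G" "Domain G \<noteq> carrier B" for G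
  proof -
    have D: "submodule (Domain G) R B" by (rule partial_hom_Domain[OF G(1) B])
    then have "Domain G \<subset> carrier B" using G(2) B.submoduleE(1)[OF D] by blast
    then obtain b where b: "b \<in> carrier B - Domain G" by blast
    then have "b \<in> carrier B" by simp
    from b maps_extend_step[OF B E G(1) this ext[OF B.colon_ideal[OF D this]]] show ?thesis by (rule bexI[rotated])
  qed
  have "\<exists>g. linear_map R B E g \<and> (\<forall>x e. (x, e) \<in> {(i x, f x) | x. x \<in> carrier A} \<longrightarrow> g x = e)"
    by (rule partial_hom_extends[OF B E graph_partial_hom[OF A B E i f ker]], assumption+, rule step)
  then show ?thesis by (rule ex_forward) auto
qed

text \<open>To extend a map from an ideal \<open>I\<close> to \<open>R\<close> it suffices to extend maps from the primes above
  \<open>I\<close>: when a map is defined on an ideal \<open>J \<supseteq> I\<close>, there is \<open>y\<close> outside \<open>J\<close> for which \<open>(J : y)\<close>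
  is prime, and a map on \<open>(J : y)\<close> that extends to \<open>R\<close> gives the next value, at \<open>y\<close>.\<close>

lemma partial_hom_extends_from_primes:
  assumes R: "cring R" and N: "noetherian_ring R" and E: "module R E"
    and G0: "partial_hom R (regular_module R) E G0"
    and primes: "\<And>P. primeideal P R \<Longrightarrow> Domain G0 \<subseteq> P \<Longrightarrow> maps_extend R E P"
  shows "\<exists>g. linear_map R (regular_module R) E g \<and> (\<forall>x e. (x, e) \<in> G0 \<longrightarrow> g x = e)"
proof -
  interpret R: cring R by fact
  interpret E: module R E by fact
  let ?B = "regular_module R"
  have B: "module R ?B" by (rule R.regular_module_module)
  interpret B: module R ?B by fact
  have step: "\<exists>b \<in> carrier ?B - Domain G. \<exists>m \<in> carrier E. \<forall>r \<in> carrier R. \<forall>e. (r \<odot>\<^bsub>?B\<^esub> b, e) \<in> G \<longrightarrow> e = r \<odot>\<^bsub>E\<^esub> m"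
    if G: "partial_hom R ?B E G" "G0 \<subseteq> G" "Domain G \<noteq> carrier ?B" for G
  proof -
    have D: "submodule (Domain G) R ?B" by (rule partial_hom_Domain[OF G(1) B])
    obtain b where b: "b \<in> carrier ?B - Domain G"
      "primeideal {r \<in> carrier R. r \<odot>\<^bsub>?B\<^esub> b \<in> Domain G} R"
      by (rule B.colon_prime[OF N D G(3)])
    have bc: "b \<in> carrier ?B" using b(1) by blast
    have dom: "Domain G0 \<subseteq> Domain G" using G(2) by auto
    have "Domain G0 \<subseteq> {r \<in> carrier R. r \<odot>\<^bsub>?B\<^esub> b \<in> Domain G}"
    proof
      fix x assume "x \<in> Domain G0"
      then have x: "x \<in> Domain G" using dom by auto
      then have xR: "x \<in> carrier R" using B.submoduleE(1)[OF D] by auto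
      have "x \<otimes>\<^bsub>R\<^esub> b = b \<otimes>\<^bsub>R\<^esub> x" using xR bc R.m_comm[of x b] by simp
      then have "x \<otimes>\<^bsub>R\<^esub> b \<in> Domain G" using B.submoduleE(4)[OF D, of b x] bc x by simp
      then show "x \<in> {r \<in> carrier R. r \<odot>\<^bsub>?B\<^esub> b \<in> Domain G}" using xR by simp
    qed
    then have ext: "maps_extend R E {r \<in> carrier R. r \<odot>\<^bsub>?B\<^esub> b \<in> Domain G}" by (rule primes[OF b(2)])
    from b(1) maps_extend_step[OF B E G(1) bc ext]
    show "\<exists>b \<in> carrier ?B - Domain G. \<exists>m \<in> carrier E. \<forall>r \<in> carrier R. \<forall>e. (r \<odot>\<^bsub>?B\<^esub> b, e) \<in> G \<longrightarrow> e = r \<odot>\<^bsub>E\<^esub> m"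
      by (rule bexI[rotated])
  qed
  show ?thesis by (rule partial_hom_extends[OF B E G0], rule step)
qed

lemma linear_map_regular:
  assumes R: "cring R" and g: "linear_map R (regular_module R) E g" and x: "x \<in> carrier R"
  shows "g x = x \<odot>\<^bsub>E\<^esub> g \<one>\<^bsub>R\<^esub>"
proof -
  interpret R: cring R by fact
  show ?thesis using linear_mapD(3)[OF g x, of "\<one>\<^bsub>R\<^esub>"] x by simp
qed

lemma ideal_map_graph:
  assumes R: "cring R" and E: "module R E" and I: "ideal I R" and f: "linear_map R (ideal_module R I) E f"
  shows "partial_hom R (regular_module R) E {(x, f x) | x. x \<in> I}"
proof -
  interpret R: cring R by fact
  interpret I: ideal I R by fact
  have i: "linear_map R (ideal_module R I) (regular_module R) (\<lambda>x. x)"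
    unfolding linear_map_def using I.a_subset by auto
  have "partial_hom R (regular_module R) E {(x, f x) | x. x \<in> carrier (ideal_module R I)}"
    by (rule graph_partial_hom[OF R.ideal_module_module[OF I] R.regular_module_module E i f])
       (use linear_map_zero[OF f R.ideal_module_module[OF I] E] in simp)
  then show ?thesis by simp
qed

text \<open>Transport of structure along \<open>j\<close>, which is only meant to be injective on the carrier. It moves
  ideals and residue modules into the universe of test modules.\<close>

definition copy_module :: "('l \<Rightarrow> 'u) \<Rightarrow> ('a, 'l, 'p) module_scheme \<Rightarrow> ('a, 'u) module" where
  "copy_module j L =
     (let j' = inv_into (carrier L) j in
      \<lparr>carrier = j ` carrier L, monoid.mult = undefined, one = undefined,
       ring.zero = j \<zero>\<^bsub>L\<^esub>, add = (\<lambda>u v. j (j' u \<oplus>\<^bsub>L\<^esub> j' v)), smult = (\<lambda>r u. j (r \<odot>\<^bsub>L\<^esub> j' u))\<rparr>)"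

lemma copy_module:
  assumes L: "module R L" and j: "inj_on j (carrier L)"
  shows "module R (copy_module j L)"
    and "linear_map R L (copy_module j L) j"
    and "linear_map R (copy_module j L) L (inv_into (carrier L) j)"
proof -
  interpret L: module R L by fact
  let ?K = "copy_module j L"
  have simps: "carrier ?K = j ` carrier L" "\<zero>\<^bsub>?K\<^esub> = j \<zero>\<^bsub>L\<^esub>"
    "\<And>x y. x \<in> carrier L \<Longrightarrow> y \<in> carrier L \<Longrightarrow> j x \<oplus>\<^bsub>?K\<^esub> j y = j (x \<oplus>\<^bsub>L\<^esub> y)"
    "\<And>r x. x \<in> carrier L \<Longrightarrow> r \<odot>\<^bsub>?K\<^esub> j x = j (r \<odot>\<^bsub>L\<^esub> x)"
    unfolding copy_module_def Let_def using j by auto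
  show "module R ?K"
  proof (rule moduleI)
    show "abelian_group ?K"
    proof (rule abelian_groupI; unfold simps(1,2))
      fix x assume "x \<in> j ` carrier L"
      then obtain u where "u \<in> carrier L" "x = j u" by auto
      then show "\<exists>y \<in> j ` carrier L. y \<oplus>\<^bsub>?K\<^esub> x = j \<zero>\<^bsub>L\<^esub>"
        by (intro bexI[of _ "j (\<ominus>\<^bsub>L\<^esub> u)"]) (auto simp: simps L.M.l_neg)
    qed (auto simp: simps L.M.add.m_ac)
  qed (auto simp: simps L.R.is_cring L.smult_l_distr L.smult_r_distr L.smult_assoc1)
  show "linear_map R L ?K j" "linear_map R ?K L (inv_into (carrier L) j)"
    unfolding linear_map_def using j by (auto simp: simps)
qed

lemma injective_extends_ideal_maps:
  fixes \<iota> :: "'a \<Rightarrow> 'u"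
  assumes inj: "injective_module TYPE('u) R E" and \<iota>: "inj_on \<iota> (carrier R)" and I: "ideal I R"
  shows "maps_extend R E I"
  unfolding maps_extend_def
proof (intro allI impI)
  fix f assume f: "linear_map R (ideal_module R I) E f"
  have E: "module R E" using inj unfolding injective_module_def by auto
  interpret E: module R E by fact
  interpret I: ideal I R by fact
  let ?I = "ideal_module R I" and ?B = "regular_module R"
  have mI: "module R ?I" by (rule E.ideal_module_module[OF I])
  have mB: "module R ?B" by (rule E.regular_module_module)
  have jI: "inj_on \<iota> (carrier ?I)" using \<iota> I.a_subset by (auto intro: inj_on_subset)
  have jB: "inj_on \<iota> (carrier ?B)" using \<iota> by simp
  note cI = copy_module[OF mI jI] and cB = copy_module[OF mB jB]
  have car: "carrier (copy_module \<iota> ?I) = \<iota> ` I" unfolding copy_module_def Let_def by simp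
  let ?j = "inv_into (carrier ?I) \<iota>"
  have "linear_map R ?I ?B (\<lambda>x. x)"
    unfolding linear_map_def using I.a_subset by auto
  then have i: "linear_map R (copy_module \<iota> ?I) (copy_module \<iota> ?B) (\<lambda>x. \<iota> (?j x))"
    by (intro linear_map_comp[OF linear_map_comp[OF cI(3)] cB(2)])
  have f': "linear_map R (copy_module \<iota> ?I) E (\<lambda>x. f (?j x))"
    by (rule linear_map_comp[OF cI(3) f])
  let ?i' = "restrict (\<lambda>x. \<iota> (?j x)) (carrier (copy_module \<iota> ?I))"
  have i'_id: "?i' u = u" if "u \<in> carrier (copy_module \<iota> ?I)" for u
    using that car f_inv_into_f[of u \<iota> I] by simp
  then have "inj_on ?i' (carrier (copy_module \<iota> ?I)) = inj_on (\<lambda>u. u) (carrier (copy_module \<iota> ?I))"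
    by (rule inj_on_cong)
  then have "inj_on ?i' (carrier (copy_module \<iota> ?I))" by simp
  then have "\<exists>g \<in> module_hom R (copy_module \<iota> ?B) E. \<forall>x \<in> carrier (copy_module \<iota> ?I).
      g (?i' x) = restrict (\<lambda>x. f (?j x)) (carrier (copy_module \<iota> ?I)) x"
    by (intro inj[unfolded injective_module_def, THEN conjunct2, rule_format] conjI cI(1) cB(1)
        restrict_module_hom[OF i] restrict_module_hom[OF f'])
  then obtain g where g: "g \<in> module_hom R (copy_module \<iota> ?B) E"
    "\<forall>x \<in> carrier (copy_module \<iota> ?I). g (?i' x) = restrict (\<lambda>x. f (?j x)) (carrier (copy_module \<iota> ?I)) x"
    by (elim bexE)
  have g': "linear_map R ?B E (\<lambda>x. g (\<iota> x))"
    by (rule linear_map_comp[OF cB(2) module_homD[OF g(1)]])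
  have "f x = x \<odot>\<^bsub>E\<^esub> g (\<iota> \<one>\<^bsub>R\<^esub>)" if x: "x \<in> I" for x
  proof -
    have "g (\<iota> x) = f x" using g(2)[rule_format, of "\<iota> x"] x jI car by simp
    moreover have "g (\<iota> x) = x \<odot>\<^bsub>E\<^esub> g (\<iota> \<one>\<^bsub>R\<^esub>)"
      using linear_mapD(3)[OF g', of x "\<one>\<^bsub>R\<^esub>"] x I.a_subset by auto
    ultimately show ?thesis by simp
  qed
  then show "\<exists>m \<in> carrier E. \<forall>x \<in> I. f x = x \<odot>\<^bsub>E\<^esub> m"
    using linear_mapD(1)[OF g', of "\<one>\<^bsub>R\<^esub>"] by auto
qed

lemma injective_module_iff:
  fixes \<iota> :: "'a \<Rightarrow> 'u"
  assumes E: "module R E" and \<iota>: "inj_on \<iota> (carrier R)"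
  shows "injective_module TYPE('u) R E \<longleftrightarrow> (\<forall>I. ideal I R \<longrightarrow> maps_extend R E I)"
proof
  assume ext: "\<forall>I. ideal I R \<longrightarrow> maps_extend R E I"
  show "injective_module TYPE('u) R E" unfolding injective_module_def
  proof (intro conjI allI impI ballI E)
    fix A B :: "('a, 'u) module" and i f
    assume AB: "module R A \<and> module R B" and i: "i \<in> module_hom R A B" "inj_on i (carrier A)"
      and f: "f \<in> module_hom R A E"
    then have AB: "module R A" "module R B" by auto
    have ker: "f x = \<zero>\<^bsub>E\<^esub>" if x: "x \<in> carrier A" "i x = \<zero>\<^bsub>B\<^esub>" for x
    proof -
      interpret A: module R A by (rule AB(1))
      have "i x = i \<zero>\<^bsub>A\<^esub>" using x(2) linear_map_zero[OF module_homD[OF i(1)] AB] by simp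
      then have "x = \<zero>\<^bsub>A\<^esub>" using inj_onD[OF i(2) _ x(1)] by simp
      then show ?thesis using linear_map_zero[OF module_homD[OF f] AB(1) E] by simp
    qed
    have "\<exists>g. linear_map R B E g \<and> (\<forall>x \<in> carrier A. g (i x) = f x)"
      by (rule Baer_criterion[OF AB E module_homD[OF i(1)] module_homD[OF f] ker]) (use ext in auto)
    then obtain g where g: "linear_map R B E g" "\<forall>x \<in> carrier A. g (i x) = f x" by (elim exE conjE)
    show "\<exists>g \<in> module_hom R B E. \<forall>x \<in> carrier A. g (i x) = f x"
      by (rule bexI[OF _ restrict_module_hom[OF g(1) AB(2)]])
         (use g(2) linear_mapD(1)[OF module_homD[OF i(1)]] in auto)
  qed
qed (use injective_extends_ideal_maps[OF _ \<iota>] in blast)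

section \<open>Quotient modules and hollow quotients\<close>

lemma (in module) coset_eq_iff:
  assumes K: "submodule K R M" and xy: "x \<in> carrier M" "y \<in> carrier M"
  shows "K +>\<^bsub>M\<^esub> x = K +>\<^bsub>M\<^esub> y \<longleftrightarrow> x \<ominus>\<^bsub>M\<^esub> y \<in> K"
proof -
  have sg: "subgroup K (add_monoid M)" using K by (rule submodule.axioms)
  have Kc: "K \<subseteq> carrier M" using submoduleE(1)[OF K] .
  show ?thesis
  proof
    assume "K +>\<^bsub>M\<^esub> x = K +>\<^bsub>M\<^esub> y"
    then have "K +>\<^bsub>M\<^esub> (x \<oplus>\<^bsub>M\<^esub> (\<ominus>\<^bsub>M\<^esub> y)) = K" by (rule M.a_coset_add_inv2[OF _ xy Kc])
    then show "x \<ominus>\<^bsub>M\<^esub> y \<in> K" unfolding a_minus_def by (rule M.a_coset_join1) (use xy sg in auto)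
  next
    assume "x \<ominus>\<^bsub>M\<^esub> y \<in> K"
    then have "K +>\<^bsub>M\<^esub> (x \<oplus>\<^bsub>M\<^esub> (\<ominus>\<^bsub>M\<^esub> y)) = K"
      unfolding a_minus_def by (intro M.a_coset_join2) (use xy sg in auto)
    then show "K +>\<^bsub>M\<^esub> x = K +>\<^bsub>M\<^esub> y" by (rule M.a_coset_add_inv1[OF _ xy Kc])
  qed
qed

lemma quot_module_carrier: "carrier (quot_module N K) = (\<lambda>x. K +>\<^bsub>N\<^esub> x) ` carrier N"
  unfolding quot_module_def by (auto simp: A_RCOSETS_def')

lemma (in module) quot_module_ops:
  assumes K: "submodule K R M"
  shows "\<zero>\<^bsub>quot_module M K\<^esub> = K +>\<^bsub>M\<^esub> \<zero>\<^bsub>M\<^esub>"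
    and "x \<in> carrier M \<Longrightarrow> y \<in> carrier M \<Longrightarrow>
      (K +>\<^bsub>M\<^esub> x) \<oplus>\<^bsub>quot_module M K\<^esub> (K +>\<^bsub>M\<^esub> y) = K +>\<^bsub>M\<^esub> (x \<oplus>\<^bsub>M\<^esub> y)"
    and "r \<in> carrier R \<Longrightarrow> x \<in> carrier M \<Longrightarrow>
      r \<odot>\<^bsub>quot_module M K\<^esub> (K +>\<^bsub>M\<^esub> x) = K +>\<^bsub>M\<^esub> (r \<odot>\<^bsub>M\<^esub> x)"
proof -
  have sg: "subgroup K (add_monoid M)" using K by (rule submodule.axioms)
  interpret K: abelian_subgroup K M
    by (rule abelian_subgroupI3) (auto intro: additive_subgroup.intro sg M.abelian_group_axioms)
  have Kc: "K \<subseteq> carrier M" using submoduleE(1)[OF K] .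
  show "\<zero>\<^bsub>quot_module M K\<^esub> = K +>\<^bsub>M\<^esub> \<zero>\<^bsub>M\<^esub>"
    using M.a_coset_add_zero[OF Kc] unfolding quot_module_def by simp
  show "(K +>\<^bsub>M\<^esub> x) \<oplus>\<^bsub>quot_module M K\<^esub> (K +>\<^bsub>M\<^esub> y) = K +>\<^bsub>M\<^esub> (x \<oplus>\<^bsub>M\<^esub> y)"
    if "x \<in> carrier M" "y \<in> carrier M"
    using K.a_rcos_sum[OF that] unfolding quot_module_def by simp
  show "r \<odot>\<^bsub>quot_module M K\<^esub> (K +>\<^bsub>M\<^esub> x) = K +>\<^bsub>M\<^esub> (r \<odot>\<^bsub>M\<^esub> x)"
    if r: "r \<in> carrier R" and x: "x \<in> carrier M"
  proof -
    have const: "K +>\<^bsub>M\<^esub> (r \<odot>\<^bsub>M\<^esub> y) = K +>\<^bsub>M\<^esub> (r \<odot>\<^bsub>M\<^esub> x)" if y: "y \<in> K +>\<^bsub>M\<^esub> x" for y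
    proof -
      have yc: "y \<in> carrier M" using y M.a_r_coset_subset_G[OF Kc x] by blast
      have "K +>\<^bsub>M\<^esub> y = K +>\<^bsub>M\<^esub> x" using M.a_repr_independence[OF y x sg] by simp
      then have "r \<odot>\<^bsub>M\<^esub> (y \<ominus>\<^bsub>M\<^esub> x) \<in> K"
        using submoduleE(4)[OF K r] coset_eq_iff[OF K yc x] by simp
      then show ?thesis
        using coset_eq_iff[OF K, of "r \<odot>\<^bsub>M\<^esub> y" "r \<odot>\<^bsub>M\<^esub> x"] r x yc smult_minus_distr[OF r yc x] by simp
    qed
    have "K +>\<^bsub>M\<^esub> x \<noteq> {}" using K.a_rcos_self[OF x] by auto
    then have "(\<Union>y \<in> K +>\<^bsub>M\<^esub> x. K +>\<^bsub>M\<^esub> (r \<odot>\<^bsub>M\<^esub> y)) = K +>\<^bsub>M\<^esub> (r \<odot>\<^bsub>M\<^esub> x)"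
      by (rule SUP_eq_const) (rule const)
    then show ?thesis unfolding quot_module_def by simp
  qed
qed

lemma (in module) quot_module:
  assumes K: "submodule K R M"
  shows "module R (quot_module M K)"
    and "linear_map R M (quot_module M K) (\<lambda>x. K +>\<^bsub>M\<^esub> x)"
    and "x \<in> carrier M \<Longrightarrow> K +>\<^bsub>M\<^esub> x = \<zero>\<^bsub>quot_module M K\<^esub> \<longleftrightarrow> x \<in> K"
proof -
  note ops = quot_module_ops[OF K]
  show "module R (quot_module M K)"
  proof (rule moduleI)
    show "abelian_group (quot_module M K)"
    proof (rule abelian_groupI)
      fix X assume "X \<in> carrier (quot_module M K)"
      then obtain x where x: "x \<in> carrier M" "X = K +>\<^bsub>M\<^esub> x" unfolding quot_module_carrier by auto
      have "(K +>\<^bsub>M\<^esub> (\<ominus>\<^bsub>M\<^esub> x)) \<oplus>\<^bsub>quot_module M K\<^esub> X = \<zero>\<^bsub>quot_module M K\<^esub>"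
        unfolding x(2) ops(1) ops(2)[OF M.a_inv_closed[OF x(1)] x(1)] M.l_neg[OF x(1)] ..
      moreover have "K +>\<^bsub>M\<^esub> (\<ominus>\<^bsub>M\<^esub> x) \<in> carrier (quot_module M K)"
        unfolding quot_module_carrier using M.a_inv_closed[OF x(1)] by (rule imageI)
      ultimately show "\<exists>Y \<in> carrier (quot_module M K). Y \<oplus>\<^bsub>quot_module M K\<^esub> X = \<zero>\<^bsub>quot_module M K\<^esub>"
        by (rule bexI)
    qed (unfold quot_module_carrier ops(1), auto simp: ops(2) M.add.m_ac)
  qed (unfold quot_module_carrier,
      auto simp: ops(2,3) R.is_cring smult_l_distr smult_r_distr smult_assoc1)
  show "linear_map R M (quot_module M K) (\<lambda>x. K +>\<^bsub>M\<^esub> x)"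
    unfolding linear_map_def quot_module_carrier by (simp add: ops)
  show "K +>\<^bsub>M\<^esub> x = \<zero>\<^bsub>quot_module M K\<^esub> \<longleftrightarrow> x \<in> K" if x: "x \<in> carrier M"
  proof -
    have "\<ominus>\<^bsub>M\<^esub> \<zero>\<^bsub>M\<^esub> = \<zero>\<^bsub>M\<^esub>" by (rule M.minus_equality) auto
    then have "x \<ominus>\<^bsub>M\<^esub> \<zero>\<^bsub>M\<^esub> = x" unfolding a_minus_def using x by (simp only: M.r_zero)
    then show ?thesis unfolding ops(1) coset_eq_iff[OF K x M.zero_closed] by (simp only:)
  qed
qed

text \<open>\<open>hollow_above R N K\<close> says that \<open>N / K\<close> is nonzero and hollow, in terms of submodules of
  \<open>N\<close>.\<close>

definition hollow_above ::
    "('a, 'r) ring_scheme \<Rightarrow> ('a, 'm, 'q) module_scheme \<Rightarrow> 'm set \<Rightarrow> bool" where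
  "hollow_above R N K \<longleftrightarrow> submodule K R N \<and> K \<noteq> carrier N \<and>
     (\<forall>A B. submodule A R N \<longrightarrow> submodule B R N \<longrightarrow> K \<subseteq> A \<longrightarrow> K \<subseteq> B \<longrightarrow>
        A <+>\<^bsub>N\<^esub> B = carrier N \<longrightarrow> A = carrier N \<or> B = carrier N)"

text \<open>If \<open>N / K\<close> is nonzero and hollow, this is the coassociated prime that it defines.\<close>

definition nonsurjective_scalars ::
    "('a, 'r) ring_scheme \<Rightarrow> ('a, 'm, 'q) module_scheme \<Rightarrow> 'm set \<Rightarrow> 'a set" where
  "nonsurjective_scalars R N K =
     {a \<in> carrier R. K <+>\<^bsub>N\<^esub> (\<lambda>x. a \<odot>\<^bsub>N\<^esub> x) ` carrier N \<noteq> carrier N}"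

lemma hollow_aboveD:
  assumes "hollow_above R N K"
  shows "submodule K R N" "K \<noteq> carrier N"
    "submodule A R N \<Longrightarrow> submodule B R N \<Longrightarrow> K \<subseteq> A \<Longrightarrow> K \<subseteq> B \<Longrightarrow> A <+>\<^bsub>N\<^esub> B = carrier N \<Longrightarrow>
      A \<noteq> carrier N \<Longrightarrow> B = carrier N"
  using assms unfolding hollow_above_def by auto

lemma (in module) set_add_eq_carrier_iff:
  assumes "submodule A R M" "submodule B R M"
  shows "A <+>\<^bsub>M\<^esub> B = carrier M \<longleftrightarrow> (\<forall>y \<in> carrier M. \<exists>a \<in> A. \<exists>b \<in> B. y = a \<oplus>\<^bsub>M\<^esub> b)"
  (is "_ \<longleftrightarrow> ?r")
proof
  assume eq: "A <+>\<^bsub>M\<^esub> B = carrier M"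
  show ?r
  proof
    fix y assume "y \<in> carrier M"
    then have "y \<in> A <+>\<^bsub>M\<^esub> B" using eq by simp
    then show "\<exists>a \<in> A. \<exists>b \<in> B. y = a \<oplus>\<^bsub>M\<^esub> b" unfolding set_add_def' by blast
  qed
next
  assume ?r
  then have "carrier M \<subseteq> A <+>\<^bsub>M\<^esub> B" unfolding set_add_def' by blast
  then show "A <+>\<^bsub>M\<^esub> B = carrier M" using submoduleE(1)[OF submodule_sum[OF assms]] by simp
qed

lemma (in module) submodule_scaled:
  assumes "a \<in> carrier R" shows "submodule ((\<lambda>x. a \<odot>\<^bsub>M\<^esub> x) ` carrier M) R M"
  by (rule submodule_image[OF linear_map_smult[OF linear_map_id] _ _ carrier_is_submodule])
     (use assms module_axioms in auto)

lemma (in module) sum_upper: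
  assumes A: "submodule A R M" and B: "submodule B R M"
  shows "A \<subseteq> A <+>\<^bsub>M\<^esub> B" and "B \<subseteq> A <+>\<^bsub>M\<^esub> B"
proof -
  have 0: "\<zero>\<^bsub>M\<^esub> \<in> A" "\<zero>\<^bsub>M\<^esub> \<in> B" using A B by (simp_all add: submodule_iff)
  have "x \<in> A <+>\<^bsub>M\<^esub> B" if "x \<in> A" for x
  proof -
    have "x = x \<oplus>\<^bsub>M\<^esub> \<zero>\<^bsub>M\<^esub>" using that submoduleE(1)[OF A] by auto
    then show ?thesis using that 0 unfolding set_add_def' by blast
  qed
  then show "A \<subseteq> A <+>\<^bsub>M\<^esub> B" by blast
  have "x \<in> A <+>\<^bsub>M\<^esub> B" if "x \<in> B" for x
  proof -
    have "x = \<zero>\<^bsub>M\<^esub> \<oplus>\<^bsub>M\<^esub> x" using that submoduleE(1)[OF B] by auto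
    then show ?thesis using that 0 unfolding set_add_def' by blast
  qed
  then show "B \<subseteq> A <+>\<^bsub>M\<^esub> B" by blast
qed

locale surjection =
  fixes R :: "('a, 'r) ring_scheme" and N :: "('a, 'm, 'p) module_scheme"
    and N' :: "('a, 'n, 'q) module_scheme" and p :: "'m \<Rightarrow> 'n"
  assumes N: "module R N" and N': "module R N'"
    and lin: "linear_map R N N' p" and surj: "p ` carrier N = carrier N'"
begin

definition preim :: "'n set \<Rightarrow> 'm set" where "preim A' = {x \<in> carrier N. p x \<in> A'}"

lemma preim_submodule: "submodule A' R N' \<Longrightarrow> submodule (preim A') R N"
  unfolding preim_def by (rule submodule_preimage[OF lin N N'])

lemma image_submodule: "submodule A R N \<Longrightarrow> submodule (p ` A) R N'"
  by (rule submodule_image[OF lin N N'])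

lemma image_preim: "submodule A' R N' \<Longrightarrow> p ` preim A' = A'"
  using surj module.submoduleE(1)[OF N', of A'] unfolding preim_def by auto

lemma kernel_in_preim: "submodule A' R N' \<Longrightarrow> preim {\<zero>\<^bsub>N'\<^esub>} \<subseteq> preim A'"
  using module.submodule_iff[OF N', of A'] unfolding preim_def by auto

lemma mem_of_image_mem:
  assumes A: "submodule A R N" and ker: "preim {\<zero>\<^bsub>N'\<^esub>} \<subseteq> A" and x: "x \<in> carrier N" "p x \<in> p ` A"
  shows "x \<in> A"
proof -
  interpret N: module R N by (rule N)
  interpret N': module R N' by (rule N')
  obtain a where a: "a \<in> A" "p x = p a" using x by auto
  have ac: "a \<in> carrier N" using a N.submoduleE(1)[OF A] by auto
  have "p (x \<ominus>\<^bsub>N\<^esub> a) = \<zero>\<^bsub>N'\<^esub>"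
    using linear_map_minus[OF lin N N' x(1) ac] a N'.minus_eq_zero_iff[of "p a" "p a"]
      linear_mapD(1)[OF lin ac] by simp
  then have "x \<ominus>\<^bsub>N\<^esub> a \<in> A" using ker x ac unfolding preim_def by auto
  then have "(x \<ominus>\<^bsub>N\<^esub> a) \<oplus>\<^bsub>N\<^esub> a \<in> A" using a N.submoduleE(5)[OF A] by auto
  then show ?thesis using x ac by (simp add: a_minus_def N.M.a_assoc N.M.l_neg)
qed

lemma preim_image:
  assumes "submodule A R N" "preim {\<zero>\<^bsub>N'\<^esub>} \<subseteq> A" shows "preim (p ` A) = A"
  using mem_of_image_mem[OF assms] module.submoduleE(1)[OF N assms(1)] unfolding preim_def by auto

lemma image_eq_carrier_iff:
  assumes A: "submodule A R N" "preim {\<zero>\<^bsub>N'\<^esub>} \<subseteq> A"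
  shows "p ` A = carrier N' \<longleftrightarrow> A = carrier N"
proof
  assume eq: "p ` A = carrier N'"
  have "preim (carrier N') = carrier N" using linear_mapD(1)[OF lin] unfolding preim_def by auto
  then show "A = carrier N" using preim_image[OF A] eq by simp
qed (simp add: surj)

lemma image_sum_eq_carrier_iff:
  assumes A: "submodule A R N" "preim {\<zero>\<^bsub>N'\<^esub>} \<subseteq> A" and B: "submodule B R N"
  shows "p ` A <+>\<^bsub>N'\<^esub> p ` B = carrier N' \<longleftrightarrow> A <+>\<^bsub>N\<^esub> B = carrier N"
proof -
  interpret N: module R N by (rule N)
  have AB: "A \<subseteq> carrier N" "B \<subseteq> carrier N" using N.submoduleE(1) A B by auto
  have "p ` (A <+>\<^bsub>N\<^esub> B) = p ` A <+>\<^bsub>N'\<^esub> p ` B"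
  proof (rule equalityI; rule subsetI)
    fix y assume "y \<in> p ` (A <+>\<^bsub>N\<^esub> B)"
    then obtain a b where "a \<in> A" "b \<in> B" "y = p (a \<oplus>\<^bsub>N\<^esub> b)" unfolding set_add_def' by auto
    then show "y \<in> p ` A <+>\<^bsub>N'\<^esub> p ` B"
      using linear_mapD(2)[OF lin, of a b] AB unfolding set_add_def' by blast
  next
    fix y assume "y \<in> p ` A <+>\<^bsub>N'\<^esub> p ` B"
    then obtain a b where ab: "a \<in> A" "b \<in> B" "y = p a \<oplus>\<^bsub>N'\<^esub> p b" unfolding set_add_def' by auto
    then have "y = p (a \<oplus>\<^bsub>N\<^esub> b)" using linear_mapD(2)[OF lin, of a b] AB by (simp add: subsetD)
    moreover have "a \<oplus>\<^bsub>N\<^esub> b \<in> A <+>\<^bsub>N\<^esub> B" using ab unfolding set_add_def' by blast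
    ultimately show "y \<in> p ` (A <+>\<^bsub>N\<^esub> B)" by (rule image_eqI)
  qed
  moreover have "preim {\<zero>\<^bsub>N'\<^esub>} \<subseteq> A <+>\<^bsub>N\<^esub> B" using A(2) N.sum_upper(1)[OF A(1) B] by simp
  ultimately show ?thesis using image_eq_carrier_iff[OF N.submodule_sum[OF A(1) B]] by simp
qed

text \<open>Images and preimages match the submodules of \<open>N'\<close> with those of \<open>N\<close> above the kernel, compatibly
  with sums.\<close>

lemma hollow_above_preim_iff:
  assumes K': "submodule K' R N'"
  shows "hollow_above R N (preim K') \<longleftrightarrow> hollow_above R N' K'"
proof
  have K: "submodule (preim K') R N" "preim {\<zero>\<^bsub>N'\<^esub>} \<subseteq> preim K'"
    using preim_submodule[OF K'] kernel_in_preim[OF K'] by auto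
  have neq: "preim K' = carrier N \<longleftrightarrow> K' = carrier N'"
    using image_eq_carrier_iff[OF K] image_preim[OF K'] by simp
  show "hollow_above R N' K'" if h: "hollow_above R N (preim K')"
    unfolding hollow_above_def
  proof (intro conjI allI impI K')
    show "K' \<noteq> carrier N'" using neq hollow_aboveD(2)[OF h] by simp
    fix A' B' assume A': "submodule A' R N'" and B': "submodule B' R N'" and sub: "K' \<subseteq> A'" "K' \<subseteq> B'"
      and sum: "A' <+>\<^bsub>N'\<^esub> B' = carrier N'"
    note pA = preim_submodule[OF A'] and pB = preim_submodule[OF B']
    have "preim A' <+>\<^bsub>N\<^esub> preim B' = carrier N"
      using image_sum_eq_carrier_iff[OF pA kernel_in_preim[OF A'] pB] sum
      by (simp add: image_preim A' B')
    moreover have "preim K' \<subseteq> preim A'" "preim K' \<subseteq> preim B'" using sub unfolding preim_def by auto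
    ultimately have "preim A' = carrier N \<or> preim B' = carrier N"
      using hollow_aboveD(3)[OF h pA pB] by auto
    then show "A' = carrier N' \<or> B' = carrier N'"
      using image_preim[OF A'] image_preim[OF B'] surj by auto
  qed
  show "hollow_above R N (preim K')" if h: "hollow_above R N' K'"
    unfolding hollow_above_def
  proof (intro conjI allI impI K(1))
    show "preim K' \<noteq> carrier N" using neq hollow_aboveD(2)[OF h] by simp
    fix A B assume A: "submodule A R N" and B: "submodule B R N" and sub: "preim K' \<subseteq> A" "preim K' \<subseteq> B"
      and sum: "A <+>\<^bsub>N\<^esub> B = carrier N"
    have ker: "preim {\<zero>\<^bsub>N'\<^esub>} \<subseteq> A" "preim {\<zero>\<^bsub>N'\<^esub>} \<subseteq> B" using K(2) sub by auto
    have "K' \<subseteq> p ` A" "K' \<subseteq> p ` B"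
      using image_mono[OF sub(1), of p] image_mono[OF sub(2), of p] image_preim[OF K'] by auto
    moreover have "p ` A <+>\<^bsub>N'\<^esub> p ` B = carrier N'"
      using image_sum_eq_carrier_iff[OF A ker(1) B] sum by simp
    ultimately have "p ` A = carrier N' \<or> p ` B = carrier N'"
      using hollow_aboveD(3)[OF h image_submodule[OF A] image_submodule[OF B]] by auto
    then show "A = carrier N \<or> B = carrier N"
      using image_eq_carrier_iff[OF A ker(1)] image_eq_carrier_iff[OF B ker(2)] by simp
  qed
qed

lemma nonsurjective_scalars_preim:
  assumes K': "submodule K' R N'"
  shows "nonsurjective_scalars R N (preim K') = nonsurjective_scalars R N' K'"
proof -
  interpret N: module R N by (rule N)
  have "preim K' <+>\<^bsub>N\<^esub> (\<lambda>x. a \<odot>\<^bsub>N\<^esub> x) ` carrier N = carrier N \<longleftrightarrow>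
      K' <+>\<^bsub>N'\<^esub> (\<lambda>x. a \<odot>\<^bsub>N'\<^esub> x) ` carrier N' = carrier N'" if a: "a \<in> carrier R" for a
  proof -
    have "p ` (\<lambda>x. a \<odot>\<^bsub>N\<^esub> x) ` carrier N = (\<lambda>x. a \<odot>\<^bsub>N'\<^esub> x) ` p ` carrier N"
      unfolding image_image using linear_mapD(3)[OF lin a] by (rule image_cong[OF refl])
    then show ?thesis
      using image_sum_eq_carrier_iff[OF preim_submodule[OF K'] kernel_in_preim[OF K'] N.submodule_scaled[OF a]]
      by (simp add: surj image_preim[OF K'])
  qed
  then show ?thesis unfolding nonsurjective_scalars_def by blast
qed

end

lemma (in module) surjection_quot_module:
  assumes K: "submodule K R M" shows "surjection R M (quot_module M K) (\<lambda>x. K +>\<^bsub>M\<^esub> x)"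
  by (intro surjection.intro module_axioms quot_module(1,2)[OF K]) (simp add: quot_module_carrier)

lemma (in module) set_add_zero:
  assumes "submodule A R M" shows "{\<zero>\<^bsub>M\<^esub>} <+>\<^bsub>M\<^esub> A = A"
  using submoduleE(1)[OF assms] unfolding set_add_def' by force

text \<open>From here on quotients are replaced by their kernels. This avoids quotients of quotients, whose
  elements are sets of sets.\<close>

lemma Coass_iff:
  assumes N: "module R N"
  shows "P \<in> Coass R N \<longleftrightarrow>
    primeideal P R \<and> (\<exists>K. hollow_above R N K \<and> P = nonsurjective_scalars R N K)"
proof -
  interpret N: module R N by (rule N)
  have "(carrier (quot_module N K) \<noteq> {\<zero>\<^bsub>quot_module N K\<^esub>} \<and> hollow R (quot_module N K) \<longleftrightarrow> hollow_above R N K) \<and>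
      {a \<in> carrier R. (\<lambda>x. a \<odot>\<^bsub>quot_module N K\<^esub> x) ` carrier (quot_module N K) \<noteq> carrier (quot_module N K)}
        = nonsurjective_scalars R N K"
    if K: "submodule K R N" for K
  proof -
    interpret S: surjection R N "quot_module N K" "\<lambda>x. K +>\<^bsub>N\<^esub> x" by (rule N.surjection_quot_module[OF K])
    interpret Q: module R "quot_module N K" by (rule S.N')
    have pre: "S.preim {\<zero>\<^bsub>quot_module N K\<^esub>} = K"
      using N.quot_module(3)[OF K] N.submoduleE(1)[OF K] unfolding S.preim_def by auto
    have "hollow_above R (quot_module N K) {\<zero>\<^bsub>quot_module N K\<^esub>} \<longleftrightarrow>
        carrier (quot_module N K) \<noteq> {\<zero>\<^bsub>quot_module N K\<^esub>} \<and> hollow R (quot_module N K)"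
      unfolding hollow_above_def hollow_def using Q.submodule_zero by (auto simp: Q.submodule_iff)
    moreover have "nonsurjective_scalars R (quot_module N K) {\<zero>\<^bsub>quot_module N K\<^esub>} =
        {a \<in> carrier R. (\<lambda>x. a \<odot>\<^bsub>quot_module N K\<^esub> x) ` carrier (quot_module N K) \<noteq> carrier (quot_module N K)}"
      unfolding nonsurjective_scalars_def
      by (rule Collect_cong, rule conj_cong[OF refl]) (simp only: Q.set_add_zero[OF Q.submodule_scaled])
    ultimately show ?thesis
      using S.hollow_above_preim_iff[OF Q.submodule_zero] S.nonsurjective_scalars_preim[OF Q.submodule_zero]
      unfolding pre by simp
  qed
  note eq = this
  show ?thesis
  proof
    assume "P \<in> Coass R N"
    then obtain K where "primeideal P R" "submodule K R N"
      "carrier (quot_module N K) \<noteq> {\<zero>\<^bsub>quot_module N K\<^esub>}" "hollow R (quot_module N K)"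
      "P = {a \<in> carrier R. (\<lambda>x. a \<odot>\<^bsub>quot_module N K\<^esub> x) ` carrier (quot_module N K) \<noteq> carrier (quot_module N K)}"
      unfolding Coass_def Let_def by auto
    then show "primeideal P R \<and> (\<exists>K. hollow_above R N K \<and> P = nonsurjective_scalars R N K)"
      using eq[of K] by (intro conjI exI[of _ K]) simp_all
  next
    assume "primeideal P R \<and> (\<exists>K. hollow_above R N K \<and> P = nonsurjective_scalars R N K)"
    then obtain K where K: "primeideal P R" "hollow_above R N K" "P = nonsurjective_scalars R N K" by auto
    then show "P \<in> Coass R N" unfolding Coass_def Let_def
      using eq[OF hollow_aboveD(1)[OF K(2)]] hollow_aboveD(1)[OF K(2)]
      by (intro CollectI conjI exI[of _ K]) simp_all
  qed
qed

text \<open>Let \<open>H\<close> be nonzero and hollow. If \<open>(a + b) H = H\<close>, then \<open>a H + b H = H\<close>, so \<open>a H = H\<close> or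
  \<open>b H = H\<close>; this gives closure under addition. The other properties hold for every nonzero module.\<close>

lemma nonsurjective_scalars_prime:
  assumes N: "module R N" and h: "hollow_above R N K"
  shows "primeideal (nonsurjective_scalars R N K) R"
proof -
  interpret N: module R N by (rule N)
  let ?P = "nonsurjective_scalars R N K"
  note K = hollow_aboveD(1)[OF h]
  let ?s = "\<lambda>a. (\<lambda>x. a \<odot>\<^bsub>N\<^esub> x) ` carrier N"
  have notin: "a \<notin> ?P \<longleftrightarrow> (\<forall>y \<in> carrier N. \<exists>k \<in> K. \<exists>x \<in> carrier N. y = k \<oplus>\<^bsub>N\<^esub> a \<odot>\<^bsub>N\<^esub> x)"
    if a: "a \<in> carrier R" for a
    using N.set_add_eq_carrier_iff[OF K N.submodule_scaled[OF a]] a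
    unfolding nonsurjective_scalars_def by auto
  have Kc: "K \<subseteq> carrier N" by (rule N.submoduleE(1)[OF K])
  have Pc: "?P \<subseteq> carrier R" unfolding nonsurjective_scalars_def by auto
  have mult: "r \<otimes>\<^bsub>R\<^esub> a \<in> ?P" if a: "a \<in> ?P" and r: "r \<in> carrier R" for a r
  proof (rule ccontr)
    assume no: "r \<otimes>\<^bsub>R\<^esub> a \<notin> ?P"
    have aR: "a \<in> carrier R" using a Pc by auto
    have "\<exists>k \<in> K. \<exists>x \<in> carrier N. y = k \<oplus>\<^bsub>N\<^esub> a \<odot>\<^bsub>N\<^esub> x" if y: "y \<in> carrier N" for y
    proof -
      obtain k x where kx: "k \<in> K" "x \<in> carrier N" "y = k \<oplus>\<^bsub>N\<^esub> (r \<otimes>\<^bsub>R\<^esub> a) \<odot>\<^bsub>N\<^esub> x"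
        using no notin[of "r \<otimes>\<^bsub>R\<^esub> a"] r aR y by auto
      then have "y = k \<oplus>\<^bsub>N\<^esub> a \<odot>\<^bsub>N\<^esub> (r \<odot>\<^bsub>N\<^esub> x)"
        using r aR N.R.m_comm[of r a] by (simp add: N.smult_assoc1)
      then show ?thesis using kx r by blast
    qed
    then show False using notin[OF aR] a by simp
  qed
  have add: "a \<oplus>\<^bsub>R\<^esub> b \<in> ?P" if a: "a \<in> ?P" and b: "b \<in> ?P" for a b
  proof (rule ccontr)
    assume no: "a \<oplus>\<^bsub>R\<^esub> b \<notin> ?P"
    have R: "a \<in> carrier R" "b \<in> carrier R" using a b Pc by auto
    let ?A = "K <+>\<^bsub>N\<^esub> ?s a" and ?B = "K <+>\<^bsub>N\<^esub> ?s b"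
    have sub: "submodule ?A R N" "submodule ?B R N"
      using N.submodule_sum[OF K N.submodule_scaled] R by auto
    have "?A <+>\<^bsub>N\<^esub> ?B = carrier N" unfolding N.set_add_eq_carrier_iff[OF sub]
    proof
      fix y assume y: "y \<in> carrier N"
      obtain k x where kx: "k \<in> K" "x \<in> carrier N" "y = k \<oplus>\<^bsub>N\<^esub> (a \<oplus>\<^bsub>R\<^esub> b) \<odot>\<^bsub>N\<^esub> x"
        using no notin[of "a \<oplus>\<^bsub>R\<^esub> b"] R y by auto
      have kc: "k \<in> carrier N" using kx Kc by auto
      have "y = (k \<oplus>\<^bsub>N\<^esub> a \<odot>\<^bsub>N\<^esub> x) \<oplus>\<^bsub>N\<^esub> b \<odot>\<^bsub>N\<^esub> x"
        using kx kc R by (simp add: N.smult_l_distr N.M.a_assoc)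
      moreover have "k \<oplus>\<^bsub>N\<^esub> a \<odot>\<^bsub>N\<^esub> x \<in> ?A" using kx unfolding set_add_def' by blast
      moreover have "b \<odot>\<^bsub>N\<^esub> x \<in> ?B"
        using kx(2) N.sum_upper(2)[OF K N.submodule_scaled[OF R(2)]] by blast
      ultimately show "\<exists>u \<in> ?A. \<exists>v \<in> ?B. y = u \<oplus>\<^bsub>N\<^esub> v" by blast
    qed
    then have "?A = carrier N \<or> ?B = carrier N"
      using hollow_aboveD(3)[OF h sub N.sum_upper(1)[OF K N.submodule_scaled[OF R(1)]]
        N.sum_upper(1)[OF K N.submodule_scaled[OF R(2)]]] by auto
    then show False using a b unfolding nonsurjective_scalars_def by auto
  qed
  have one: "\<one>\<^bsub>R\<^esub> \<notin> ?P"
  proof -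
    have "y = \<zero>\<^bsub>N\<^esub> \<oplus>\<^bsub>N\<^esub> \<one>\<^bsub>R\<^esub> \<odot>\<^bsub>N\<^esub> y" if "y \<in> carrier N" for y using that by simp
    moreover have "\<zero>\<^bsub>N\<^esub> \<in> K" using K unfolding N.submodule_iff by simp
    ultimately show ?thesis unfolding notin[OF N.R.one_closed] by blast
  qed
  have zero: "\<zero>\<^bsub>R\<^esub> \<in> ?P"
  proof (rule ccontr)
    assume "\<zero>\<^bsub>R\<^esub> \<notin> ?P"
    then have all: "\<forall>y \<in> carrier N. \<exists>k \<in> K. \<exists>x \<in> carrier N. y = k \<oplus>\<^bsub>N\<^esub> \<zero>\<^bsub>R\<^esub> \<odot>\<^bsub>N\<^esub> x"
      unfolding notin[OF N.R.zero_closed] .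
    have "y \<in> K" if y: "y \<in> carrier N" for y
    proof -
      obtain k x where "k \<in> K" "x \<in> carrier N" "y = k \<oplus>\<^bsub>N\<^esub> \<zero>\<^bsub>R\<^esub> \<odot>\<^bsub>N\<^esub> x"
        using bspec[OF all y] by (elim bexE)
      then show ?thesis using Kc by auto
    qed
    then show False using Kc hollow_aboveD(2)[OF h] by auto
  qed
  show ?thesis
  proof (rule primeidealI)
    show "ideal ?P R"
    proof (rule idealI)
      show "subgroup ?P (add_monoid R)"
      proof (rule N.R.add.subgroupI)
        show "\<ominus>\<^bsub>R\<^esub> a \<in> ?P" if a: "a \<in> ?P" for a
          using mult[OF a, of "\<ominus>\<^bsub>R\<^esub> \<one>\<^bsub>R\<^esub>"] a Pc by (auto simp: N.R.l_minus)
      qed (use Pc zero add in auto)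
      show "r \<otimes>\<^bsub>R\<^esub> a \<in> ?P" "a \<otimes>\<^bsub>R\<^esub> r \<in> ?P" if "a \<in> ?P" "r \<in> carrier R" for a r
        using mult[OF that] N.R.m_comm[of a r] that Pc by auto
    qed unfold_locales
    show "cring R" by (rule N.R.is_cring)
    show "carrier R \<noteq> ?P" using one by auto
    show "a \<in> ?P \<or> b \<in> ?P" if ab: "a \<in> carrier R" "b \<in> carrier R" "a \<otimes>\<^bsub>R\<^esub> b \<in> ?P" for a b
    proof (rule ccontr)
      assume no: "\<not> (a \<in> ?P \<or> b \<in> ?P)"
      have "\<exists>k \<in> K. \<exists>x \<in> carrier N. y = k \<oplus>\<^bsub>N\<^esub> (a \<otimes>\<^bsub>R\<^esub> b) \<odot>\<^bsub>N\<^esub> x" if y: "y \<in> carrier N" for y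
      proof -
        obtain k x where kx: "k \<in> K" "x \<in> carrier N" "y = k \<oplus>\<^bsub>N\<^esub> a \<odot>\<^bsub>N\<^esub> x"
          using no notin[OF ab(1)] y by auto
        obtain l z where lz: "l \<in> K" "z \<in> carrier N" "x = l \<oplus>\<^bsub>N\<^esub> b \<odot>\<^bsub>N\<^esub> z"
          using no notin[OF ab(2)] kx(2) by auto
        have c: "k \<in> carrier N" "l \<in> carrier N" using kx lz Kc by auto
        have "y = (k \<oplus>\<^bsub>N\<^esub> a \<odot>\<^bsub>N\<^esub> l) \<oplus>\<^bsub>N\<^esub> (a \<otimes>\<^bsub>R\<^esub> b) \<odot>\<^bsub>N\<^esub> z"
          using kx(3) lz c ab by (simp add: N.smult_r_distr N.smult_assoc1 N.M.a_assoc)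
        moreover have "k \<oplus>\<^bsub>N\<^esub> a \<odot>\<^bsub>N\<^esub> l \<in> K"
          using N.submoduleE(5)[OF K kx(1) N.submoduleE(4)[OF K ab(1) lz(1)]] .
        ultimately show ?thesis using lz(2) by blast
      qed
      then show False using notin[of "a \<otimes>\<^bsub>R\<^esub> b"] ab by simp
    qed
  qed
qed

lemma hollow_above_Coass:
  assumes "module R N" "hollow_above R N K"
  shows "nonsurjective_scalars R N K \<in> Coass R N"
  using Coass_iff[OF assms(1)] nonsurjective_scalars_prime[OF assms] assms(2) by blast

lemma (in surjection) Coass_lift:
  assumes "P \<in> Coass R N'" shows "P \<in> Coass R N"
proof -
  obtain K' where K': "hollow_above R N' K'" "P = nonsurjective_scalars R N' K'"
    using assms unfolding Coass_iff[OF N'] by auto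
  note s = hollow_aboveD(1)[OF K'(1)]
  show ?thesis
    using hollow_above_Coass[OF N, of "preim K'"] hollow_above_preim_iff[OF s] nonsurjective_scalars_preim[OF s] K'
    by simp
qed

lemma set_add_mono:
  assumes "A \<subseteq> A'" "B \<subseteq> B'" shows "A <+>\<^bsub>M\<^esub> B \<subseteq> A' <+>\<^bsub>M\<^esub> B'"
  using assms unfolding set_add_def set_mult_def by auto

lemma (in module) sum_assoc_absorb:
  assumes A: "submodule A R M" and B: "submodule B R M" and C: "submodule C R M"
    and sub: "A \<subseteq> B" and eq: "A <+>\<^bsub>M\<^esub> C = carrier M"
  shows "B <+>\<^bsub>M\<^esub> C = carrier M"
proof -
  have "A <+>\<^bsub>M\<^esub> C \<subseteq> B <+>\<^bsub>M\<^esub> C" by (rule set_add_mono[OF sub subset_refl])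
  then show ?thesis using eq submoduleE(1)[OF submodule_sum[OF B C]] by auto
qed

text \<open>If \<open>a\<close> is surjective on the quotient of a hollow module \<open>H\<close> by a proper submodule \<open>K\<close>, then
  \<open>a H + K = H\<close>, and \<open>a H = H\<close> because \<open>H\<close> is hollow.\<close>

lemma hollow_above_mono:
  assumes N: "module R N" and h: "hollow_above R N K"
    and K2: "submodule K2 R N" "K \<subseteq> K2" "K2 \<noteq> carrier N"
  shows "hollow_above R N K2" and "nonsurjective_scalars R N K2 = nonsurjective_scalars R N K"
proof -
  interpret N: module R N by (rule N)
  note K = hollow_aboveD(1)[OF h]
  show "hollow_above R N K2"
    unfolding hollow_above_def
  proof (intro conjI allI impI K2(1,3))
    fix A B assume "submodule A R N" "submodule B R N" "K2 \<subseteq> A" "K2 \<subseteq> B" "A <+>\<^bsub>N\<^esub> B = carrier N"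
    then show "A = carrier N \<or> B = carrier N"
      using hollow_aboveD(3)[OF h, of A B] K2(2) by blast
  qed
  have "K2 <+>\<^bsub>N\<^esub> (\<lambda>x. a \<odot>\<^bsub>N\<^esub> x) ` carrier N = carrier N \<longleftrightarrow>
      K <+>\<^bsub>N\<^esub> (\<lambda>x. a \<odot>\<^bsub>N\<^esub> x) ` carrier N = carrier N" if a: "a \<in> carrier R" for a
  proof
    note s = N.submodule_scaled[OF a]
    let ?A = "K <+>\<^bsub>N\<^esub> (\<lambda>x. a \<odot>\<^bsub>N\<^esub> x) ` carrier N"
    have A: "submodule ?A R N" by (rule N.submodule_sum[OF K s])
    show "K2 <+>\<^bsub>N\<^esub> (\<lambda>x. a \<odot>\<^bsub>N\<^esub> x) ` carrier N = carrier N" if "?A = carrier N"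
      by (rule N.sum_assoc_absorb[OF K K2(1) s K2(2) that])
    assume eq: "K2 <+>\<^bsub>N\<^esub> (\<lambda>x. a \<odot>\<^bsub>N\<^esub> x) ` carrier N = carrier N"
    have "K2 <+>\<^bsub>N\<^esub> (\<lambda>x. a \<odot>\<^bsub>N\<^esub> x) ` carrier N \<subseteq> K2 <+>\<^bsub>N\<^esub> ?A"
      by (rule set_add_mono[OF subset_refl N.sum_upper(2)[OF K s]])
    then have "K2 <+>\<^bsub>N\<^esub> ?A = carrier N"
      using eq N.submoduleE(1)[OF N.submodule_sum[OF K2(1) A]] by auto
    then show "?A = carrier N"
      by (rule hollow_aboveD(3)[OF h K2(1) A K2(2) N.sum_upper(1)[OF K s] _ K2(3)])
  qed
  then show "nonsurjective_scalars R N K2 = nonsurjective_scalars R N K"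
    unfolding nonsurjective_scalars_def by blast
qed

text \<open>The condition says that the hollow quotient \<open>N / K\<close> is not covered by the kernel of \<open>p\<close>. Then
  \<open>N / (K + ker p)\<close> is a nonzero quotient both of \<open>N / K\<close> and of \<open>N'\<close>.\<close>

lemma (in surjection) Coass_push:
  assumes h: "hollow_above R N K" and ne: "K <+>\<^bsub>N\<^esub> preim {\<zero>\<^bsub>N'\<^esub>} \<noteq> carrier N"
  shows "nonsurjective_scalars R N K \<in> Coass R N'"
proof -
  interpret N: module R N by (rule N)
  interpret N': module R N' by (rule N')
  let ?K = "K <+>\<^bsub>N\<^esub> preim {\<zero>\<^bsub>N'\<^esub>}"
  note K = hollow_aboveD(1)[OF h] and k = preim_submodule[OF N'.submodule_zero]
  have K2: "submodule ?K R N" "K \<subseteq> ?K" "preim {\<zero>\<^bsub>N'\<^esub>} \<subseteq> ?K"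
    using N.submodule_sum[OF K k] N.sum_upper[OF K k] by auto
  note h2 = hollow_above_mono[OF N h K2(1,2) ne]
  have p: "preim (p ` ?K) = ?K" by (rule preim_image[OF K2(1,3)])
  have s: "submodule (p ` ?K) R N'" by (rule image_submodule[OF K2(1)])
  have "hollow_above R N' (p ` ?K)" using hollow_above_preim_iff[OF s] h2(1) p by simp
  moreover have "nonsurjective_scalars R N' (p ` ?K) = nonsurjective_scalars R N K"
    using nonsurjective_scalars_preim[OF s] h2(2) p by simp
  ultimately show ?thesis using hollow_above_Coass[OF N', of "p ` ?K"] by simp
qed

section \<open>Existence of hollow quotients\<close>

text \<open>The descending chain condition for the submodules of \<open>N\<close> contained in \<open>D\<close>, stated as
  well-foundedness so that it yields both minimal elements and stabilising chains.\<close>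

definition dcc_below ::
    "('a, 'r) ring_scheme \<Rightarrow> ('a, 'm, 'q) module_scheme \<Rightarrow> 'm set \<Rightarrow> bool" where
  "dcc_below R N D \<longleftrightarrow>
     wf {(A, B). submodule A R N \<and> submodule B R N \<and> A \<subset> B \<and> B \<subseteq> D}"

lemma dcc_below_minimal:
  assumes dcc: "dcc_below R N D" and Q: "X \<in> Q" "\<And>A. A \<in> Q \<Longrightarrow> submodule A R N" "\<And>A. A \<in> Q \<Longrightarrow> A \<subseteq> D"
  shows "\<exists>A \<in> Q. \<forall>B \<in> Q. B \<subseteq> A \<longrightarrow> B = A"
proof -
  obtain A where A: "A \<in> Q"
    "\<And>B. (B, A) \<in> {(A, B). submodule A R N \<and> submodule B R N \<and> A \<subset> B \<and> B \<subseteq> D} \<Longrightarrow> B \<notin> Q"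
    by (rule wfE_min[OF dcc[unfolded dcc_below_def] Q(1)]) rule
  have "B = A" if B: "B \<in> Q" "B \<subseteq> A" for B
  proof (rule ccontr)
    assume "B \<noteq> A"
    then have "B \<subset> A" using B(2) by simp
    then show False using A(2)[of B] Q(2)[OF A(1)] Q(2)[OF B(1)] Q(3)[OF A(1)] B(1) by simp
  qed
  then show ?thesis using A(1) by blast
qed

lemma dcc_below_stabilises:
  assumes dcc: "dcc_below R N D"
    and H: "\<And>i :: nat. submodule (H i) R N" "\<And>i. H i \<subseteq> D" "\<And>i. H (Suc i) \<subseteq> H i"
  shows "\<exists>n. \<forall>i \<ge> n. H i = H n"
proof -
  have "\<exists>A \<in> range H. \<forall>B \<in> range H. B \<subseteq> A \<longrightarrow> B = A"
    by (rule dcc_below_minimal[OF dcc, of "H 0"]) (use H in auto)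
  then obtain n where n: "\<forall>B \<in> range H. B \<subseteq> H n \<longrightarrow> B = H n" by auto
  have "H i = H n" if "n \<le> i" for i
    using n lift_Suc_antimono_le[of H, OF H(3) that] by simp
  then show ?thesis by blast
qed

lemma dcc_belowI:
  assumes "\<And>H :: nat \<Rightarrow> 'm set. (\<And>i. submodule (H i) R N) \<Longrightarrow> (\<And>i. H i \<subseteq> D) \<Longrightarrow>
    (\<And>i. H (Suc i) \<subset> H i) \<Longrightarrow> False"
  shows "dcc_below R (N :: ('a, 'm, 'q) module_scheme) D"
  unfolding dcc_below_def wf_iff_no_infinite_down_chain
proof
  assume "\<exists>f. \<forall>i. (f (Suc i), f i) \<in> {(A, B). submodule A R N \<and> submodule B R N \<and> A \<subset> B \<and> B \<subseteq> D}"
  then obtain f where f: "\<forall>i. (f (Suc i), f i) \<in> {(A, B). submodule A R N \<and> submodule B R N \<and> A \<subset> B \<and> B \<subseteq> D}"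
    by (rule exE)
  show False by (rule assms[of f]) (use f in simp_all)
qed

text \<open>A module on which \<open>a\<close> acts locally nilpotently is Artinian if the kernel of \<open>a\<close> is. A
  submodule \<open>D\<close> is determined, among those above or below it, by the sequence of submodules
  \<open>a\<^sup>n (D \<inter> ker a\<^sup>n\<^sup>+\<^sup>1)\<close> of \<open>ker a\<close>, which decreases both in \<open>n\<close> and with \<open>D\<close>; hence only finitely
  many values of \<open>n\<close> matter along a descending chain of submodules.\<close>

lemma (in module) dcc_below_of_kernel:
  assumes a: "a \<in> carrier R" and D: "submodule D R M"
    and nil: "\<And>y. y \<in> D \<Longrightarrow> \<exists>n :: nat. (a [^] n) \<odot>\<^bsub>M\<^esub> y = \<zero>\<^bsub>M\<^esub>"
    and dcc: "dcc_below R M {y \<in> D. a \<odot>\<^bsub>M\<^esub> y = \<zero>\<^bsub>M\<^esub>}"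
  shows "dcc_below R M D"
proof (rule dcc_belowI)
  fix H :: "nat \<Rightarrow> _ set"
  assume H: "\<And>i. submodule (H i) R M" "\<And>i. H i \<subseteq> D" "\<And>i. H (Suc i) \<subset> H i"
  have an: "a [^] n \<in> carrier R" for n :: nat using a by simp
  have Hc: "y \<in> carrier M" if "y \<in> H i" for y i using that submoduleE(1)[OF H(1)] by blast
  define S where "S i n = {(a [^] n) \<odot>\<^bsub>M\<^esub> y | y. y \<in> H i \<and> (a [^] Suc n) \<odot>\<^bsub>M\<^esub> y = \<zero>\<^bsub>M\<^esub>}" for i n :: nat
  have S_im: "S i n = (\<lambda>y. (a [^] n) \<odot>\<^bsub>M\<^esub> y) ` {y \<in> H i. (a [^] Suc n) \<odot>\<^bsub>M\<^esub> y = \<zero>\<^bsub>M\<^esub>}" for i n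
    unfolding S_def by blast
  have pre: "submodule {y \<in> H i. (a [^] Suc n) \<odot>\<^bsub>M\<^esub> y = \<zero>\<^bsub>M\<^esub>} R M" for i and n :: nat
  proof -
    have "submodule {y \<in> carrier M. (a [^] Suc n) \<odot>\<^bsub>M\<^esub> y \<in> {\<zero>\<^bsub>M\<^esub>}} R M"
      by (rule submodule_preimage[OF linear_map_smult[OF linear_map_id] _ _ submodule_zero])
         (use an[of "Suc n"] module_axioms in simp_all)
    from submodule_Int[OF H(1)[of i] this] have "submodule (H i \<inter> {y \<in> carrier M. (a [^] Suc n) \<odot>\<^bsub>M\<^esub> y \<in> {\<zero>\<^bsub>M\<^esub>}}) R M" .
    moreover have "H i \<inter> {y \<in> carrier M. (a [^] Suc n) \<odot>\<^bsub>M\<^esub> y \<in> {\<zero>\<^bsub>M\<^esub>}} = {y \<in> H i. (a [^] Suc n) \<odot>\<^bsub>M\<^esub> y = \<zero>\<^bsub>M\<^esub>}"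
      using Hc by blast
    ultimately show ?thesis by simp
  qed
  have S_sub: "submodule (S i n) R M" for i n unfolding S_im
    by (rule submodule_image[OF linear_map_smult[OF linear_map_id] _ _ pre])
       (use an module_axioms in simp_all)
  have S_ker: "S i n \<subseteq> {y \<in> D. a \<odot>\<^bsub>M\<^esub> y = \<zero>\<^bsub>M\<^esub>}" for i n
  proof
    fix z assume "z \<in> S i n"
    then obtain y where y: "y \<in> H i" "(a [^] Suc n) \<odot>\<^bsub>M\<^esub> y = \<zero>\<^bsub>M\<^esub>" "z = (a [^] n) \<odot>\<^bsub>M\<^esub> y"
      unfolding S_def by auto
    have "a \<odot>\<^bsub>M\<^esub> z = (a [^] Suc n) \<odot>\<^bsub>M\<^esub> y"
      using y a an Hc[OF y(1)] by (simp add: smult_assoc1 smult_comm)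
    moreover have "z \<in> D" using y submoduleE(4)[OF D an] H(2) by blast
    ultimately show "z \<in> {y \<in> D. a \<odot>\<^bsub>M\<^esub> y = \<zero>\<^bsub>M\<^esub>}" using y(2) by simp
  qed
  have S_i: "S (Suc i) n \<subseteq> S i n" for i n unfolding S_def using H(3)[of i] by blast
  have S_n: "S i (Suc n) \<subseteq> S i n" for i n
  proof
    fix z assume "z \<in> S i (Suc n)"
    then obtain y where y: "y \<in> H i" "(a [^] Suc (Suc n)) \<odot>\<^bsub>M\<^esub> y = \<zero>\<^bsub>M\<^esub>" "z = (a [^] Suc n) \<odot>\<^bsub>M\<^esub> y"
      unfolding S_def by auto
    have yc: "y \<in> carrier M" by (rule Hc[OF y(1)])
    have "(a [^] Suc n) \<odot>\<^bsub>M\<^esub> (a \<odot>\<^bsub>M\<^esub> y) = (a [^] Suc (Suc n)) \<odot>\<^bsub>M\<^esub> y"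
      using a an[of "Suc n"] yc smult_assoc1[of "a [^] Suc n" a y] by simp
    moreover have "z = (a [^] n) \<odot>\<^bsub>M\<^esub> (a \<odot>\<^bsub>M\<^esub> y)"
      using y(3) a an[of n] yc smult_assoc1[of "a [^] n" a y] by simp
    moreover have "a \<odot>\<^bsub>M\<^esub> y \<in> H i" using submoduleE(4)[OF H(1) a y(1)] .
    ultimately show "z \<in> S i n" using y(2) unfolding S_def by auto
  qed
  have S_mono: "S i' n' \<subseteq> S i n" if "i \<le> i'" "n \<le> n'" for i i' n n'
  proof -
    have "S i' n' \<subseteq> S i n'" using lift_Suc_antimono_le[of "\<lambda>i. S i n'", OF S_i that(1)] .
    also have "S i n' \<subseteq> S i n" using lift_Suc_antimono_le[of "S i", OF S_n that(2)] .
    finally show ?thesis .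
  qed
  have "\<exists>k. \<forall>i \<ge> k. S i i = S k k"
    by (rule dcc_below_stabilises[OF dcc, of "\<lambda>i. S i i"]) (use S_sub S_ker S_mono in simp_all)
  then obtain k where k: "\<And>i. k \<le> i \<Longrightarrow> S i i = S k k" by auto
  have "\<exists>j. \<forall>i \<ge> j. S i n = S j n" for n
    by (rule dcc_below_stabilises[OF dcc, of "\<lambda>i. S i n"]) (use S_sub S_ker S_i in simp_all)
  then obtain j where j: "\<And>n i. j n \<le> i \<Longrightarrow> S i n = S (j n) n" by metis
  \<comment> \<open>From \<open>J\<close> on, the diagonal and the finitely many columns \<open>n \<le> k\<close> are constant; the columns
    \<open>n > k\<close> are caught between two entries of the diagonal.\<close>
  define J where "J = max k (Max (j ` {..k}))"
  have kJ: "k \<le> J" unfolding J_def by simp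
  have S_eq: "S J n \<subseteq> S (Suc J) n" for n
  proof (cases "n \<le> k")
    case True
    then have "j n \<le> Max (j ` {..k})" by (intro Max_ge) auto
    then have "j n \<le> J" unfolding J_def by simp
    then show ?thesis using j[of n J] j[of n "Suc J"] by simp
  next
    case False
    let ?m = "max (Suc J) n"
    have "S J n \<subseteq> S k k" using False kJ by (intro S_mono) auto
    also have "S k k = S ?m ?m" using k[of ?m] kJ by simp
    also have "S ?m ?m \<subseteq> S (Suc J) n" by (intro S_mono) auto
    finally show ?thesis .
  qed
  have "y \<in> H J \<Longrightarrow> (a [^] n) \<odot>\<^bsub>M\<^esub> y = \<zero>\<^bsub>M\<^esub> \<Longrightarrow> y \<in> H (Suc J)" for y and n :: nat
  proof (induction n arbitrary: y)
    case 0
    then have "y = \<zero>\<^bsub>M\<^esub>" using Hc[OF 0(1)] by simp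
    then show ?case using H(1)[of "Suc J"] by (simp add: submodule_iff)
  next
    case (Suc n)
    have "(a [^] n) \<odot>\<^bsub>M\<^esub> y \<in> S J n" unfolding S_def using Suc.prems by blast
    then have "(a [^] n) \<odot>\<^bsub>M\<^esub> y \<in> S (Suc J) n" using S_eq by blast
    then obtain z where z: "z \<in> H (Suc J)" "(a [^] n) \<odot>\<^bsub>M\<^esub> y = (a [^] n) \<odot>\<^bsub>M\<^esub> z" unfolding S_def by blast
    have zJ: "z \<in> H J" using z(1) H(3)[of J] by blast
    have c: "y \<in> carrier M" "z \<in> carrier M" using Hc Suc.prems(1) zJ by blast+
    have "y \<ominus>\<^bsub>M\<^esub> z \<in> H J" by (rule submodule_minus[OF H(1) Suc.prems(1) zJ])
    moreover have "(a [^] n) \<odot>\<^bsub>M\<^esub> (y \<ominus>\<^bsub>M\<^esub> z) = \<zero>\<^bsub>M\<^esub>"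
      using smult_minus_distr[OF an[of n] c] z(2) minus_eq_zero_iff[of "(a [^] n) \<odot>\<^bsub>M\<^esub> z" "(a [^] n) \<odot>\<^bsub>M\<^esub> z"] c an[of n]
      by simp
    ultimately have "y \<ominus>\<^bsub>M\<^esub> z \<in> H (Suc J)" by (rule Suc.IH)
    then have "(y \<ominus>\<^bsub>M\<^esub> z) \<oplus>\<^bsub>M\<^esub> z \<in> H (Suc J)" using submoduleE(5)[OF H(1)] z(1) by blast
    then show ?case using c by (simp add: a_minus_def M.a_assoc M.l_neg)
  qed
  then have "H J \<subseteq> H (Suc J)" using nil H(2)[of J] by blast
  then show False using H(3)[of J] by blast
qed

text \<open>A module is cocyclic if some \<open>x \<noteq> 0\<close> lies in all its nonzero submodules. Let \<open>I\<close> be the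
  annihilator of \<open>x\<close>. The elements killed by \<open>I\<close> form the simple module \<open>R x\<close>, and each element
  of \<open>I\<close> acts locally nilpotently. Adding the generators of \<open>I\<close> one by one, the preceding lemma
  climbs from \<open>R x\<close> to the whole module.\<close>

lemma (in module) cocyclic_dcc:
  assumes N: "noetherian_ring R" and x: "x \<in> carrier M" "x \<noteq> \<zero>\<^bsub>M\<^esub>"
    and ess: "\<And>H. submodule H R M \<Longrightarrow> H \<noteq> {\<zero>\<^bsub>M\<^esub>} \<Longrightarrow> x \<in> H"
  shows "dcc_below R M (carrier M)"
proof -
  interpret N: noetherian_ring R by (rule N)
  define I where "I = {r \<in> carrier R. r \<odot>\<^bsub>M\<^esub> x \<in> {\<zero>\<^bsub>M\<^esub>}}"
  have multiple: "\<exists>t \<in> carrier R. x = t \<odot>\<^bsub>M\<^esub> z" if z: "z \<in> carrier M" "z \<noteq> \<zero>\<^bsub>M\<^esub>" for z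
  proof -
    have "x \<in> (\<lambda>r. r \<odot>\<^bsub>M\<^esub> z) ` carrier R"
      by (rule ess[OF submodule_cyclic(1)[OF z(1)]]) (use submodule_cyclic(2)[OF z(1)] z(2) in blast)
    then show ?thesis by auto
  qed
  have idI: "ideal I R" unfolding I_def by (rule colon_ideal[OF submodule_zero x(1)])
  obtain A where A: "A \<subseteq> carrier R" "finite A" "I = Idl A" using N.finetely_gen[OF idI] by auto
  have AI: "A \<subseteq> I" using R.genideal_self[OF A(1)] A(3) by simp
  have nil: "\<exists>n :: nat. (a [^] n) \<odot>\<^bsub>M\<^esub> y = \<zero>\<^bsub>M\<^esub>" if a: "a \<in> A" and y: "y \<in> carrier M" for a y
  proof -
    have aR: "a \<in> carrier R" and ax: "a \<odot>\<^bsub>M\<^esub> x = \<zero>\<^bsub>M\<^esub>" using a AI unfolding I_def by auto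
    have an: "a [^] n \<in> carrier R" for n :: nat using aR by simp
    define z where "z n = (a [^] n) \<odot>\<^bsub>M\<^esub> y" for n :: nat
    have zc: "z n \<in> carrier M" for n unfolding z_def using an y by simp
    define J where "J n = {r \<in> carrier R. r \<odot>\<^bsub>M\<^esub> z n \<in> {\<zero>\<^bsub>M\<^esub>}}" for n
    have idJ: "ideal (J n) R" for n unfolding J_def by (rule colon_ideal[OF submodule_zero zc])
    have zSuc: "z (Suc n) = a \<odot>\<^bsub>M\<^esub> z n" for n
      unfolding z_def using aR an[of n] y smult_assoc1[of "a [^] n" a y] smult_comm[of a "a [^] n" y] by simp
    obtain K where K: "K \<in> range J" "\<And>L. L \<in> range J \<Longrightarrow> K \<subseteq> L \<Longrightarrow> L = K"
      by (rule N.ideals_maximal[of "range J"]) (use idJ in auto)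
    then obtain n where n: "K = J n" by auto
    have "J n \<subseteq> J (Suc n)"
    proof
      fix r assume "r \<in> J n"
      then show "r \<in> J (Suc n)"
        unfolding J_def using smult_comm[OF _ aR zc, of r n] aR zSuc[of n] by auto
    qed
    then have eq: "J (Suc n) = J n" using K(2)[of "J (Suc n)"] n by simp
    have "z n = \<zero>\<^bsub>M\<^esub>"
    proof (rule ccontr)
      assume "z n \<noteq> \<zero>\<^bsub>M\<^esub>"
      from multiple[OF zc this] obtain t where t: "t \<in> carrier R" "x = t \<odot>\<^bsub>M\<^esub> z n" by (elim bexE)
      then have "t \<odot>\<^bsub>M\<^esub> z (Suc n) = \<zero>\<^bsub>M\<^esub>"
        using ax smult_comm[OF t(1) aR zc, of n] zSuc[of n] by simp
      then have "t \<in> J n" using eq t(1) unfolding J_def by blast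
      then show False using t(2) x(2) unfolding J_def by simp
    qed
    then show ?thesis unfolding z_def by blast
  qed
  define D where "D B = {y \<in> carrier M. \<forall>b \<in> B. b \<odot>\<^bsub>M\<^esub> y = \<zero>\<^bsub>M\<^esub>}" for B
  have D_sub: "submodule (D B) R M" if B: "B \<subseteq> carrier R" for B
  proof -
    have Bc: "b \<in> carrier R" if "b \<in> B" for b using that B by blast
    show ?thesis unfolding submodule_iff D_def
      by (auto simp: smult_r_distr Bc smult_comm[OF Bc])
  qed
  have socle: "D A \<subseteq> (\<lambda>r. r \<odot>\<^bsub>M\<^esub> x) ` carrier R"
  proof
    fix y assume y: "y \<in> D A"
    then have yc: "y \<in> carrier M" unfolding D_def by simp
    have kills: "r \<odot>\<^bsub>M\<^esub> u = \<zero>\<^bsub>M\<^esub>" if r: "r \<in> I" and u: "u \<in> D A" for r u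
    proof -
      have uc: "u \<in> carrier M" using u unfolding D_def by simp
      have "A \<subseteq> {r \<in> carrier R. r \<odot>\<^bsub>M\<^esub> u \<in> {\<zero>\<^bsub>M\<^esub>}}" using u A(1) unfolding D_def by auto
      then have "I \<subseteq> {r \<in> carrier R. r \<odot>\<^bsub>M\<^esub> u \<in> {\<zero>\<^bsub>M\<^esub>}}"
        unfolding A(3) by (rule R.genideal_minimal[OF colon_ideal[OF submodule_zero uc]])
      then show ?thesis using r by blast
    qed
    show "y \<in> (\<lambda>r. r \<odot>\<^bsub>M\<^esub> x) ` carrier R"
    proof (cases "y = \<zero>\<^bsub>M\<^esub>")
      case True
      then show ?thesis using x(1) by (intro image_eqI[of _ _ \<zero>]) auto
    next
      case False
      from multiple[OF yc this] obtain r where r: "r \<in> carrier R" "x = r \<odot>\<^bsub>M\<^esub> y" by (elim bexE)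
      have "r \<notin> I" using kills[OF _ y] r(2) x(2) by blast
      then have rx: "r \<odot>\<^bsub>M\<^esub> x \<noteq> \<zero>\<^bsub>M\<^esub>" using r(1) unfolding I_def by simp
      have "r \<odot>\<^bsub>M\<^esub> x \<in> carrier M" using r(1) x(1) by simp
      from multiple[OF this rx] obtain s where s: "s \<in> carrier R" "x = s \<odot>\<^bsub>M\<^esub> (r \<odot>\<^bsub>M\<^esub> x)" by (elim bexE)
      define u where "u = y \<ominus>\<^bsub>M\<^esub> s \<odot>\<^bsub>M\<^esub> x"
      have sx: "s \<odot>\<^bsub>M\<^esub> x \<in> carrier M" using s(1) x(1) by simp
      have uc: "u \<in> carrier M" unfolding u_def using yc sx by simp
      have ru: "r \<odot>\<^bsub>M\<^esub> u = \<zero>\<^bsub>M\<^esub>"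
      proof -
        have "r \<odot>\<^bsub>M\<^esub> u = r \<odot>\<^bsub>M\<^esub> y \<ominus>\<^bsub>M\<^esub> r \<odot>\<^bsub>M\<^esub> (s \<odot>\<^bsub>M\<^esub> x)"
          unfolding u_def by (rule smult_minus_distr[OF r(1) yc sx])
        also have "\<dots> = x \<ominus>\<^bsub>M\<^esub> x" using r(2) s(2) smult_comm[OF r(1) s(1) x(1)] by simp
        finally show ?thesis using minus_eq_zero_iff[OF x(1) x(1)] by simp
      qed
      have "u = \<zero>\<^bsub>M\<^esub>"
      proof (rule ccontr)
        assume "u \<noteq> \<zero>\<^bsub>M\<^esub>"
        from multiple[OF uc this] obtain t where t: "t \<in> carrier R" "x = t \<odot>\<^bsub>M\<^esub> u" by (elim bexE)
        then have "r \<odot>\<^bsub>M\<^esub> x = \<zero>\<^bsub>M\<^esub>" using smult_comm[OF r(1) t(1) uc] ru by simp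
        then show False using rx by simp
      qed
      then have "y = s \<odot>\<^bsub>M\<^esub> x" unfolding u_def using minus_eq_zero_iff[OF yc sx] by simp
      then show ?thesis using s(1) by blast
    qed
  qed
  have base: "dcc_below R M (D A)"
  proof (rule dcc_belowI)
    fix H :: "nat \<Rightarrow> _ set"
    assume H: "\<And>i. submodule (H i) R M" "\<And>i. H i \<subseteq> D A" "\<And>i. H (Suc i) \<subset> H i"
    have full: "(\<lambda>r. r \<odot>\<^bsub>M\<^esub> x) ` carrier R \<subseteq> H i" if "H i \<noteq> {\<zero>\<^bsub>M\<^esub>}" for i
      using submoduleE(4)[OF H(1)] ess[OF H(1) that] by blast
    have "H 1 \<noteq> {\<zero>\<^bsub>M\<^esub>}"
      using H(3)[of 1] H(1)[of "Suc 1"] by (auto simp: submodule_iff)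
    then have "H 0 \<subseteq> H 1" using full[of 1] H(2)[of 0] socle by blast
    then show False using H(3)[of 0] by simp
  qed
  have "\<forall>B \<subseteq> A. dcc_below R M (D (X \<union> B)) \<longrightarrow> dcc_below R M (D B)" if "finite X" "X \<subseteq> A" for X
    using that
  proof induction
    case empty
    show ?case by simp
  next
    case (insert a X)
    show ?case
    proof (intro allI impI)
      fix B assume B: "B \<subseteq> A" and "dcc_below R M (D (insert a X \<union> B))"
      then have "dcc_below R M (D (X \<union> insert a B))" by simp
      then have "dcc_below R M (D (insert a B))" using insert.IH insert.prems B by simp
      moreover have "D (insert a B) = {y \<in> D B. a \<odot>\<^bsub>M\<^esub> y = \<zero>\<^bsub>M\<^esub>}" unfolding D_def by blast
      ultimately have d: "dcc_below R M {y \<in> D B. a \<odot>\<^bsub>M\<^esub> y = \<zero>\<^bsub>M\<^esub>}" by simp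
      have aA: "a \<in> A" using insert.prems by simp
      show "dcc_below R M (D B)"
      proof (rule dcc_below_of_kernel[OF _ _ _ d])
        show "a \<in> carrier R" using aA A(1) by blast
        show "submodule (D B) R M" using B A(1) by (intro D_sub) simp
        show "\<exists>n :: nat. (a [^] n) \<odot>\<^bsub>M\<^esub> y = \<zero>\<^bsub>M\<^esub>" if "y \<in> D B" for y
          by (rule nil[OF aA]) (use that in \<open>simp add: D_def\<close>)
      qed
    qed
  qed
  from this[OF A(2) subset_refl] base have "dcc_below R M (D {})" by simp
  then show ?thesis unfolding D_def by simp
qed

text \<open>Choose \<open>D\<close> minimal among the submodules that, together with some proper \<open>K\<close>, span \<open>M\<close>.
  Then \<open>M / K \<cong> D / (D \<inter> K)\<close> is hollow.\<close>

lemma (in module) dcc_hollow_above: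
  assumes dcc: "dcc_below R M (carrier M)" and ne: "carrier M \<noteq> {\<zero>\<^bsub>M\<^esub>}"
  shows "\<exists>K. hollow_above R M K"
proof -
  define Q where "Q = {D. submodule D R M \<and> (\<exists>K. submodule K R M \<and> K \<noteq> carrier M \<and> D <+>\<^bsub>M\<^esub> K = carrier M)}"
  have car: "carrier M \<in> Q"
  proof -
    have "carrier M <+>\<^bsub>M\<^esub> {\<zero>\<^bsub>M\<^esub>} = carrier M"
      using sum_upper(1)[OF carrier_is_submodule submodule_zero]
        submoduleE(1)[OF submodule_sum[OF carrier_is_submodule submodule_zero]] by simp
    then show ?thesis unfolding Q_def using carrier_is_submodule submodule_zero ne by blast
  qed
  have "\<exists>D \<in> Q. \<forall>B \<in> Q. B \<subseteq> D \<longrightarrow> B = D"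
    by (rule dcc_below_minimal[OF dcc car]) (auto simp: Q_def dest: submoduleE(1))
  then obtain D where DQ: "D \<in> Q" and min: "\<forall>B \<in> Q. B \<subseteq> D \<longrightarrow> B = D" by (rule bexE)
  from DQ obtain K where D: "submodule D R M" and K: "submodule K R M" "K \<noteq> carrier M"
    and DK: "D <+>\<^bsub>M\<^esub> K = carrier M" unfolding Q_def by blast
  have hollow: "A = carrier M"
    if A: "submodule A R M" "K \<subseteq> A" and B: "submodule B R M" "K \<subseteq> B" "B \<noteq> carrier M"
      and AB: "A <+>\<^bsub>M\<^esub> B = carrier M" for A B
  proof -
    note c = submoduleE(1)
    have AD: "submodule (A \<inter> D) R M" by (rule submodule_Int[OF A(1) D])
    have "(A \<inter> D) <+>\<^bsub>M\<^esub> B = carrier M"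
      unfolding set_add_eq_carrier_iff[OF AD B(1)]
    proof
      fix y assume y: "y \<in> carrier M"
      obtain a b where ab: "a \<in> A" "b \<in> B" "y = a \<oplus>\<^bsub>M\<^esub> b"
        using AB[unfolded set_add_eq_carrier_iff[OF A(1) B(1)]] y by blast
      have ac: "a \<in> carrier M" "b \<in> carrier M" using ab c[OF A(1)] c[OF B(1)] by blast+
      obtain d k where dk: "d \<in> D" "k \<in> K" "a = d \<oplus>\<^bsub>M\<^esub> k"
        using DK[unfolded set_add_eq_carrier_iff[OF D K(1)]] ac(1) by blast
      have dc: "d \<in> carrier M" "k \<in> carrier M" using dk c[OF D] c[OF K(1)] by blast+
      have kA: "k \<in> A" and kB: "k \<in> B" using dk(2) A(2) B(2) by auto
      have "a \<ominus>\<^bsub>M\<^esub> k \<in> A" by (rule submodule_minus[OF A(1) ab(1) kA])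
      moreover have "a \<ominus>\<^bsub>M\<^esub> k = d" using dk(3) dc by (simp add: a_minus_def M.a_assoc M.r_neg)
      ultimately have dA: "d \<in> A \<inter> D" using dk(1) by simp
      have "y = d \<oplus>\<^bsub>M\<^esub> (k \<oplus>\<^bsub>M\<^esub> b)" using ab(3) dk(3) dc ac by (simp add: M.a_assoc)
      then show "\<exists>u \<in> A \<inter> D. \<exists>v \<in> B. y = u \<oplus>\<^bsub>M\<^esub> v"
        using dA submoduleE(5)[OF B(1) kB ab(2)] by blast
    qed
    then have "A \<inter> D \<in> Q" unfolding Q_def using AD B by blast
    then have "A \<inter> D = D" using min by simp
    then have "D \<subseteq> A" by blast
    then have "A <+>\<^bsub>M\<^esub> K = carrier M" by (rule sum_assoc_absorb[OF D A(1) K(1) _ DK])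
    moreover have "A <+>\<^bsub>M\<^esub> K \<subseteq> A"
      unfolding set_add_def' using submoduleE(5)[OF A(1)] A(2) by blast
    ultimately show ?thesis using c[OF A(1)] by simp
  qed
  have "hollow_above R M K" unfolding hollow_above_def
  proof (intro conjI allI impI K)
    fix A B assume "submodule A R M" "submodule B R M" "K \<subseteq> A" "K \<subseteq> B" "A <+>\<^bsub>M\<^esub> B = carrier M"
    then show "A = carrier M \<or> B = carrier M" using hollow[of A B] by (cases "B = carrier M") simp_all
  qed
  then show ?thesis by (rule exI)
qed

text \<open>The quotient of \<open>N\<close> by a submodule that is maximal among those avoiding a given \<open>x \<notin> K0\<close> is
  cocyclic, hence Artinian.\<close>

lemma exists_hollow_above:
  assumes M: "module R N" and N: "noetherian_ring R" and K0: "submodule K0 R N" "K0 \<noteq> carrier N"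
  shows "\<exists>K. K0 \<subseteq> K \<and> hollow_above R N K"
proof -
  interpret M: module R N by (rule M)
  obtain x where x: "x \<in> carrier N" "x \<notin> K0" using M.submoduleE(1)[OF K0(1)] K0(2) by blast
  let ?F = "{H. submodule H R N \<and> K0 \<subseteq> H \<and> x \<notin> H}"
  have "\<exists>K \<in> ?F. \<forall>H \<in> ?F. K \<subseteq> H \<longrightarrow> H = K"
  proof (rule subset_Zorn_nonempty)
    show "?F \<noteq> {}" using K0(1) x(2) by blast
    fix C assume C: "C \<noteq> {}" "subset.chain ?F C"
    have "C \<subseteq> ?F" using C(2) unfolding subset_chain_def by (rule conjunct1)
    then have CF: "H \<in> ?F" if "H \<in> C" for H using that by (rule subsetD)
    have Csub: "submodule H R N" if "H \<in> C" for H using CF[OF that] by simp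
    obtain H0 where H0: "H0 \<in> C" using C(1) by auto
    have "submodule (\<Union>C) R N" unfolding M.submodule_iff
    proof (intro conjI ballI)
      show "\<Union>C \<subseteq> carrier N" using M.submoduleE(1)[OF Csub] by (rule Union_least)
      show "\<zero>\<^bsub>N\<^esub> \<in> \<Union>C" using H0 Csub[OF H0] by (intro UnionI[OF H0]) (simp add: M.submodule_iff)
    next
      fix u v assume "u \<in> \<Union>C" "v \<in> \<Union>C"
      then obtain H1 H2 where H12: "H1 \<in> C" "u \<in> H1" "H2 \<in> C" "v \<in> H2" by blast
      then have "H1 \<subseteq> H2 \<or> H2 \<subseteq> H1" using C(2) unfolding subset_chain_def by blast
      then obtain H where "H \<in> C" "u \<in> H" "v \<in> H" using H12 by blast
      then show "u \<oplus>\<^bsub>N\<^esub> v \<in> \<Union>C" using M.submoduleE(5)[OF Csub[of H], of u v] by auto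
    next
      fix r u assume r: "r \<in> carrier R" and "u \<in> \<Union>C"
      then obtain H where "H \<in> C" "u \<in> H" by blast
      then show "r \<odot>\<^bsub>N\<^esub> u \<in> \<Union>C" using M.submoduleE(4)[OF Csub[of H] r, of u] by auto
    qed
    moreover have "K0 \<subseteq> \<Union>C" using CF[OF H0] H0 by auto
    moreover have "x \<notin> \<Union>C"
    proof
      assume "x \<in> \<Union>C"
      then obtain H where "H \<in> C" "x \<in> H" by (rule UnionE)
      then show False using CF[of H] by simp
    qed
    ultimately show "\<Union>C \<in> ?F" by simp
  qed
  then obtain K1 where "K1 \<in> ?F" and max: "\<forall>H \<in> ?F. K1 \<subseteq> H \<longrightarrow> H = K1" by (rule bexE)
  then have K1: "submodule K1 R N" "K0 \<subseteq> K1" "x \<notin> K1" by auto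
  let ?C = "quot_module N K1"
  interpret S: surjection R N ?C "\<lambda>x. K1 +>\<^bsub>N\<^esub> x" by (rule M.surjection_quot_module[OF K1(1)])
  interpret C: module R ?C by (rule S.N')
  have pre0: "S.preim {\<zero>\<^bsub>?C\<^esub>} = K1"
    using M.quot_module(3)[OF K1(1)] M.submoduleE(1)[OF K1(1)] unfolding S.preim_def by auto
  have x': "K1 +>\<^bsub>N\<^esub> x \<in> carrier ?C" "K1 +>\<^bsub>N\<^esub> x \<noteq> \<zero>\<^bsub>?C\<^esub>"
    using x(1) K1(3) M.quot_module(3)[OF K1(1) x(1)] unfolding quot_module_carrier by auto
  have ess: "K1 +>\<^bsub>N\<^esub> x \<in> H" if H: "submodule H R ?C" "H \<noteq> {\<zero>\<^bsub>?C\<^esub>}" for H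
  proof (rule ccontr)
    assume no: "K1 +>\<^bsub>N\<^esub> x \<notin> H"
    have "K1 \<subseteq> S.preim H" using S.kernel_in_preim[OF H(1)] pre0 by simp
    moreover have "x \<notin> S.preim H" using no unfolding S.preim_def by simp
    ultimately have "S.preim H = K1" using max S.preim_submodule[OF H(1)] K1(2) by simp
    then have eq: "S.preim H = S.preim {\<zero>\<^bsub>?C\<^esub>}" using pre0 by simp
    have "H = {\<zero>\<^bsub>?C\<^esub>}"
      using S.image_preim[OF H(1)] unfolding eq S.image_preim[OF C.submodule_zero] by (rule sym)
    with H(2) show False by (rule notE)
  qed
  have "dcc_below R ?C (carrier ?C)" by (rule C.cocyclic_dcc[OF N x' ess])
  then have "\<exists>K. hollow_above R ?C K" using x' by (intro C.dcc_hollow_above) auto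
  then obtain K' where K': "hollow_above R ?C K'" by (rule exE)
  note s = hollow_aboveD(1)[OF K']
  have "hollow_above R N (S.preim K')" using S.hollow_above_preim_iff[OF s] K' by simp
  moreover have "K0 \<subseteq> S.preim K'" using S.kernel_in_preim[OF s] pre0 K1(2) by simp
  ultimately show ?thesis by blast
qed

section \<open>Coassociated primes of modules of homomorphisms\<close>

definition Baer_injective :: "('a, 'r) ring_scheme \<Rightarrow> ('a, 'm, 'q) module_scheme \<Rightarrow> bool" where
  "Baer_injective R E \<longleftrightarrow> module R E \<and> (\<forall>I. ideal I R \<longrightarrow> maps_extend R E I)"

lemma Baer_injective_extends:
  assumes E: "Baer_injective R E" and AB: "module R A" "module R B"
    and i: "linear_map R A B i" and f: "linear_map R A E f"
    and ker: "\<And>x. x \<in> carrier A \<Longrightarrow> i x = \<zero>\<^bsub>B\<^esub> \<Longrightarrow> f x = \<zero>\<^bsub>E\<^esub>"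
  shows "\<exists>g. linear_map R B E g \<and> (\<forall>x \<in> carrier A. g (i x) = f x)"
  by (rule Baer_criterion[OF AB _ i f ker]) (use E in \<open>auto simp: Baer_injective_def\<close>)

lemma restriction_surjection:
  assumes E: "Baer_injective R E" and L: "module R L" and H: "submodule H R L"
  shows "surjection R (hom_module R L E) (hom_module R (L\<lparr>carrier := H\<rparr>) E) (\<lambda>f. restrict f H)"
proof -
  interpret L: module R L by (rule L)
  have mE: "module R E" using E unfolding Baer_injective_def by simp
  let ?H = "L\<lparr>carrier := H\<rparr>"
  have mH: "module R ?H" by (rule submodule.submodule_is_module[OF H L])
  interpret H: module R ?H by (rule mH)
  have HL: "H \<subseteq> carrier L" by (rule L.submoduleE(1)[OF H])
  have res: "restrict f H \<in> module_hom R ?H E" if "f \<in> module_hom R L E" for f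
    using restrict_module_hom[OF linear_map_submodule[OF module_homD[OF that] HL] mH] by simp
  have "linear_map R (hom_module R L E) (hom_module R ?H E) (\<lambda>f. restrict f H)"
    unfolding linear_map_def hom_module_simps
  proof (intro conjI ballI)
    show "restrict f H \<in> module_hom R ?H E" if "f \<in> module_hom R L E" for f by (rule res[OF that])
    show "restrict (\<lambda>x \<in> carrier L. f x \<oplus>\<^bsub>E\<^esub> g x) H = (\<lambda>x \<in> carrier ?H. restrict f H x \<oplus>\<^bsub>E\<^esub> restrict g H x)" for f g
      using HL by (auto simp: restrict_def fun_eq_iff subset_iff)
    show "restrict (\<lambda>x \<in> carrier L. r \<odot>\<^bsub>E\<^esub> f x) H = (\<lambda>x \<in> carrier ?H. r \<odot>\<^bsub>E\<^esub> restrict f H x)" for r f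
      using HL by (auto simp: restrict_def fun_eq_iff subset_iff)
  qed
  moreover have "(\<lambda>f. restrict f H) ` module_hom R L E = module_hom R ?H E"
  proof (rule equalityI; rule subsetI)
    fix g assume g: "g \<in> module_hom R ?H E"
    have "linear_map R ?H L (\<lambda>x. x)" using linear_map_submodule[OF linear_map_id HL] .
    from Baer_injective_extends[OF E mH L this module_homD[OF g]]
    have "\<exists>h. linear_map R L E h \<and> (\<forall>x \<in> carrier ?H. h x = g x)"
      using linear_map_zero[OF module_homD[OF g] mH mE] by simp
    then obtain h where h: "linear_map R L E h" "\<forall>x \<in> carrier ?H. h x = g x" by (elim exE conjE)
    have "g = restrict (restrict h (carrier L)) H"
      by (rule module_hom_eqI[of _ ?H]) (use g h(2) HL in \<open>auto simp: module_hom_iff\<close>)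
    then show "g \<in> (\<lambda>f. restrict f H) ` module_hom R L E"
      by (rule image_eqI[of g "\<lambda>f. restrict f H" "restrict h (carrier L)"]) (rule restrict_module_hom[OF h(1) L])
  qed (use res in auto)
  ultimately show ?thesis
    by (intro surjection.intro hom_module_module L mH mE) simp_all
qed

text \<open>If \<open>ker a\<^sup>n = ker a\<^sup>n\<^sup>+\<^sup>1\<close> on \<open>L\<close>, then \<open>a\<close> is injective on \<open>L / ker a\<^sup>n\<close>, hence surjective on
  \<open>Hom(L / ker a\<^sup>n, E)\<close>.\<close>

lemma Baer_injective_divide:
  assumes E: "Baer_injective R E" and L: "module R L" and a: "a \<in> carrier R"
    and f: "linear_map R L E f"
    and ker: "\<And>x. x \<in> carrier L \<Longrightarrow> (a [^]\<^bsub>R\<^esub> Suc n) \<odot>\<^bsub>L\<^esub> x = \<zero>\<^bsub>L\<^esub> \<Longrightarrow> f x = \<zero>\<^bsub>E\<^esub>"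
  shows "\<exists>g. linear_map R L E g \<and> (\<forall>x \<in> carrier L. f x = a \<odot>\<^bsub>E\<^esub> g x)"
proof -
  interpret L: module R L by (rule L)
  have mE: "module R E" using E unfolding Baer_injective_def by simp
  interpret E: module R E by (rule mE)
  have an: "a [^]\<^bsub>R\<^esub> (k :: nat) \<in> carrier R" for k using a by simp
  \<comment> \<open>Extending \<open>a\<^sup>n\<^sup>+\<^sup>1 x \<mapsto> f(x)\<close> from \<open>a\<^sup>n\<^sup>+\<^sup>1 L\<close> to \<open>L\<close> divides \<open>f\<close> even by \<open>a\<^sup>n\<^sup>+\<^sup>1\<close>.\<close>
  have "linear_map R L L (\<lambda>x. (a [^]\<^bsub>R\<^esub> Suc n) \<odot>\<^bsub>L\<^esub> x)"
    by (rule linear_map_smult[OF linear_map_id L L an])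
  from Baer_injective_extends[OF E L L this f ker]
  obtain g where g: "linear_map R L E g" "\<forall>x \<in> carrier L. g ((a [^]\<^bsub>R\<^esub> Suc n) \<odot>\<^bsub>L\<^esub> x) = f x" by auto
  have "f x = a \<odot>\<^bsub>E\<^esub> ((a [^]\<^bsub>R\<^esub> n) \<odot>\<^bsub>E\<^esub> g x)" if x: "x \<in> carrier L" for x
  proof -
    have gx: "g x \<in> carrier E" by (rule linear_mapD(1)[OF g(1) x])
    have "f x = (a [^]\<^bsub>R\<^esub> Suc n) \<odot>\<^bsub>E\<^esub> g x"
      using bspec[OF g(2) x] linear_mapD(3)[OF g(1) an[of "Suc n"] x] by simp
    also have "\<dots> = (a [^]\<^bsub>R\<^esub> n) \<odot>\<^bsub>E\<^esub> (a \<odot>\<^bsub>E\<^esub> g x)"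
      using E.smult_assoc1[OF an[of n] a gx] by simp
    also have "\<dots> = a \<odot>\<^bsub>E\<^esub> ((a [^]\<^bsub>R\<^esub> n) \<odot>\<^bsub>E\<^esub> g x)" by (rule E.smult_comm[OF an a gx])
    finally show ?thesis .
  qed
  then show ?thesis using linear_map_smult[OF g(1) L mE an[of n]] by blast
qed

text \<open>Since \<open>a \<in> P\<close> is not surjective on the given hollow quotient of \<open>Hom(L, E)\<close>, that quotient is
  not an image of \<open>Hom(L / ker a\<^sup>n, E)\<close>; so it has a nonzero quotient that comes from
  \<open>Hom(ker a\<^sup>n, E)\<close>.\<close>

lemma Coass_hom_nilpotent_step:
  assumes N: "noetherian_ring R" and E: "Baer_injective R E" and L: "fin_gen_module R L"
    and P: "P \<in> Coass R (hom_module R L E)" and a: "a \<in> P"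
  shows "\<exists>H. submodule H R L \<and> P \<in> Coass R (hom_module R (L\<lparr>carrier := H\<rparr>) E) \<and>
    (\<forall>x \<in> H. \<exists>n :: nat. (a [^]\<^bsub>R\<^esub> n) \<odot>\<^bsub>L\<^esub> x = \<zero>\<^bsub>L\<^esub>)"
proof -
  have mL: "module R L" using L unfolding fin_gen_module_def by simp
  have mE: "module R E" using E unfolding Baer_injective_def by simp
  interpret L: module R L by (rule mL)
  let ?N = "hom_module R L E"
  have mN: "module R ?N" by (rule hom_module_module[OF mL mE])
  interpret N: module R ?N by (rule mN)
  obtain K where K: "hollow_above R ?N K" "P = nonsurjective_scalars R ?N K"
    using P unfolding Coass_iff[OF mN] by (elim conjE exE)
  have aR: "a \<in> carrier R" and aK: "K <+>\<^bsub>?N\<^esub> (\<lambda>f. a \<odot>\<^bsub>?N\<^esub> f) ` carrier ?N \<noteq> carrier ?N"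
    using a unfolding K(2) nonsurjective_scalars_def by auto
  have an: "a [^]\<^bsub>R\<^esub> (k :: nat) \<in> carrier R" for k using aR by simp
  define H where "H n = {x \<in> carrier L. (a [^]\<^bsub>R\<^esub> n) \<odot>\<^bsub>L\<^esub> x = \<zero>\<^bsub>L\<^esub>}" for n :: nat
  have H: "submodule (H n) R L" for n
    using submodule_preimage[OF linear_map_smult[OF linear_map_id mL mL an[of n]] mL mL L.submodule_zero]
    unfolding H_def by simp
  have "H n \<subseteq> H (Suc n)" for n
  proof
    fix x assume "x \<in> H n"
    then have x: "x \<in> carrier L" "(a [^]\<^bsub>R\<^esub> n) \<odot>\<^bsub>L\<^esub> x = \<zero>\<^bsub>L\<^esub>" unfolding H_def by auto
    have "(a [^]\<^bsub>R\<^esub> Suc n) \<odot>\<^bsub>L\<^esub> x = a \<odot>\<^bsub>L\<^esub> ((a [^]\<^bsub>R\<^esub> n) \<odot>\<^bsub>L\<^esub> x)"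
      using L.smult_assoc1[OF an[of n] aR x(1)] L.smult_comm[OF an[of n] aR x(1)] by simp
    then show "x \<in> H (Suc n)" using x aR unfolding H_def by simp
  qed
  from noetherian_chain_stabilises[of R L H, OF N L H this] obtain n where n: "\<forall>m. H m \<subseteq> H n" by (rule exE)
  interpret S: surjection R ?N "hom_module R (L\<lparr>carrier := H n\<rparr>) E" "\<lambda>f. restrict f (H n)"
    by (rule restriction_surjection[OF E mL H])
  let ?Z = "S.preim {\<zero>\<^bsub>hom_module R (L\<lparr>carrier := H n\<rparr>) E\<^esub>}"
  have sub: "?Z \<subseteq> (\<lambda>f. a \<odot>\<^bsub>?N\<^esub> f) ` carrier ?N"
  proof
    fix f assume "f \<in> ?Z"
    then have f: "f \<in> module_hom R L E" "restrict f (H n) = (\<lambda>x \<in> H n. \<zero>\<^bsub>E\<^esub>)"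
      unfolding S.preim_def by auto
    have f0: "f x = \<zero>\<^bsub>E\<^esub>" if "x \<in> carrier L" "(a [^]\<^bsub>R\<^esub> Suc n) \<odot>\<^bsub>L\<^esub> x = \<zero>\<^bsub>L\<^esub>" for x
    proof -
      have "x \<in> H (Suc n)" using that unfolding H_def by simp
      then have "x \<in> H n" using n by blast
      then show ?thesis using fun_cong[OF f(2), of x] by simp
    qed
    obtain g where g: "linear_map R L E g" "\<forall>x \<in> carrier L. f x = a \<odot>\<^bsub>E\<^esub> g x"
      using Baer_injective_divide[OF E mL aR module_homD[OF f(1)] f0] by auto
    have "f = a \<odot>\<^bsub>?N\<^esub> restrict g (carrier L)"
      unfolding hom_module_simps by (rule module_hom_eqI[of _ L]) (use f(1) g(2) in \<open>auto simp: module_hom_iff\<close>)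
    then show "f \<in> (\<lambda>f. a \<odot>\<^bsub>?N\<^esub> f) ` carrier ?N"
      by (rule image_eqI[of f "\<lambda>f. a \<odot>\<^bsub>?N\<^esub> f" "restrict g (carrier L)"])
         (simp add: restrict_module_hom[OF g(1) mL])
  qed
  have "K <+>\<^bsub>?N\<^esub> ?Z \<noteq> carrier ?N"
  proof
    assume eq: "K <+>\<^bsub>?N\<^esub> ?Z = carrier ?N"
    have "K <+>\<^bsub>?N\<^esub> ?Z \<subseteq> K <+>\<^bsub>?N\<^esub> (\<lambda>f. a \<odot>\<^bsub>?N\<^esub> f) ` carrier ?N"
      by (rule set_add_mono[OF subset_refl sub])
    moreover have "K <+>\<^bsub>?N\<^esub> (\<lambda>f. a \<odot>\<^bsub>?N\<^esub> f) ` carrier ?N \<subseteq> carrier ?N"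
      by (rule N.submoduleE(1)[OF N.submodule_sum[OF hollow_aboveD(1)[OF K(1)] N.submodule_scaled[OF aR]]])
    ultimately show False using eq aK by simp
  qed
  then have "P \<in> Coass R (hom_module R (L\<lparr>carrier := H n\<rparr>) E)"
    unfolding K(2) by (rule S.Coass_push[OF K(1)])
  moreover have "\<forall>x \<in> H n. \<exists>n :: nat. (a [^]\<^bsub>R\<^esub> n) \<odot>\<^bsub>L\<^esub> x = \<zero>\<^bsub>L\<^esub>" unfolding H_def by blast
  ultimately show ?thesis using H[of n] by blast
qed

lemma fin_gen_restrict:
  assumes N: "noetherian_ring R" and L: "fin_gen_module R L" and H: "submodule H R L"
  shows "fin_gen_module R (L\<lparr>carrier := H\<rparr>)"
  using fin_gen_submodule_iff[OF _ H] noetherian_fin_gen_submodule[OF N L H] L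
  unfolding fin_gen_module_def by simp

lemma Coass_hom_nilpotent:
  assumes N: "noetherian_ring R" and E: "Baer_injective R E" and L: "fin_gen_module R L"
    and P: "P \<in> Coass R (hom_module R L E)" and A: "finite A" "A \<subseteq> P"
  shows "\<exists>H. submodule H R L \<and> P \<in> Coass R (hom_module R (L\<lparr>carrier := H\<rparr>) E) \<and>
    (\<forall>a \<in> A. \<forall>x \<in> H. \<exists>n :: nat. (a [^]\<^bsub>R\<^esub> n) \<odot>\<^bsub>L\<^esub> x = \<zero>\<^bsub>L\<^esub>)"
  using A
proof induction
  case empty
  have "module R L" using L unfolding fin_gen_module_def by simp
  then show ?case using P module.carrier_is_submodule[of R L] by (intro exI[of _ "carrier L"]) simp
next
  case (insert a A)
  have mL: "module R L" using L unfolding fin_gen_module_def by simp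
  from insert.IH insert.prems obtain H where H: "submodule H R L"
    "P \<in> Coass R (hom_module R (L\<lparr>carrier := H\<rparr>) E)"
    "\<forall>a \<in> A. \<forall>x \<in> H. \<exists>n :: nat. (a [^]\<^bsub>R\<^esub> n) \<odot>\<^bsub>L\<^esub> x = \<zero>\<^bsub>L\<^esub>" by auto
  obtain H' where H': "submodule H' R (L\<lparr>carrier := H\<rparr>)" "P \<in> Coass R (hom_module R (L\<lparr>carrier := H'\<rparr>) E)"
    "\<forall>x \<in> H'. \<exists>n :: nat. (a [^]\<^bsub>R\<^esub> n) \<odot>\<^bsub>L\<^esub> x = \<zero>\<^bsub>L\<^esub>"
    using Coass_hom_nilpotent_step[OF N E fin_gen_restrict[OF N L H(1)] H(2), of a] insert.prems by auto
  have "submodule H' R L" "H' \<subseteq> H" using H'(1) module.submodule_restrict_iff[OF mL H(1)] by auto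
  then show ?case using H' H(3) by (intro exI[of _ H']) auto
qed

lemma (in module) common_annihilator:
  assumes P: "primeideal P R" and X: "finite X" "X \<subseteq> carrier M"
    and ann: "\<And>x. x \<in> X \<Longrightarrow> \<exists>s \<in> carrier R - P. s \<odot>\<^bsub>M\<^esub> x = \<zero>\<^bsub>M\<^esub>"
  shows "\<exists>s \<in> carrier R - P. \<forall>x \<in> X. s \<odot>\<^bsub>M\<^esub> x = \<zero>\<^bsub>M\<^esub>"
  using X ann
proof induction
  case empty
  have "\<one> \<notin> P" using primeideal.I_notcarr[OF P] ideal.one_imp_carrier[OF primeideal.axioms(1)[OF P]] by blast
  then show ?case by auto
next
  case (insert x X)
  then obtain s where s: "s \<in> carrier R - P" "\<forall>x \<in> X. s \<odot>\<^bsub>M\<^esub> x = \<zero>\<^bsub>M\<^esub>" by auto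
  from insert.prems(2)[of x] obtain t where t: "t \<in> carrier R - P" "t \<odot>\<^bsub>M\<^esub> x = \<zero>\<^bsub>M\<^esub>" by auto
  have "s \<otimes> t \<in> carrier R - P" using s(1) t(1) primeideal.I_prime[OF P, of s t] by auto
  moreover have "(s \<otimes> t) \<odot>\<^bsub>M\<^esub> y = \<zero>\<^bsub>M\<^esub>" if y: "y \<in> insert x X" for y
  proof -
    have yc: "y \<in> carrier M" using y insert.prems(1) by blast
    have st: "s \<in> carrier R" "t \<in> carrier R" using s(1) t(1) by auto
    have "(s \<otimes> t) \<odot>\<^bsub>M\<^esub> y = s \<odot>\<^bsub>M\<^esub> (t \<odot>\<^bsub>M\<^esub> y)" "(s \<otimes> t) \<odot>\<^bsub>M\<^esub> y = t \<odot>\<^bsub>M\<^esub> (s \<odot>\<^bsub>M\<^esub> y)"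
      using smult_assoc1[OF st yc] smult_comm[OF st yc] by simp_all
    then show ?thesis using y s(2) t(2) st by auto
  qed
  ultimately show ?case by blast
qed

lemma primeideal_nat_pow:
  assumes P: "primeideal P R" and a: "a \<in> carrier R" "a [^]\<^bsub>R\<^esub> (n :: nat) \<in> P"
  shows "a \<in> P"
  using a(2)
proof (induction n)
  interpret P: primeideal P R by (rule P)
  case 0
  then have "\<one>\<^bsub>R\<^esub> \<in> P" by simp
  then show ?case using P.one_imp_carrier P.I_notcarr by blast
next
  interpret P: primeideal P R by (rule P)
  case (Suc n)
  then have "a [^]\<^bsub>R\<^esub> n \<otimes>\<^bsub>R\<^esub> a \<in> P" by simp
  then show ?case using P.I_prime[of "a [^]\<^bsub>R\<^esub> n" a] Suc.IH a(1) by auto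
qed

text \<open>By the preceding lemmas \<open>P\<close> is coassociated to \<open>Hom(H, E)\<close> for a submodule \<open>H \<subseteq> L\<close> on which
  all elements of \<open>P\<close> are nilpotent. No \<open>s\<close> outside \<open>P\<close> kills \<open>H\<close>, because \<open>s\<close> is surjective on a
  nonzero quotient of \<open>Hom(H, E)\<close>. So the elements of \<open>H\<close> that are killed by some \<open>s\<close> outside
  \<open>P\<close> form a proper submodule \<open>T\<close>; a prime \<open>(T : y)\<close> must be \<open>P\<close>, and a suitable multiple of \<open>y\<close>
  has annihilator \<open>P\<close>.\<close>

lemma Coass_hom_subset_Ass:
  assumes N: "noetherian_ring R" and E: "Baer_injective R E" and L: "fin_gen_module R L"
  shows "Coass R (hom_module R L E) \<subseteq> Ass R L"
proof
  fix P assume PC: "P \<in> Coass R (hom_module R L E)"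
  have mL: "module R L" using L unfolding fin_gen_module_def by simp
  have mE: "module R E" using E unfolding Baer_injective_def by simp
  interpret N: noetherian_ring R by (rule N)
  interpret L: module R L by (rule mL)
  interpret E: module R E by (rule mE)
  have P: "primeideal P R" using PC unfolding Coass_def by blast
  interpret P: primeideal P R by (rule P)
  obtain A where A: "A \<subseteq> carrier R" "finite A" "P = Idl\<^bsub>R\<^esub> A"
    using N.finetely_gen[OF P.ideal_axioms] by auto
  have AP: "A \<subseteq> P" using N.genideal_self[OF A(1)] A(3) by simp
  obtain H where H: "submodule H R L" and PH: "P \<in> Coass R (hom_module R (L\<lparr>carrier := H\<rparr>) E)"
    and nil: "\<forall>a \<in> A. \<forall>x \<in> H. \<exists>n :: nat. (a [^]\<^bsub>R\<^esub> n) \<odot>\<^bsub>L\<^esub> x = \<zero>\<^bsub>L\<^esub>"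
    using Coass_hom_nilpotent[OF N E L PC A(2) AP] by (elim exE conjE)
  let ?H = "L\<lparr>carrier := H\<rparr>"
  have fH: "fin_gen_module R ?H" by (rule fin_gen_restrict[OF N L H])
  have mH: "module R ?H" by (rule submodule.submodule_is_module[OF H mL])
  interpret H: module R ?H by (rule mH)
  have HL: "H \<subseteq> carrier L" by (rule L.submoduleE(1)[OF H])
  define T where "T = {x \<in> H. \<exists>s \<in> carrier R - P. s \<odot>\<^bsub>L\<^esub> x = \<zero>\<^bsub>L\<^esub>}"
  have notinP: "s \<otimes>\<^bsub>R\<^esub> t \<in> carrier R - P" if "s \<in> carrier R - P" "t \<in> carrier R - P" for s t
    using that P.I_prime[of s t] by auto
  have T: "submodule T R ?H" unfolding H.submodule_iff
  proof (intro conjI ballI)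
    show "T \<subseteq> carrier ?H" unfolding T_def by auto
    have "\<one>\<^bsub>R\<^esub> \<in> carrier R - P" using P.one_imp_carrier P.I_notcarr by auto
    moreover have "\<zero>\<^bsub>L\<^esub> \<in> H" using H unfolding L.submodule_iff by simp
    ultimately show "\<zero>\<^bsub>?H\<^esub> \<in> T" unfolding T_def by auto
  next
    fix x y assume xy: "x \<in> T" "y \<in> T"
    then have xyH: "x \<in> H" "y \<in> H" unfolding T_def by auto
    have "\<exists>s \<in> carrier R - P. \<forall>z \<in> {x, y}. s \<odot>\<^bsub>L\<^esub> z = \<zero>\<^bsub>L\<^esub>"
      by (rule L.common_annihilator[OF P]) (use xy HL in \<open>auto simp: T_def\<close>)
    then obtain s where s: "s \<in> carrier R - P" "s \<odot>\<^bsub>L\<^esub> x = \<zero>\<^bsub>L\<^esub>" "s \<odot>\<^bsub>L\<^esub> y = \<zero>\<^bsub>L\<^esub>" by auto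
    have "s \<odot>\<^bsub>L\<^esub> (x \<oplus>\<^bsub>L\<^esub> y) = \<zero>\<^bsub>L\<^esub>"
      using s L.smult_r_distr[of s x y] xyH HL by auto
    then show "x \<oplus>\<^bsub>?H\<^esub> y \<in> T" unfolding T_def using s(1) L.submoduleE(5)[OF H xyH] by auto
  next
    fix r x assume r: "r \<in> carrier R" and x: "x \<in> T"
    then obtain s where s: "x \<in> H" "s \<in> carrier R - P" "s \<odot>\<^bsub>L\<^esub> x = \<zero>\<^bsub>L\<^esub>" unfolding T_def by auto
    then have "s \<odot>\<^bsub>L\<^esub> (r \<odot>\<^bsub>L\<^esub> x) = \<zero>\<^bsub>L\<^esub>" using L.smult_comm[of s r x] r HL by auto
    then show "r \<odot>\<^bsub>?H\<^esub> x \<in> T" unfolding T_def using s(2) L.submoduleE(4)[OF H r s(1)] by auto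
  qed
  have "T \<noteq> carrier ?H"
  proof
    assume TH: "T = carrier ?H"
    obtain X where X: "X \<subseteq> carrier ?H" "finite X"
      "\<forall>H'. submodule H' R ?H \<and> X \<subseteq> H' \<longrightarrow> H' = carrier ?H"
      using fH unfolding fin_gen_module_def by blast
    have "\<exists>s \<in> carrier R - P. \<forall>x \<in> X. s \<odot>\<^bsub>L\<^esub> x = \<zero>\<^bsub>L\<^esub>"
      by (rule L.common_annihilator[OF P X(2)]) (use X(1) HL TH in \<open>auto simp: T_def\<close>)
    then obtain s where s: "s \<in> carrier R - P" "\<forall>x \<in> X. s \<odot>\<^bsub>L\<^esub> x = \<zero>\<^bsub>L\<^esub>" by (elim bexE)
    have sR: "s \<in> carrier R" using s(1) by simp
    have "submodule {x \<in> carrier ?H. s \<odot>\<^bsub>?H\<^esub> x \<in> {\<zero>\<^bsub>?H\<^esub>}} R ?H"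
      by (rule submodule_preimage[OF linear_map_smult[OF linear_map_id mH mH sR] mH mH H.submodule_zero])
    moreover have "X \<subseteq> {x \<in> carrier ?H. s \<odot>\<^bsub>?H\<^esub> x \<in> {\<zero>\<^bsub>?H\<^esub>}}" using X(1) s(2) by auto
    ultimately have "{x \<in> carrier ?H. s \<odot>\<^bsub>?H\<^esub> x \<in> {\<zero>\<^bsub>?H\<^esub>}} = carrier ?H" using X(3) by blast
    then have kill: "s \<odot>\<^bsub>L\<^esub> x = \<zero>\<^bsub>L\<^esub>" if "x \<in> H" for x using that by auto
    let ?N = "hom_module R ?H E"
    have mN: "module R ?N" by (rule hom_module_module[OF mH mE])
    interpret HN: module R ?N by (rule mN)
    obtain K where K: "hollow_above R ?N K" "P = nonsurjective_scalars R ?N K"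
      using PH unfolding Coass_iff[OF mN] by (elim conjE exE)
    have zero: "s \<odot>\<^bsub>?N\<^esub> f = \<zero>\<^bsub>?N\<^esub>" if "f \<in> carrier ?N" for f
    proof -
      have f: "linear_map R ?H E f" using that module_homD by simp
      have "s \<odot>\<^bsub>E\<^esub> f x = \<zero>\<^bsub>E\<^esub>" if "x \<in> H" for x
        using linear_mapD(3)[OF f sR, of x] kill[OF that] that linear_map_zero[OF f mH mE] by simp
      then show ?thesis unfolding hom_module_simps by (intro restrict_ext) simp
    qed
    have "(\<lambda>f. s \<odot>\<^bsub>?N\<^esub> f) ` carrier ?N \<subseteq> K"
    proof
      fix h assume "h \<in> (\<lambda>f. s \<odot>\<^bsub>?N\<^esub> f) ` carrier ?N"
      then have "h = \<zero>\<^bsub>?N\<^esub>" using zero by blast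
      then show "h \<in> K" using hollow_aboveD(1)[OF K(1)] unfolding HN.submodule_iff by simp
    qed
    then have "K <+>\<^bsub>?N\<^esub> (\<lambda>f. s \<odot>\<^bsub>?N\<^esub> f) ` carrier ?N \<subseteq> K <+>\<^bsub>?N\<^esub> K"
      by (rule set_add_mono[OF subset_refl])
    also have "\<dots> \<subseteq> K" using HN.submoduleE(5)[OF hollow_aboveD(1)[OF K(1)]] unfolding set_add_def' by auto
    finally have "K <+>\<^bsub>?N\<^esub> (\<lambda>f. s \<odot>\<^bsub>?N\<^esub> f) ` carrier ?N \<noteq> carrier ?N"
      using hollow_aboveD(2)[OF K(1)] HN.submoduleE(1)[OF hollow_aboveD(1)[OF K(1)]] by blast
    then have "s \<in> P" unfolding K(2) nonsurjective_scalars_def using sR by blast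
    then show False using s(1) by simp
  qed
  from H.colon_prime[OF N T this] obtain y where y: "y \<in> carrier ?H - T"
    and py: "primeideal {r \<in> carrier R. r \<odot>\<^bsub>?H\<^esub> y \<in> T} R" .
  have yH: "y \<in> H" "y \<notin> T" using y by auto
  have yL: "y \<in> carrier L" using yH HL by auto
  have notT: "r \<in> P" if r: "r \<in> carrier R" "r \<odot>\<^bsub>L\<^esub> y \<in> T" for r
  proof (rule ccontr)
    assume "r \<notin> P"
    obtain s where s: "s \<in> carrier R - P" "s \<odot>\<^bsub>L\<^esub> (r \<odot>\<^bsub>L\<^esub> y) = \<zero>\<^bsub>L\<^esub>" using r(2) unfolding T_def by auto
    then have "(s \<otimes>\<^bsub>R\<^esub> r) \<odot>\<^bsub>L\<^esub> y = \<zero>\<^bsub>L\<^esub>" using L.smult_assoc1[of s r y] r(1) yL by simp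
    then have "y \<in> T" unfolding T_def using notinP[OF s(1), of r] r(1) \<open>r \<notin> P\<close> yH(1) by blast
    then show False using yH(2) by simp
  qed
  have aT: "a \<odot>\<^bsub>L\<^esub> y \<in> T" if a: "a \<in> A" for a
  proof -
    obtain n :: nat where n: "(a [^]\<^bsub>R\<^esub> n) \<odot>\<^bsub>L\<^esub> y = \<zero>\<^bsub>L\<^esub>" using nil a yH(1) by blast
    have aR: "a \<in> carrier R" using a A(1) by auto
    have "\<zero>\<^bsub>L\<^esub> \<in> T" using T unfolding H.submodule_iff by simp
    then have "a [^]\<^bsub>R\<^esub> n \<in> {r \<in> carrier R. r \<odot>\<^bsub>?H\<^esub> y \<in> T}" using n aR by simp
    from primeideal_nat_pow[OF py aR this] show ?thesis by simp
  qed
  have "\<exists>s \<in> carrier R - P. \<forall>z \<in> (\<lambda>a. a \<odot>\<^bsub>L\<^esub> y) ` A. s \<odot>\<^bsub>L\<^esub> z = \<zero>\<^bsub>L\<^esub>"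
  proof (rule L.common_annihilator[OF P])
    show "finite ((\<lambda>a. a \<odot>\<^bsub>L\<^esub> y) ` A)" using A(2) by simp
    show "(\<lambda>a. a \<odot>\<^bsub>L\<^esub> y) ` A \<subseteq> carrier L" using A(1) yL by auto
    show "\<exists>s \<in> carrier R - P. s \<odot>\<^bsub>L\<^esub> z = \<zero>\<^bsub>L\<^esub>" if "z \<in> (\<lambda>a. a \<odot>\<^bsub>L\<^esub> y) ` A" for z
      using that aT unfolding T_def by auto
  qed
  then obtain s where s: "s \<in> carrier R - P" "\<forall>z \<in> (\<lambda>a. a \<odot>\<^bsub>L\<^esub> y) ` A. s \<odot>\<^bsub>L\<^esub> z = \<zero>\<^bsub>L\<^esub>" by (rule bexE)
  have sR: "s \<in> carrier R" using s(1) by simp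
  let ?z = "s \<odot>\<^bsub>L\<^esub> y"
  have zc: "?z \<in> carrier L" using sR yL by simp
  have "P = {r \<in> carrier R. r \<odot>\<^bsub>L\<^esub> ?z = \<zero>\<^bsub>L\<^esub>}"
  proof (rule equalityI)
    have "A \<subseteq> {r \<in> carrier R. r \<odot>\<^bsub>L\<^esub> ?z \<in> {\<zero>\<^bsub>L\<^esub>}}"
    proof
      fix a assume a: "a \<in> A"
      then have aR: "a \<in> carrier R" using A(1) by auto
      have "a \<odot>\<^bsub>L\<^esub> ?z = s \<odot>\<^bsub>L\<^esub> (a \<odot>\<^bsub>L\<^esub> y)" by (rule L.smult_comm[OF aR sR yL])
      then show "a \<in> {r \<in> carrier R. r \<odot>\<^bsub>L\<^esub> ?z \<in> {\<zero>\<^bsub>L\<^esub>}}" using s(2) a aR by simp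
    qed
    then have "P \<subseteq> {r \<in> carrier R. r \<odot>\<^bsub>L\<^esub> ?z \<in> {\<zero>\<^bsub>L\<^esub>}}"
      unfolding A(3) by (rule N.genideal_minimal[OF L.colon_ideal[OF L.submodule_zero zc]])
    then show "P \<subseteq> {r \<in> carrier R. r \<odot>\<^bsub>L\<^esub> ?z = \<zero>\<^bsub>L\<^esub>}" by simp
    show "{r \<in> carrier R. r \<odot>\<^bsub>L\<^esub> ?z = \<zero>\<^bsub>L\<^esub>} \<subseteq> P"
    proof
      fix r assume "r \<in> {r \<in> carrier R. r \<odot>\<^bsub>L\<^esub> ?z = \<zero>\<^bsub>L\<^esub>}"
      then have r: "r \<in> carrier R" "r \<odot>\<^bsub>L\<^esub> ?z = \<zero>\<^bsub>L\<^esub>" by auto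
      have "s \<odot>\<^bsub>L\<^esub> (r \<odot>\<^bsub>L\<^esub> y) = \<zero>\<^bsub>L\<^esub>" using r L.smult_comm[OF r(1) sR yL] by simp
      then have "r \<odot>\<^bsub>L\<^esub> y \<in> T" unfolding T_def using s(1) L.submoduleE(4)[OF H r(1) yH(1)] by blast
      then show "r \<in> P" by (rule notT[OF r(1)])
    qed
  qed
  then show "P \<in> Ass R L" unfolding Ass_def using P zc by blast
qed

lemma Coass_nonempty:
  assumes N: "module R N" and R: "noetherian_ring R" and ne: "carrier N \<noteq> {\<zero>\<^bsub>N\<^esub>}"
  shows "Coass R N \<noteq> {}"
proof -
  interpret N: module R N by (rule N)
  obtain K where "hollow_above R N K"
    using exists_hollow_above[OF N R N.submodule_zero] ne by auto
  then show ?thesis using hollow_above_Coass[OF N] by auto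
qed

text \<open>If \<open>s N \<noteq> N\<close>, then \<open>N / s N\<close> has a nonzero hollow quotient, so \<open>s\<close> lies in a prime coassociated
  to \<open>N\<close>.\<close>

lemma surjective_if_avoids_Coass:
  assumes N: "module R N" and R: "noetherian_ring R" and s: "s \<in> carrier R"
    and avoid: "\<And>P. P \<in> Coass R N \<Longrightarrow> s \<notin> P"
  shows "(\<lambda>x. s \<odot>\<^bsub>N\<^esub> x) ` carrier N = carrier N"
proof (rule ccontr)
  assume ne: "(\<lambda>x. s \<odot>\<^bsub>N\<^esub> x) ` carrier N \<noteq> carrier N"
  interpret N: module R N by (rule N)
  obtain K where K: "(\<lambda>x. s \<odot>\<^bsub>N\<^esub> x) ` carrier N \<subseteq> K" "hollow_above R N K"
    using exists_hollow_above[OF N R N.submodule_scaled[OF s] ne] by (elim exE conjE)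
  have "K <+>\<^bsub>N\<^esub> (\<lambda>x. s \<odot>\<^bsub>N\<^esub> x) ` carrier N \<subseteq> K <+>\<^bsub>N\<^esub> K"
    by (rule set_add_mono[OF subset_refl K(1)])
  also have "\<dots> \<subseteq> K" using N.submoduleE(5)[OF hollow_aboveD(1)[OF K(2)]] unfolding set_add_def' by auto
  finally have "K <+>\<^bsub>N\<^esub> (\<lambda>x. s \<odot>\<^bsub>N\<^esub> x) ` carrier N \<noteq> carrier N"
    using hollow_aboveD(2)[OF K(2)] N.submoduleE(1)[OF hollow_aboveD(1)[OF K(2)]] by blast
  then have "s \<in> nonsurjective_scalars R N K" unfolding nonsurjective_scalars_def using s by blast
  then show False using avoid[OF hollow_above_Coass[OF N K(2)]] by simp
qed

text \<open>A nonzerodivisor annihilates no nonzero element of a torsion-free module, so it lies in no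
  associated prime.\<close>

lemma divisible_hom_if_Coass_subset_Ass:
  assumes R: "noetherian_ring R" and L: "torsion_free R L" and M: "module R M"
    and sub: "Coass R (hom_module R L M) \<subseteq> Ass R L"
  shows "divisible R (hom_module R L M)"
proof -
  have mL: "module R L" using L unfolding torsion_free_def by simp
  interpret L: module R L by (rule mL)
  have mN: "module R (hom_module R L M)" by (rule hom_module_module[OF mL M])
  have avoid: "s \<notin> P" if s: "s \<in> nonzerodivisors R" and P: "P \<in> Coass R (hom_module R L M)" for s P
  proof
    assume sP: "s \<in> P"
    have sR: "s \<in> carrier R" using s unfolding nonzerodivisors_def by simp
    have "P \<in> Ass R L" using P sub by (rule subsetD[rotated])
    then obtain x where pP: "primeideal P R" and x: "x \<in> carrier L" and Px: "P = {a \<in> carrier R. a \<odot>\<^bsub>L\<^esub> x = \<zero>\<^bsub>L\<^esub>}"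
      unfolding Ass_def by blast
    have "s \<odot>\<^bsub>L\<^esub> x = s \<odot>\<^bsub>L\<^esub> \<zero>\<^bsub>L\<^esub>" using sP sR unfolding Px by simp
    then have "x = \<zero>\<^bsub>L\<^esub>"
      using L s x unfolding torsion_free_def by (auto dest!: inj_onD bspec)
    then have "P = carrier R" using Px by auto
    then show False using primeideal.I_notcarr[OF pP] by simp
  qed
  show ?thesis unfolding divisible_def
  proof (intro conjI ballI mN)
    fix s assume s: "s \<in> nonzerodivisors R"
    then have "s \<in> carrier R" unfolding nonzerodivisors_def by simp
    then show "(\<lambda>x. s \<odot>\<^bsub>hom_module R L M\<^esub> x) ` carrier (hom_module R L M) = carrier (hom_module R L M)"
      by (rule surjective_if_avoids_Coass[OF mN R _ avoid[OF s]])
  qed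
qed

text \<open>\<open>Hom(R x, E)\<close> is a quotient of \<open>Hom(L, E)\<close>. If it is nonzero, it has a coassociated prime, which
  belongs to \<open>Ass(R x) = Ass(R/P) = {P}\<close>.\<close>

lemma Ass_subset_Coass_hom:
  assumes N: "noetherian_ring R" and E: "Baer_injective R E" and L: "module R L"
    and P: "primeideal P R" and x: "x \<in> carrier L" and Px: "P = {a \<in> carrier R. a \<odot>\<^bsub>L\<^esub> x = \<zero>\<^bsub>L\<^esub>}"
    and ne: "module_hom R (L\<lparr>carrier := (\<lambda>r. r \<odot>\<^bsub>L\<^esub> x) ` carrier R\<rparr>) E \<noteq>
      {\<lambda>y \<in> (\<lambda>r. r \<odot>\<^bsub>L\<^esub> x) ` carrier R. \<zero>\<^bsub>E\<^esub>}"
  shows "P \<in> Coass R (hom_module R L E)"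
proof -
  interpret L: module R L by (rule L)
  have mE: "module R E" using E unfolding Baer_injective_def by simp
  let ?X = "(\<lambda>r. r \<odot>\<^bsub>L\<^esub> x) ` carrier R"
  let ?H = "L\<lparr>carrier := ?X\<rparr>"
  note X = L.submodule_cyclic[OF x]
  have mH: "module R ?H" by (rule submodule.submodule_is_module[OF X(1) L])
  have "fin_gen_submodule R L ?X"
    unfolding fin_gen_submodule_def
  proof (intro exI[of _ "{x}"] conjI allI impI)
    show "{x} \<subseteq> ?X" using X(2) by simp
    fix H' assume "submodule H' R L \<and> {x} \<subseteq> H'"
    then show "?X \<subseteq> H'" using L.submoduleE(4)[of H' _ x] by auto
  qed simp
  then have fH: "fin_gen_module R ?H" using fin_gen_submodule_iff[OF L X(1)] by simp
  have "Coass R (hom_module R ?H E) \<noteq> {}"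
    by (rule Coass_nonempty[OF hom_module_module[OF mH mE] N]) (use ne in simp)
  then obtain Q where Q: "Q \<in> Coass R (hom_module R ?H E)" by auto
  then have "Q \<in> Ass R ?H" using Coass_hom_subset_Ass[OF N E fH] by (rule subsetD[rotated])
  then obtain y where Qp: "primeideal Q R" and y: "y \<in> ?X" and Qy: "Q = {a \<in> carrier R. a \<odot>\<^bsub>L\<^esub> y = \<zero>\<^bsub>L\<^esub>}"
    unfolding Ass_def by auto
  from y obtain r where r: "r \<in> carrier R" "y = r \<odot>\<^bsub>L\<^esub> x" by auto
  have rP: "r \<notin> P"
  proof
    assume "r \<in> P"
    then have "y = \<zero>\<^bsub>L\<^esub>" using Px r by simp
    then have "Q = carrier R" using Qy by auto
    then show False using primeideal.I_notcarr[OF Qp] by simp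
  qed
  have "a \<odot>\<^bsub>L\<^esub> y = \<zero>\<^bsub>L\<^esub> \<longleftrightarrow> a \<odot>\<^bsub>L\<^esub> x = \<zero>\<^bsub>L\<^esub>" if a: "a \<in> carrier R" for a
  proof
    assume "a \<odot>\<^bsub>L\<^esub> y = \<zero>\<^bsub>L\<^esub>"
    then have "a \<otimes>\<^bsub>R\<^esub> r \<in> P" using a r x Px by (simp add: L.smult_assoc1)
    then have "a \<in> P" using primeideal.I_prime[OF P a r(1)] rP by simp
    then show "a \<odot>\<^bsub>L\<^esub> x = \<zero>\<^bsub>L\<^esub>" using Px by simp
  next
    assume "a \<odot>\<^bsub>L\<^esub> x = \<zero>\<^bsub>L\<^esub>"
    then show "a \<odot>\<^bsub>L\<^esub> y = \<zero>\<^bsub>L\<^esub>" using L.smult_comm[OF a r(1) x] r by simp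
  qed
  then have "Q = P" unfolding Qy Px by blast
  with Q have "P \<in> Coass R (hom_module R ?H E)" by simp
  then show ?thesis by (rule surjection.Coass_lift[OF restriction_surjection[OF E L X(1)]])
qed

section \<open>Fractions and h-divisible modules\<close>

lemma (in cring) nonzerodivisors_simps:
  "s \<in> nonzerodivisors R \<Longrightarrow> s \<in> carrier R"
  "\<one> \<in> nonzerodivisors R"
  "s \<in> nonzerodivisors R \<Longrightarrow> t \<in> nonzerodivisors R \<Longrightarrow> s \<otimes> t \<in> nonzerodivisors R"
proof -
  show "s \<in> nonzerodivisors R \<Longrightarrow> s \<in> carrier R" "\<one> \<in> nonzerodivisors R"
    unfolding nonzerodivisors_def by auto
  assume s': "s \<in> nonzerodivisors R" and t': "t \<in> nonzerodivisors R"
  note s = CollectD[OF s'[unfolded nonzerodivisors_def], THEN conjunct1]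
    CollectD[OF s'[unfolded nonzerodivisors_def], THEN conjunct2]
  note t = CollectD[OF t'[unfolded nonzerodivisors_def], THEN conjunct1]
    CollectD[OF t'[unfolded nonzerodivisors_def], THEN conjunct2]
  have "x = \<zero>" if x: "x \<in> carrier R" "(s \<otimes> t) \<otimes> x = \<zero>" for x
  proof -
    have "s \<otimes> (t \<otimes> x) = \<zero>" using x m_assoc[OF s(1) t(1) x(1)] by simp
    then have "t \<otimes> x = \<zero>" using s(2) t(1) x(1) by simp
    then show ?thesis using t(2) x(1) by simp
  qed
  then show "s \<otimes> t \<in> nonzerodivisors R" unfolding nonzerodivisors_def using s(1) t(1) by simp
qed

lemma (in cring) nonzerodivisors_cancel:
  assumes s: "s \<in> nonzerodivisors R" and xy: "x \<in> carrier R" "y \<in> carrier R" and eq: "s \<otimes> x = s \<otimes> y"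
  shows "x = y"
proof -
  have sR: "s \<in> carrier R" using s by (rule nonzerodivisors_simps)
  have "s \<otimes> (x \<ominus> y) = s \<otimes> x \<ominus> s \<otimes> y"
    using sR xy unfolding a_minus_def by (simp add: r_distr r_minus)
  also have "\<dots> = \<zero>" unfolding eq using sR xy by (simp add: r_right_minus_eq)
  finally have "x \<ominus> y = \<zero>" using s xy unfolding nonzerodivisors_def by simp
  then show ?thesis using r_right_minus_eq[OF xy] by simp
qed

lemma (in cring) torsion_free_regular: "torsion_free R (regular_module R)"
  unfolding torsion_free_def
proof (intro conjI ballI inj_onI regular_module_module)
  fix s x y assume "s \<in> nonzerodivisors R" "x \<in> carrier (regular_module R)"
    "y \<in> carrier (regular_module R)" "s \<odot>\<^bsub>regular_module R\<^esub> x = s \<odot>\<^bsub>regular_module R\<^esub> y"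
  then show "x = y" using nonzerodivisors_cancel[of s x y] by simp
qed

lemma torsion_free_cancel:
  assumes L: "torsion_free R L" and s: "s \<in> nonzerodivisors R"
    and xy: "x \<in> carrier L" "y \<in> carrier L" and eq: "s \<odot>\<^bsub>L\<^esub> x = s \<odot>\<^bsub>L\<^esub> y"
  shows "x = y"
proof -
  have "inj_on (\<lambda>x. s \<odot>\<^bsub>L\<^esub> x) (carrier L)" using L s unfolding torsion_free_def by (elim conjE bspec)
  then show ?thesis using eq xy by (rule inj_onD)
qed

lemma torsion_free_submodule:
  assumes L: "torsion_free R L" and H: "submodule H R L"
  shows "torsion_free R (L\<lparr>carrier := H\<rparr>)"
proof -
  have mL: "module R L" using L unfolding torsion_free_def by simp
  have HL: "H \<subseteq> carrier L" by (rule module.submoduleE(1)[OF mL H])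
  show ?thesis unfolding torsion_free_def
  proof (intro conjI ballI inj_onI submodule.submodule_is_module[OF H mL])
    fix s x y assume s: "s \<in> nonzerodivisors R" and "x \<in> carrier (L\<lparr>carrier := H\<rparr>)"
      "y \<in> carrier (L\<lparr>carrier := H\<rparr>)" "s \<odot>\<^bsub>L\<lparr>carrier := H\<rparr>\<^esub> x = s \<odot>\<^bsub>L\<lparr>carrier := H\<rparr>\<^esub> y"
    then show "x = y" using torsion_free_cancel[OF L s, of x y] HL by auto
  qed
qed

text \<open>The fraction \<open>x / s\<close> as a class of pairs. For torsion-free \<open>L\<close>, the relation \<open>t x = s y\<close> between
  pairs \<open>(x, s)\<close> and \<open>(y, t)\<close> is transitive.\<close>

definition frac_class ::
    "('a, 'r) ring_scheme \<Rightarrow> ('a, 'l, 'p) module_scheme \<Rightarrow> 'l \<Rightarrow> 'a \<Rightarrow> ('l \<times> 'a) set" where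
  "frac_class R L x s = {(y, t). y \<in> carrier L \<and> t \<in> nonzerodivisors R \<and> t \<odot>\<^bsub>L\<^esub> x = s \<odot>\<^bsub>L\<^esub> y}"

definition fraction_module ::
    "('a, 'r) ring_scheme \<Rightarrow> ('a, 'l, 'p) module_scheme \<Rightarrow> ('a, ('l \<times> 'a) set) module" where
  "fraction_module R L =
     \<lparr>carrier = {frac_class R L x s | x s. x \<in> carrier L \<and> s \<in> nonzerodivisors R},
      monoid.mult = undefined, one = undefined, ring.zero = frac_class R L \<zero>\<^bsub>L\<^esub> \<one>\<^bsub>R\<^esub>,
      add = (\<lambda>X Y. \<Union>(x, s) \<in> X. \<Union>(y, t) \<in> Y.
               frac_class R L ((t \<odot>\<^bsub>L\<^esub> x) \<oplus>\<^bsub>L\<^esub> (s \<odot>\<^bsub>L\<^esub> y)) (s \<otimes>\<^bsub>R\<^esub> t)),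
      smult = (\<lambda>r X. \<Union>(x, s) \<in> X. frac_class R L (r \<odot>\<^bsub>L\<^esub> x) s)\<rparr>"

lemma UN_pair_const:
  assumes "(a, s) \<in> X" "\<And>b t. (b, t) \<in> X \<Longrightarrow> F b t = F a s"
  shows "(\<Union>(b, t) \<in> X. F b t) = F a s"
  using assms by fast

locale torsion_free_module =
  fixes R :: "('a, 'r) ring_scheme" and L :: "('a, 'l, 'p) module_scheme"
  assumes tf: "torsion_free R L"
begin

sublocale L: module R L using tf unfolding torsion_free_def by simp

abbreviation S where "S \<equiv> nonzerodivisors R"
abbreviation cls where "cls \<equiv> frac_class R L"

lemmas S_simps = L.nonzerodivisors_simps

lemma cls_eq_iff:
  assumes x: "x \<in> carrier L" "s \<in> S" and y: "y \<in> carrier L" "t \<in> S"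
  shows "cls x s = cls y t \<longleftrightarrow> t \<odot>\<^bsub>L\<^esub> x = s \<odot>\<^bsub>L\<^esub> y"
proof
  assume "cls x s = cls y t"
  moreover have "(x, s) \<in> cls x s" unfolding frac_class_def using x by simp
  ultimately have "(x, s) \<in> cls y t" by simp
  then show "t \<odot>\<^bsub>L\<^esub> x = s \<odot>\<^bsub>L\<^esub> y" unfolding frac_class_def by simp
next
  have sub: "cls x s \<subseteq> cls y t"
    if x: "x \<in> carrier L" "s \<in> S" and y: "y \<in> carrier L" "t \<in> S" and eq: "t \<odot>\<^bsub>L\<^esub> x = s \<odot>\<^bsub>L\<^esub> y" for x s y t
  proof (rule subrelI)
    fix z u assume "(z, u) \<in> cls x s"
    then have z: "z \<in> carrier L" "u \<in> S" "u \<odot>\<^bsub>L\<^esub> x = s \<odot>\<^bsub>L\<^esub> z" unfolding frac_class_def by auto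
    note R = S_simps(1)[OF x(2)] S_simps(1)[OF y(2)] S_simps(1)[OF z(2)]
    have "s \<odot>\<^bsub>L\<^esub> (u \<odot>\<^bsub>L\<^esub> y) = u \<odot>\<^bsub>L\<^esub> (t \<odot>\<^bsub>L\<^esub> x)" using L.smult_comm[OF R(1,3) y(1)] eq by simp
    also have "\<dots> = t \<odot>\<^bsub>L\<^esub> (s \<odot>\<^bsub>L\<^esub> z)" using L.smult_comm[OF R(3,2) x(1)] z(3) by simp
    also have "\<dots> = s \<odot>\<^bsub>L\<^esub> (t \<odot>\<^bsub>L\<^esub> z)" by (rule L.smult_comm[OF R(2,1) z(1)])
    finally have "u \<odot>\<^bsub>L\<^esub> y = t \<odot>\<^bsub>L\<^esub> z"
      by (rule torsion_free_cancel[OF tf x(2), rotated 2]) (use R y(1) z(1) in auto)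
    then show "(z, u) \<in> cls y t" unfolding frac_class_def using z by simp
  qed
  assume eq: "t \<odot>\<^bsub>L\<^esub> x = s \<odot>\<^bsub>L\<^esub> y"
  show "cls x s = cls y t" using sub[OF x y eq] sub[OF y x eq[symmetric]] by (rule equalityI)
qed

lemma cls_self: "x \<in> carrier L \<Longrightarrow> s \<in> S \<Longrightarrow> (x, s) \<in> cls x s"
  unfolding frac_class_def by simp

lemma clsD:
  assumes "(y, t) \<in> cls x s" shows "y \<in> carrier L" "t \<in> S" "t \<odot>\<^bsub>L\<^esub> x = s \<odot>\<^bsub>L\<^esub> y"
  using assms unfolding frac_class_def by auto

lemma cls_add:
  assumes x: "x \<in> carrier L" "s \<in> S" and y: "y \<in> carrier L" "t \<in> S"
  shows "cls x s \<oplus>\<^bsub>fraction_module R L\<^esub> cls y t = cls ((t \<odot>\<^bsub>L\<^esub> x) \<oplus>\<^bsub>L\<^esub> (s \<odot>\<^bsub>L\<^esub> y)) (s \<otimes>\<^bsub>R\<^esub> t)"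
proof -
  have eq: "cls ((t' \<odot>\<^bsub>L\<^esub> x') \<oplus>\<^bsub>L\<^esub> (s' \<odot>\<^bsub>L\<^esub> y')) (s' \<otimes>\<^bsub>R\<^esub> t') = cls ((t \<odot>\<^bsub>L\<^esub> x) \<oplus>\<^bsub>L\<^esub> (s \<odot>\<^bsub>L\<^esub> y)) (s \<otimes>\<^bsub>R\<^esub> t)"
    if "(x', s') \<in> cls x s" "(y', t') \<in> cls y t" for x' s' y' t'
  proof -
    note x' = clsD[OF that(1)] and y' = clsD[OF that(2)]
    note R = S_simps(1)[OF x(2)] S_simps(1)[OF y(2)] S_simps(1)[OF x'(2)] S_simps(1)[OF y'(2)]
    have e1: "(s \<otimes>\<^bsub>R\<^esub> t) \<odot>\<^bsub>L\<^esub> (t' \<odot>\<^bsub>L\<^esub> x') = (s' \<otimes>\<^bsub>R\<^esub> t') \<odot>\<^bsub>L\<^esub> (t \<odot>\<^bsub>L\<^esub> x)"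
    proof -
      have "(s \<otimes>\<^bsub>R\<^esub> t) \<odot>\<^bsub>L\<^esub> (t' \<odot>\<^bsub>L\<^esub> x') = (t \<otimes>\<^bsub>R\<^esub> t') \<odot>\<^bsub>L\<^esub> (s \<odot>\<^bsub>L\<^esub> x')"
        using R x'(1) by (simp add: L.smult_assoc1[symmetric] L.m_ac)
      also have "\<dots> = (t \<otimes>\<^bsub>R\<^esub> t') \<odot>\<^bsub>L\<^esub> (s' \<odot>\<^bsub>L\<^esub> x)" using x'(3) by simp
      also have "\<dots> = (s' \<otimes>\<^bsub>R\<^esub> t') \<odot>\<^bsub>L\<^esub> (t \<odot>\<^bsub>L\<^esub> x)"
        using R x(1) by (simp add: L.smult_assoc1[symmetric] L.m_ac)
      finally show ?thesis .
    qed
    have e2: "(s \<otimes>\<^bsub>R\<^esub> t) \<odot>\<^bsub>L\<^esub> (s' \<odot>\<^bsub>L\<^esub> y') = (s' \<otimes>\<^bsub>R\<^esub> t') \<odot>\<^bsub>L\<^esub> (s \<odot>\<^bsub>L\<^esub> y)"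
    proof -
      have "(s \<otimes>\<^bsub>R\<^esub> t) \<odot>\<^bsub>L\<^esub> (s' \<odot>\<^bsub>L\<^esub> y') = (s \<otimes>\<^bsub>R\<^esub> s') \<odot>\<^bsub>L\<^esub> (t \<odot>\<^bsub>L\<^esub> y')"
        using R y'(1) by (simp add: L.smult_assoc1[symmetric] L.m_ac)
      also have "\<dots> = (s \<otimes>\<^bsub>R\<^esub> s') \<odot>\<^bsub>L\<^esub> (t' \<odot>\<^bsub>L\<^esub> y)" using y'(3) by simp
      also have "\<dots> = (s' \<otimes>\<^bsub>R\<^esub> t') \<odot>\<^bsub>L\<^esub> (s \<odot>\<^bsub>L\<^esub> y)"
        using R y(1) by (simp add: L.smult_assoc1[symmetric] L.m_ac)
      finally show ?thesis .
    qed
    show ?thesis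
      by (subst cls_eq_iff) (use R x y x' y' e1 e2 in \<open>simp_all add: S_simps(3) L.smult_r_distr\<close>)
  qed
  have "cls x s \<oplus>\<^bsub>fraction_module R L\<^esub> cls y t =
      (\<Union>(x', s') \<in> cls x s. \<Union>(y', t') \<in> cls y t. cls ((t' \<odot>\<^bsub>L\<^esub> x') \<oplus>\<^bsub>L\<^esub> (s' \<odot>\<^bsub>L\<^esub> y')) (s' \<otimes>\<^bsub>R\<^esub> t'))"
    unfolding fraction_module_def by simp
  also have "\<dots> = (\<Union>(x', s') \<in> cls x s. cls ((t \<odot>\<^bsub>L\<^esub> x) \<oplus>\<^bsub>L\<^esub> (s \<odot>\<^bsub>L\<^esub> y)) (s \<otimes>\<^bsub>R\<^esub> t))"
    using eq cls_self[OF y] by (intro SUP_cong refl) (fastforce intro!: SUP_eq_const)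
  also have "\<dots> = cls ((t \<odot>\<^bsub>L\<^esub> x) \<oplus>\<^bsub>L\<^esub> (s \<odot>\<^bsub>L\<^esub> y)) (s \<otimes>\<^bsub>R\<^esub> t)"
    using cls_self[OF x] by auto
  finally show ?thesis .
qed

lemma cls_smult:
  assumes r: "r \<in> carrier R" and x: "x \<in> carrier L" "s \<in> S"
  shows "r \<odot>\<^bsub>fraction_module R L\<^esub> cls x s = cls (r \<odot>\<^bsub>L\<^esub> x) s"
proof -
  have "cls (r \<odot>\<^bsub>L\<^esub> x') s' = cls (r \<odot>\<^bsub>L\<^esub> x) s" if "(x', s') \<in> cls x s" for x' s'
  proof -
    note x' = clsD[OF that]
    have "s \<odot>\<^bsub>L\<^esub> (r \<odot>\<^bsub>L\<^esub> x') = s' \<odot>\<^bsub>L\<^esub> (r \<odot>\<^bsub>L\<^esub> x)"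
      using L.smult_comm[OF S_simps(1)[OF x(2)] r x'(1)] L.smult_comm[OF S_simps(1)[OF x'(2)] r x(1)] x'(3)
      by simp
    then show ?thesis using cls_eq_iff r x x' by simp
  qed
  then have "(\<Union>(x', s') \<in> cls x s. cls (r \<odot>\<^bsub>L\<^esub> x') s') = cls (r \<odot>\<^bsub>L\<^esub> x) s"
    by (rule UN_pair_const[OF cls_self[OF x]])
  then show ?thesis unfolding fraction_module_def by simp
qed

lemma fraction_module_carrier:
  "X \<in> carrier (fraction_module R L) \<longleftrightarrow> (\<exists>x s. X = cls x s \<and> x \<in> carrier L \<and> s \<in> S)"
  unfolding fraction_module_def by simp

lemma fraction_module_zero: "\<zero>\<^bsub>fraction_module R L\<^esub> = cls \<zero>\<^bsub>L\<^esub> \<one>\<^bsub>R\<^esub>"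
  unfolding fraction_module_def by simp

lemma cls_add_same:
  assumes x: "x \<in> carrier L" "y \<in> carrier L" and s: "s \<in> S"
  shows "cls x s \<oplus>\<^bsub>fraction_module R L\<^esub> cls y s = cls (x \<oplus>\<^bsub>L\<^esub> y) s"
proof -
  note sR = S_simps(1)[OF s]
  have "cls ((s \<odot>\<^bsub>L\<^esub> x) \<oplus>\<^bsub>L\<^esub> (s \<odot>\<^bsub>L\<^esub> y)) (s \<otimes>\<^bsub>R\<^esub> s) = cls (x \<oplus>\<^bsub>L\<^esub> y) s"
    by (subst cls_eq_iff) (use x s sR in \<open>simp_all add: S_simps(3) L.smult_r_distr L.smult_assoc1\<close>)
  then show ?thesis using cls_add[OF x(1) s x(2) s] by simp
qed

lemma common_denominator:
  assumes "X \<in> carrier (fraction_module R L)" "Y \<in> carrier (fraction_module R L)"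
  shows "\<exists>x y s. x \<in> carrier L \<and> y \<in> carrier L \<and> s \<in> S \<and> X = cls x s \<and> Y = cls y s"
proof -
  obtain x s where x: "X = cls x s" "x \<in> carrier L" "s \<in> S" using assms(1) unfolding fraction_module_carrier by auto
  obtain y t where y: "Y = cls y t" "y \<in> carrier L" "t \<in> S" using assms(2) unfolding fraction_module_carrier by auto
  note R = S_simps(1)[OF x(3)] S_simps(1)[OF y(3)]
  have "X = cls (t \<odot>\<^bsub>L\<^esub> x) (s \<otimes>\<^bsub>R\<^esub> t)" unfolding x(1)
    by (subst cls_eq_iff) (use x y R in \<open>simp_all add: S_simps(3) L.smult_assoc1\<close>)
  moreover have "Y = cls (s \<odot>\<^bsub>L\<^esub> y) (s \<otimes>\<^bsub>R\<^esub> t)" unfolding y(1)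
    by (subst cls_eq_iff) (use x y R in \<open>simp_all add: S_simps(3) L.smult_assoc1 L.smult_comm[of t s]\<close>)
  ultimately show ?thesis using x y R S_simps(3)[OF x(3) y(3)] by (metis L.smult_closed)
qed

lemma zero_cls: "s \<in> S \<Longrightarrow> cls \<zero>\<^bsub>L\<^esub> s = \<zero>\<^bsub>fraction_module R L\<^esub>"
  unfolding fraction_module_zero by (subst cls_eq_iff) (auto simp: S_simps)

lemma fraction_module_module: "module R (fraction_module R L)"
proof (rule moduleI)
  let ?F = "fraction_module R L"
  have cl: "cls x s \<in> carrier ?F" if "x \<in> carrier L" "s \<in> S" for x s
    using that unfolding fraction_module_carrier by blast
  show "cring R" by (rule L.R.is_cring)
  show "abelian_group ?F"
  proof (rule abelian_groupI)
    fix X Y assume XY: "X \<in> carrier ?F" "Y \<in> carrier ?F"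
    obtain x y s where *: "x \<in> carrier L" "y \<in> carrier L" "s \<in> S" "X = cls x s" "Y = cls y s"
      using common_denominator[OF XY] by (elim exE conjE)
    show "X \<oplus>\<^bsub>?F\<^esub> Y \<in> carrier ?F" using * by (simp add: cls_add_same cl)
    show "X \<oplus>\<^bsub>?F\<^esub> Y = Y \<oplus>\<^bsub>?F\<^esub> X" using * by (simp add: cls_add_same L.M.a_comm)
  next
    show "\<zero>\<^bsub>?F\<^esub> \<in> carrier ?F" unfolding fraction_module_zero by (rule cl) (auto simp: S_simps)
  next
    fix X assume "X \<in> carrier ?F"
    then obtain x s where *: "X = cls x s" "x \<in> carrier L" "s \<in> S" unfolding fraction_module_carrier by auto
    show "\<zero>\<^bsub>?F\<^esub> \<oplus>\<^bsub>?F\<^esub> X = X" using * zero_cls[OF *(3), symmetric] by (simp add: cls_add_same)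
    have "cls (\<ominus>\<^bsub>L\<^esub> x) s \<oplus>\<^bsub>?F\<^esub> X = \<zero>\<^bsub>?F\<^esub>" using * by (simp add: cls_add_same L.M.l_neg zero_cls)
    then show "\<exists>Y \<in> carrier ?F. Y \<oplus>\<^bsub>?F\<^esub> X = \<zero>\<^bsub>?F\<^esub>" using * cl by blast
  next
    fix X Y Z assume XYZ: "X \<in> carrier ?F" "Y \<in> carrier ?F" "Z \<in> carrier ?F"
    obtain x s where x: "X = cls x s" "x \<in> carrier L" "s \<in> S" using XYZ(1) unfolding fraction_module_carrier by auto
    obtain y z t where *: "y \<in> carrier L" "z \<in> carrier L" "t \<in> S" "Y = cls y t" "Z = cls z t"
      using common_denominator[OF XYZ(2,3)] by (elim exE conjE)
    note R = S_simps(1)[OF x(3)] S_simps(1)[OF *(3)]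
    have "(cls x s \<oplus>\<^bsub>?F\<^esub> cls y t) \<oplus>\<^bsub>?F\<^esub> cls z t = cls x s \<oplus>\<^bsub>?F\<^esub> (cls y t \<oplus>\<^bsub>?F\<^esub> cls z t)"
    proof -
      have c: "(t \<odot>\<^bsub>L\<^esub> x) \<oplus>\<^bsub>L\<^esub> (s \<odot>\<^bsub>L\<^esub> y) \<in> carrier L" using x * R by simp
      have st: "s \<otimes>\<^bsub>R\<^esub> t \<in> S" using x * by (simp add: S_simps)
      have zs: "cls z t = cls (s \<odot>\<^bsub>L\<^esub> z) (s \<otimes>\<^bsub>R\<^esub> t)"
        by (subst cls_eq_iff) (use x * R st in \<open>simp_all add: L.smult_assoc1 L.smult_comm[of t s]\<close>)
      have "(cls x s \<oplus>\<^bsub>?F\<^esub> cls y t) \<oplus>\<^bsub>?F\<^esub> cls z t = cls (((t \<odot>\<^bsub>L\<^esub> x) \<oplus>\<^bsub>L\<^esub> (s \<odot>\<^bsub>L\<^esub> y)) \<oplus>\<^bsub>L\<^esub> s \<odot>\<^bsub>L\<^esub> z) (s \<otimes>\<^bsub>R\<^esub> t)"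
        unfolding zs cls_add[OF x(2,3) *(1,3)] using * R st by (intro cls_add_same[OF c]) simp_all
      also have "\<dots> = cls ((t \<odot>\<^bsub>L\<^esub> x) \<oplus>\<^bsub>L\<^esub> (s \<odot>\<^bsub>L\<^esub> (y \<oplus>\<^bsub>L\<^esub> z))) (s \<otimes>\<^bsub>R\<^esub> t)"
        using x * R by (simp add: L.smult_r_distr L.M.a_assoc)
      also have "\<dots> = cls x s \<oplus>\<^bsub>?F\<^esub> (cls y t \<oplus>\<^bsub>?F\<^esub> cls z t)"
        unfolding cls_add_same[OF *(1-3)] using * by (intro cls_add[OF x(2,3), symmetric]) simp_all
      finally show ?thesis .
    qed
    then show "(X \<oplus>\<^bsub>?F\<^esub> Y) \<oplus>\<^bsub>?F\<^esub> Z = X \<oplus>\<^bsub>?F\<^esub> (Y \<oplus>\<^bsub>?F\<^esub> Z)" using x * by simp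
  qed
  have rep: "\<exists>x s. X = cls x s \<and> x \<in> carrier L \<and> s \<in> S" if "X \<in> carrier ?F" for X
    using that unfolding fraction_module_carrier .
  show "a \<odot>\<^bsub>?F\<^esub> X \<in> carrier ?F" if "a \<in> carrier R" "X \<in> carrier ?F" for a X
    using rep[OF that(2)] that(1) by (auto simp: cls_smult cl)
  show "(a \<oplus>\<^bsub>R\<^esub> b) \<odot>\<^bsub>?F\<^esub> X = a \<odot>\<^bsub>?F\<^esub> X \<oplus>\<^bsub>?F\<^esub> b \<odot>\<^bsub>?F\<^esub> X"
    if "a \<in> carrier R" "b \<in> carrier R" "X \<in> carrier ?F" for a b X
    using rep[OF that(3)] that(1,2) by (auto simp: cls_smult cls_add_same L.smult_l_distr)
  show "(a \<otimes>\<^bsub>R\<^esub> b) \<odot>\<^bsub>?F\<^esub> X = a \<odot>\<^bsub>?F\<^esub> (b \<odot>\<^bsub>?F\<^esub> X)"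
    if "a \<in> carrier R" "b \<in> carrier R" "X \<in> carrier ?F" for a b X
    using rep[OF that(3)] that(1,2) by (auto simp: cls_smult L.smult_assoc1)
  show "\<one>\<^bsub>R\<^esub> \<odot>\<^bsub>?F\<^esub> X = X" if "X \<in> carrier ?F" for X
    using rep[OF that] by (auto simp: cls_smult)
  fix a X Y assume a: "a \<in> carrier R" and XY: "X \<in> carrier ?F" "Y \<in> carrier ?F"
  obtain x y s where *: "x \<in> carrier L" "y \<in> carrier L" "s \<in> S" "X = cls x s" "Y = cls y s"
    using common_denominator[OF XY] by (elim exE conjE)
  show "a \<odot>\<^bsub>?F\<^esub> (X \<oplus>\<^bsub>?F\<^esub> Y) = a \<odot>\<^bsub>?F\<^esub> X \<oplus>\<^bsub>?F\<^esub> a \<odot>\<^bsub>?F\<^esub> Y"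
    using * a by (simp add: cls_smult cls_add_same L.smult_r_distr)
qed

lemma cls_linear:
  assumes s: "s \<in> S" shows "linear_map R L (fraction_module R L) (\<lambda>x. cls x s)"
  unfolding linear_map_def fraction_module_carrier
  using s by (auto simp: cls_add_same cls_smult)

end

subsection \<open>The total quotient ring\<close>

context cring
begin

text \<open>The additive group of the total quotient ring is the fraction module of the regular module.\<close>

lemma fraction_eq_frac_class:
  assumes "a \<in> carrier R" "s \<in> nonzerodivisors R"
  shows "fraction R (nonzerodivisors R) a s = frac_class R (regular_module R) a s"
proof -
  have "(\<exists>u \<in> nonzerodivisors R. u \<otimes> (t \<otimes> a) = u \<otimes> (s \<otimes> b)) \<longleftrightarrow> t \<otimes> a = s \<otimes> b"
    if "b \<in> carrier R" "t \<in> nonzerodivisors R" for b t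
  proof
    assume "\<exists>u \<in> nonzerodivisors R. u \<otimes> (t \<otimes> a) = u \<otimes> (s \<otimes> b)"
    then obtain u where "u \<in> nonzerodivisors R" "u \<otimes> (t \<otimes> a) = u \<otimes> (s \<otimes> b)" by (rule bexE)
    then show "t \<otimes> a = s \<otimes> b"
      using nonzerodivisors_cancel[of u "t \<otimes> a" "s \<otimes> b"] assms that by (simp add: nonzerodivisors_simps)
  qed (rule bexI[of _ \<one>], simp, rule nonzerodivisors_simps(2))
  then show ?thesis
    unfolding fraction_def frac_rel_def frac_class_def using assms by auto
qed

lemma UN_pair_cong:
  assumes "\<And>a s. (a, s) \<in> X \<Longrightarrow> F a s = G a s"
  shows "(\<Union>(a, s) \<in> X. F a s) = (\<Union>(a, s) \<in> X. G a s)"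
  using assms by (intro SUP_cong) auto

lemma frac_class_regular_simps:
  assumes "a \<in> carrier R" "s \<in> nonzerodivisors R" "b \<in> carrier R" "t \<in> nonzerodivisors R"
  shows "frac_class R (regular_module R) a s = frac_class R (regular_module R) b t \<longleftrightarrow> t \<otimes> a = s \<otimes> b"
proof -
  interpret T: torsion_free_module R "regular_module R" by unfold_locales (rule torsion_free_regular)
  show ?thesis using T.cls_eq_iff assms by simp
qed

abbreviation Q where "Q \<equiv> total_quotient_ring R"
abbreviation frac where "frac \<equiv> frac_class R (regular_module R)"

lemma Q_carrier: "X \<in> carrier Q \<longleftrightarrow> (\<exists>a s. X = frac a s \<and> a \<in> carrier R \<and> s \<in> nonzerodivisors R)"
proof -
  have "X \<in> carrier Q \<longleftrightarrow> (\<exists>a s. X = fraction R (nonzerodivisors R) a s \<and> a \<in> carrier R \<and> s \<in> nonzerodivisors R)"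
    unfolding total_quotient_ring_def localization_def quotient_def fraction_def by auto
  also have "\<dots> \<longleftrightarrow> (\<exists>a s. X = frac a s \<and> a \<in> carrier R \<and> s \<in> nonzerodivisors R)"
    by (rule ex_cong1, rule ex_cong1) (auto simp: fraction_eq_frac_class)
  finally show ?thesis .
qed

lemma Q_zero: "\<zero>\<^bsub>Q\<^esub> = frac \<zero> \<one>"
  unfolding total_quotient_ring_def localization_def by (simp add: fraction_eq_frac_class nonzerodivisors_simps)

lemma to_Q: "r \<in> carrier R \<Longrightarrow> to_total_quotient R r = frac r \<one>"
  unfolding to_total_quotient_def by (simp add: fraction_eq_frac_class nonzerodivisors_simps)

lemma fracD:
  assumes "(b, t) \<in> frac a s" shows "b \<in> carrier R" "t \<in> nonzerodivisors R" "t \<otimes> a = s \<otimes> b"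
  using assms unfolding frac_class_def by auto

lemma Q_add:
  assumes a: "a \<in> carrier R" "s \<in> nonzerodivisors R" and b: "b \<in> carrier R" "t \<in> nonzerodivisors R"
  shows "frac a s \<oplus>\<^bsub>Q\<^esub> frac b t = frac a s \<oplus>\<^bsub>fraction_module R (regular_module R)\<^esub> frac b t"
proof -
  have "(\<Union>(a', s') \<in> frac a s. \<Union>(b', t') \<in> frac b t. fraction R (nonzerodivisors R) ((t' \<otimes> a') \<oplus> (s' \<otimes> b')) (s' \<otimes> t'))
      = (\<Union>(a', s') \<in> frac a s. \<Union>(b', t') \<in> frac b t. frac ((t' \<otimes> a') \<oplus> (s' \<otimes> b')) (s' \<otimes> t'))"
    by (rule UN_pair_cong, rule UN_pair_cong, rule fraction_eq_frac_class)
       (use fracD nonzerodivisors_simps in auto)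
  then show ?thesis
    unfolding total_quotient_ring_def localization_def fraction_module_def by simp
qed

lemma Q_mult:
  assumes a: "a \<in> carrier R" "s \<in> nonzerodivisors R" and b: "b \<in> carrier R" "t \<in> nonzerodivisors R"
  shows "frac a s \<otimes>\<^bsub>Q\<^esub> frac b t = frac (a \<otimes> b) (s \<otimes> t)"
proof -
  have eq: "fraction R (nonzerodivisors R) (a' \<otimes> b') (s' \<otimes> t') = frac (a \<otimes> b) (s \<otimes> t)"
    if "(a', s') \<in> frac a s" "(b', t') \<in> frac b t" for a' s' b' t'
  proof -
    note a' = fracD[OF that(1)] and b' = fracD[OF that(2)]
    note R = nonzerodivisors_simps(1)[OF a(2)] nonzerodivisors_simps(1)[OF b(2)]
      nonzerodivisors_simps(1)[OF a'(2)] nonzerodivisors_simps(1)[OF b'(2)]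
    have "(s \<otimes> t) \<otimes> (a' \<otimes> b') = (s \<otimes> a') \<otimes> (t \<otimes> b')" using R a'(1) b'(1) by (simp add: m_ac)
    also have "\<dots> = (s' \<otimes> a) \<otimes> (t' \<otimes> b)" using a'(3) b'(3) by simp
    also have "\<dots> = (s' \<otimes> t') \<otimes> (a \<otimes> b)" using R a(1) b(1) by (simp add: m_ac)
    finally show ?thesis
      using a b a' b' by (simp add: fraction_eq_frac_class nonzerodivisors_simps frac_class_regular_simps)
  qed
  have self: "(a, s) \<in> frac a s" "(b, t) \<in> frac b t" using a b unfolding frac_class_def by auto
  have "frac a s \<otimes>\<^bsub>Q\<^esub> frac b t =
      (\<Union>(a', s') \<in> frac a s. \<Union>(b', t') \<in> frac b t. fraction R (nonzerodivisors R) (a' \<otimes> b') (s' \<otimes> t'))"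
    unfolding total_quotient_ring_def localization_def by simp
  also have "\<dots> = (\<Union>(a', s') \<in> frac a s. frac (a \<otimes> b) (s \<otimes> t))"
    using eq self(2) by (intro SUP_cong refl) (fastforce intro!: SUP_eq_const)
  also have "\<dots> = frac (a \<otimes> b) (s \<otimes> t)" using self(1) by auto
  finally show ?thesis .
qed

lemma Q_scalar:
  assumes r: "r \<in> carrier R" and a: "a \<in> carrier R" "s \<in> nonzerodivisors R"
  shows "to_total_quotient R r \<otimes>\<^bsub>Q\<^esub> frac a s = frac (r \<otimes> a) s"
  using assms by (simp add: to_Q Q_mult nonzerodivisors_simps)

end

section \<open>Linear maps on free modules\<close>

lemma linear_map_finsum:
  assumes f: "linear_map R L M f" and L: "module R L" and M: "module R M"
    and A: "finite A" "x \<in> A \<rightarrow> carrier L"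
  shows "f (finsum L x A) = finsum M (\<lambda>a. f (x a)) A"
proof -
  interpret L: module R L by (rule L)
  interpret M: module R M by (rule M)
  show ?thesis using A
  proof induction
    case empty
    show ?case using linear_map_zero[OF f L M] by simp
  next
    case (insert a A)
    then have x: "x a \<in> carrier L" "x \<in> A \<rightarrow> carrier L" by auto
    have fx: "f (x a) \<in> carrier M" "(\<lambda>a. f (x a)) \<in> A \<rightarrow> carrier M"
      using x linear_mapD(1)[OF f] by auto
    have "f (finsum L x (insert a A)) = f (x a \<oplus>\<^bsub>L\<^esub> finsum L x A)"
      using insert.hyps x by simp
    also have "\<dots> = f (x a) \<oplus>\<^bsub>M\<^esub> f (finsum L x A)"
      by (rule linear_mapD(2)[OF f x(1) L.M.finsum_closed[OF x(2)]])
    also have "\<dots> = finsum M (\<lambda>a. f (x a)) (insert a A)"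
      using insert.hyps insert.IH[OF x(2)] fx by simp
    finally show ?case .
  qed
qed

text \<open>The sum of \<open>g b (c b)\<close> over the support of a family \<open>c\<close>, where \<open>z\<close> is the zero of the values
  of \<open>c\<close>. This covers both \<open>R\<close>-linear maps on free \<open>R\<close>-modules and maps on free modules over the
  total quotient ring that are only \<open>R\<close>-linear.\<close>

definition support_sum ::
    "('a, 'm, 'q) module_scheme \<Rightarrow> 'b set \<Rightarrow> 'c \<Rightarrow> ('b \<Rightarrow> 'c \<Rightarrow> 'm) \<Rightarrow> ('b \<Rightarrow> 'c) \<Rightarrow> 'm" where
  "support_sum N B z g c = (\<Oplus>\<^bsub>N\<^esub>b \<in> {b \<in> B. c b \<noteq> z}. g b (c b))"

context module
begin

lemma support_sum_eq:
  assumes U: "finite U" "{b \<in> B. c b \<noteq> z} \<subseteq> U" "U \<subseteq> B"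
    and g: "\<And>b. b \<in> B \<Longrightarrow> g b (c b) \<in> carrier M" "\<And>b. b \<in> B \<Longrightarrow> g b z = \<zero>\<^bsub>M\<^esub>"
  shows "support_sum M B z g c = (\<Oplus>\<^bsub>M\<^esub>b \<in> U. g b (c b))"
  unfolding support_sum_def
proof (rule M.add.finprod_mono_neutral_cong_left[OF U(1,2)])
  show "g b (c b) = \<zero>\<^bsub>M\<^esub>" if "b \<in> U - {b \<in> B. c b \<noteq> z}" for b
    using that U(3) g(2)[of b] by auto
  show "(\<lambda>b. g b (c b)) \<in> U \<rightarrow> carrier M" using g(1) U(3) by auto
qed simp

lemma support_sum_closed:
  assumes "\<And>b. b \<in> B \<Longrightarrow> g b (c b) \<in> carrier M"
  shows "support_sum M B z g c \<in> carrier M"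
  unfolding support_sum_def using assms by (intro M.finsum_closed) auto

lemma support_sum_add:
  assumes fin: "finite {b \<in> B. c b \<noteq> z}" "finite {b \<in> B. d b \<noteq> z}"
    and e: "\<And>b. b \<in> B \<Longrightarrow> c b = z \<Longrightarrow> d b = z \<Longrightarrow> e b = z"
    and g: "\<And>b. b \<in> B \<Longrightarrow> g b (c b) \<in> carrier M" "\<And>b. b \<in> B \<Longrightarrow> g b (d b) \<in> carrier M"
      "\<And>b. b \<in> B \<Longrightarrow> g b z = \<zero>\<^bsub>M\<^esub>" "\<And>b. b \<in> B \<Longrightarrow> g b (e b) = g b (c b) \<oplus>\<^bsub>M\<^esub> g b (d b)"
  shows "support_sum M B z g e = support_sum M B z g c \<oplus>\<^bsub>M\<^esub> support_sum M B z g d"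
proof -
  let ?U = "{b \<in> B. c b \<noteq> z} \<union> {b \<in> B. d b \<noteq> z}"
  have U: "finite ?U" "?U \<subseteq> B" using fin by auto
  have ge: "g b (e b) \<in> carrier M" if "b \<in> B" for b using g(1,2,4)[OF that] by simp
  have eU: "{b \<in> B. e b \<noteq> z} \<subseteq> ?U" using e by blast
  have "support_sum M B z g e = (\<Oplus>\<^bsub>M\<^esub>b \<in> ?U. g b (e b))"
    by (rule support_sum_eq[OF U(1) eU U(2) ge g(3)])
  also have "\<dots> = (\<Oplus>\<^bsub>M\<^esub>b \<in> ?U. g b (c b) \<oplus>\<^bsub>M\<^esub> g b (d b))"
    by (rule M.finsum_cong'[OF refl]) (use g in auto)
  also have "\<dots> = (\<Oplus>\<^bsub>M\<^esub>b \<in> ?U. g b (c b)) \<oplus>\<^bsub>M\<^esub> (\<Oplus>\<^bsub>M\<^esub>b \<in> ?U. g b (d b))"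
    by (rule M.finsum_addf) (use g in auto)
  also have "(\<Oplus>\<^bsub>M\<^esub>b \<in> ?U. g b (c b)) = support_sum M B z g c"
    by (rule support_sum_eq[of ?U B c z g, symmetric]) (use U g in auto)
  also have "(\<Oplus>\<^bsub>M\<^esub>b \<in> ?U. g b (d b)) = support_sum M B z g d"
    by (rule support_sum_eq[of ?U B d z g, symmetric]) (use U g in auto)
  finally show ?thesis .
qed

lemma support_sum_smult:
  assumes fin: "finite {b \<in> B. c b \<noteq> z}" and r: "r \<in> carrier R"
    and e: "\<And>b. b \<in> B \<Longrightarrow> c b = z \<Longrightarrow> e b = z"
    and g: "\<And>b. b \<in> B \<Longrightarrow> g b (c b) \<in> carrier M"
      "\<And>b. b \<in> B \<Longrightarrow> g b z = \<zero>\<^bsub>M\<^esub>" "\<And>b. b \<in> B \<Longrightarrow> g b (e b) = r \<odot>\<^bsub>M\<^esub> g b (c b)"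
  shows "support_sum M B z g e = r \<odot>\<^bsub>M\<^esub> support_sum M B z g c"
proof -
  let ?U = "{b \<in> B. c b \<noteq> z}"
  have ge: "g b (e b) \<in> carrier M" if "b \<in> B" for b using g(1,3)[OF that] r by simp
  have eU: "{b \<in> B. e b \<noteq> z} \<subseteq> ?U" using e by blast
  have "support_sum M B z g e = (\<Oplus>\<^bsub>M\<^esub>b \<in> ?U. g b (e b))"
    by (rule support_sum_eq[OF fin eU _ ge g(2)]) auto
  also have "\<dots> = (\<Oplus>\<^bsub>M\<^esub>b \<in> ?U. r \<odot>\<^bsub>M\<^esub> g b (c b))"
    by (rule M.finsum_cong'[OF refl]) (use g r in auto)
  also have "\<dots> = r \<odot>\<^bsub>M\<^esub> support_sum M B z g c" unfolding support_sum_def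
    by (rule finsum_smult_ldistr[OF fin r, symmetric]) (use g in auto)
  finally show ?thesis .
qed

lemma support_sum_single:
  assumes b: "b \<in> B" "c b = v" "\<And>x. x \<in> B \<Longrightarrow> x \<noteq> b \<Longrightarrow> c x = z"
    and g: "g b v \<in> carrier M" "\<And>b. b \<in> B \<Longrightarrow> g b z = \<zero>\<^bsub>M\<^esub>"
  shows "support_sum M B z g c = g b v"
proof -
  have "support_sum M B z g c = (\<Oplus>\<^bsub>M\<^esub>x \<in> {b}. g x (c x))"
  proof (rule support_sum_eq)
    show "{b \<in> B. c b \<noteq> z} \<subseteq> {b}" using b(3) by blast
    show "g x (c x) \<in> carrier M" if "x \<in> B" for x
      using that b g(1) g(2)[OF that] by (cases "x = b") simp_all
  qed (use b(1) g(2) in auto)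
  also have "\<dots> = g b (c b)" by (simp add: b(2) g(1))
  finally show ?thesis using b(2) by simp
qed

end

lemma free_module_simps [simp]:
  "carrier (free_module R B) = {c \<in> B \<rightarrow>\<^sub>E carrier R. finite {b \<in> B. c b \<noteq> \<zero>\<^bsub>R\<^esub>}}"
  "\<zero>\<^bsub>free_module R B\<^esub> = (\<lambda>b \<in> B. \<zero>\<^bsub>R\<^esub>)"
  "c \<oplus>\<^bsub>free_module R B\<^esub> d = (\<lambda>b \<in> B. c b \<oplus>\<^bsub>R\<^esub> d b)"
  "r \<odot>\<^bsub>free_module R B\<^esub> c = (\<lambda>b \<in> B. r \<otimes>\<^bsub>R\<^esub> c b)"
  unfolding free_module_def by auto

context cring
begin

lemma free_module_add_closed:
  assumes "c \<in> carrier (free_module R B)" "d \<in> carrier (free_module R B)"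
  shows "c \<oplus>\<^bsub>free_module R B\<^esub> d \<in> carrier (free_module R B)"
proof -
  have "finite ({b \<in> B. c b \<noteq> \<zero>} \<union> {b \<in> B. d b \<noteq> \<zero>})" using assms by auto
  moreover have "{b \<in> B. (\<lambda>b \<in> B. c b \<oplus> d b) b \<noteq> \<zero>} \<subseteq> {b \<in> B. c b \<noteq> \<zero>} \<union> {b \<in> B. d b \<noteq> \<zero>}" by auto
  ultimately have "finite {b \<in> B. (\<lambda>b \<in> B. c b \<oplus> d b) b \<noteq> \<zero>}" by (rule rev_finite_subset)
  then show ?thesis using assms by (auto simp: PiE_def Pi_def)
qed

lemma free_module_smult_closed:
  assumes "r \<in> carrier R" "c \<in> carrier (free_module R B)"
  shows "r \<odot>\<^bsub>free_module R B\<^esub> c \<in> carrier (free_module R B)"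
proof -
  have "{b \<in> B. (\<lambda>b \<in> B. r \<otimes> c b) b \<noteq> \<zero>} \<subseteq> {b \<in> B. c b \<noteq> \<zero>}" using assms(1) by auto
  then have "finite {b \<in> B. (\<lambda>b \<in> B. r \<otimes> c b) b \<noteq> \<zero>}" by (rule finite_subset) (use assms in auto)
  then show ?thesis using assms by (auto simp: PiE_def Pi_def)
qed

lemma free_module_val: "c \<in> carrier (free_module R B) \<Longrightarrow> b \<in> B \<Longrightarrow> c b \<in> carrier R"
  by auto

lemma free_module_eqI:
  assumes "c \<in> extensional B" "d \<in> extensional B" "\<And>b. b \<in> B \<Longrightarrow> c b = d b"
  shows "c = d"
  using assms by (rule extensionalityI)

lemma free_module_module: "module R (free_module R B)"
proof (rule moduleI)
  let ?F = "free_module R B"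
  note val = free_module_val
  have ext: "c \<in> extensional B" if "c \<in> carrier ?F" for c using that by (auto simp: PiE_def)
  show "cring R" by (rule is_cring)
  show "abelian_group ?F"
  proof (rule abelian_groupI)
    show "\<zero>\<^bsub>?F\<^esub> \<in> carrier ?F" by simp
    fix c d assume c: "c \<in> carrier ?F"
    show "\<zero>\<^bsub>?F\<^esub> \<oplus>\<^bsub>?F\<^esub> c = c"
      by (rule free_module_eqI[OF _ ext[OF c]]) (use val[OF c] in auto)
    have "(\<ominus> \<one>) \<odot>\<^bsub>?F\<^esub> c \<oplus>\<^bsub>?F\<^esub> c = \<zero>\<^bsub>?F\<^esub>"
      by (rule free_module_eqI[of _ B]) (use val[OF c] in \<open>auto simp: l_minus l_neg\<close>)
    then show "\<exists>d \<in> carrier ?F. d \<oplus>\<^bsub>?F\<^esub> c = \<zero>\<^bsub>?F\<^esub>"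
      using free_module_smult_closed[OF _ c, of "\<ominus> \<one>"] by blast
    assume d: "d \<in> carrier ?F"
    show "c \<oplus>\<^bsub>?F\<^esub> d \<in> carrier ?F" by (rule free_module_add_closed[OF c d])
    show "c \<oplus>\<^bsub>?F\<^esub> d = d \<oplus>\<^bsub>?F\<^esub> c"
      by (rule free_module_eqI[of _ B]) (use val[OF c] val[OF d] in \<open>auto simp: a_comm\<close>)
    fix e assume e: "e \<in> carrier ?F"
    show "(c \<oplus>\<^bsub>?F\<^esub> d) \<oplus>\<^bsub>?F\<^esub> e = c \<oplus>\<^bsub>?F\<^esub> (d \<oplus>\<^bsub>?F\<^esub> e)"
      by (rule free_module_eqI[of _ B]) (use val[OF c] val[OF d] val[OF e] in \<open>auto simp: a_assoc\<close>)
  qed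
  show "r \<odot>\<^bsub>?F\<^esub> c \<in> carrier ?F" if "r \<in> carrier R" "c \<in> carrier ?F" for r c
    by (rule free_module_smult_closed[OF that])
  show "\<one> \<odot>\<^bsub>?F\<^esub> c = c" if c: "c \<in> carrier ?F" for c
    by (rule free_module_eqI[OF _ ext[OF c]]) (use val[OF c] in auto)
  show "(r \<oplus> s) \<odot>\<^bsub>?F\<^esub> c = r \<odot>\<^bsub>?F\<^esub> c \<oplus>\<^bsub>?F\<^esub> s \<odot>\<^bsub>?F\<^esub> c"
    if "r \<in> carrier R" "s \<in> carrier R" "c \<in> carrier ?F" for r s c
    by (rule free_module_eqI[of _ B]) (use that(1,2) val[OF that(3)] in \<open>auto simp: l_distr\<close>)
  show "(r \<otimes> s) \<odot>\<^bsub>?F\<^esub> c = r \<odot>\<^bsub>?F\<^esub> (s \<odot>\<^bsub>?F\<^esub> c)"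
    if "r \<in> carrier R" "s \<in> carrier R" "c \<in> carrier ?F" for r s c
    by (rule free_module_eqI[of _ B]) (use that(1,2) val[OF that(3)] in \<open>auto simp: m_assoc\<close>)
  show "r \<odot>\<^bsub>?F\<^esub> (c \<oplus>\<^bsub>?F\<^esub> d) = r \<odot>\<^bsub>?F\<^esub> c \<oplus>\<^bsub>?F\<^esub> r \<odot>\<^bsub>?F\<^esub> d"
    if "r \<in> carrier R" "c \<in> carrier ?F" "d \<in> carrier ?F" for r c d
    by (rule free_module_eqI[of _ B]) (use that(1) val[OF that(2)] val[OF that(3)] in \<open>auto simp: r_distr\<close>)
qed

definition basis_vector :: "'x set \<Rightarrow> 'x \<Rightarrow> 'x \<Rightarrow> 'a" where
  "basis_vector B b = (\<lambda>x \<in> B. if x = b then \<one> else \<zero>)"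

lemma basis_vector_closed: "basis_vector B b \<in> carrier (free_module R B)"
proof -
  have "{x \<in> B. basis_vector B b x \<noteq> \<zero>} \<subseteq> {b}" unfolding basis_vector_def by auto
  then have "finite {x \<in> B. basis_vector B b x \<noteq> \<zero>}" by (rule finite_subset) simp
  then show ?thesis unfolding basis_vector_def by auto
qed

end

definition free_map ::
    "('a, 'r) ring_scheme \<Rightarrow> ('a, 'm, 'q) module_scheme \<Rightarrow> 'b set \<Rightarrow> ('b \<Rightarrow> 'm) \<Rightarrow> ('b \<Rightarrow> 'a) \<Rightarrow> 'm" where
  "free_map R N B y = support_sum N B \<zero>\<^bsub>R\<^esub> (\<lambda>b r. r \<odot>\<^bsub>N\<^esub> y b)"

lemma free_map_linear:
  assumes N: "module R N" and y: "\<And>b. b \<in> B \<Longrightarrow> y b \<in> carrier N"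
  shows "linear_map R (free_module R B) N (free_map R N B y)"
proof -
  interpret N: module R N by (rule N)
  let ?F = "free_module R B"
  have fin: "finite {b \<in> B. c b \<noteq> \<zero>\<^bsub>R\<^esub>}" if "c \<in> carrier ?F" for c using that by simp
  note val = N.free_module_val
  show ?thesis unfolding linear_map_def free_map_def
  proof (intro conjI ballI)
    fix c assume c: "c \<in> carrier ?F"
    show "support_sum N B \<zero>\<^bsub>R\<^esub> (\<lambda>b r. r \<odot>\<^bsub>N\<^esub> y b) c \<in> carrier N"
      by (rule N.support_sum_closed) (use y val[OF c] in simp)
    show "support_sum N B \<zero>\<^bsub>R\<^esub> (\<lambda>b r. r \<odot>\<^bsub>N\<^esub> y b) (r \<odot>\<^bsub>?F\<^esub> c) =
        r \<odot>\<^bsub>N\<^esub> support_sum N B \<zero>\<^bsub>R\<^esub> (\<lambda>b r. r \<odot>\<^bsub>N\<^esub> y b) c" if r: "r \<in> carrier R" for r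
      by (rule N.support_sum_smult[OF fin[OF c] r]) (use r y val[OF c] in \<open>simp_all add: N.smult_assoc1\<close>)
    fix d assume d: "d \<in> carrier ?F"
    show "support_sum N B \<zero>\<^bsub>R\<^esub> (\<lambda>b r. r \<odot>\<^bsub>N\<^esub> y b) (c \<oplus>\<^bsub>?F\<^esub> d) =
        support_sum N B \<zero>\<^bsub>R\<^esub> (\<lambda>b r. r \<odot>\<^bsub>N\<^esub> y b) c \<oplus>\<^bsub>N\<^esub> support_sum N B \<zero>\<^bsub>R\<^esub> (\<lambda>b r. r \<odot>\<^bsub>N\<^esub> y b) d"
      by (rule N.support_sum_add[OF fin[OF c] fin[OF d]])
         (use y val[OF c] val[OF d] in \<open>simp_all add: N.smult_l_distr\<close>)
  qed
qed

lemma free_map_basis: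
  assumes N: "module R N" and y: "\<And>b. b \<in> B \<Longrightarrow> y b \<in> carrier N" and b: "b \<in> B"
  shows "free_map R N B y (cring.basis_vector R B b) = y b"
proof -
  interpret N: module R N by (rule N)
  have "support_sum N B \<zero>\<^bsub>R\<^esub> (\<lambda>b r. r \<odot>\<^bsub>N\<^esub> y b) (N.basis_vector B b) = \<one>\<^bsub>R\<^esub> \<odot>\<^bsub>N\<^esub> y b"
    by (rule N.support_sum_single[OF b]) (use b y in \<open>simp_all add: N.basis_vector_def\<close>)
  then show ?thesis unfolding free_map_def using y[OF b] by simp
qed

lemma gen_map_eq:
  "c \<in> carrier (free_module R B) \<Longrightarrow> gen_map R N B c = free_map R N B (\<lambda>b. b) c"
  unfolding gen_map_def free_map_def support_sum_def by simp

lemma gen_map_linear: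
  assumes N: "module R N" and B: "B \<subseteq> carrier N"
  shows "linear_map R (free_module R B) N (gen_map R N B)"
proof -
  interpret N: module R N by (rule N)
  show ?thesis
    by (rule linear_map_cong[OF free_map_linear[OF N, of B "\<lambda>b. b"] N.free_module_module gen_map_eq])
       (use B in auto)
qed

lemma gen_map_basis:
  assumes N: "module R N" and B: "B \<subseteq> carrier N" "b \<in> B"
  shows "gen_map R N B (cring.basis_vector R B b) = b"
proof -
  interpret N: module R N by (rule N)
  have "free_map R N B (\<lambda>b. b) (N.basis_vector B b) = b"
    by (rule free_map_basis[OF N _ B(2)]) (use B(1) in auto)
  then show ?thesis using gen_map_eq[OF N.basis_vector_closed, of N B b] by simp
qed

lemma relations_submodule:
  assumes N: "module R N" and B: "B \<subseteq> carrier N"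
  shows "submodule (relations R N B) R (free_module R B)"
proof -
  interpret N: module R N by (rule N)
  show ?thesis
    using submodule_preimage[OF gen_map_linear[OF N B] N.free_module_module N N.submodule_zero]
    unfolding relations_def by simp
qed

lemma gen_map_into_submodule:
  assumes N: "module R N" and B: "submodule B R N" and c: "c \<in> carrier (free_module R B)"
  shows "gen_map R N B c \<in> B"
proof -
  interpret N: module R N by (rule N)
  have "finite {b \<in> B. c b \<noteq> \<zero>\<^bsub>R\<^esub>}" using c by simp
  moreover have "{b \<in> B. c b \<noteq> \<zero>\<^bsub>R\<^esub>} \<subseteq> B" by auto
  ultimately have "(\<Oplus>\<^bsub>N\<^esub>b \<in> {b \<in> B. c b \<noteq> \<zero>\<^bsub>R\<^esub>}. c b \<odot>\<^bsub>N\<^esub> b) \<in> B"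
  proof induction
    case empty
    show ?case using B by (simp add: N.submodule_iff)
  next
    case (insert b A)
    have BN: "B \<subseteq> carrier N" by (rule N.submoduleE(1)[OF B])
    have cb: "c x \<odot>\<^bsub>N\<^esub> x \<in> B" if "x \<in> B" for x
      by (rule N.submoduleE(4)[OF B N.free_module_val[OF c that] that])
    have "(\<Oplus>\<^bsub>N\<^esub>x \<in> insert b A. c x \<odot>\<^bsub>N\<^esub> x) = c b \<odot>\<^bsub>N\<^esub> b \<oplus>\<^bsub>N\<^esub> (\<Oplus>\<^bsub>N\<^esub>x \<in> A. c x \<odot>\<^bsub>N\<^esub> x)"
      by (rule N.M.finsum_insert[OF insert.hyps]) (use insert.prems cb BN in auto)
    also have "\<dots> \<in> B"
      by (rule N.submoduleE(5)[OF B]) (use insert cb in auto)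
    finally show ?case .
  qed
  then show ?thesis unfolding gen_map_def using c by simp
qed

section \<open>The module \<open>Ext\<^sup>1\<close>\<close>

lemma divisible_quot_iff:
  assumes N: "module R N" and K: "submodule K R N"
  shows "divisible R (quot_module N K) \<longleftrightarrow>
    (\<forall>s \<in> nonzerodivisors R. \<forall>x \<in> carrier N. \<exists>y \<in> carrier N. \<exists>k \<in> K. x = s \<odot>\<^bsub>N\<^esub> y \<oplus>\<^bsub>N\<^esub> k)"
proof -
  interpret N: module R N by (rule N)
  note q = N.quot_module(1)[OF K] and ops = N.quot_module_ops[OF K]
  have "(\<lambda>X. s \<odot>\<^bsub>quot_module N K\<^esub> X) ` carrier (quot_module N K) = carrier (quot_module N K) \<longleftrightarrow>
      (\<forall>x \<in> carrier N. \<exists>y \<in> carrier N. \<exists>k \<in> K. x = s \<odot>\<^bsub>N\<^esub> y \<oplus>\<^bsub>N\<^esub> k)"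
    if s: "s \<in> nonzerodivisors R" for s
  proof -
    have sR: "s \<in> carrier R" by (rule N.nonzerodivisors_simps(1)[OF s])
    have "(\<lambda>X. s \<odot>\<^bsub>quot_module N K\<^esub> X) ` carrier (quot_module N K) =
        (\<lambda>y. K +>\<^bsub>N\<^esub> (s \<odot>\<^bsub>N\<^esub> y)) ` carrier N"
      unfolding quot_module_carrier image_image using ops(3)[OF sR] by (rule image_cong[OF refl])
    moreover have "(\<lambda>y. K +>\<^bsub>N\<^esub> (s \<odot>\<^bsub>N\<^esub> y)) ` carrier N \<subseteq> (\<lambda>x. K +>\<^bsub>N\<^esub> x) ` carrier N"
      using sR by auto
    moreover have "(\<lambda>x. K +>\<^bsub>N\<^esub> x) ` carrier N \<subseteq> (\<lambda>y. K +>\<^bsub>N\<^esub> (s \<odot>\<^bsub>N\<^esub> y)) ` carrier N \<longleftrightarrow>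
        (\<forall>x \<in> carrier N. \<exists>y \<in> carrier N. K +>\<^bsub>N\<^esub> x = K +>\<^bsub>N\<^esub> (s \<odot>\<^bsub>N\<^esub> y))"
      by (simp add: image_subset_iff image_iff)
    moreover have "\<dots> \<longleftrightarrow> (\<forall>x \<in> carrier N. \<exists>y \<in> carrier N. \<exists>k \<in> K. x = s \<odot>\<^bsub>N\<^esub> y \<oplus>\<^bsub>N\<^esub> k)"
    proof (intro ball_cong bex_cong refl)
      fix x y assume xy: "x \<in> carrier N" "y \<in> carrier N"
      have sy: "s \<odot>\<^bsub>N\<^esub> y \<in> carrier N" using sR xy by simp
      have "x \<ominus>\<^bsub>N\<^esub> s \<odot>\<^bsub>N\<^esub> y \<in> K \<longleftrightarrow> (\<exists>k \<in> K. x = s \<odot>\<^bsub>N\<^esub> y \<oplus>\<^bsub>N\<^esub> k)"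
      proof
        assume "x \<ominus>\<^bsub>N\<^esub> s \<odot>\<^bsub>N\<^esub> y \<in> K"
        moreover have "x = s \<odot>\<^bsub>N\<^esub> y \<oplus>\<^bsub>N\<^esub> (x \<ominus>\<^bsub>N\<^esub> s \<odot>\<^bsub>N\<^esub> y)"
        proof -
          have "s \<odot>\<^bsub>N\<^esub> y \<oplus>\<^bsub>N\<^esub> (x \<ominus>\<^bsub>N\<^esub> s \<odot>\<^bsub>N\<^esub> y) = s \<odot>\<^bsub>N\<^esub> y \<oplus>\<^bsub>N\<^esub> (\<ominus>\<^bsub>N\<^esub> (s \<odot>\<^bsub>N\<^esub> y) \<oplus>\<^bsub>N\<^esub> x)"
            unfolding a_minus_def using xy sy N.M.a_comm[of x "\<ominus>\<^bsub>N\<^esub> (s \<odot>\<^bsub>N\<^esub> y)"] by simp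
          then show ?thesis using N.M.r_neg2[OF sy xy(1)] by simp
        qed
        ultimately show "\<exists>k \<in> K. x = s \<odot>\<^bsub>N\<^esub> y \<oplus>\<^bsub>N\<^esub> k" by (rule rev_bexI)
      next
        assume "\<exists>k \<in> K. x = s \<odot>\<^bsub>N\<^esub> y \<oplus>\<^bsub>N\<^esub> k"
        then obtain k where k: "k \<in> K" "x = s \<odot>\<^bsub>N\<^esub> y \<oplus>\<^bsub>N\<^esub> k" by (rule bexE)
        have kc: "k \<in> carrier N" using k(1) N.submoduleE(1)[OF K] by auto
        have "x \<ominus>\<^bsub>N\<^esub> s \<odot>\<^bsub>N\<^esub> y = \<ominus>\<^bsub>N\<^esub> (s \<odot>\<^bsub>N\<^esub> y) \<oplus>\<^bsub>N\<^esub> (s \<odot>\<^bsub>N\<^esub> y \<oplus>\<^bsub>N\<^esub> k)"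
          unfolding k(2) a_minus_def using sy kc by (intro N.M.a_comm) simp_all
        then show "x \<ominus>\<^bsub>N\<^esub> s \<odot>\<^bsub>N\<^esub> y \<in> K" using N.M.r_neg1[OF sy kc] k(1) by simp
      qed
      then show "K +>\<^bsub>N\<^esub> x = K +>\<^bsub>N\<^esub> (s \<odot>\<^bsub>N\<^esub> y) \<longleftrightarrow> (\<exists>k \<in> K. x = s \<odot>\<^bsub>N\<^esub> y \<oplus>\<^bsub>N\<^esub> k)"
        using N.coset_eq_iff[OF K xy(1) sy] by simp
    qed
    ultimately show ?thesis unfolding quot_module_carrier by auto
  qed
  note eq = this
  have "(\<forall>s \<in> nonzerodivisors R.
        (\<lambda>X. s \<odot>\<^bsub>quot_module N K\<^esub> X) ` carrier (quot_module N K) = carrier (quot_module N K)) \<longleftrightarrow>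
      (\<forall>s \<in> nonzerodivisors R. \<forall>x \<in> carrier N. \<exists>y \<in> carrier N. \<exists>k \<in> K. x = s \<odot>\<^bsub>N\<^esub> y \<oplus>\<^bsub>N\<^esub> k)"
    by (rule ball_cong[OF refl eq])
  then show ?thesis unfolding divisible_def using q by (simp only: simp_thms)
qed

text \<open>The image of the second differential is \<open>K\<^sub>1\<close>, so the cocycles are the maps on \<open>F\<^sub>1\<close> that vanish
  on \<open>K\<^sub>1\<close>. A class \<open>h\<close> is \<open>s\<close> times the class of \<open>h'\<close> if they differ by a coboundary \<open>g \<circ> d\<^sub>1\<close>.\<close>

lemma divisible_ext1_iff:
  assumes N: "module R N" and M: "module R M"
  defines "F\<^sub>0 \<equiv> free_module R (carrier N)" and "K\<^sub>0 \<equiv> relations R N (carrier N)"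
  defines "F\<^sub>1 \<equiv> free_module R K\<^sub>0" and "d\<^sub>1 \<equiv> gen_map R F\<^sub>0 K\<^sub>0" and "K\<^sub>1 \<equiv> relations R F\<^sub>0 K\<^sub>0"
  shows "divisible R (ext1_module R N M) \<longleftrightarrow>
    (\<forall>s \<in> nonzerodivisors R. \<forall>h. linear_map R F\<^sub>1 M h \<and> (\<forall>c \<in> K\<^sub>1. h c = \<zero>\<^bsub>M\<^esub>) \<longrightarrow>
       (\<exists>h' g. linear_map R F\<^sub>1 M h' \<and> (\<forall>c \<in> K\<^sub>1. h' c = \<zero>\<^bsub>M\<^esub>) \<and> linear_map R F\<^sub>0 M g \<and>
          (\<forall>c \<in> carrier F\<^sub>1. h c = s \<odot>\<^bsub>M\<^esub> h' c \<oplus>\<^bsub>M\<^esub> g (d\<^sub>1 c))))" (is "_ \<longleftrightarrow> ?r")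
proof -
  interpret N: module R N by (rule N)
  interpret M: module R M by (rule M)
  have F0: "module R F\<^sub>0" and F1: "module R F\<^sub>1" unfolding F\<^sub>0_def F\<^sub>1_def by (rule N.free_module_module)+
  interpret F0: module R F\<^sub>0 by (rule F0)
  interpret F1: module R F\<^sub>1 by (rule F1)
  have K0: "submodule K\<^sub>0 R F\<^sub>0" unfolding K\<^sub>0_def F\<^sub>0_def by (rule relations_submodule[OF N subset_refl])
  have K0c: "K\<^sub>0 \<subseteq> carrier F\<^sub>0" by (rule F0.submoduleE(1)[OF K0])
  have K1: "submodule K\<^sub>1 R F\<^sub>1" unfolding K\<^sub>1_def F\<^sub>1_def by (rule relations_submodule[OF F0 K0c])
  have K1c: "K\<^sub>1 \<subseteq> carrier F\<^sub>1" by (rule F1.submoduleE(1)[OF K1])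
  have d1: "linear_map R F\<^sub>1 F\<^sub>0 d\<^sub>1" unfolding d\<^sub>1_def F\<^sub>1_def by (rule gen_map_linear[OF F0 K0c])
  have d1_K1: "d\<^sub>1 c = \<zero>\<^bsub>F\<^sub>0\<^esub>" if "c \<in> K\<^sub>1" for c
    using that unfolding K\<^sub>1_def relations_def d\<^sub>1_def by simp
  let ?F2 = "free_module R K\<^sub>1" and ?d2 = "gen_map R F\<^sub>1 K\<^sub>1"
  \<comment> \<open>the cocycles and the coboundaries\<close>
  define Z where "Z = {h \<in> module_hom R F\<^sub>1 M. \<forall>c \<in> carrier ?F2. h (?d2 c) = \<zero>\<^bsub>M\<^esub>}"
  define Bd where "Bd = {compose (carrier F\<^sub>1) g d\<^sub>1 | g. g \<in> module_hom R F\<^sub>0 M}"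
  let ?H = "hom_module R F\<^sub>1 M"
  let ?Z = "?H\<lparr>carrier := Z\<rparr>"
  have ext: "ext1_module R N M = quot_module ?Z Bd"
    unfolding ext1_module_def Let_def Z_def Bd_def F\<^sub>0_def F\<^sub>1_def K\<^sub>0_def d\<^sub>1_def K\<^sub>1_def ..
  have H: "module R ?H" by (rule hom_module_module[OF F1 M])
  interpret H: module R ?H by (rule H)
  have "(\<forall>c \<in> carrier ?F2. h (?d2 c) = \<zero>\<^bsub>M\<^esub>) \<longleftrightarrow> (\<forall>c \<in> K\<^sub>1. h c = \<zero>\<^bsub>M\<^esub>)" for h
  proof
    assume h: "\<forall>c \<in> carrier ?F2. h (?d2 c) = \<zero>\<^bsub>M\<^esub>"
    show "\<forall>c \<in> K\<^sub>1. h c = \<zero>\<^bsub>M\<^esub>"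
    proof
      fix c assume c: "c \<in> K\<^sub>1"
      show "h c = \<zero>\<^bsub>M\<^esub>"
        using bspec[OF h N.basis_vector_closed[of K\<^sub>1 c]] gen_map_basis[OF F1 K1c c] by simp
    qed
  next
    assume h: "\<forall>c \<in> K\<^sub>1. h c = \<zero>\<^bsub>M\<^esub>"
    show "\<forall>c \<in> carrier ?F2. h (?d2 c) = \<zero>\<^bsub>M\<^esub>"
    proof
      fix c assume "c \<in> carrier ?F2"
      then show "h (?d2 c) = \<zero>\<^bsub>M\<^esub>" using bspec[OF h gen_map_into_submodule[OF F1 K1]] by simp
    qed
  qed
  then have Z_iff: "h \<in> Z \<longleftrightarrow> h \<in> module_hom R F\<^sub>1 M \<and> (\<forall>c \<in> K\<^sub>1. h c = \<zero>\<^bsub>M\<^esub>)" for h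
    unfolding Z_def by simp
  have Z: "submodule Z R ?H"
    unfolding H.submodule_iff
  proof (intro conjI ballI)
    show "Z \<subseteq> carrier ?H" using Z_iff by auto
    show "\<zero>\<^bsub>?H\<^esub> \<in> Z" using H.M.zero_closed K1c unfolding Z_iff by auto
  next
    fix f g assume fg: "f \<in> Z" "g \<in> Z"
    then have "f \<oplus>\<^bsub>?H\<^esub> g \<in> carrier ?H" by (intro H.M.add.m_closed) (simp_all add: Z_iff)
    then show "f \<oplus>\<^bsub>?H\<^esub> g \<in> Z" using fg K1c unfolding Z_iff by auto
  next
    fix r f assume r: "r \<in> carrier R" and f: "f \<in> Z"
    then have "r \<odot>\<^bsub>?H\<^esub> f \<in> carrier ?H" by (intro H.smult_closed) (simp_all add: Z_iff)
    then show "r \<odot>\<^bsub>?H\<^esub> f \<in> Z" using r f K1c unfolding Z_iff by auto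
  qed
  have mZ: "module R ?Z" by (rule submodule.submodule_is_module[OF Z H])
  interpret Z: module R ?Z by (rule mZ)
  have cmp: "compose (carrier F\<^sub>1) g d\<^sub>1 = restrict (\<lambda>c. g (d\<^sub>1 c)) (carrier F\<^sub>1)" for g
    unfolding compose_def ..
  have Bd_iff: "b \<in> Bd \<longleftrightarrow> b \<in> extensional (carrier F\<^sub>1) \<and>
      (\<exists>g. linear_map R F\<^sub>0 M g \<and> (\<forall>c \<in> carrier F\<^sub>1. b c = g (d\<^sub>1 c)))" for b
  proof
    assume "b \<in> Bd"
    then obtain g where "g \<in> module_hom R F\<^sub>0 M" "b = compose (carrier F\<^sub>1) g d\<^sub>1" unfolding Bd_def by auto
    then show "b \<in> extensional (carrier F\<^sub>1) \<and> (\<exists>g. linear_map R F\<^sub>0 M g \<and> (\<forall>c \<in> carrier F\<^sub>1. b c = g (d\<^sub>1 c)))"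
      using module_homD[of g] unfolding cmp by auto
  next
    assume "b \<in> extensional (carrier F\<^sub>1) \<and> (\<exists>g. linear_map R F\<^sub>0 M g \<and> (\<forall>c \<in> carrier F\<^sub>1. b c = g (d\<^sub>1 c)))"
    then obtain g where b: "b \<in> extensional (carrier F\<^sub>1)" and g: "linear_map R F\<^sub>0 M g"
      "\<forall>c \<in> carrier F\<^sub>1. b c = g (d\<^sub>1 c)" by (elim conjE exE)
    have "b = compose (carrier F\<^sub>1) (restrict g (carrier F\<^sub>0)) d\<^sub>1" unfolding cmp
      by (rule extensionalityI[OF b]) (use g(2) linear_mapD(1)[OF d1] in auto)
    then show "b \<in> Bd" unfolding Bd_def using restrict_module_hom[OF g(1) F0] by blast
  qed
  have Bd: "submodule Bd R ?Z"
    unfolding Z.submodule_iff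
  proof (intro conjI ballI)
    show "Bd \<subseteq> carrier ?Z"
    proof
      fix b assume "b \<in> Bd"
      then obtain g where b: "b \<in> extensional (carrier F\<^sub>1)" and g: "linear_map R F\<^sub>0 M g"
        "\<forall>c \<in> carrier F\<^sub>1. b c = g (d\<^sub>1 c)" unfolding Bd_iff by (elim conjE exE)
      have "linear_map R F\<^sub>1 M b"
        by (rule linear_map_cong[OF linear_map_comp[OF d1 g(1)] F1]) (use g(2) in simp)
      moreover have "b c = \<zero>\<^bsub>M\<^esub>" if "c \<in> K\<^sub>1" for c
        using g(2) that K1c d1_K1[OF that] linear_map_zero[OF g(1) F0 M] by auto
      ultimately show "b \<in> carrier ?Z" using b by (simp add: Z_iff module_hom_iff)
    qed
    have "linear_map R F\<^sub>0 M (\<lambda>c. \<zero>\<^bsub>M\<^esub>)" unfolding linear_map_def by simp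
    then show "\<zero>\<^bsub>?Z\<^esub> \<in> Bd" unfolding Bd_iff by (auto intro!: exI[of _ "\<lambda>c. \<zero>\<^bsub>M\<^esub>"])
  next
    fix a b assume "a \<in> Bd" "b \<in> Bd"
    then obtain f g where "linear_map R F\<^sub>0 M f" "\<forall>c \<in> carrier F\<^sub>1. a c = f (d\<^sub>1 c)"
      "linear_map R F\<^sub>0 M g" "\<forall>c \<in> carrier F\<^sub>1. b c = g (d\<^sub>1 c)" unfolding Bd_iff by (elim conjE exE)
    then show "a \<oplus>\<^bsub>?Z\<^esub> b \<in> Bd" unfolding Bd_iff
      by (auto intro!: exI[of _ "\<lambda>c. f c \<oplus>\<^bsub>M\<^esub> g c"] linear_map_add F0 M)
  next
    fix r a assume r: "r \<in> carrier R" and "a \<in> Bd"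
    then obtain f where "linear_map R F\<^sub>0 M f" "\<forall>c \<in> carrier F\<^sub>1. a c = f (d\<^sub>1 c)"
      unfolding Bd_iff by (elim conjE exE)
    then show "r \<odot>\<^bsub>?Z\<^esub> a \<in> Bd" unfolding Bd_iff
      using r by (auto intro!: exI[of _ "\<lambda>c. r \<odot>\<^bsub>M\<^esub> f c"] linear_map_smult F0 M)
  qed
  show ?thesis unfolding ext divisible_quot_iff[OF mZ Bd]
  proof (intro ball_cong refl iffI allI impI ballI)
    fix s h assume s: "s \<in> nonzerodivisors R"
      and all: "\<forall>h \<in> carrier ?Z. \<exists>h' \<in> carrier ?Z. \<exists>b \<in> Bd. h = s \<odot>\<^bsub>?Z\<^esub> h' \<oplus>\<^bsub>?Z\<^esub> b"
      and h: "linear_map R F\<^sub>1 M h \<and> (\<forall>c \<in> K\<^sub>1. h c = \<zero>\<^bsub>M\<^esub>)"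
    have "restrict h (carrier F\<^sub>1) \<in> Z"
      unfolding Z_iff using restrict_module_hom[OF conjunct1[OF h] F1] h K1c by auto
    then obtain h' b where h': "h' \<in> Z" and b: "b \<in> Bd"
      and eq: "restrict h (carrier F\<^sub>1) = s \<odot>\<^bsub>?Z\<^esub> h' \<oplus>\<^bsub>?Z\<^esub> b" using all by auto
    obtain g where g: "linear_map R F\<^sub>0 M g" "\<forall>c \<in> carrier F\<^sub>1. b c = g (d\<^sub>1 c)"
      using b unfolding Bd_iff by (elim conjE exE)
    have "h c = s \<odot>\<^bsub>M\<^esub> h' c \<oplus>\<^bsub>M\<^esub> g (d\<^sub>1 c)" if c: "c \<in> carrier F\<^sub>1" for c
      using fun_cong[OF eq, of c] c g(2) by simp
    then show "\<exists>h' g. linear_map R F\<^sub>1 M h' \<and> (\<forall>c \<in> K\<^sub>1. h' c = \<zero>\<^bsub>M\<^esub>) \<and> linear_map R F\<^sub>0 M g \<and>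
        (\<forall>c \<in> carrier F\<^sub>1. h c = s \<odot>\<^bsub>M\<^esub> h' c \<oplus>\<^bsub>M\<^esub> g (d\<^sub>1 c))"
      using h' g(1) module_homD[of h'] unfolding Z_iff by blast
  next
    fix s h assume s: "s \<in> nonzerodivisors R"
      and all: "\<forall>h. linear_map R F\<^sub>1 M h \<and> (\<forall>c \<in> K\<^sub>1. h c = \<zero>\<^bsub>M\<^esub>) \<longrightarrow>
       (\<exists>h' g. linear_map R F\<^sub>1 M h' \<and> (\<forall>c \<in> K\<^sub>1. h' c = \<zero>\<^bsub>M\<^esub>) \<and> linear_map R F\<^sub>0 M g \<and>
          (\<forall>c \<in> carrier F\<^sub>1. h c = s \<odot>\<^bsub>M\<^esub> h' c \<oplus>\<^bsub>M\<^esub> g (d\<^sub>1 c)))"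
      and h: "h \<in> carrier ?Z"
    then have hZ: "h \<in> module_hom R F\<^sub>1 M" "\<forall>c \<in> K\<^sub>1. h c = \<zero>\<^bsub>M\<^esub>" by (simp_all add: Z_iff)
    from all[rule_format, OF conjI[OF module_homD[OF hZ(1)] hZ(2)]]
    obtain h' g where h': "linear_map R F\<^sub>1 M h'" "\<forall>c \<in> K\<^sub>1. h' c = \<zero>\<^bsub>M\<^esub>" and g: "linear_map R F\<^sub>0 M g"
      and eq: "\<forall>c \<in> carrier F\<^sub>1. h c = s \<odot>\<^bsub>M\<^esub> h' c \<oplus>\<^bsub>M\<^esub> g (d\<^sub>1 c)" by (elim exE conjE)
    let ?h' = "restrict h' (carrier F\<^sub>1)" and ?b = "restrict (\<lambda>c. g (d\<^sub>1 c)) (carrier F\<^sub>1)"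
    have 1: "?h' \<in> carrier ?Z"
      using restrict_module_hom[OF h'(1) F1] h'(2) K1c by (auto simp: Z_iff)
    have 2: "?b \<in> Bd" unfolding Bd_iff using g by auto
    have "h = s \<odot>\<^bsub>?Z\<^esub> ?h' \<oplus>\<^bsub>?Z\<^esub> ?b"
      by (rule extensionalityI[of _ "carrier F\<^sub>1"]) (use hZ(1) eq in \<open>auto simp: module_hom_iff\<close>)
    with 1 2 show "\<exists>h' \<in> carrier ?Z. \<exists>b \<in> Bd. h = s \<odot>\<^bsub>?Z\<^esub> h' \<oplus>\<^bsub>?Z\<^esub> b" by blast
  qed
qed

section \<open>h-divisible modules of homomorphisms\<close>

lemma restrict_scalars_simps [simp]:
  "carrier (restrict_scalars \<phi> N) = carrier N" "\<zero>\<^bsub>restrict_scalars \<phi> N\<^esub> = \<zero>\<^bsub>N\<^esub>"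
  "x \<oplus>\<^bsub>restrict_scalars \<phi> N\<^esub> y = x \<oplus>\<^bsub>N\<^esub> y" "r \<odot>\<^bsub>restrict_scalars \<phi> N\<^esub> x = \<phi> r \<odot>\<^bsub>N\<^esub> x"
  unfolding restrict_scalars_def by auto

lemma (in cring) frac_inverse:
  assumes s: "s \<in> nonzerodivisors R" and q: "q \<in> carrier (total_quotient_ring R)"
  shows "frac_class R (regular_module R) \<one> s \<otimes>\<^bsub>total_quotient_ring R\<^esub> q \<in> carrier (total_quotient_ring R)"
    and "to_total_quotient R s \<otimes>\<^bsub>total_quotient_ring R\<^esub>
      (frac_class R (regular_module R) \<one> s \<otimes>\<^bsub>total_quotient_ring R\<^esub> q) = q"
    and "frac_class R (regular_module R) \<one> s \<otimes>\<^bsub>total_quotient_ring R\<^esub> \<zero>\<^bsub>total_quotient_ring R\<^esub> =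
      \<zero>\<^bsub>total_quotient_ring R\<^esub>"
proof -
  have sR: "s \<in> carrier R" by (rule nonzerodivisors_simps(1)[OF s])
  obtain a t where a: "q = frac a t" "a \<in> carrier R" "t \<in> nonzerodivisors R"
    using q unfolding Q_carrier by (elim exE conjE)
  have tR: "t \<in> carrier R" by (rule nonzerodivisors_simps(1)[OF a(3)])
  have eq: "frac \<one> s \<otimes>\<^bsub>Q\<^esub> q = frac a (s \<otimes> t)"
    using a s by (simp add: Q_mult)
  show "frac \<one> s \<otimes>\<^bsub>Q\<^esub> q \<in> carrier Q"
    unfolding eq Q_carrier using a nonzerodivisors_simps(3)[OF s a(3)] by blast
  have "to_total_quotient R s \<otimes>\<^bsub>Q\<^esub> (frac \<one> s \<otimes>\<^bsub>Q\<^esub> q) = frac (s \<otimes> a) (s \<otimes> t)"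
    unfolding eq by (rule Q_scalar[OF sR a(2) nonzerodivisors_simps(3)[OF s a(3)]])
  also have "\<dots> = frac a t"
    by (subst frac_class_regular_simps) (use a s sR tR in \<open>simp_all add: nonzerodivisors_simps m_ac\<close>)
  finally show "to_total_quotient R s \<otimes>\<^bsub>Q\<^esub> (frac \<one> s \<otimes>\<^bsub>Q\<^esub> q) = q" using a(1) by simp
  have "frac \<one> s \<otimes>\<^bsub>Q\<^esub> \<zero>\<^bsub>Q\<^esub> = frac \<zero> (s \<otimes> \<one>)"
    unfolding Q_zero by (subst Q_mult) (use s in \<open>simp_all add: nonzerodivisors_simps\<close>)
  also have "\<dots> = frac \<zero> \<one>"
    by (subst frac_class_regular_simps) (use s sR in \<open>simp_all add: nonzerodivisors_simps\<close>)
  finally show "frac \<one> s \<otimes>\<^bsub>Q\<^esub> \<zero>\<^bsub>Q\<^esub> = \<zero>\<^bsub>Q\<^esub>" unfolding Q_zero .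
qed

text \<open>In a free module over the total quotient ring, \<open>c = s (s\<^sup>-\<^sup>1 c)\<close>.\<close>

lemma h_divisible_imp_divisible:
  fixes N :: "('a, 'm, 'q) module_scheme"
  assumes "h_divisible R N" shows "divisible R N"
proof -
  have N: "module R N" using assms unfolding h_divisible_def by simp
  interpret N: module R N by (rule N)
  let ?Q = "total_quotient_ring R"
  obtain B :: "'m set" and p where p: "p \<in> module_hom R (restrict_scalars (to_total_quotient R) (free_module ?Q B)) N"
    and surj: "p ` carrier (free_module ?Q B) = carrier N"
    using assms unfolding h_divisible_def Let_def by auto
  note lin = linear_mapD[OF module_homD[OF p]]
  have "n \<in> (\<lambda>x. s \<odot>\<^bsub>N\<^esub> x) ` carrier N" if s: "s \<in> nonzerodivisors R" and n: "n \<in> carrier N" for s n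
  proof -
    have "n \<in> p ` carrier (free_module ?Q B)" using n by (simp only: surj)
    then obtain c where c: "n = p c" "c \<in> carrier (free_module ?Q B)" by (rule imageE)
    note c = c(2,1)
    have val: "c b \<in> carrier ?Q" if "b \<in> B" for b using c(1) that by auto
    define c' where "c' = (\<lambda>b \<in> B. frac_class R (regular_module R) \<one>\<^bsub>R\<^esub> s \<otimes>\<^bsub>?Q\<^esub> c b)"
    have sub: "{b \<in> B. c' b \<noteq> \<zero>\<^bsub>?Q\<^esub>} \<subseteq> {b \<in> B. c b \<noteq> \<zero>\<^bsub>?Q\<^esub>}"
    proof
      fix b assume b: "b \<in> {b \<in> B. c' b \<noteq> \<zero>\<^bsub>?Q\<^esub>}"
      have "c b \<noteq> \<zero>\<^bsub>?Q\<^esub>"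
      proof
        assume "c b = \<zero>\<^bsub>?Q\<^esub>"
        then have "c' b = \<zero>\<^bsub>?Q\<^esub>" using b N.frac_inverse(3)[OF s] val[of b] unfolding c'_def by simp
        then show False using b by simp
      qed
      then show "b \<in> {b \<in> B. c b \<noteq> \<zero>\<^bsub>?Q\<^esub>}" using b by simp
    qed
    have "finite {b \<in> B. c b \<noteq> \<zero>\<^bsub>?Q\<^esub>}" using c(1) by simp
    then have "finite {b \<in> B. c' b \<noteq> \<zero>\<^bsub>?Q\<^esub>}" by (rule finite_subset[OF sub])
    moreover have "c' \<in> B \<rightarrow>\<^sub>E carrier ?Q" unfolding c'_def using N.frac_inverse(1)[OF s val] by simp
    ultimately have c': "c' \<in> carrier (free_module ?Q B)" by simp
    have "(\<lambda>b \<in> B. to_total_quotient R s \<otimes>\<^bsub>?Q\<^esub> c' b) = c"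
      by (rule extensionalityI[of _ B])
         (use c(1) N.frac_inverse(2)[OF s val] in \<open>auto simp: c'_def PiE_def\<close>)
    then have "p c = s \<odot>\<^bsub>N\<^esub> p c'"
      using lin(3)[of s c'] c' N.nonzerodivisors_simps(1)[OF s] by simp
    then show ?thesis using c(2) lin(1)[of c'] c' by simp
  qed
  moreover have "(\<lambda>x. s \<odot>\<^bsub>N\<^esub> x) ` carrier N \<subseteq> carrier N" if "s \<in> nonzerodivisors R" for s
    using N.nonzerodivisors_simps(1)[OF that] by auto
  ultimately show ?thesis unfolding divisible_def using N by blast
qed

text \<open>A map \<open>f : L \<rightarrow> E\<close> extends to a map \<open>F\<close> on the module of fractions of \<open>L\<close>. Then
  \<open>q \<mapsto> (x \<mapsto> F (q x))\<close> maps the total quotient ring to \<open>Hom(L, E)\<close> and \<open>1\<close> to \<open>f\<close>; together, these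
  maps present \<open>Hom(L, E)\<close> as a quotient of a free module over the total quotient ring.\<close>

lemma h_divisible_hom:
  assumes E: "Baer_injective R E" and tf: "torsion_free R L"
  shows "h_divisible R (hom_module R L E)"
proof -
  interpret R: cring R using tf unfolding torsion_free_def module_def by simp
  interpret T: torsion_free_module R L by unfold_locales (rule tf)
  have L: "module R L" by (rule T.L.module_axioms)
  have mE: "module R E" using E unfolding Baer_injective_def by simp
  interpret E: module R E by (rule mE)
  interpret A: torsion_free_module R "regular_module R" by unfold_locales (rule R.torsion_free_regular)
  let ?Q = "total_quotient_ring R" and ?N = "hom_module R L E" and ?F = "fraction_module R L"
  have mN: "module R ?N" by (rule hom_module_module[OF L mE])
  interpret N: module R ?N by (rule mN)
  have mF: "module R ?F" by (rule T.fraction_module_module)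
  interpret F: module R ?F by (rule mF)
  have one: "\<one>\<^bsub>R\<^esub> \<in> nonzerodivisors R" by (rule R.nonzerodivisors_simps(2))
  note SR = R.nonzerodivisors_simps(1)
  have "\<exists>F. linear_map R ?F E F \<and> (\<forall>x \<in> carrier L. F (T.cls x \<one>\<^bsub>R\<^esub>) = f x)" if f: "linear_map R L E f" for f
  proof (rule Baer_injective_extends[OF E L mF T.cls_linear[OF one] f])
    fix x assume x: "x \<in> carrier L" "T.cls x \<one>\<^bsub>R\<^esub> = \<zero>\<^bsub>?F\<^esub>"
    then have "x = \<zero>\<^bsub>L\<^esub>"
      unfolding T.fraction_module_zero using T.cls_eq_iff[OF x(1) one T.L.M.zero_closed one] by simp
    then show "f x = \<zero>\<^bsub>E\<^esub>" using linear_map_zero[OF f L mE] by simp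
  qed
  then have "\<forall>f. \<exists>F. f \<in> module_hom R L E \<longrightarrow> linear_map R ?F E F \<and> (\<forall>x \<in> carrier L. F (T.cls x \<one>\<^bsub>R\<^esub>) = f x)"
    using module_homD by blast
  then obtain ft where "\<forall>f. f \<in> module_hom R L E \<longrightarrow>
      linear_map R ?F E (ft f) \<and> (\<forall>x \<in> carrier L. ft f (T.cls x \<one>\<^bsub>R\<^esub>) = f x)"
    by (rule choice[THEN exE])
  then have ft: "linear_map R ?F E (ft f)" "x \<in> carrier L \<Longrightarrow> ft f (T.cls x \<one>\<^bsub>R\<^esub>) = f x"
    if "f \<in> module_hom R L E" for f x using that by auto
  define act where "act q x = (\<Union>(a, s) \<in> q. T.cls (a \<odot>\<^bsub>L\<^esub> x) s)" for q :: "('a \<times> 'a) set" and x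
  have act: "act (A.cls a s) x = T.cls (a \<odot>\<^bsub>L\<^esub> x) s"
    if a: "a \<in> carrier R" "s \<in> nonzerodivisors R" and x: "x \<in> carrier L" for a s x
    unfolding act_def
  proof (rule UN_pair_const)
    show "(a, s) \<in> A.cls a s" by (rule A.cls_self) (use a in auto)
    fix b t assume "(b, t) \<in> A.cls a s"
    then have b: "b \<in> carrier R" "t \<in> nonzerodivisors R" "t \<otimes>\<^bsub>R\<^esub> a = s \<otimes>\<^bsub>R\<^esub> b" using A.clsD[of b t a s] by auto
    have "s \<odot>\<^bsub>L\<^esub> (b \<odot>\<^bsub>L\<^esub> x) = t \<odot>\<^bsub>L\<^esub> (a \<odot>\<^bsub>L\<^esub> x)"
      using T.L.smult_assoc1[OF SR[OF a(2)] b(1) x] T.L.smult_assoc1[OF SR[OF b(2)] a(1) x] b(3) by simp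
    then show "T.cls (b \<odot>\<^bsub>L\<^esub> x) t = T.cls (a \<odot>\<^bsub>L\<^esub> x) s"
      using T.cls_eq_iff[of "b \<odot>\<^bsub>L\<^esub> x" t "a \<odot>\<^bsub>L\<^esub> x" s] a b x by simp
  qed
  have Q_rep: "\<exists>a s. q = A.cls a s \<and> a \<in> carrier R \<and> s \<in> nonzerodivisors R" if "q \<in> carrier ?Q" for q
    using that unfolding R.Q_carrier .
  have Q_reps: "\<exists>a b s. a \<in> carrier R \<and> b \<in> carrier R \<and> s \<in> nonzerodivisors R \<and> q = A.cls a s \<and> q' = A.cls b s"
    if "q \<in> carrier ?Q" "q' \<in> carrier ?Q" for q q'
    using A.common_denominator[of q q'] that unfolding R.Q_carrier A.fraction_module_carrier by simp
  have act_lin: "linear_map R L ?F (act q)" if q: "q \<in> carrier ?Q" for q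
  proof -
    obtain a s where a: "q = A.cls a s" "a \<in> carrier R" "s \<in> nonzerodivisors R" using Q_rep[OF q] by (elim exE conjE)
    show ?thesis
      by (rule linear_map_cong[OF linear_map_comp[OF linear_map_smult[OF linear_map_id L L a(2)] T.cls_linear[OF a(3)]] L])
         (use act a in simp)
  qed
  define \<Phi> where "\<Phi> f q = (\<lambda>x \<in> carrier L. ft f (act q x))" for f q
  have \<Phi>_hom: "\<Phi> f q \<in> carrier ?N" if "f \<in> module_hom R L E" "q \<in> carrier ?Q" for f q
    using restrict_module_hom[OF linear_map_comp[OF act_lin[OF that(2)] ft(1)[OF that(1)]] L] unfolding \<Phi>_def by simp
  have Qadd: "A.cls a s \<oplus>\<^bsub>?Q\<^esub> A.cls b s = A.cls (a \<oplus>\<^bsub>R\<^esub> b) s"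
    if "a \<in> carrier R" "b \<in> carrier R" "s \<in> nonzerodivisors R" for a b s
    using R.Q_add[OF that(1,3,2,3)] A.cls_add_same[of a b s] that by simp
  have \<Phi>_add: "\<Phi> f (q \<oplus>\<^bsub>?Q\<^esub> q') = \<Phi> f q \<oplus>\<^bsub>?N\<^esub> \<Phi> f q'"
    if f: "f \<in> module_hom R L E" and q: "q \<in> carrier ?Q" "q' \<in> carrier ?Q" for f q q'
  proof -
    obtain a b s where a: "a \<in> carrier R" "b \<in> carrier R" "s \<in> nonzerodivisors R" "q = A.cls a s" "q' = A.cls b s"
      using Q_reps[OF q] by (elim exE conjE)
    have "ft f (act (q \<oplus>\<^bsub>?Q\<^esub> q') x) = ft f (act q x) \<oplus>\<^bsub>E\<^esub> ft f (act q' x)" if x: "x \<in> carrier L" for x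
    proof -
      have "act (q \<oplus>\<^bsub>?Q\<^esub> q') x = act q x \<oplus>\<^bsub>?F\<^esub> act q' x"
        using a x by (simp add: Qadd act T.L.smult_l_distr T.cls_add_same)
      then show ?thesis
        using linear_mapD(2)[OF ft(1)[OF f]] linear_mapD(1)[OF act_lin[OF q(1)] x] linear_mapD(1)[OF act_lin[OF q(2)] x]
        by simp
    qed
    then show ?thesis unfolding hom_module_simps \<Phi>_def by (intro restrict_ext) simp
  qed
  have \<Phi>_smult: "\<Phi> f (to_total_quotient R r \<otimes>\<^bsub>?Q\<^esub> q) = r \<odot>\<^bsub>?N\<^esub> \<Phi> f q"
    if f: "f \<in> module_hom R L E" and r: "r \<in> carrier R" and q: "q \<in> carrier ?Q" for f r q
  proof -
    obtain a s where a: "q = A.cls a s" "a \<in> carrier R" "s \<in> nonzerodivisors R" using Q_rep[OF q] by (elim exE conjE)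
    have "ft f (act (to_total_quotient R r \<otimes>\<^bsub>?Q\<^esub> q) x) = r \<odot>\<^bsub>E\<^esub> ft f (act q x)" if x: "x \<in> carrier L" for x
    proof -
      have "act (to_total_quotient R r \<otimes>\<^bsub>?Q\<^esub> q) x = r \<odot>\<^bsub>?F\<^esub> act q x"
        using a x r by (simp add: R.Q_scalar act T.L.smult_assoc1 T.cls_smult)
      then show ?thesis using linear_mapD(3)[OF ft(1)[OF f] r linear_mapD(1)[OF act_lin[OF q] x]] by simp
    qed
    then show ?thesis unfolding hom_module_simps \<Phi>_def by (intro restrict_ext) simp
  qed
  have zQ: "\<zero>\<^bsub>?Q\<^esub> = A.cls \<zero>\<^bsub>R\<^esub> \<one>\<^bsub>R\<^esub>" by (rule R.Q_zero)
  have zc: "\<zero>\<^bsub>?Q\<^esub> \<in> carrier ?Q" unfolding R.Q_carrier zQ using one by blast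
  have z_add: "\<zero>\<^bsub>?Q\<^esub> \<oplus>\<^bsub>?Q\<^esub> \<zero>\<^bsub>?Q\<^esub> = \<zero>\<^bsub>?Q\<^esub>" unfolding zQ using Qadd[OF _ _ one] by simp
  have z_smult: "to_total_quotient R r \<otimes>\<^bsub>?Q\<^esub> \<zero>\<^bsub>?Q\<^esub> = \<zero>\<^bsub>?Q\<^esub>" if "r \<in> carrier R" for r
    unfolding zQ using that one by (simp add: R.Q_scalar)
  have \<Phi>_zero: "\<Phi> f \<zero>\<^bsub>?Q\<^esub> = \<zero>\<^bsub>?N\<^esub>" if f: "f \<in> module_hom R L E" for f
  proof -
    have "ft f (act \<zero>\<^bsub>?Q\<^esub> x) = \<zero>\<^bsub>E\<^esub>" if x: "x \<in> carrier L" for x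
      unfolding zQ using x act[OF _ one x] T.zero_cls[OF one] linear_map_zero[OF ft(1)[OF f] mF mE] by simp
    then show ?thesis unfolding hom_module_simps \<Phi>_def by (intro restrict_ext) simp
  qed
  let ?B = "module_hom R L E"
  let ?Fr = "free_module ?Q ?B"
  let ?p = "support_sum ?N ?B \<zero>\<^bsub>?Q\<^esub> \<Phi>"
  have val: "c f \<in> carrier ?Q" if "c \<in> carrier ?Fr" "f \<in> ?B" for c f using that by auto
  have fin: "finite {f \<in> ?B. c f \<noteq> \<zero>\<^bsub>?Q\<^esub>}" if "c \<in> carrier ?Fr" for c using that by simp
  have add_closed: "c \<oplus>\<^bsub>?Fr\<^esub> d \<in> carrier ?Fr" if c: "c \<in> carrier ?Fr" and d: "d \<in> carrier ?Fr" for c d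
  proof -
    have "c f \<oplus>\<^bsub>?Q\<^esub> d f \<in> carrier ?Q" if f: "f \<in> ?B" for f
    proof -
      obtain a b s where a: "a \<in> carrier R" "b \<in> carrier R" "s \<in> nonzerodivisors R" "c f = A.cls a s" "d f = A.cls b s"
        using Q_reps[OF val[OF c f] val[OF d f]] by (elim exE conjE)
      then show ?thesis unfolding R.Q_carrier using Qadd[OF a(1-3)] by auto
    qed
    moreover have "finite {f \<in> ?B. (\<lambda>f \<in> ?B. c f \<oplus>\<^bsub>?Q\<^esub> d f) f \<noteq> \<zero>\<^bsub>?Q\<^esub>}"
      by (rule finite_subset[of _ "{f \<in> ?B. c f \<noteq> \<zero>\<^bsub>?Q\<^esub>} \<union> {f \<in> ?B. d f \<noteq> \<zero>\<^bsub>?Q\<^esub>}"])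
         (use fin[OF c] fin[OF d] z_add in auto)
    ultimately show ?thesis by simp
  qed
  have smult_closed: "(\<lambda>f \<in> ?B. to_total_quotient R r \<otimes>\<^bsub>?Q\<^esub> c f) \<in> carrier ?Fr"
    if r: "r \<in> carrier R" and c: "c \<in> carrier ?Fr" for r c
  proof -
    have "to_total_quotient R r \<otimes>\<^bsub>?Q\<^esub> c f \<in> carrier ?Q" if f: "f \<in> ?B" for f
    proof -
      obtain a s where a: "c f = A.cls a s" "a \<in> carrier R" "s \<in> nonzerodivisors R"
        using Q_rep[OF val[OF c f]] by (elim exE conjE)
      then show ?thesis unfolding R.Q_carrier using R.Q_scalar[OF r a(2,3)] r by auto
    qed
    moreover have "finite {f \<in> ?B. (\<lambda>f \<in> ?B. to_total_quotient R r \<otimes>\<^bsub>?Q\<^esub> c f) f \<noteq> \<zero>\<^bsub>?Q\<^esub>}"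
      by (rule finite_subset[OF _ fin[OF c]]) (use z_smult[OF r] in auto)
    ultimately show ?thesis by simp
  qed
  have p_closed: "?p c \<in> carrier ?N" if c: "c \<in> carrier ?Fr" for c
    by (rule N.support_sum_closed) (rule \<Phi>_hom[OF _ val[OF c]])
  have p_add: "?p (c \<oplus>\<^bsub>?Fr\<^esub> d) = ?p c \<oplus>\<^bsub>?N\<^esub> ?p d" if c: "c \<in> carrier ?Fr" and d: "d \<in> carrier ?Fr" for c d
  proof (rule N.support_sum_add[OF fin[OF c] fin[OF d]])
    fix f assume f: "f \<in> ?B"
    show "\<Phi> f (c f) \<in> carrier ?N" "\<Phi> f (d f) \<in> carrier ?N" by (rule \<Phi>_hom[OF f val[OF _ f]], fact)+
    show "\<Phi> f \<zero>\<^bsub>?Q\<^esub> = \<zero>\<^bsub>?N\<^esub>" by (rule \<Phi>_zero[OF f])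
    have eq: "(c \<oplus>\<^bsub>?Fr\<^esub> d) f = c f \<oplus>\<^bsub>?Q\<^esub> d f" using f unfolding free_module_def by simp
    show "\<Phi> f ((c \<oplus>\<^bsub>?Fr\<^esub> d) f) = \<Phi> f (c f) \<oplus>\<^bsub>?N\<^esub> \<Phi> f (d f)"
      unfolding eq by (rule \<Phi>_add[OF f val[OF c f] val[OF d f]])
    show "(c \<oplus>\<^bsub>?Fr\<^esub> d) f = \<zero>\<^bsub>?Q\<^esub>" if "c f = \<zero>\<^bsub>?Q\<^esub>" "d f = \<zero>\<^bsub>?Q\<^esub>"
      unfolding eq that by (rule z_add)
  qed
  have p_smult: "?p (\<lambda>f \<in> ?B. to_total_quotient R r \<otimes>\<^bsub>?Q\<^esub> c f) = r \<odot>\<^bsub>?N\<^esub> ?p c"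
    if r: "r \<in> carrier R" and c: "c \<in> carrier ?Fr" for r c
  proof (rule N.support_sum_smult[OF fin[OF c] r])
    fix f assume f: "f \<in> ?B"
    show "\<Phi> f (c f) \<in> carrier ?N" by (rule \<Phi>_hom[OF f val[OF c f]])
    show "\<Phi> f \<zero>\<^bsub>?Q\<^esub> = \<zero>\<^bsub>?N\<^esub>" by (rule \<Phi>_zero[OF f])
    have eq: "(\<lambda>f \<in> ?B. to_total_quotient R r \<otimes>\<^bsub>?Q\<^esub> c f) f = to_total_quotient R r \<otimes>\<^bsub>?Q\<^esub> c f" using f by simp
    show "\<Phi> f ((\<lambda>f \<in> ?B. to_total_quotient R r \<otimes>\<^bsub>?Q\<^esub> c f) f) = r \<odot>\<^bsub>?N\<^esub> \<Phi> f (c f)"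
      unfolding eq by (rule \<Phi>_smult[OF f r val[OF c f]])
    show "(\<lambda>f \<in> ?B. to_total_quotient R r \<otimes>\<^bsub>?Q\<^esub> c f) f = \<zero>\<^bsub>?Q\<^esub>" if "c f = \<zero>\<^bsub>?Q\<^esub>"
      unfolding eq that by (rule z_smult[OF r])
  qed
  have p_onto: "f \<in> ?p ` carrier ?Fr" if f: "f \<in> ?B" for f
  proof -
    define c where "c = (\<lambda>g \<in> ?B. if g = f then A.cls \<one>\<^bsub>R\<^esub> \<one>\<^bsub>R\<^esub> else \<zero>\<^bsub>?Q\<^esub>)"
    have oneQ: "A.cls \<one>\<^bsub>R\<^esub> \<one>\<^bsub>R\<^esub> \<in> carrier ?Q" unfolding R.Q_carrier using one by blast
    have "finite {g \<in> ?B. c g \<noteq> \<zero>\<^bsub>?Q\<^esub>}"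
      by (rule finite_subset[of _ "{f}"]) (auto simp: c_def)
    then have c: "c \<in> carrier ?Fr" using oneQ zc unfolding c_def by auto
    have "?p c = \<Phi> f (A.cls \<one>\<^bsub>R\<^esub> \<one>\<^bsub>R\<^esub>)"
      by (rule N.support_sum_single[OF f]) (use f oneQ \<Phi>_hom \<Phi>_zero in \<open>auto simp: c_def\<close>)
    also have "\<dots> = f"
      by (rule module_hom_eqI[of _ L])
         (use f act[OF _ one] ft(2)[OF f] in \<open>auto simp: \<Phi>_def module_hom_iff\<close>)
    finally show ?thesis using c by (intro image_eqI[of f ?p c]) simp_all
  qed
  let ?FF = "restrict_scalars (to_total_quotient R) ?Fr"
  have "linear_map R ?FF ?N (restrict ?p (carrier ?Fr))"
    unfolding linear_map_def restrict_scalars_simps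
  proof (intro conjI ballI)
    fix c assume c: "c \<in> carrier ?Fr"
    show "restrict ?p (carrier ?Fr) c \<in> carrier ?N" unfolding restrict_apply'[OF c] by (rule p_closed[OF c])
    show "restrict ?p (carrier ?Fr) (to_total_quotient R r \<odot>\<^bsub>?Fr\<^esub> c) = r \<odot>\<^bsub>?N\<^esub> restrict ?p (carrier ?Fr) c"
      if r: "r \<in> carrier R" for r
      using p_smult[OF r c] smult_closed[OF r c] unfolding free_module_simps(4) restrict_apply'[OF c]
      by (simp only: restrict_apply')
    show "restrict ?p (carrier ?Fr) (c \<oplus>\<^bsub>?Fr\<^esub> d) = restrict ?p (carrier ?Fr) c \<oplus>\<^bsub>?N\<^esub> restrict ?p (carrier ?Fr) d"
      if d: "d \<in> carrier ?Fr" for d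
      unfolding restrict_apply'[OF c] restrict_apply'[OF d] restrict_apply'[OF add_closed[OF c d]] by (rule p_add[OF c d])
  qed
  then have "restrict ?p (carrier ?Fr) \<in> module_hom R ?FF ?N" unfolding module_hom_iff by (simp del: free_module_simps)
  moreover have "restrict ?p (carrier ?Fr) ` carrier ?FF = carrier ?N"
  proof -
    have "restrict ?p (carrier ?Fr) ` carrier ?FF = ?p ` carrier ?Fr"
      unfolding restrict_scalars_simps by (rule image_cong[OF refl restrict_apply'])
    also have "\<dots> = carrier ?N"
    proof (rule equalityI; rule subsetI)
      fix n assume "n \<in> ?p ` carrier ?Fr"
      then show "n \<in> carrier ?N" using p_closed by blast
    next
      fix n assume "n \<in> carrier ?N"
      then show "n \<in> ?p ` carrier ?Fr" using p_onto[of n] unfolding hom_module_simps(1) by blast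
    qed
    finally show ?thesis .
  qed
  ultimately show ?thesis unfolding h_divisible_def Let_def using mN by blast
qed

section \<open>\<open>Ext\<^sup>1\<close> and extension of maps from ideals\<close>

text \<open>A cocycle vanishes on the kernel of \<open>d\<^sub>1\<close>, so it factors through the image of \<open>d\<^sub>1\<close>; the factor
  extends to \<open>F\<^sub>0\<close>, and the cocycle is a coboundary.\<close>

lemma divisible_ext1_if_injective:
  assumes E: "Baer_injective R E" and N: "module R N"
  shows "divisible R (ext1_module R N E)"
proof -
  have mE: "module R E" using E unfolding Baer_injective_def by simp
  interpret N: module R N by (rule N)
  interpret E: module R E by (rule mE)
  let ?F0 = "free_module R (carrier N)" and ?K0 = "relations R N (carrier N)"
  let ?F1 = "free_module R ?K0" and ?d1 = "gen_map R ?F0 ?K0" and ?K1 = "relations R ?F0 ?K0"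
  have F0: "module R ?F0" and F1: "module R ?F1" by (rule N.free_module_module)+
  have K0c: "?K0 \<subseteq> carrier ?F0"
    using module.submoduleE(1)[OF F0 relations_submodule[OF N subset_refl]] .
  have d1: "linear_map R ?F1 ?F0 ?d1" by (rule gen_map_linear[OF F0 K0c])
  show ?thesis unfolding divisible_ext1_iff[OF N mE]
  proof (intro ballI allI impI)
    fix s h assume s: "s \<in> nonzerodivisors R" and h: "linear_map R ?F1 E h \<and> (\<forall>c \<in> ?K1. h c = \<zero>\<^bsub>E\<^esub>)"
    have "\<exists>g. linear_map R ?F0 E g \<and> (\<forall>c \<in> carrier ?F1. g (?d1 c) = h c)"
    proof (rule Baer_injective_extends[OF E F1 F0 d1 conjunct1[OF h]])
      fix c assume "c \<in> carrier ?F1" "?d1 c = \<zero>\<^bsub>?F0\<^esub>"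
      then have "c \<in> ?K1" unfolding relations_def[of R ?F0 ?K0] by blast
      then show "h c = \<zero>\<^bsub>E\<^esub>" using h by blast
    qed
    then obtain g where g: "linear_map R ?F0 E g" "\<forall>c \<in> carrier ?F1. g (?d1 c) = h c" by (elim exE conjE)
    have "linear_map R ?F1 E (\<lambda>c. \<zero>\<^bsub>E\<^esub>)" unfolding linear_map_def by simp
    moreover have "h c = s \<odot>\<^bsub>E\<^esub> \<zero>\<^bsub>E\<^esub> \<oplus>\<^bsub>E\<^esub> g (?d1 c)" if c: "c \<in> carrier ?F1" for c
    proof -
      have hc: "h c \<in> carrier E" by (rule linear_mapD(1)[OF conjunct1[OF h] c])
      have "s \<odot>\<^bsub>E\<^esub> \<zero>\<^bsub>E\<^esub> \<oplus>\<^bsub>E\<^esub> g (?d1 c) = \<zero>\<^bsub>E\<^esub> \<oplus>\<^bsub>E\<^esub> h c"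
        using bspec[OF g(2) c] E.smult_r_null[OF N.nonzerodivisors_simps(1)[OF s]] by simp
      also have "\<dots> = h c" by (rule E.M.l_zero[OF hc])
      finally show ?thesis by (rule sym)
    qed
    ultimately show "\<exists>h' g. linear_map R ?F1 E h' \<and> (\<forall>c \<in> ?K1. h' c = \<zero>\<^bsub>E\<^esub>) \<and> linear_map R ?F0 E g \<and>
        (\<forall>c \<in> carrier ?F1. h c = s \<odot>\<^bsub>E\<^esub> h' c \<oplus>\<^bsub>E\<^esub> g (?d1 c))"
      using g(1) by (intro exI[of _ "\<lambda>c. \<zero>\<^bsub>E\<^esub>"] exI[of _ g]) simp
  qed
qed

text \<open>If \<open>g = s h\<close> on \<open>P\<close> and \<open>s \<in> P\<close>, then \<open>g(x) = h(s x) = x h(s)\<close>.\<close>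

lemma maps_extend_if_divisible_hom:
  assumes E: "module R E" and P: "ideal P R" and s: "s \<in> nonzerodivisors R" "s \<in> P"
    and div: "divisible R (hom_module R (ideal_module R P) E)"
  shows "maps_extend R E P"
  unfolding maps_extend_def
proof (intro allI impI)
  interpret E: module R E by (rule E)
  interpret P: ideal P R by (rule P)
  fix g assume g: "linear_map R (ideal_module R P) E g"
  have "\<exists>h. linear_map R (ideal_module R P) E h \<and> (\<forall>x \<in> carrier (ideal_module R P). g x = s \<odot>\<^bsub>E\<^esub> h x)"
    using div[unfolded divisible_hom_iff[OF E.ideal_module_module[OF P] E]] s(1) g by blast
  then obtain h where h: "linear_map R (ideal_module R P) E h" "\<forall>x \<in> P. g x = s \<odot>\<^bsub>E\<^esub> h x" by auto
  have hs: "h s \<in> carrier E" using linear_mapD(1)[OF h(1), of s] s(2) by simp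
  have "g x = x \<odot>\<^bsub>E\<^esub> h s" if x: "x \<in> P" for x
  proof -
    have xR: "x \<in> carrier R" and sR: "s \<in> carrier R" using x s(2) P.a_subset by auto
    have "g x = h (s \<otimes>\<^bsub>R\<^esub> x)" using h(2) x linear_mapD(3)[OF h(1) sR, of x] by simp
    also have "\<dots> = h (x \<otimes>\<^bsub>R\<^esub> s)" using E.R.m_comm[OF sR xR] by simp
    also have "\<dots> = x \<odot>\<^bsub>E\<^esub> h s" using linear_mapD(3)[OF h(1) xR, of s] s(2) by simp
    finally show ?thesis .
  qed
  then show "\<exists>m \<in> carrier E. \<forall>x \<in> P. g x = x \<odot>\<^bsub>E\<^esub> m" using hs by blast
qed

text \<open>Modulo the maps that extend to \<open>R\<close>, \<open>Hom(P, E)\<close> is \<open>Ext\<^sup>1(R/P, E)\<close>: let \<open>\<alpha> : F\<^sub>0 \<rightarrow> R\<close> lift the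
  canonical map \<open>F\<^sub>0 \<rightarrow> R/P\<close>; then \<open>g : P \<rightarrow> E\<close> gives the cocycle \<open>g \<circ> \<alpha> \<circ> d\<^sub>1\<close>. The value at
  \<open>x \<in> P\<close> is recovered from the relation \<open>x e\<close>, where \<open>e\<close> is the basis vector of the coset of \<open>1\<close>.\<close>

lemma maps_extend_if_divisible_ext1:
  assumes E: "module R E" and P: "ideal P R" and s: "s \<in> nonzerodivisors R" "s \<in> P"
    and div: "divisible R (ext1_module R (residue_module R P) E)"
  shows "maps_extend R E P"
  unfolding maps_extend_def
proof (intro allI impI)
  interpret E: module R E by (rule E)
  interpret P: ideal P R by (rule P)
  fix g assume g: "linear_map R (ideal_module R P) E g"
  let ?A = "regular_module R"
  have mA: "module R ?A" by (rule E.regular_module_module)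
  interpret A: module R ?A by (rule mA)
  have PA: "submodule P R ?A" using P E.submodule_regular_iff by simp
  let ?N = "residue_module R P"
  have Ndef: "?N = quot_module ?A P" unfolding residue_module_def ..
  let ?\<pi> = "\<lambda>x. P +>\<^bsub>?A\<^esub> x"
  have N: "module R ?N" and \<pi>: "linear_map R ?A ?N ?\<pi>" unfolding Ndef by (rule A.quot_module[OF PA])+
  have \<pi>0: "?\<pi> x = \<zero>\<^bsub>?N\<^esub> \<longleftrightarrow> x \<in> P" if "x \<in> carrier R" for x
    unfolding Ndef using A.quot_module(3)[OF PA, of x] that by simp
  have N_car: "carrier ?N = ?\<pi> ` carrier R" unfolding Ndef quot_module_carrier by simp
  interpret N: module R ?N by (rule N)
  \<comment> \<open>The coset of \<open>1\<close> is represented by \<open>1\<close>, so that \<open>\<alpha>\<close> sends its basis vector to \<open>1\<close>.\<close>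
  define rep where "rep X = (if X = ?\<pi> \<one>\<^bsub>R\<^esub> then \<one>\<^bsub>R\<^esub> else (SOME x. x \<in> carrier R \<and> ?\<pi> x = X))" for X
  have rep: "rep X \<in> carrier R \<and> ?\<pi> (rep X) = X" if "X \<in> carrier ?N" for X
  proof (cases "X = ?\<pi> \<one>\<^bsub>R\<^esub>")
    case False
    have "\<exists>x. x \<in> carrier R \<and> ?\<pi> x = X" using that unfolding N_car by blast
    from someI_ex[OF this] show ?thesis unfolding rep_def using False by simp
  qed (simp add: rep_def)
  let ?F0 = "free_module R (carrier ?N)" and ?K0 = "relations R ?N (carrier ?N)"
  let ?F1 = "free_module R ?K0" and ?d1 = "gen_map R ?F0 ?K0" and ?K1 = "relations R ?F0 ?K0"
  have F0: "module R ?F0" and F1: "module R ?F1" by (rule E.free_module_module)+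
  interpret F0: module R ?F0 by (rule F0)
  interpret F1: module R ?F1 by (rule F1)
  have K0: "submodule ?K0 R ?F0" by (rule relations_submodule[OF N subset_refl])
  have K0c: "?K0 \<subseteq> carrier ?F0" by (rule F0.submoduleE(1)[OF K0])
  have K1: "submodule ?K1 R ?F1" by (rule relations_submodule[OF F0 K0c])
  have d1: "linear_map R ?F1 ?F0 ?d1" by (rule gen_map_linear[OF F0 K0c])
  have d1_K0: "?d1 c \<in> ?K0" if "c \<in> carrier ?F1" for c by (rule gen_map_into_submodule[OF F0 K0 that])
  define \<alpha> where "\<alpha> = free_map R ?A (carrier ?N) rep"
  have \<alpha>: "linear_map R ?F0 ?A \<alpha>" unfolding \<alpha>_def by (rule free_map_linear[OF mA]) (use rep in simp)
  have \<pi>\<alpha>: "?\<pi> (\<alpha> c) = gen_map R ?N (carrier ?N) c" if c: "c \<in> carrier ?F0" for c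
  proof -
    let ?U = "{X \<in> carrier ?N. c X \<noteq> \<zero>\<^bsub>R\<^esub>}"
    have fin: "finite ?U" using c by simp
    have val: "c X \<in> carrier R" if "X \<in> carrier ?N" for X by (rule E.free_module_val[OF c that])
    have "?\<pi> (\<alpha> c) = (\<Oplus>\<^bsub>?N\<^esub>X \<in> ?U. ?\<pi> (c X \<odot>\<^bsub>?A\<^esub> rep X))"
      unfolding \<alpha>_def free_map_def support_sum_def
      by (rule linear_map_finsum[OF \<pi> mA N fin]) (use val rep in auto)
    also have "\<dots> = (\<Oplus>\<^bsub>?N\<^esub>X \<in> ?U. c X \<odot>\<^bsub>?N\<^esub> X)"
    proof (rule N.M.finsum_cong'[OF refl])
      show "(\<lambda>X. c X \<odot>\<^bsub>?N\<^esub> X) \<in> ?U \<rightarrow> carrier ?N" using val by auto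
      show "?\<pi> (c X \<odot>\<^bsub>?A\<^esub> rep X) = c X \<odot>\<^bsub>?N\<^esub> X" if "X \<in> ?U" for X
        using linear_mapD(3)[OF \<pi> val[of X], of "rep X"] rep[of X] that by simp
    qed
    also have "\<dots> = gen_map R ?N (carrier ?N) c" unfolding gen_map_def using c by simp
    finally show ?thesis .
  qed
  have \<alpha>_K0: "\<alpha> k \<in> P" if k: "k \<in> ?K0" for k
  proof -
    have kc: "k \<in> carrier ?F0" using k K0c by blast
    have "?\<pi> (\<alpha> k) = \<zero>\<^bsub>?N\<^esub>" using \<pi>\<alpha>[OF kc] k unfolding relations_def by simp
    then show ?thesis using \<pi>0[of "\<alpha> k"] linear_mapD(1)[OF \<alpha> kc] by simp
  qed
  have lin_h: "linear_map R ?F1 E (\<lambda>c. g (\<alpha> (?d1 c)))"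
  proof -
    have "linear_map R ?F1 (?A\<lparr>carrier := P\<rparr>) (\<lambda>c. \<alpha> (?d1 c))"
      by (rule linear_map_into_submodule[OF linear_map_comp[OF d1 \<alpha>]]) (rule \<alpha>_K0[OF d1_K0])
    from linear_map_comp[OF this[folded ideal_module_def] g] show ?thesis .
  qed
  have K1_d1: "?d1 c = \<zero>\<^bsub>?F0\<^esub>" if "c \<in> ?K1" for c
    using that unfolding relations_def[of R ?F0 ?K0] by blast
  have h_K1: "\<forall>c \<in> ?K1. g (\<alpha> (?d1 c)) = \<zero>\<^bsub>E\<^esub>"
  proof
    fix c assume "c \<in> ?K1"
    then have "\<alpha> (?d1 c) = \<zero>\<^bsub>R\<^esub>" using K1_d1 linear_map_zero[OF \<alpha> F0 mA] by simp
    then show "g (\<alpha> (?d1 c)) = \<zero>\<^bsub>E\<^esub>" using linear_map_zero[OF g E.ideal_module_module[OF P] E] by simp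
  qed
  obtain h' \<theta> where h': "linear_map R ?F1 E h'" "\<forall>c \<in> ?K1. h' c = \<zero>\<^bsub>E\<^esub>" and \<theta>: "linear_map R ?F0 E \<theta>"
    and eq: "\<forall>c \<in> carrier ?F1. g (\<alpha> (?d1 c)) = s \<odot>\<^bsub>E\<^esub> h' c \<oplus>\<^bsub>E\<^esub> \<theta> (?d1 c)"
    using div[unfolded divisible_ext1_iff[OF N E], THEN bspec, OF s(1), THEN spec, THEN mp,
        OF conjI[OF lin_h h_K1]]
    by (elim exE conjE)
  let ?b = "\<lambda>k. E.basis_vector ?K0 k"
  have b: "?b k \<in> carrier ?F1" for k by (rule E.basis_vector_closed)
  have d1_b: "?d1 (?b k) = k" if "k \<in> ?K0" for k by (rule gen_map_basis[OF F0 K0c that])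
  have h'_smult: "h' (?b (r \<odot>\<^bsub>?F0\<^esub> k)) = r \<odot>\<^bsub>E\<^esub> h' (?b k)" if r: "r \<in> carrier R" and k: "k \<in> ?K0" for r k
  proof -
    have rk: "r \<odot>\<^bsub>?F0\<^esub> k \<in> ?K0" by (rule F0.submoduleE(4)[OF K0 r k])
    have rb: "r \<odot>\<^bsub>?F1\<^esub> ?b k \<in> carrier ?F1" by (rule F1.smult_closed[OF r b])
    let ?c = "?b (r \<odot>\<^bsub>?F0\<^esub> k) \<ominus>\<^bsub>?F1\<^esub> r \<odot>\<^bsub>?F1\<^esub> ?b k"
    have cc: "?c \<in> carrier ?F1" by (rule F1.M.minus_closed[OF b rb])
    have "?d1 ?c = r \<odot>\<^bsub>?F0\<^esub> k \<ominus>\<^bsub>?F0\<^esub> r \<odot>\<^bsub>?F0\<^esub> k"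
      using linear_map_minus[OF d1 F1 F0 b rb, of "r \<odot>\<^bsub>?F0\<^esub> k"] linear_mapD(3)[OF d1 r b, of k] d1_b[OF rk] d1_b[OF k]
      by (simp del: free_module_simps)
    also have "\<dots> = \<zero>\<^bsub>?F0\<^esub>" using F0.minus_eq_zero_iff rk K0c by blast
    finally have "?c \<in> ?K1" unfolding relations_def[of R ?F0 ?K0] using cc by blast
    then have "h' ?c = \<zero>\<^bsub>E\<^esub>" using h'(2) by blast
    moreover have "h' ?c = h' (?b (r \<odot>\<^bsub>?F0\<^esub> k)) \<ominus>\<^bsub>E\<^esub> r \<odot>\<^bsub>E\<^esub> h' (?b k)"
      using linear_map_minus[OF h'(1) F1 E b rb, of "r \<odot>\<^bsub>?F0\<^esub> k"] linear_mapD(3)[OF h'(1) r b, of k]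
      by (simp del: free_module_simps)
    ultimately show ?thesis
      using E.minus_eq_zero_iff linear_mapD(1)[OF h'(1) b] r E.smult_closed by metis
  qed
  let ?X = "?\<pi> \<one>\<^bsub>R\<^esub>"
  let ?e = "E.basis_vector (carrier ?N) ?X"
  have X: "?X \<in> carrier ?N" unfolding N_car by simp
  have e: "?e \<in> carrier ?F0" by (rule E.basis_vector_closed)
  have \<alpha>e: "\<alpha> ?e = \<one>\<^bsub>R\<^esub>"
    using free_map_basis[OF mA _ X, of rep] rep unfolding \<alpha>_def by (simp add: rep_def)
  have xe: "x \<odot>\<^bsub>?F0\<^esub> ?e \<in> ?K0" if x: "x \<in> P" for x
  proof -
    have xR: "x \<in> carrier R" using x P.a_subset by auto
    have xc: "x \<odot>\<^bsub>?F0\<^esub> ?e \<in> carrier ?F0" by (rule F0.smult_closed[OF xR e])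
    have "\<alpha> (x \<odot>\<^bsub>?F0\<^esub> ?e) = x" using linear_mapD(3)[OF \<alpha> xR e] \<alpha>e xR by simp
    then have "gen_map R ?N (carrier ?N) (x \<odot>\<^bsub>?F0\<^esub> ?e) = \<zero>\<^bsub>?N\<^esub>" using \<pi>\<alpha>[OF xc] \<pi>0[OF xR] x by simp
    then show ?thesis unfolding relations_def using xc by blast
  qed
  let ?m = "h' (?b (s \<odot>\<^bsub>?F0\<^esub> ?e)) \<oplus>\<^bsub>E\<^esub> \<theta> ?e"
  have mc: "h' (?b (s \<odot>\<^bsub>?F0\<^esub> ?e)) \<in> carrier E" "\<theta> ?e \<in> carrier E"
    using linear_mapD(1)[OF h'(1) b] linear_mapD(1)[OF \<theta> e] by auto
  have "g x = x \<odot>\<^bsub>E\<^esub> ?m" if x: "x \<in> P" for x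
  proof -
    have xR: "x \<in> carrier R" and sR: "s \<in> carrier R" using x s(2) P.a_subset by auto
    let ?k = "x \<odot>\<^bsub>?F0\<^esub> ?e"
    have "g x = g (\<alpha> (?d1 (?b ?k)))"
      using d1_b[OF xe[OF x]] linear_mapD(3)[OF \<alpha> xR e] \<alpha>e xR by simp
    also have "\<dots> = s \<odot>\<^bsub>E\<^esub> h' (?b ?k) \<oplus>\<^bsub>E\<^esub> \<theta> ?k"
      using bspec[OF eq b[of ?k]] d1_b[OF xe[OF x]] by simp
    also have "s \<odot>\<^bsub>E\<^esub> h' (?b ?k) = h' (?b (s \<odot>\<^bsub>?F0\<^esub> ?k))" by (rule h'_smult[OF sR xe[OF x], symmetric])
    also have "s \<odot>\<^bsub>?F0\<^esub> ?k = x \<odot>\<^bsub>?F0\<^esub> (s \<odot>\<^bsub>?F0\<^esub> ?e)" by (rule F0.smult_comm[OF sR xR e])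
    also have "h' (?b (x \<odot>\<^bsub>?F0\<^esub> (s \<odot>\<^bsub>?F0\<^esub> ?e))) = x \<odot>\<^bsub>E\<^esub> h' (?b (s \<odot>\<^bsub>?F0\<^esub> ?e))"
      by (rule h'_smult[OF xR xe[OF s(2)]])
    also have "\<theta> ?k = x \<odot>\<^bsub>E\<^esub> \<theta> ?e" by (rule linear_mapD(3)[OF \<theta> xR e])
    also have "x \<odot>\<^bsub>E\<^esub> h' (?b (s \<odot>\<^bsub>?F0\<^esub> ?e)) \<oplus>\<^bsub>E\<^esub> x \<odot>\<^bsub>E\<^esub> \<theta> ?e = x \<odot>\<^bsub>E\<^esub> ?m"
      by (rule E.smult_r_distr[OF xR mc, symmetric])
    finally show ?thesis .
  qed
  then show "\<exists>m \<in> carrier E. \<forall>x \<in> P. g x = x \<odot>\<^bsub>E\<^esub> m" using E.M.add.m_closed[OF mc] by blast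
qed

section \<open>Reduced Noetherian rings\<close>

lemma reduced_square:
  assumes "reduced_ring R" "x \<in> carrier R" "x \<otimes>\<^bsub>R\<^esub> x = \<zero>\<^bsub>R\<^esub>" shows "x = \<zero>\<^bsub>R\<^esub>"
proof -
  interpret cring R using assms(1) unfolding reduced_ring_def by simp
  have "x [^]\<^bsub>R\<^esub> (2 :: nat) = \<zero>\<^bsub>R\<^esub>" using assms(2,3) by (simp add: numeral_2_eq_2)
  then show ?thesis using assms(1,2) unfolding reduced_ring_def by blast
qed

text \<open>Choose \<open>r \<in> I\<close> whose double annihilator is maximal. If \<open>r z = 0\<close> with \<open>z \<noteq> 0\<close>, there is
  \<open>w = z y \<noteq> 0\<close> with \<open>y \<in> I\<close>. In a reduced ring \<open>r w = 0\<close> forces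
  \<open>ann (r + w) = ann r \<inter> ann w\<close>, so the double annihilator of \<open>r + w\<close> contains also \<open>w\<close>.\<close>

lemma nonzerodivisor_in_ideal:
  assumes R: "cring R" and N: "noetherian_ring R" and red: "reduced_ring R" and I: "ideal I R"
    and ann: "\<And>x. x \<in> carrier R \<Longrightarrow> (\<forall>y \<in> I. x \<otimes>\<^bsub>R\<^esub> y = \<zero>\<^bsub>R\<^esub>) \<Longrightarrow> x = \<zero>\<^bsub>R\<^esub>"
  shows "\<exists>s \<in> I. s \<in> nonzerodivisors R"
proof -
  interpret R: cring R by (rule R)
  interpret N: noetherian_ring R by (rule N)
  interpret I: ideal I R by (rule I)
  have IR: "y \<in> carrier R" if "y \<in> I" for y using that I.a_subset by auto
  define A where "A r = {t \<in> carrier R. \<forall>z \<in> carrier R. r \<otimes>\<^bsub>R\<^esub> z = \<zero>\<^bsub>R\<^esub> \<longrightarrow> t \<otimes>\<^bsub>R\<^esub> z = \<zero>\<^bsub>R\<^esub>}" for r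
  have A_mem: "t \<in> A r \<longleftrightarrow> t \<in> carrier R \<and> (\<forall>z \<in> carrier R. r \<otimes>\<^bsub>R\<^esub> z = \<zero>\<^bsub>R\<^esub> \<longrightarrow> t \<otimes>\<^bsub>R\<^esub> z = \<zero>\<^bsub>R\<^esub>)" for t r
    unfolding A_def by simp
  have A: "ideal (A r) R" if r: "r \<in> carrier R" for r
  proof -
    interpret M: module R "regular_module R" by (rule R.regular_module_module)
    have "submodule (A r) R (regular_module R)"
      unfolding M.submodule_iff
      by (auto simp: A_mem R.l_distr R.m_assoc)
    then show ?thesis using R.submodule_regular_iff by simp
  qed
  have "A ` I \<noteq> {}" using imageI[OF I.zero_closed, of A] by blast
  then obtain J where J: "J \<in> A ` I" "\<And>L. L \<in> A ` I \<Longrightarrow> J \<subseteq> L \<Longrightarrow> L = J"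
    by (rule N.ideals_maximal) (use A IR in auto)
  from J(1) obtain r where r: "r \<in> I" "J = A r" by auto
  have rR: "r \<in> carrier R" by (rule IR[OF r(1)])
  have "z = \<zero>\<^bsub>R\<^esub>" if z: "z \<in> carrier R" "r \<otimes>\<^bsub>R\<^esub> z = \<zero>\<^bsub>R\<^esub>" for z
  proof (rule ccontr)
    assume "z \<noteq> \<zero>\<^bsub>R\<^esub>"
    then obtain y where y: "y \<in> I" "z \<otimes>\<^bsub>R\<^esub> y \<noteq> \<zero>\<^bsub>R\<^esub>" using ann[OF z(1)] by auto
    have yR: "y \<in> carrier R" by (rule IR[OF y(1)])
    define w where "w = z \<otimes>\<^bsub>R\<^esub> y"
    have w: "w \<in> I" "w \<in> carrier R" "w \<noteq> \<zero>\<^bsub>R\<^esub>"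
      unfolding w_def using y z(1) yR I.I_l_closed by auto
    have rw: "r \<otimes>\<^bsub>R\<^esub> w = \<zero>\<^bsub>R\<^esub>" unfolding w_def using z rR yR R.m_assoc[of r z y] by simp
    have key: "r \<otimes>\<^bsub>R\<^esub> u = \<zero>\<^bsub>R\<^esub> \<and> w \<otimes>\<^bsub>R\<^esub> u = \<zero>\<^bsub>R\<^esub>"
      if u: "u \<in> carrier R" "(r \<oplus>\<^bsub>R\<^esub> w) \<otimes>\<^bsub>R\<^esub> u = \<zero>\<^bsub>R\<^esub>" for u
    proof -
      have sum: "r \<otimes>\<^bsub>R\<^esub> u \<oplus>\<^bsub>R\<^esub> w \<otimes>\<^bsub>R\<^esub> u = \<zero>\<^bsub>R\<^esub>" using u rR w(2) by (simp add: R.l_distr)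
      have c: "r \<otimes>\<^bsub>R\<^esub> u \<in> carrier R" "w \<otimes>\<^bsub>R\<^esub> u \<in> carrier R" using u rR w(2) by auto
      have "(r \<otimes>\<^bsub>R\<^esub> u) \<otimes>\<^bsub>R\<^esub> (w \<otimes>\<^bsub>R\<^esub> u) = (r \<otimes>\<^bsub>R\<^esub> w) \<otimes>\<^bsub>R\<^esub> (u \<otimes>\<^bsub>R\<^esub> u)"
        using u rR w(2) by (simp add: R.m_ac)
      then have zero: "(r \<otimes>\<^bsub>R\<^esub> u) \<otimes>\<^bsub>R\<^esub> (w \<otimes>\<^bsub>R\<^esub> u) = \<zero>\<^bsub>R\<^esub>" using rw u by simp
      have "(r \<otimes>\<^bsub>R\<^esub> u) \<otimes>\<^bsub>R\<^esub> (r \<otimes>\<^bsub>R\<^esub> u \<oplus>\<^bsub>R\<^esub> w \<otimes>\<^bsub>R\<^esub> u) = (r \<otimes>\<^bsub>R\<^esub> u) \<otimes>\<^bsub>R\<^esub> (r \<otimes>\<^bsub>R\<^esub> u)"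
        using R.r_distr[OF c(1,2,1)] zero c by simp
      then have "(r \<otimes>\<^bsub>R\<^esub> u) \<otimes>\<^bsub>R\<^esub> (r \<otimes>\<^bsub>R\<^esub> u) = \<zero>\<^bsub>R\<^esub>" using sum c by simp
      then have ru: "r \<otimes>\<^bsub>R\<^esub> u = \<zero>\<^bsub>R\<^esub>" by (rule reduced_square[OF red c(1)])
      then show ?thesis using sum c by simp
    qed
    have "r \<oplus>\<^bsub>R\<^esub> w \<in> I" using r(1) w(1) by auto
    moreover have "A r \<subseteq> A (r \<oplus>\<^bsub>R\<^esub> w)" unfolding A_def using key by auto
    ultimately have "A (r \<oplus>\<^bsub>R\<^esub> w) = A r" using J(2) r(2) by auto
    moreover have "w \<in> A (r \<oplus>\<^bsub>R\<^esub> w)" unfolding A_mem using key w(2) by simp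
    ultimately have "w \<in> A r" by simp
    then have "w \<otimes>\<^bsub>R\<^esub> w = \<zero>\<^bsub>R\<^esub>" using rw w(2) unfolding A_mem by simp
    then have "w = \<zero>\<^bsub>R\<^esub>" by (rule reduced_square[OF red w(2)])
    then show False using w(3) by simp
  qed
  then have "r \<in> nonzerodivisors R" unfolding nonzerodivisors_def using rR by simp
  then show ?thesis using r(1) by blast
qed

text \<open>In a reduced ring \<open>I \<inter> ann I = 0\<close>, so a map on \<open>I\<close> extends by zero to \<open>I + ann I\<close>. That ideal has
  zero annihilator, and all primes above it contain nonzerodivisors.\<close>

lemma Baer_injective_from_regular_primes:
  assumes R: "cring R" and N: "noetherian_ring R" and red: "reduced_ring R" and E: "module R E"
    and primes: "\<And>P s. primeideal P R \<Longrightarrow> s \<in> P \<Longrightarrow> s \<in> nonzerodivisors R \<Longrightarrow> maps_extend R E P"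
  shows "Baer_injective R E"
  unfolding Baer_injective_def maps_extend_def
proof (intro conjI allI impI E)
  fix I f assume I: "ideal I R" and f: "linear_map R (ideal_module R I) E f"
  interpret R: cring R by (rule R)
  interpret E: module R E by (rule E)
  interpret I: ideal I R by (rule I)
  let ?A = "regular_module R"
  note mI = R.ideal_module_module[OF I]
  have IR: "x \<in> carrier R" if "x \<in> I" for x using that I.a_subset by auto
  define J where "J = {x \<in> carrier R. \<forall>y \<in> I. x \<otimes>\<^bsub>R\<^esub> y = \<zero>\<^bsub>R\<^esub>}"
  have JR: "x \<in> carrier R" if "x \<in> J" for x using that unfolding J_def by simp
  have JI: "x \<otimes>\<^bsub>R\<^esub> y = \<zero>\<^bsub>R\<^esub>" if "x \<in> J" "y \<in> I" for x y using that unfolding J_def by simp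
  have J_add: "x \<oplus>\<^bsub>R\<^esub> y \<in> J" if "x \<in> J" "y \<in> J" for x y
    using that IR unfolding J_def by (auto simp: R.l_distr)
  have J_mult: "r \<otimes>\<^bsub>R\<^esub> x \<in> J" if "r \<in> carrier R" "x \<in> J" for r x
    using that IR unfolding J_def by (auto simp: R.m_assoc)
  have J0: "\<zero>\<^bsub>R\<^esub> \<in> J" unfolding J_def using IR by auto
  have meet: "x = \<zero>\<^bsub>R\<^esub>" if "x \<in> I" "x \<in> J" for x
    by (rule reduced_square[OF red JR[OF that(2)] JI[OF that(2,1)]])
  define G where "G = {(x \<oplus>\<^bsub>R\<^esub> j, f x) | x j. x \<in> I \<and> j \<in> J}"
  note f' = linear_mapD[OF f, unfolded ideal_module_simps]
  have GI: "(u, v) \<in> G" if "x \<in> I" "j \<in> J" "u = x \<oplus>\<^bsub>R\<^esub> j" "v = f x" for x j u v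
    using that unfolding G_def by blast
  have f0: "f \<zero>\<^bsub>R\<^esub> = \<zero>\<^bsub>E\<^esub>" using linear_map_zero[OF f mI E] by simp
  have G: "partial_hom R ?A E G"
    unfolding partial_hom_def
  proof (intro conjI allI impI ballI)
    show "G \<subseteq> carrier ?A \<times> carrier E" unfolding G_def using IR JR f'(1) by auto
    show "(\<zero>\<^bsub>?A\<^esub>, \<zero>\<^bsub>E\<^esub>) \<in> G" by (rule GI[OF I.zero_closed J0]) (simp_all add: f0)
  next
    fix u v u' v' assume "(u, v) \<in> G" "(u', v') \<in> G"
    then obtain x j x' j' where *: "x \<in> I" "j \<in> J" "u = x \<oplus>\<^bsub>R\<^esub> j" "v = f x"
      "x' \<in> I" "j' \<in> J" "u' = x' \<oplus>\<^bsub>R\<^esub> j'" "v' = f x'" unfolding G_def by blast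
    show "(u \<oplus>\<^bsub>?A\<^esub> u', v \<oplus>\<^bsub>E\<^esub> v') \<in> G"
      by (rule GI[OF I.a_closed[OF *(1,5)] J_add[OF *(2,6)]])
         (use * IR JR f'(2)[OF *(1,5)] in \<open>simp_all add: R.a_ac\<close>)
  next
    fix r u v assume r: "r \<in> carrier R" and "(u, v) \<in> G"
    then obtain x j where *: "x \<in> I" "j \<in> J" "u = x \<oplus>\<^bsub>R\<^esub> j" "v = f x" unfolding G_def by blast
    show "(r \<odot>\<^bsub>?A\<^esub> u, r \<odot>\<^bsub>E\<^esub> v) \<in> G"
      by (rule GI[OF I.I_l_closed[OF *(1) r] J_mult[OF r *(2)]])
         (use * r IR JR f'(3)[OF r *(1)] in \<open>simp_all add: R.r_distr\<close>)
  next
    fix v assume "(\<zero>\<^bsub>?A\<^esub>, v) \<in> G"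
    then obtain x j where *: "x \<in> I" "j \<in> J" "\<zero>\<^bsub>R\<^esub> = x \<oplus>\<^bsub>R\<^esub> j" "v = f x" unfolding G_def by auto
    have "x = \<ominus>\<^bsub>R\<^esub> j" using R.minus_equality[of x j] *(3) IR[OF *(1)] JR[OF *(2)] by simp
    then have "x = (\<ominus>\<^bsub>R\<^esub> \<one>\<^bsub>R\<^esub>) \<otimes>\<^bsub>R\<^esub> j" using JR[OF *(2)] by (simp add: R.l_minus)
    then have "x \<in> J" using J_mult[OF _ *(2), of "\<ominus>\<^bsub>R\<^esub> \<one>\<^bsub>R\<^esub>"] by simp
    then show "v = \<zero>\<^bsub>E\<^esub>" using meet[OF *(1)] *(4) f0 by simp
  qed
  have dom: "I \<subseteq> Domain G" "J \<subseteq> Domain G"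
  proof -
    have "(x, f x) \<in> G" if "x \<in> I" for x by (rule GI[OF that J0]) (use IR[OF that] in simp_all)
    then show "I \<subseteq> Domain G" by blast
    have "(x, f \<zero>\<^bsub>R\<^esub>) \<in> G" if "x \<in> J" for x by (rule GI[OF I.zero_closed that]) (use JR[OF that] in simp_all)
    then show "J \<subseteq> Domain G" by blast
  qed
  have "\<exists>g. linear_map R ?A E g \<and> (\<forall>x e. (x, e) \<in> G \<longrightarrow> g x = e)"
  proof (rule partial_hom_extends_from_primes[OF R N E G])
    fix P assume P: "primeideal P R" and GP: "Domain G \<subseteq> P"
    have "\<exists>s \<in> P. s \<in> nonzerodivisors R"
    proof (rule nonzerodivisor_in_ideal[OF R N red primeideal.axioms(1)[OF P]])
      fix x assume x: "x \<in> carrier R" "\<forall>y \<in> P. x \<otimes>\<^bsub>R\<^esub> y = \<zero>\<^bsub>R\<^esub>"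
      then have "x \<in> J" unfolding J_def using dom(1) GP by blast
      then have "x \<otimes>\<^bsub>R\<^esub> x = \<zero>\<^bsub>R\<^esub>" using x(2) dom(2) GP by blast
      then show "x = \<zero>\<^bsub>R\<^esub>" by (rule reduced_square[OF red x(1)])
    qed
    then show "maps_extend R E P" using primes[OF P] by blast
  qed
  then obtain g where g: "linear_map R ?A E g" "\<forall>x e. (x, e) \<in> G \<longrightarrow> g x = e" by (elim exE conjE)
  have "f x = x \<odot>\<^bsub>E\<^esub> g \<one>\<^bsub>R\<^esub>" if x: "x \<in> I" for x
  proof -
    have "(x, f x) \<in> G" by (rule GI[OF x J0]) (use IR[OF x] in simp_all)
    then show ?thesis using g(2) linear_map_regular[OF R g(1) IR[OF x]] by simp
  qed
  then show "\<exists>m \<in> carrier E. \<forall>x \<in> I. f x = x \<odot>\<^bsub>E\<^esub> m"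
    using linear_mapD(1)[OF g(1), of "\<one>\<^bsub>R\<^esub>"] by auto
qed

section \<open>Finitely generated modules in the test universe\<close>

lemma fin_gen_ideal_module:
  assumes R: "cring R" and N: "noetherian_ring R" and I: "ideal I R"
  shows "fin_gen_module R (ideal_module R I)"
proof -
  interpret R: cring R by (rule R)
  interpret N: noetherian_ring R by (rule N)
  have mA: "module R (regular_module R)" by (rule R.regular_module_module)
  have sI: "submodule I R (regular_module R)" using I R.submodule_regular_iff by simp
  obtain A where A: "A \<subseteq> carrier R" "finite A" "I = Idl\<^bsub>R\<^esub> A" using N.finetely_gen[OF I] by auto
  have "fin_gen_submodule R (regular_module R) I"
    unfolding fin_gen_submodule_def
  proof (intro exI[of _ A] conjI allI impI)
    show "A \<subseteq> I" using R.genideal_self[OF A(1)] A(3) by simp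
    show "finite A" by (rule A(2))
    fix H assume "submodule H R (regular_module R) \<and> A \<subseteq> H"
    then show "I \<subseteq> H" unfolding A(3) using R.submodule_regular_iff by (intro R.genideal_minimal) auto
  qed
  then show ?thesis using fin_gen_submodule_iff[OF mA sI] unfolding ideal_module_def by simp
qed

lemma torsion_free_ideal_module:
  assumes R: "cring R" and I: "ideal I R" shows "torsion_free R (ideal_module R I)"
proof -
  interpret R: cring R by (rule R)
  show ?thesis
    unfolding ideal_module_def
    by (rule torsion_free_submodule[OF R.torsion_free_regular]) (use I R.submodule_regular_iff in simp)
qed

lemma copy_module_surjection:
  assumes L: "module R L" and j: "inj_on j (carrier L)"
  shows "surjection R L (copy_module j L) j"
  by (rule surjection.intro[OF L copy_module(1,2)[OF L j]]) (simp add: copy_module_def Let_def)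

lemma (in surjection) fin_gen_image:
  assumes "fin_gen_module R N" shows "fin_gen_module R N'"
proof -
  obtain A where A: "A \<subseteq> carrier N" "finite A" "\<forall>H. submodule H R N \<and> A \<subseteq> H \<longrightarrow> H = carrier N"
    using assms unfolding fin_gen_module_def by blast
  have "H' = carrier N'" if H': "submodule H' R N'" "p ` A \<subseteq> H'" for H'
  proof -
    have "A \<subseteq> preim H'" using A(1) H'(2) unfolding preim_def by auto
    then have "preim H' = carrier N" using A(3) preim_submodule[OF H'(1)] by simp
    then show ?thesis using image_preim[OF H'(1)] surj by simp
  qed
  moreover have "p ` A \<subseteq> carrier N'" using A(1) surj by auto
  ultimately show ?thesis unfolding fin_gen_module_def using A(2) N' by blast
qed

lemma torsion_free_copy:
  assumes tf: "torsion_free R L" and j: "inj_on j (carrier L)"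
  shows "torsion_free R (copy_module j L)"
proof -
  have L: "module R L" using tf unfolding torsion_free_def by simp
  interpret L: module R L by (rule L)
  let ?K = "copy_module j L" and ?k = "inv_into (carrier L) j"
  note K = copy_module[OF L j]
  have car: "carrier ?K = j ` carrier L" by (simp add: copy_module_def Let_def)
  show ?thesis unfolding torsion_free_def
  proof (intro conjI ballI inj_onI K(1))
    fix s x y assume s: "s \<in> nonzerodivisors R" and x: "x \<in> carrier ?K" and y: "y \<in> carrier ?K"
      and eq: "s \<odot>\<^bsub>?K\<^esub> x = s \<odot>\<^bsub>?K\<^esub> y"
    have sR: "s \<in> carrier R" by (rule L.nonzerodivisors_simps(1)[OF s])
    have "s \<odot>\<^bsub>L\<^esub> ?k x = s \<odot>\<^bsub>L\<^esub> ?k y"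
      using linear_mapD(3)[OF K(3) sR x] linear_mapD(3)[OF K(3) sR y] eq by simp
    then have "?k x = ?k y"
      by (rule torsion_free_cancel[OF tf s linear_mapD(1)[OF K(3) x] linear_mapD(1)[OF K(3) y]])
    then show "x = y" using inv_into_injective x y car by metis
  qed
qed

lemma divisible_hom_copy:
  assumes L: "module R L" and M: "module R M" and j: "inj_on j (carrier L)"
    and div: "divisible R (hom_module R (copy_module j L) M)"
  shows "divisible R (hom_module R L M)"
  unfolding divisible_hom_iff[OF L M]
proof (intro ballI allI impI)
  fix s f assume s: "s \<in> nonzerodivisors R" and f: "linear_map R L M f"
  let ?K = "copy_module j L" and ?k = "inv_into (carrier L) j"
  note K = copy_module[OF L j]
  obtain g where g: "linear_map R ?K M g" "\<forall>x \<in> carrier ?K. f (?k x) = s \<odot>\<^bsub>M\<^esub> g x"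
    using div[unfolded divisible_hom_iff[OF K(1) M], THEN bspec, OF s, THEN spec, THEN mp,
        OF linear_map_comp[OF K(3) f]] by (elim exE conjE)
  have "f x = s \<odot>\<^bsub>M\<^esub> g (j x)" if x: "x \<in> carrier L" for x
    using bspec[OF g(2) linear_mapD(1)[OF K(2) x]] inv_into_f_f[OF j x] by simp
  then show "\<exists>g. linear_map R L M g \<and> (\<forall>x \<in> carrier L. f x = s \<odot>\<^bsub>M\<^esub> g x)"
    using linear_map_comp[OF K(2) g(1)] by blast
qed

section \<open>Local rings\<close>

lemma maximalideal_above:
  assumes R: "cring R" and N: "noetherian_ring R" and I: "ideal I R" "I \<noteq> carrier R"
  shows "\<exists>J. maximalideal J R \<and> I \<subseteq> J"
proof -
  interpret N: noetherian_ring R by (rule N)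
  let ?F = "{J. ideal J R \<and> I \<subseteq> J \<and> J \<noteq> carrier R}"
  have "?F \<noteq> {}" using I by blast
  then obtain J where J: "J \<in> ?F" "\<And>L. L \<in> ?F \<Longrightarrow> J \<subseteq> L \<Longrightarrow> L = J"
    by (rule N.ideals_maximal) auto
  have "maximalideal J R"
  proof (rule maximalidealI)
    show "ideal J R" "carrier R \<noteq> J" using J(1) by auto
    fix L assume "ideal L R" "J \<subseteq> L" "L \<subseteq> carrier R"
    then show "L = J \<or> L = carrier R" using J(1) J(2)[of L] by auto
  qed
  then show ?thesis using J(1) by blast
qed

lemma local_ring_unit:
  assumes S: "noetherian_local_ring S \<nn>" and u: "u \<in> carrier S" "u \<notin> \<nn>"
  shows "\<exists>v \<in> carrier S. v \<otimes>\<^bsub>S\<^esub> u = \<one>\<^bsub>S\<^esub>"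
proof (rule ccontr)
  assume no: "\<not> (\<exists>v \<in> carrier S. v \<otimes>\<^bsub>S\<^esub> u = \<one>\<^bsub>S\<^esub>)"
  interpret S: cring S using S unfolding noetherian_local_ring_def by simp
  have "\<one>\<^bsub>S\<^esub> \<notin> PIdl\<^bsub>S\<^esub> u" using no unfolding cgenideal_def by auto
  then have ne: "PIdl\<^bsub>S\<^esub> u \<noteq> carrier S" by auto
  have "noetherian_ring S" "\<And>J. maximalideal J S \<Longrightarrow> J = \<nn>" using S unfolding noetherian_local_ring_def by auto
  then have "PIdl\<^bsub>S\<^esub> u \<subseteq> \<nn>"
    using maximalideal_above[OF S.is_cring _ S.cgenideal_ideal[OF u(1)] ne] by auto
  then show False using S.cgenideal_self[OF u(1)] u(2) by blast
qed

text \<open>The submodules \<open>S b\<^sup>i x\<close> stabilise, so \<open>b\<^sup>n x = c b b\<^sup>n x\<close> for some \<open>n\<close> and \<open>c\<close>, and \<open>1 - c b\<close> is a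
  unit.\<close>

lemma artinian_local_nilpotent:
  assumes S: "noetherian_local_ring S \<nn>" and N: "artinian_module S N"
    and b: "b \<in> \<nn>" and x: "x \<in> carrier N"
  shows "\<exists>n :: nat. (b [^]\<^bsub>S\<^esub> n) \<odot>\<^bsub>N\<^esub> x = \<zero>\<^bsub>N\<^esub>"
proof -
  have mN: "module S N" using N unfolding artinian_module_def by simp
  interpret N: module S N by (rule mN)
  interpret n: maximalideal \<nn> S using S unfolding noetherian_local_ring_def by simp
  have bS: "b \<in> carrier S" using b n.a_subset by auto
  have bn: "b [^]\<^bsub>S\<^esub> k \<in> carrier S" for k :: nat using bS by simp
  define z where "z k = (b [^]\<^bsub>S\<^esub> k) \<odot>\<^bsub>N\<^esub> x" for k :: nat
  have zc: "z k \<in> carrier N" for k unfolding z_def using bn x by simp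
  have zSuc: "z (Suc k) = b \<odot>\<^bsub>N\<^esub> z k" for k
    unfolding z_def using N.smult_assoc1[OF bn[of k] bS x] N.smult_comm[OF bn[of k] bS x] by simp
  define H where "H k = (\<lambda>c. c \<odot>\<^bsub>N\<^esub> z k) ` carrier S" for k
  have H: "submodule (H k) S N" "z k \<in> H k" for k unfolding H_def using N.submodule_cyclic[OF zc] by auto
  have dec: "H (Suc k) \<subseteq> H k" for k
  proof
    fix y assume "y \<in> H (Suc k)"
    then obtain c where c: "c \<in> carrier S" "y = c \<odot>\<^bsub>N\<^esub> z (Suc k)" unfolding H_def by auto
    then have "y = (c \<otimes>\<^bsub>S\<^esub> b) \<odot>\<^bsub>N\<^esub> z k" using zSuc N.smult_assoc1[OF c(1) bS zc] by simp
    then show "y \<in> H k" unfolding H_def using c(1) bS by auto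
  qed
  have "\<exists>n. \<forall>i \<ge> n. H i = H n"
    by (rule N[unfolded artinian_module_def, THEN conjunct2, rule_format]) (rule conjI[OF H(1) dec])
  then obtain n where n: "\<forall>i \<ge> n. H i = H n" by (rule exE)
  have "H (Suc n) = H n" by (rule n[rule_format]) simp
  with H(2)[of n] have "z n \<in> H (Suc n)" by (simp only:)
  then obtain c where c: "c \<in> carrier S" "z n = c \<odot>\<^bsub>N\<^esub> z (Suc n)" unfolding H_def by auto
  have cb: "c \<otimes>\<^bsub>S\<^esub> b \<in> \<nn>" using n.I_l_closed[OF b c(1)] .
  have cbS: "c \<otimes>\<^bsub>S\<^esub> b \<in> carrier S" using c(1) bS by simp
  define u where "u = \<one>\<^bsub>S\<^esub> \<ominus>\<^bsub>S\<^esub> c \<otimes>\<^bsub>S\<^esub> b"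
  have uS: "u \<in> carrier S" unfolding u_def using cbS by simp
  have "u \<notin> \<nn>"
  proof
    assume "u \<in> \<nn>"
    then have "u \<oplus>\<^bsub>S\<^esub> c \<otimes>\<^bsub>S\<^esub> b \<in> \<nn>" using cb by auto
    moreover have "u \<oplus>\<^bsub>S\<^esub> c \<otimes>\<^bsub>S\<^esub> b = \<one>\<^bsub>S\<^esub>"
      unfolding u_def a_minus_def using cbS by (simp add: N.R.a_assoc N.R.l_neg)
    ultimately have "\<one>\<^bsub>S\<^esub> \<in> \<nn>" by simp
    then show False using n.one_imp_carrier n.I_notcarr by simp
  qed
  from local_ring_unit[OF S uS this] obtain v where v: "v \<in> carrier S" "v \<otimes>\<^bsub>S\<^esub> u = \<one>\<^bsub>S\<^esub>" by (rule bexE)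
  have "u \<odot>\<^bsub>N\<^esub> z n = z n \<oplus>\<^bsub>N\<^esub> \<ominus>\<^bsub>N\<^esub> ((c \<otimes>\<^bsub>S\<^esub> b) \<odot>\<^bsub>N\<^esub> z n)"
    unfolding u_def a_minus_def using cbS zc[of n] N.smult_l_distr[of "\<one>\<^bsub>S\<^esub>" "\<ominus>\<^bsub>S\<^esub> (c \<otimes>\<^bsub>S\<^esub> b)" "z n"]
      N.smult_l_minus[OF cbS zc[of n]] by simp
  also have "(c \<otimes>\<^bsub>S\<^esub> b) \<odot>\<^bsub>N\<^esub> z n = z n"
    using c(2) zSuc[of n] N.smult_assoc1[OF c(1) bS zc[of n]] by simp
  also have "z n \<oplus>\<^bsub>N\<^esub> \<ominus>\<^bsub>N\<^esub> z n = \<zero>\<^bsub>N\<^esub>" by (rule N.M.r_neg[OF zc])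
  finally have "v \<odot>\<^bsub>N\<^esub> (u \<odot>\<^bsub>N\<^esub> z n) = \<zero>\<^bsub>N\<^esub>" using v(1) by simp
  then have "z n = \<zero>\<^bsub>N\<^esub>" using N.smult_assoc1[OF v(1) uS zc[of n]] v(2) zc[of n] by simp
  then show ?thesis unfolding z_def by blast
qed

text \<open>Multiplication by \<open>r\<close> is injective on \<open>Ext\<^sup>1(R/P, E)\<close> when \<open>Ext\<^sup>1(R/Q, E) = 0\<close> for all primes \<open>Q\<close> that
  contain \<open>P\<close> and \<open>r\<close>: if \<open>r f(x) = x m\<close> on \<open>P\<close>, then \<open>x + r a \<mapsto> f(x) + a m\<close> defines a map on
  \<open>P + r R\<close>.\<close>

lemma extends_if_multiple_extends:
  assumes R: "cring R" and N: "noetherian_ring R" and E: "module R E" and P: "primeideal P R"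
    and r: "r \<in> carrier R" "r \<notin> P"
    and primes: "\<And>Q. primeideal Q R \<Longrightarrow> P \<subseteq> Q \<Longrightarrow> r \<in> Q \<Longrightarrow> maps_extend R E Q"
    and f: "linear_map R (ideal_module R P) E f"
    and m: "m \<in> carrier E" "\<forall>x \<in> P. r \<odot>\<^bsub>E\<^esub> f x = x \<odot>\<^bsub>E\<^esub> m"
  shows "\<exists>m \<in> carrier E. \<forall>x \<in> P. f x = x \<odot>\<^bsub>E\<^esub> m"
proof -
  interpret R: cring R by (rule R)
  interpret E: module R E by (rule E)
  interpret P: primeideal P R by (rule P)
  have PI: "ideal P R" by (rule primeideal.axioms(1)[OF P])
  let ?A = "regular_module R" and ?G = "{(x, f x) | x. x \<in> P}"
  have mA: "module R ?A" by (rule R.regular_module_module)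
  have G: "partial_hom R ?A E ?G" by (rule ideal_map_graph[OF R E PI f])
  have compat: "e = t \<odot>\<^bsub>E\<^esub> m" if t: "t \<in> carrier R" and e: "(t \<odot>\<^bsub>?A\<^esub> r, e) \<in> ?G" for t e
  proof -
    have tr: "t \<otimes>\<^bsub>R\<^esub> r \<in> P" "e = f (t \<otimes>\<^bsub>R\<^esub> r)" using e by auto
    then have tP: "t \<in> P" using P.I_prime[OF t r(1)] r(2) by blast
    have "e = f (r \<otimes>\<^bsub>R\<^esub> t)" using tr(2) R.m_comm[OF t r(1)] by simp
    also have "\<dots> = r \<odot>\<^bsub>E\<^esub> f t" using linear_mapD(3)[OF f r(1), of t] tP by simp
    also have "\<dots> = t \<odot>\<^bsub>E\<^esub> m" using m(2) tP by simp
    finally show ?thesis .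
  qed
  have "\<exists>G'. partial_hom R ?A E G' \<and> ?G \<subseteq> G' \<and> (r, m) \<in> G'"
    by (rule partial_hom_adjoin[OF G mA E _ m(1) compat]) (use r(1) in simp_all)
  then obtain G' where G': "partial_hom R ?A E G'" "?G \<subseteq> G'" "(r, m) \<in> G'" by (elim exE conjE)
  have "P \<subseteq> Domain G'" using G'(2) by auto
  moreover have "r \<in> Domain G'" using G'(3) by auto
  ultimately have "\<exists>g. linear_map R ?A E g \<and> (\<forall>x e. (x, e) \<in> G' \<longrightarrow> g x = e)"
    by (intro partial_hom_extends_from_primes[OF R N E G'(1)] primes) auto
  then obtain g where g: "linear_map R ?A E g" "\<forall>x e. (x, e) \<in> G' \<longrightarrow> g x = e" by (elim exE conjE)
  have "f x = x \<odot>\<^bsub>E\<^esub> g \<one>\<^bsub>R\<^esub>" if x: "x \<in> P" for x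
  proof -
    have "(x, f x) \<in> G'" using G'(2) x by auto
    then show ?thesis using g(2) linear_map_regular[OF R g(1), of x] x P.a_subset by auto
  qed
  then show ?thesis using linear_mapD(1)[OF g(1), of "\<one>\<^bsub>R\<^esub>"] by auto
qed

text \<open>Let \<open>P\<close> be maximal among the primes for which the conclusion fails, \<open>f\<close> a map on \<open>P\<close> that does
  not extend, and \<open>r \<in> \<mm> - P\<close>. As \<open>P\<close> is finitely generated, \<open>r\<^sup>n f = 0\<close> for some \<open>n\<close>; the preceding
  lemma then cancels the factors \<open>r\<close> one by one.\<close>

lemma maps_extend_from_maximal_ideal:
  assumes R: "noetherian_local_ring R \<mm>" and E: "module R E" and m: "maps_extend R E \<mm>"
    and nil: "\<And>r x. r \<in> \<mm> \<Longrightarrow> x \<in> carrier E \<Longrightarrow> \<exists>n :: nat. (r [^]\<^bsub>R\<^esub> n) \<odot>\<^bsub>E\<^esub> x = \<zero>\<^bsub>E\<^esub>"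
    and P: "primeideal P R"
  shows "maps_extend R E P"
proof (rule ccontr)
  assume no: "\<not> maps_extend R E P"
  have cR: "cring R" and N: "noetherian_ring R" and max: "maximalideal \<mm> R"
    and uniq: "\<And>J. maximalideal J R \<Longrightarrow> J = \<mm>" using R unfolding noetherian_local_ring_def by auto
  interpret R: cring R by (rule cR)
  interpret N: noetherian_ring R by (rule N)
  interpret E: module R E by (rule E)
  let ?F = "{P. primeideal P R \<and> \<not> maps_extend R E P}"
  have "?F \<noteq> {}" using P no by blast
  then obtain Q where Q: "Q \<in> ?F" "\<And>J. J \<in> ?F \<Longrightarrow> Q \<subseteq> J \<Longrightarrow> J = Q"
    by (rule N.ideals_maximal) (auto dest: primeideal.axioms(1))
  then have Qp: "primeideal Q R" and Qno: "\<not> maps_extend R E Q" by auto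
  interpret Q: primeideal Q R by (rule Qp)
  have QI: "ideal Q R" by (rule primeideal.axioms(1)[OF Qp])
  have "Q \<noteq> carrier R" using Q.I_notcarr by simp
  from maximalideal_above[OF cR N QI this] have "Q \<subseteq> \<mm>" using uniq by auto
  moreover have "Q \<noteq> \<mm>" using Qno m by auto
  ultimately obtain r where r: "r \<in> \<mm>" "r \<notin> Q" by auto
  have rR: "r \<in> carrier R"
    using r(1) additive_subgroup.a_subset[OF ideal.axioms(1)[OF maximalideal.axioms(1)[OF max]]] by auto
  have rn: "r [^]\<^bsub>R\<^esub> n \<in> carrier R" for n :: nat using rR by simp
  obtain f where f: "linear_map R (ideal_module R Q) E f"
    and fno: "\<not> (\<exists>m \<in> carrier E. \<forall>x \<in> Q. f x = x \<odot>\<^bsub>E\<^esub> m)"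
    using Qno unfolding maps_extend_def by blast
  note mQ = R.ideal_module_module[OF QI]
  define ok where "ok n \<longleftrightarrow> (\<exists>m \<in> carrier E. \<forall>x \<in> Q. (r [^]\<^bsub>R\<^esub> n) \<odot>\<^bsub>E\<^esub> f x = x \<odot>\<^bsub>E\<^esub> m)" for n :: nat
  have fval: "f x \<in> carrier E" if "x \<in> Q" for x using linear_mapD(1)[OF f, of x] that by simp
  have "\<not> ok 0"
  proof
    assume "ok 0"
    then obtain m where "m \<in> carrier E" "\<forall>x \<in> Q. (r [^]\<^bsub>R\<^esub> (0 :: nat)) \<odot>\<^bsub>E\<^esub> f x = x \<odot>\<^bsub>E\<^esub> m" unfolding ok_def by (rule bexE)
    then show False using fno fval by auto
  qed
  moreover have "ok n" if Suc: "ok (Suc n)" for n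
  proof -
    obtain m where m: "m \<in> carrier E" "\<forall>x \<in> Q. (r [^]\<^bsub>R\<^esub> Suc n) \<odot>\<^bsub>E\<^esub> f x = x \<odot>\<^bsub>E\<^esub> m"
      using Suc unfolding ok_def by (rule bexE)
    have "r \<odot>\<^bsub>E\<^esub> ((r [^]\<^bsub>R\<^esub> n) \<odot>\<^bsub>E\<^esub> f x) = x \<odot>\<^bsub>E\<^esub> m" if x: "x \<in> Q" for x
      using bspec[OF m(2) x] E.smult_assoc1[OF rn[of n] rR fval[OF x]] E.smult_comm[OF rn[of n] rR fval[OF x]] by simp
    then have "\<forall>x \<in> Q. r \<odot>\<^bsub>E\<^esub> ((r [^]\<^bsub>R\<^esub> n) \<odot>\<^bsub>E\<^esub> f x) = x \<odot>\<^bsub>E\<^esub> m" by blast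
    moreover have "maps_extend R E Q'" if Q': "primeideal Q' R" "Q \<subseteq> Q'" "r \<in> Q'" for Q'
    proof (rule ccontr)
      assume "\<not> maps_extend R E Q'"
      then have "Q' = Q" using Q(2)[of Q'] Q'(1,2) by simp
      then show False using Q'(3) r(2) by simp
    qed
    ultimately show ?thesis unfolding ok_def
      by (intro extends_if_multiple_extends[OF cR N E Qp rR r(2) _ linear_map_smult[OF f mQ E rn] m(1)]) simp_all
  qed
  ultimately have none: "\<not> ok n" for n by (induction n) auto
  obtain A where A: "A \<subseteq> carrier (ideal_module R Q)" "finite A"
    "\<forall>H. submodule H R (ideal_module R Q) \<and> A \<subseteq> H \<longrightarrow> H = carrier (ideal_module R Q)"
    using fin_gen_ideal_module[OF cR N QI] unfolding fin_gen_module_def by blast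
  have "\<exists>n :: nat. \<forall>x \<in> A. (r [^]\<^bsub>R\<^esub> n) \<odot>\<^bsub>E\<^esub> f x = \<zero>\<^bsub>E\<^esub>" using A(2,1)
  proof induction
    case (insert a A)
    then obtain n :: nat where n: "\<forall>x \<in> A. (r [^]\<^bsub>R\<^esub> n) \<odot>\<^bsub>E\<^esub> f x = \<zero>\<^bsub>E\<^esub>" by auto
    have aQ: "a \<in> Q" and AQ: "A \<subseteq> Q" using insert.prems by auto
    obtain k :: nat where k: "(r [^]\<^bsub>R\<^esub> k) \<odot>\<^bsub>E\<^esub> f a = \<zero>\<^bsub>E\<^esub>" using nil[OF r(1) fval[OF aQ]] by (rule exE)
    have "(r [^]\<^bsub>R\<^esub> (n + k)) \<odot>\<^bsub>E\<^esub> f x = \<zero>\<^bsub>E\<^esub>" if x: "x \<in> insert a A" for x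
    proof -
      have xQ: "x \<in> Q" using x aQ AQ by auto
      have "(r [^]\<^bsub>R\<^esub> (n + k)) \<odot>\<^bsub>E\<^esub> f x = (r [^]\<^bsub>R\<^esub> n) \<odot>\<^bsub>E\<^esub> ((r [^]\<^bsub>R\<^esub> k) \<odot>\<^bsub>E\<^esub> f x)"
        using E.smult_assoc1[OF rn rn fval[OF xQ], of n k] rR by (simp add: R.nat_pow_mult)
      moreover have "\<dots> = (r [^]\<^bsub>R\<^esub> k) \<odot>\<^bsub>E\<^esub> ((r [^]\<^bsub>R\<^esub> n) \<odot>\<^bsub>E\<^esub> f x)" by (rule E.smult_comm[OF rn rn fval[OF xQ]])
      ultimately show ?thesis using x n k rn by auto
    qed
    then show ?case by blast
  qed simp
  then obtain n :: nat where n: "\<forall>x \<in> A. (r [^]\<^bsub>R\<^esub> n) \<odot>\<^bsub>E\<^esub> f x = \<zero>\<^bsub>E\<^esub>" by (rule exE)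
  have "submodule {x \<in> carrier (ideal_module R Q). (r [^]\<^bsub>R\<^esub> n) \<odot>\<^bsub>E\<^esub> f x \<in> {\<zero>\<^bsub>E\<^esub>}} R (ideal_module R Q)"
    by (rule submodule_preimage[OF linear_map_smult[OF f mQ E rn] mQ E E.submodule_zero])
  moreover have "A \<subseteq> {x \<in> carrier (ideal_module R Q). (r [^]\<^bsub>R\<^esub> n) \<odot>\<^bsub>E\<^esub> f x \<in> {\<zero>\<^bsub>E\<^esub>}}" using A(1) n by auto
  ultimately have "{x \<in> carrier (ideal_module R Q). (r [^]\<^bsub>R\<^esub> n) \<odot>\<^bsub>E\<^esub> f x \<in> {\<zero>\<^bsub>E\<^esub>}} = carrier (ideal_module R Q)"
    using A(3) by blast
  then have zero: "(r [^]\<^bsub>R\<^esub> n) \<odot>\<^bsub>E\<^esub> f x = \<zero>\<^bsub>E\<^esub>" if "x \<in> Q" for x using that by auto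
  have "ok n" unfolding ok_def
  proof (rule bexI[of _ "\<zero>\<^bsub>E\<^esub>"])
    show "\<forall>x \<in> Q. (r [^]\<^bsub>R\<^esub> n) \<odot>\<^bsub>E\<^esub> f x = x \<odot>\<^bsub>E\<^esub> \<zero>\<^bsub>E\<^esub>" using zero Q.a_subset by auto
  qed simp
  then show False using none by simp
qed

lemma restrict_scalars_module:
  assumes R: "cring R" and N: "module S N" and \<phi>: "\<phi> \<in> ring_hom R S"
  shows "module R (restrict_scalars \<phi> N)"
proof -
  interpret N: module S N by (rule N)
  interpret R: cring R by (rule R)
  have ph: "\<phi> r \<in> carrier S" if "r \<in> carrier R" for r using ring_hom_closed[OF \<phi> that] .
  show ?thesis
  proof (rule moduleI)
    show "abelian_group (restrict_scalars \<phi> N)"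
      by (rule abelian_groupI; unfold restrict_scalars_simps)
         (auto intro: N.M.a_assoc N.M.a_comm N.M.l_neg)
  qed (use \<phi> in \<open>auto simp: R.is_cring ph ring_hom_add ring_hom_mult ring_hom_one
        N.smult_l_distr N.smult_r_distr N.smult_assoc1\<close>)
qed

section \<open>Cogenerators\<close>

lemma Coass_hom_nonzero:
  assumes L: "module R L" and M: "module R M" and P: "P \<in> Coass R (hom_module R L M)"
  shows "\<exists>f x. linear_map R L M f \<and> x \<in> carrier L \<and> f x \<noteq> \<zero>\<^bsub>M\<^esub>"
proof (rule ccontr)
  assume no: "\<not> ?thesis"
  let ?N = "hom_module R L M"
  have mN: "module R ?N" by (rule hom_module_module[OF L M])
  interpret N: module R ?N by (rule mN)
  obtain K where K: "hollow_above R ?N K" using P unfolding Coass_iff[OF mN] by (elim conjE exE)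
  note sK = hollow_aboveD(1)[OF K]
  have "f \<in> K" if f: "f \<in> carrier ?N" for f
  proof -
    have f': "f \<in> module_hom R L M" using f by simp
    have "f = \<zero>\<^bsub>?N\<^esub>" unfolding hom_module_simps
      by (rule module_hom_eqI[of _ L]) (use f' no module_homD[OF f'] in \<open>auto simp: module_hom_iff\<close>)
    then show ?thesis using sK unfolding N.submodule_iff by simp
  qed
  then have "K = carrier ?N" using N.submoduleE(1)[OF sK] by blast
  then show False using hollow_aboveD(2)[OF K] by simp
qed

lemma simple_module_fin_gen:
  assumes "simple_module R L" shows "fin_gen_module R L"
proof -
  have L: "module R L" and ne: "carrier L \<noteq> {\<zero>\<^bsub>L\<^esub>}"
    and simple: "\<forall>H. submodule H R L \<longrightarrow> H = {\<zero>\<^bsub>L\<^esub>} \<or> H = carrier L"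
    using assms unfolding simple_module_def by auto
  interpret L: module R L by (rule L)
  obtain x where x: "x \<in> carrier L" "x \<noteq> \<zero>\<^bsub>L\<^esub>" using ne L.M.zero_closed by blast
  have "\<forall>H. submodule H R L \<and> {x} \<subseteq> H \<longrightarrow> H = carrier L" using simple x(2) by blast
  then show ?thesis unfolding fin_gen_module_def using L x(1) by (intro conjI exI[of _ "{x}"]) auto
qed

lemma (in surjection) simple_if_maximal_kernel:
  assumes ker: "preim {\<zero>\<^bsub>N'\<^esub>} \<noteq> carrier N"
    and max: "\<And>H. submodule H R N \<Longrightarrow> preim {\<zero>\<^bsub>N'\<^esub>} \<subseteq> H \<Longrightarrow> H = preim {\<zero>\<^bsub>N'\<^esub>} \<or> H = carrier N"
  shows "simple_module R N'"
proof -
  interpret N': module R N' by (rule N')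
  have "carrier N' \<noteq> {\<zero>\<^bsub>N'\<^esub>}"
  proof
    assume "carrier N' = {\<zero>\<^bsub>N'\<^esub>}"
    then have "preim {\<zero>\<^bsub>N'\<^esub>} = carrier N" using linear_mapD(1)[OF lin] unfolding preim_def by auto
    then show False using ker by simp
  qed
  moreover have "H = {\<zero>\<^bsub>N'\<^esub>} \<or> H = carrier N'" if H: "submodule H R N'" for H
  proof -
    have "preim H = preim {\<zero>\<^bsub>N'\<^esub>} \<or> preim H = carrier N"
      by (rule max[OF preim_submodule[OF H] kernel_in_preim[OF H]])
    then show ?thesis
    proof
      assume "preim H = preim {\<zero>\<^bsub>N'\<^esub>}"
      then have "p ` preim H = p ` preim {\<zero>\<^bsub>N'\<^esub>}" by (rule arg_cong)
      then show ?thesis unfolding image_preim[OF H] image_preim[OF N'.submodule_zero] by simp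
    next
      assume "preim H = carrier N"
      then have "p ` preim H = p ` carrier N" by (rule arg_cong)
      then show ?thesis unfolding image_preim[OF H] surj by simp
    qed
  qed
  ultimately show ?thesis unfolding simple_module_def using N' by blast
qed

lemma surjection_comp:
  assumes "surjection R L M f" "surjection R M N g"
  shows "surjection R L N (\<lambda>x. g (f x))"
proof -
  interpret f: surjection R L M f by fact
  interpret g: surjection R M N g by fact
  have "(\<lambda>x. g (f x)) ` carrier L = g ` f ` carrier L" by (simp add: image_image)
  then show ?thesis
    by (intro surjection.intro f.N g.N' linear_map_comp[OF f.lin g.lin]) (simp add: f.surj g.surj)
qed

text \<open>A copy of \<open>R/J\<close> in a type that admits an injection from \<open>R\<close>: cosets are represented by the
  images of chosen members.\<close>

lemma residue_field_copy:
  fixes \<iota> :: "'a \<Rightarrow> 'u"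
  assumes R: "cring R" and J: "maximalideal J R" and \<iota>: "inj_on \<iota> (carrier R)"
  shows "\<exists>(L :: ('a, 'u) module) k. surjection R (regular_module R) L k \<and>
    (\<forall>x \<in> carrier R. k x = \<zero>\<^bsub>L\<^esub> \<longleftrightarrow> x \<in> J)"
proof -
  interpret R: cring R by (rule R)
  let ?A = "regular_module R" and ?Q = "quot_module (regular_module R) J"
  have mA: "module R ?A" by (rule R.regular_module_module)
  interpret A: module R ?A by (rule mA)
  have sJ: "submodule J R ?A" using maximalideal.axioms(1)[OF J] R.submodule_regular_iff by simp
  have S: "surjection R ?A ?Q (\<lambda>x. J +>\<^bsub>?A\<^esub> x)" by (rule A.surjection_quot_module[OF sJ])
  have Q: "module R ?Q" by (rule A.quot_module(1)[OF sJ])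
  interpret Q: module R ?Q by (rule Q)
  define rep where "rep X = (SOME x. x \<in> carrier R \<and> J +>\<^bsub>?A\<^esub> x = X)" for X
  have rep: "rep X \<in> carrier R \<and> J +>\<^bsub>?A\<^esub> rep X = X" if "X \<in> carrier ?Q" for X
  proof -
    have "\<exists>x. x \<in> carrier R \<and> J +>\<^bsub>?A\<^esub> x = X" using that unfolding quot_module_carrier by auto
    from someI_ex[OF this] show ?thesis unfolding rep_def .
  qed
  let ?j = "\<lambda>X. \<iota> (rep X)"
  have j: "inj_on ?j (carrier ?Q)"
  proof (rule inj_onI)
    fix X Y assume X: "X \<in> carrier ?Q" and Y: "Y \<in> carrier ?Q" and "\<iota> (rep X) = \<iota> (rep Y)"
    then have "rep X = rep Y" using inj_onD[OF \<iota>] rep[OF X] rep[OF Y] by blast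
    then show "X = Y" using rep[OF X] rep[OF Y] by metis
  qed
  let ?L = "copy_module ?j ?Q"
  have C: "surjection R ?Q ?L ?j" by (rule copy_module_surjection[OF Q j])
  have "surjection R ?A ?L (\<lambda>x. ?j (J +>\<^bsub>?A\<^esub> x))" by (rule surjection_comp[OF S C])
  moreover have "?j (J +>\<^bsub>?A\<^esub> x) = \<zero>\<^bsub>?L\<^esub> \<longleftrightarrow> x \<in> J" if x: "x \<in> carrier R" for x
  proof -
    have Xc: "J +>\<^bsub>?A\<^esub> x \<in> carrier ?Q" unfolding quot_module_carrier using x by simp
    have "\<zero>\<^bsub>?L\<^esub> = ?j \<zero>\<^bsub>?Q\<^esub>" by (simp add: copy_module_def Let_def)
    then have "?j (J +>\<^bsub>?A\<^esub> x) = \<zero>\<^bsub>?L\<^esub> \<longleftrightarrow> J +>\<^bsub>?A\<^esub> x = \<zero>\<^bsub>?Q\<^esub>"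
      using inj_on_eq_iff[OF j Xc Q.M.zero_closed] by simp
    then show ?thesis using A.quot_module(3)[OF sJ, of x] x by simp
  qed
  ultimately show ?thesis by blast
qed

text \<open>Let \<open>x \<noteq> 0\<close> in \<open>N\<close>, and let \<open>J\<close> be a maximal ideal above the annihilator of \<open>x\<close>. The
  hypothesis gives a nonzero map \<open>R/J \<rightarrow> M\<close>; its composite with \<open>R x \<rightarrow> R/J\<close> extends to \<open>N\<close>.\<close>

lemma nonzero_map_if_simple_Coass:
  fixes \<iota> :: "'a \<Rightarrow> 'u"
  assumes R: "cring R" and Noeth: "noetherian_ring R" and E: "Baer_injective R E"
    and \<iota>: "inj_on \<iota> (carrier R)"
    and simple: "\<And>L :: ('a, 'u) module. simple_module R L \<Longrightarrow> Coass R (hom_module R L E) = Ass R L"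
    and N: "module R N" and ne: "carrier N \<noteq> {\<zero>\<^bsub>N\<^esub>}"
  shows "\<exists>f x. linear_map R N E f \<and> x \<in> carrier N \<and> f x \<noteq> \<zero>\<^bsub>E\<^esub>"
proof -
  interpret R: cring R by (rule R)
  interpret N: module R N by (rule N)
  have mE: "module R E" using E unfolding Baer_injective_def by simp
  interpret E: module R E by (rule mE)
  let ?A = "regular_module R"
  have mA: "module R ?A" by (rule R.regular_module_module)
  obtain x where x: "x \<in> carrier N" "x \<noteq> \<zero>\<^bsub>N\<^esub>" using ne N.M.zero_closed by blast
  let ?I = "{r \<in> carrier R. r \<odot>\<^bsub>N\<^esub> x \<in> {\<zero>\<^bsub>N\<^esub>}}"
  have I: "ideal ?I R" by (rule N.colon_ideal[OF N.submodule_zero x(1)])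
  have "\<one>\<^bsub>R\<^esub> \<notin> ?I" using x by simp
  then have "?I \<noteq> carrier R" using R.one_closed by blast
  from maximalideal_above[OF R Noeth I this] obtain J where J: "maximalideal J R" "?I \<subseteq> J" by (elim exE conjE)
  interpret J: maximalideal J R by (rule J(1))
  have JI: "ideal J R" by (rule maximalideal.axioms(1)[OF J(1)])
  obtain L :: "('a, 'u) module" and k where S: "surjection R ?A L k"
    and k0: "\<forall>x \<in> carrier R. k x = \<zero>\<^bsub>L\<^esub> \<longleftrightarrow> x \<in> J"
    using residue_field_copy[OF R J(1) \<iota>] by (elim exE conjE)
  interpret S: surjection R ?A L k by (rule S)
  interpret L: module R L by (rule S.N')
  have JR: "J \<subseteq> carrier R" by (rule additive_subgroup.a_subset[OF ideal.axioms(1)[OF JI]])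
  have pre: "S.preim {\<zero>\<^bsub>L\<^esub>} = J" unfolding S.preim_def using k0 JR by auto
  have sL: "simple_module R L"
  proof (rule S.simple_if_maximal_kernel; unfold pre)
    show "J \<noteq> carrier ?A" using J.I_notcarr by simp
    fix H assume H: "submodule H R ?A" "J \<subseteq> H"
    have "ideal H R" using H(1) R.submodule_regular_iff by simp
    moreover have "H \<subseteq> carrier R" using module.submoduleE(1)[OF mA H(1)] by simp
    ultimately show "H = J \<or> H = carrier ?A" using J.I_maximal[of H] H(2) by simp
  qed
  have k1: "k \<one>\<^bsub>R\<^esub> \<in> carrier L" using linear_mapD(1)[OF S.lin, of "\<one>\<^bsub>R\<^esub>"] by simp
  have kr: "k r = r \<odot>\<^bsub>L\<^esub> k \<one>\<^bsub>R\<^esub>" if "r \<in> carrier R" for r by (rule linear_map_regular[OF R S.lin that])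
  have ann: "a \<odot>\<^bsub>L\<^esub> k \<one>\<^bsub>R\<^esub> = \<zero>\<^bsub>L\<^esub> \<longleftrightarrow> a \<in> J" if a: "a \<in> carrier R" for a
    using bspec[OF k0 a] by (simp only: kr[OF a])
  have "J = {a \<in> carrier R. a \<odot>\<^bsub>L\<^esub> k \<one>\<^bsub>R\<^esub> = \<zero>\<^bsub>L\<^esub>}"
    by (rule equalityI; rule subsetI) (use ann JR in blast)+
  then have "J \<in> Ass R L" unfolding Ass_def using R.maximalideal_prime[OF J(1)] k1 by blast
  then have "J \<in> Coass R (hom_module R L E)" using simple[OF sL] by simp
  from Coass_hom_nonzero[OF L.module_axioms mE this]
  obtain h u where h: "linear_map R L E h" and u: "u \<in> carrier L" "h u \<noteq> \<zero>\<^bsub>E\<^esub>" by (elim exE conjE)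
  have hk: "linear_map R ?A E (\<lambda>r. h (k r))" by (rule linear_map_comp[OF S.lin h])
  have mul: "linear_map R ?A N (\<lambda>r. r \<odot>\<^bsub>N\<^esub> x)"
    unfolding linear_map_def using x(1) by (auto simp: N.smult_l_distr N.smult_assoc1)
  have "\<exists>g. linear_map R N E g \<and> (\<forall>r \<in> carrier ?A. g (r \<odot>\<^bsub>N\<^esub> x) = h (k r))"
  proof (rule Baer_injective_extends[OF E mA N mul hk])
    fix r assume "r \<in> carrier ?A" "r \<odot>\<^bsub>N\<^esub> x = \<zero>\<^bsub>N\<^esub>"
    then have "r \<in> J" using J(2) by auto
    then have "k r = \<zero>\<^bsub>L\<^esub>" using k0 JR by auto
    then show "h (k r) = \<zero>\<^bsub>E\<^esub>" using linear_map_zero[OF h L.module_axioms mE] by simp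
  qed
  then obtain g where g: "linear_map R N E g" "\<forall>r \<in> carrier ?A. g (r \<odot>\<^bsub>N\<^esub> x) = h (k r)" by (elim exE conjE)
  from u(1) have "u \<in> k ` carrier ?A" by (simp only: S.surj)
  then obtain r where r: "u = k r" "r \<in> carrier ?A" by (rule imageE)
  have "g (r \<odot>\<^bsub>N\<^esub> x) \<noteq> \<zero>\<^bsub>E\<^esub>" using bspec[OF g(2) r(2)] r(1) u(2) by simp
  moreover have "r \<odot>\<^bsub>N\<^esub> x \<in> carrier N" using r(2) x(1) by simp
  ultimately show ?thesis using g(1) by blast
qed

lemma module_hom_nonzero_iff:
  assumes L: "module R L" and M: "module R M"
  shows "carrier (hom_module R L M) \<noteq> {\<zero>\<^bsub>hom_module R L M\<^esub>} \<longleftrightarrow>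
    (\<exists>f x. linear_map R L M f \<and> x \<in> carrier L \<and> f x \<noteq> \<zero>\<^bsub>M\<^esub>)"
proof
  interpret N: module R "hom_module R L M" by (rule hom_module_module[OF L M])
  assume "carrier (hom_module R L M) \<noteq> {\<zero>\<^bsub>hom_module R L M\<^esub>}"
  then obtain f where f: "f \<in> module_hom R L M" "f \<noteq> (\<lambda>x \<in> carrier L. \<zero>\<^bsub>M\<^esub>)"
    using N.M.zero_closed by auto
  have "\<exists>x \<in> carrier L. f x \<noteq> \<zero>\<^bsub>M\<^esub>"
  proof (rule ccontr)
    assume "\<not> (\<exists>x \<in> carrier L. f x \<noteq> \<zero>\<^bsub>M\<^esub>)"
    then have "f = (\<lambda>x \<in> carrier L. \<zero>\<^bsub>M\<^esub>)"
      by (intro module_hom_eqI[of _ L]) (use f(1) in \<open>auto simp: module_hom_iff\<close>)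
    then show False using f(2) by simp
  qed
  then show "\<exists>f x. linear_map R L M f \<and> x \<in> carrier L \<and> f x \<noteq> \<zero>\<^bsub>M\<^esub>" using module_homD[OF f(1)] by blast
next
  assume "\<exists>f x. linear_map R L M f \<and> x \<in> carrier L \<and> f x \<noteq> \<zero>\<^bsub>M\<^esub>"
  then obtain f x where f: "linear_map R L M f" "x \<in> carrier L" "f x \<noteq> \<zero>\<^bsub>M\<^esub>" by (elim exE conjE)
  have "restrict f (carrier L) \<noteq> \<zero>\<^bsub>hom_module R L M\<^esub>"
  proof
    assume "restrict f (carrier L) = \<zero>\<^bsub>hom_module R L M\<^esub>"
    from fun_cong[OF this, of x] show False using f(2,3) by simp
  qed
  then show "carrier (hom_module R L M) \<noteq> {\<zero>\<^bsub>hom_module R L M\<^esub>}"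
    using restrict_module_hom[OF f(1) L] by auto
qed

section \<open>The characterisations of injectivity\<close>

text \<open>The implications are (a) to (b) to (d) to (f), (a) to (c) to (d), (a) to (e) to (f), (f) to (a), and
  (a) to (g) to (a). For (d) to (f), a prime is copied into the universe of test modules.\<close>

lemma injective_characterisations:
  fixes R :: "('a, 'r) ring_scheme" and M :: "('a, 'm, 'q) module_scheme" and \<iota> :: "'a \<Rightarrow> 'u"
  assumes R: "cring R" and N: "noetherian_ring R" and red: "reduced_ring R" and M: "module R M"
    and \<iota>: "inj_on \<iota> (carrier R)"
  shows
    "Baer_injective R M \<longleftrightarrow>
       (\<forall>L :: ('a, 'u) module. fin_gen_module R L \<longrightarrow> Coass R (hom_module R L M) \<subseteq> Ass R L)" (is "?a \<longleftrightarrow> ?b")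
    "Baer_injective R M \<longleftrightarrow>
       (\<forall>L :: ('a, 'u) module. torsion_free R L \<longrightarrow> h_divisible R (hom_module R L M))" (is "_ \<longleftrightarrow> ?c")
    "Baer_injective R M \<longleftrightarrow>
       (\<forall>L :: ('a, 'u) module. fin_gen_module R L \<and> torsion_free R L \<longrightarrow> divisible R (hom_module R L M))"
      (is "_ \<longleftrightarrow> ?d")
    "Baer_injective R M \<longleftrightarrow>
       (\<forall>P. primeideal P R \<longrightarrow> h_divisible R (hom_module R (ideal_module R P) M))" (is "_ \<longleftrightarrow> ?e")
    "Baer_injective R M \<longleftrightarrow>
       (\<forall>P. primeideal P R \<longrightarrow> divisible R (hom_module R (ideal_module R P) M))" (is "_ \<longleftrightarrow> ?f")
    "Baer_injective R M \<longleftrightarrow>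
       (\<forall>P. primeideal P R \<longrightarrow> divisible R (ext1_module R (residue_module R P) M))" (is "_ \<longleftrightarrow> ?g")
proof -
  interpret R: cring R by (rule R)
  have id: "ideal P R" if "primeideal P R" for P by (rule primeideal.axioms(1)[OF that])
  have res: "module R (residue_module R P)" if "primeideal P R" for P
    unfolding residue_module_def
    by (rule module.quot_module(1)[OF R.regular_module_module]) (use id[OF that] R.submodule_regular_iff in simp)
  have ab: ?b if ?a using Coass_hom_subset_Ass[OF N that] by blast
  have bd: ?d if ?b
  proof (intro allI impI)
    fix L :: "('a, 'u) module" assume L: "fin_gen_module R L \<and> torsion_free R L"
    show "divisible R (hom_module R L M)"
      by (rule divisible_hom_if_Coass_subset_Ass[OF N conjunct2[OF L] M]) (use that L in blast)
  qed
  have ac: ?c if ?a using h_divisible_hom[OF that] by blast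
  have cd: ?d if ?c using that h_divisible_imp_divisible by blast
  have df: ?f if d: ?d
  proof (intro allI impI)
    fix P assume P: "primeideal P R"
    let ?P = "ideal_module R P"
    have mP: "module R ?P" by (rule R.ideal_module_module[OF id[OF P]])
    have j: "inj_on \<iota> (carrier ?P)"
      using \<iota> additive_subgroup.a_subset[OF ideal.axioms(1)[OF id[OF P]]] by (auto intro: inj_on_subset)
    have "fin_gen_module R (copy_module \<iota> ?P)"
      by (rule surjection.fin_gen_image[OF copy_module_surjection[OF mP j] fin_gen_ideal_module[OF R N id[OF P]]])
    moreover have "torsion_free R (copy_module \<iota> ?P)"
      by (rule torsion_free_copy[OF torsion_free_ideal_module[OF R id[OF P]] j])
    ultimately have "divisible R (hom_module R (copy_module \<iota> ?P) M)" using d by blast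
    then show "divisible R (hom_module R ?P M)" by (rule divisible_hom_copy[OF mP M j])
  qed
  have ae: ?e if ?a using h_divisible_hom[OF that torsion_free_ideal_module[OF R id]] by blast
  have ef: ?f if ?e using that h_divisible_imp_divisible by blast
  have fa: ?a if f: ?f
  proof (rule Baer_injective_from_regular_primes[OF R N red M])
    fix P s assume P: "primeideal P R" and s: "s \<in> P" "s \<in> nonzerodivisors R"
    show "maps_extend R M P"
      by (rule maps_extend_if_divisible_hom[OF M id[OF P] s(2,1)]) (use f P in blast)
  qed
  have ag: ?g if ?a using divisible_ext1_if_injective[OF that res] by blast
  have ga: ?a if g: ?g
  proof (rule Baer_injective_from_regular_primes[OF R N red M])
    fix P s assume P: "primeideal P R" and s: "s \<in> P" "s \<in> nonzerodivisors R"
    show "maps_extend R M P"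
      by (rule maps_extend_if_divisible_ext1[OF M id[OF P] s(2,1)]) (use g P in blast)
  qed
  show "?a \<longleftrightarrow> ?b" using ab bd df fa by (intro iffI) simp_all
  show "?a \<longleftrightarrow> ?c" using ac cd df fa by (intro iffI) simp_all
  show "?a \<longleftrightarrow> ?d" using ac cd df fa by (intro iffI) simp_all
  show "?a \<longleftrightarrow> ?e" using ae ef fa by (intro iffI) simp_all
  show "?a \<longleftrightarrow> ?f" using ae ef fa by (intro iffI) simp_all
  show "?a \<longleftrightarrow> ?g" using ag ga by (intro iffI) simp_all
qed

lemma ring_hom_nat_pow:
  assumes R: "cring R" and S: "cring S" and \<phi>: "\<phi> \<in> ring_hom R S" and r: "r \<in> carrier R"
  shows "\<phi> (r [^]\<^bsub>R\<^esub> (n :: nat)) = \<phi> r [^]\<^bsub>S\<^esub> n"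
proof -
  interpret R: cring R by (rule R)
  interpret S: cring S by (rule S)
  show ?thesis
    using r by (induction n) (simp_all add: ring_hom_one[OF \<phi>] ring_hom_mult[OF \<phi>])
qed

text \<open>Regular elements of \<open>R\<close> that lie in some prime lie in \<open>\<mm>\<close>. If there are any, the hypothesis extends
  the maps on \<open>\<mm>\<close>, and nilpotence passes this on to all primes.\<close>

lemma local_injective_characterisations:
  assumes red: "reduced_ring R" and R: "noetherian_local_ring R \<mm>" and S: "noetherian_local_ring S \<nn>"
    and \<phi>: "\<phi> \<in> ring_hom R S" "\<phi> ` \<mm> \<subseteq> \<nn>" and N: "artinian_module S N"
  defines "M \<equiv> restrict_scalars \<phi> N"
  shows "Baer_injective R M \<longleftrightarrow> divisible R (hom_module R (ideal_module R \<mm>) M)" (is "?a \<longleftrightarrow> ?f")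
    and "Baer_injective R M \<longleftrightarrow> divisible R (ext1_module R (residue_module R \<mm>) M)" (is "_ \<longleftrightarrow> ?g")
proof -
  have cR: "cring R" and NR: "noetherian_ring R" and max: "maximalideal \<mm> R"
    and uniq: "\<And>J. maximalideal J R \<Longrightarrow> J = \<mm>" using R unfolding noetherian_local_ring_def by auto
  have cS: "cring S" using S unfolding noetherian_local_ring_def by auto
  interpret R: cring R by (rule cR)
  have mN: "module S N" using N unfolding artinian_module_def by simp
  have M: "module R M" unfolding M_def by (rule restrict_scalars_module[OF cR mN \<phi>(1)])
  have m: "ideal \<mm> R" by (rule maximalideal.axioms(1)[OF max])
  have mc: "\<mm> \<subseteq> carrier R" by (rule additive_subgroup.a_subset[OF ideal.axioms(1)[OF m]])
  have res: "module R (residue_module R \<mm>)"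
    unfolding residue_module_def
    by (rule module.quot_module(1)[OF R.regular_module_module]) (use m R.submodule_regular_iff in simp)
  have nil: "\<exists>n :: nat. (r [^]\<^bsub>R\<^esub> n) \<odot>\<^bsub>M\<^esub> x = \<zero>\<^bsub>M\<^esub>" if r: "r \<in> \<mm>" and x: "x \<in> carrier M" for r x
  proof -
    have rR: "r \<in> carrier R" using r mc by blast
    have "\<phi> r \<in> \<nn>" using r \<phi>(2) by blast
    then have "\<exists>n :: nat. (\<phi> r [^]\<^bsub>S\<^esub> n) \<odot>\<^bsub>N\<^esub> x = \<zero>\<^bsub>N\<^esub>"
      by (rule artinian_local_nilpotent[OF S N]) (use x in \<open>simp add: M_def\<close>)
    then show ?thesis unfolding M_def by (simp add: ring_hom_nat_pow[OF cR cS \<phi>(1) rR])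
  qed
  have suff: ?a if ext: "\<And>s. s \<in> \<mm> \<Longrightarrow> s \<in> nonzerodivisors R \<Longrightarrow> maps_extend R M \<mm>"
  proof (rule Baer_injective_from_regular_primes[OF cR NR red M])
    fix P s assume P: "primeideal P R" and s: "s \<in> P" "s \<in> nonzerodivisors R"
    have "P \<noteq> carrier R" using primeideal.I_notcarr[OF P] by simp
    from maximalideal_above[OF cR NR primeideal.axioms(1)[OF P] this] have "P \<subseteq> \<mm>" using uniq by auto
    then have sm: "s \<in> \<mm>" using s(1) by blast
    show "maps_extend R M P" by (rule maps_extend_from_maximal_ideal[OF R M ext[OF sm s(2)] nil P])
  qed
  show "?a \<longleftrightarrow> ?f"
  proof
    show ?f if ?a by (rule h_divisible_imp_divisible[OF h_divisible_hom[OF that torsion_free_ideal_module[OF cR m]]])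
    show ?a if f: ?f by (rule suff) (rule maps_extend_if_divisible_hom[OF M m _ _ f])
  qed
  show "?a \<longleftrightarrow> ?g"
  proof
    show ?g if ?a by (rule divisible_ext1_if_injective[OF that res])
    show ?a if g: ?g by (rule suff) (rule maps_extend_if_divisible_ext1[OF M m _ _ g])
  qed
qed

text \<open>For finitely generated \<open>L\<close> and \<open>P = ann x\<close>, the cogenerator property is used only for \<open>R x\<close>.
  Conversely, simple modules suffice, as every nonzero module has a cyclic submodule with a simple
  quotient.\<close>

lemma cogenerator_characterisations:
  fixes R :: "('a, 'r) ring_scheme" and M :: "('a, 'm, 'q) module_scheme" and \<iota> :: "'a \<Rightarrow> 'u"
  assumes R: "cring R" and N: "noetherian_ring R" and red: "reduced_ring R" and M: "module R M"
    and \<iota>: "inj_on \<iota> (carrier R)"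
  shows
    "injective_cogenerator TYPE('u) R M \<longleftrightarrow>
       (\<forall>L :: ('a, 'u) module. fin_gen_module R L \<longrightarrow> Coass R (hom_module R L M) = Ass R L)" (is "?i \<longleftrightarrow> ?ii")
    "injective_cogenerator TYPE('u) R M \<longleftrightarrow> injective_module TYPE('u) R M \<and>
       (\<forall>L :: ('a, 'u) module. simple_module R L \<longrightarrow> Coass R (hom_module R L M) = Ass R L)" (is "_ \<longleftrightarrow> ?iii")
proof -
  have inj: "injective_module TYPE('u) R M \<longleftrightarrow> Baer_injective R M"
    unfolding injective_module_iff[OF M \<iota>] Baer_injective_def using M by simp
  have i_ii: ?ii if i: ?i
  proof (intro allI impI equalityI)
    fix L :: "('a, 'u) module" assume L: "fin_gen_module R L"
    have E: "Baer_injective R M" using i inj unfolding injective_cogenerator_def by simp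
    have mL: "module R L" using L unfolding fin_gen_module_def by simp
    interpret L: module R L by (rule mL)
    show "Coass R (hom_module R L M) \<subseteq> Ass R L" by (rule Coass_hom_subset_Ass[OF N E L])
    show "Ass R L \<subseteq> Coass R (hom_module R L M)"
    proof
      fix P assume "P \<in> Ass R L"
      then obtain x where P: "primeideal P R" and x: "x \<in> carrier L"
        and Px: "P = {a \<in> carrier R. a \<odot>\<^bsub>L\<^esub> x = \<zero>\<^bsub>L\<^esub>}" unfolding Ass_def by blast
      let ?X = "(\<lambda>r. r \<odot>\<^bsub>L\<^esub> x) ` carrier R"
      let ?H = "L\<lparr>carrier := ?X\<rparr>"
      have mH: "module R ?H" by (rule submodule.submodule_is_module[OF L.submodule_cyclic(1)[OF x] mL])
      have "x \<noteq> \<zero>\<^bsub>L\<^esub>"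
      proof
        assume "x = \<zero>\<^bsub>L\<^esub>"
        then have "P = carrier R" using Px by auto
        then show False using primeideal.I_notcarr[OF P] by simp
      qed
      then have ne: "carrier ?H \<noteq> {\<zero>\<^bsub>?H\<^esub>}" using L.submodule_cyclic(2)[OF x] by auto
      have cog: "\<forall>N :: ('a, 'u) module. module R N \<and> carrier N \<noteq> {\<zero>\<^bsub>N\<^esub>} \<longrightarrow>
          carrier (hom_module R N M) \<noteq> {\<zero>\<^bsub>hom_module R N M\<^esub>}"
        using i unfolding injective_cogenerator_def by (rule conjunct2)
      have "carrier (hom_module R ?H M) \<noteq> {\<zero>\<^bsub>hom_module R ?H M\<^esub>}"
        by (rule cog[rule_format, OF conjI[OF mH ne]])
      then show "P \<in> Coass R (hom_module R L M)"
        by (intro Ass_subset_Coass_hom[OF N E mL P x Px]) simp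
    qed
  qed
  have ii_iii: ?iii if ii: ?ii
  proof
    have "Baer_injective R M"
      unfolding injective_characterisations(1)[OF R N red M \<iota>] using ii by blast
    then show "injective_module TYPE('u) R M" using inj by simp
    show "\<forall>L :: ('a, 'u) module. simple_module R L \<longrightarrow> Coass R (hom_module R L M) = Ass R L"
      using ii simple_module_fin_gen by blast
  qed
  have iii_i: ?i if iii: ?iii
    unfolding injective_cogenerator_def
  proof (intro conjI allI impI)
    show "injective_module TYPE('u) R M" using iii by (rule conjunct1)
    then have E: "Baer_injective R M" using inj by simp
    fix L :: "('a, 'u) module" assume L: "module R L \<and> carrier L \<noteq> {\<zero>\<^bsub>L\<^esub>}"
    have simple: "Coass R (hom_module R K M) = Ass R K" if "simple_module R K" for K :: "('a, 'u) module"
      using conjunct2[OF iii] that by blast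
    show "carrier (hom_module R L M) \<noteq> {\<zero>\<^bsub>hom_module R L M\<^esub>}"
      unfolding module_hom_nonzero_iff[OF conjunct1[OF L] M]
      by (rule nonzero_map_if_simple_Coass[OF R N E \<iota> simple conjunct1[OF L] conjunct2[OF L]])
  qed
  show "?i \<longleftrightarrow> ?ii" using i_ii ii_iii iii_i by (intro iffI) simp_all
  show "?i \<longleftrightarrow> ?iii" using i_ii ii_iii iii_i by (intro iffI) simp_all
qed

theorem theorem6p3:
  fixes R :: "('a, 'r) ring_scheme"
    and M :: "('a, 'm, 'q) module_scheme"
    and \<iota> :: "'a \<Rightarrow> 'u"
  assumes "cring R" and "noetherian_ring R" and "reduced_ring R"
    and "module R M"
    and "infinite (UNIV :: 'u set)" and "inj_on \<iota> (carrier R)"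
  shows
    "\<comment> \<open>part 1: each of (b)--(g) is equivalent to (a)\<close>
     ((injective_module TYPE('u) R M \<longleftrightarrow>
         (\<forall>L :: ('a, 'u) module. fin_gen_module R L \<longrightarrow> Coass R (hom_module R L M) \<subseteq> Ass R L)) \<and>
      (injective_module TYPE('u) R M \<longleftrightarrow>
         (\<forall>L :: ('a, 'u) module. torsion_free R L \<longrightarrow> h_divisible R (hom_module R L M))) \<and>
      (injective_module TYPE('u) R M \<longleftrightarrow>
         (\<forall>L :: ('a, 'u) module. fin_gen_module R L \<and> torsion_free R L \<longrightarrow>
            divisible R (hom_module R L M))) \<and>
      (injective_module TYPE('u) R M \<longleftrightarrow>
         (\<forall>P. primeideal P R \<longrightarrow> h_divisible R (hom_module R (ideal_module R P) M))) \<and>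
      (injective_module TYPE('u) R M \<longleftrightarrow>
         (\<forall>P. primeideal P R \<longrightarrow> divisible R (hom_module R (ideal_module R P) M))) \<and>
      (injective_module TYPE('u) R M \<longleftrightarrow>
         (\<forall>P. primeideal P R \<longrightarrow> divisible R (ext1_module R (residue_module R P) M)))) \<and>
     \<comment> \<open>part 2\<close>
     (\<forall>(\<mm> :: 'a set) (S :: ('s, 't) ring_scheme) (\<nn> :: 's set) (\<phi> :: 'a \<Rightarrow> 's)
        (N :: ('s, 'n, 'v) module_scheme).
        noetherian_local_ring R \<mm> \<and> noetherian_local_ring S \<nn> \<and>
        \<phi> \<in> ring_hom R S \<and> \<phi> ` \<mm> \<subseteq> \<nn> \<and> artinian_module S N \<longrightarrow>
          (injective_module TYPE('u) R (restrict_scalars \<phi> N) \<longleftrightarrow>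
             divisible R (hom_module R (ideal_module R \<mm>) (restrict_scalars \<phi> N))) \<and>
          (injective_module TYPE('u) R (restrict_scalars \<phi> N) \<longleftrightarrow>
             divisible R (ext1_module R (residue_module R \<mm>) (restrict_scalars \<phi> N)))) \<and>
     \<comment> \<open>part 3\<close>
     ((injective_cogenerator TYPE('u) R M \<longleftrightarrow>
         (\<forall>L :: ('a, 'u) module. fin_gen_module R L \<longrightarrow> Coass R (hom_module R L M) = Ass R L)) \<and>
      (injective_cogenerator TYPE('u) R M \<longleftrightarrow>
         injective_module TYPE('u) R M \<and>
         (\<forall>L :: ('a, 'u) module. simple_module R L \<longrightarrow> Coass R (hom_module R L M) = Ass R L)))"
proof -
  note inj = injective_module_iff[OF _ assms(6)]
  have Baer: "injective_module TYPE('u) R E \<longleftrightarrow> Baer_injective R E" if "module R E"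
    for E :: "('a, 'e, 'f) module_scheme"
    unfolding inj[OF that] Baer_injective_def using that by simp
  note part1 = injective_characterisations[OF assms(1-4,6), folded Baer[OF assms(4)]]
  have part2: "(injective_module TYPE('u) R (restrict_scalars \<phi> N) \<longleftrightarrow>
             divisible R (hom_module R (ideal_module R \<mm>) (restrict_scalars \<phi> N))) \<and>
          (injective_module TYPE('u) R (restrict_scalars \<phi> N) \<longleftrightarrow>
             divisible R (ext1_module R (residue_module R \<mm>) (restrict_scalars \<phi> N)))"
    if asm: "noetherian_local_ring R \<mm> \<and> noetherian_local_ring S \<nn> \<and>
        \<phi> \<in> ring_hom R S \<and> \<phi> ` \<mm> \<subseteq> \<nn> \<and> artinian_module S N"
    for \<mm> and S :: "('s, 't) ring_scheme" and \<nn> \<phi> and N :: "('s, 'n, 'v) module_scheme"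
  proof -
    from asm have loc: "noetherian_local_ring R \<mm>" "noetherian_local_ring S \<nn>" "\<phi> \<in> ring_hom R S"
      "\<phi> ` \<mm> \<subseteq> \<nn>" "artinian_module S N" by auto
    have "module S N" using loc(5) unfolding artinian_module_def by (rule conjunct1)
    then have M: "module R (restrict_scalars \<phi> N)" by (rule restrict_scalars_module[OF assms(1) _ loc(3)])
    show ?thesis
      using local_injective_characterisations[OF assms(3) loc] unfolding Baer[OF M] by (rule conjI)
  qed
  show ?thesis
    by (intro conjI allI impI part1 cogenerator_characterisations[OF assms(1-4,6)])
       (rule part2[THEN conjunct1], assumption, rule part2[THEN conjunct2], assumption)
qed

end
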